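(* Let $N\ge2$ and let $(F_1,\dots,F_N)$ be a non-degenerate iterated function system of surjective maps on a complete metric space $(T,d)$, with invariant set $K$, satisfying the open set condition and such that $F_i(K)$ is open in $K$ for all $i=1,\dots,N$. Let $X=\{1,\dots,N\}^\infty$ with shift map $\sigma$, let $L=\bigcup_nL_n$ be the associated fractafold bundle (which is then locally compact), let $\tilde\sigma:L\to L$ be the local homeomorphism $\tilde\sigma(x,t)=(\sigma(x),F_{x_1}(t))$, and let $\tilde{\mathcal{G}}=\mathcal{G}(L,\tilde\sigma)$ be its Renault–Deaconu groupoid, with unit space $L$; it is isomorphic to the action groupoid $\mathcal{G}*L$ of the canonical action on $L$ of $\mathcal{G}=\mathcal{G}(X,\sigma)$. Let $\mu_\infty$ be the unique $\tilde{\mathcal{G}}$-invariant Borel measure on $L$ such that $\mu_\infty(L\setminus L_n)=\infty$ for all $n\ge1$ and $\mu_\infty(U\times A)=\nu(\sigma^n(U))\cdot\mu(F_\omega(A))$ whenever $\omega\in W^n$ and $U\times A\subset Z(\omega)\times L_n(\omega)$ is Borel. Then the map $$\tau(f)=\int_L f\,d\mu_\infty\qquad\text{for } f\in C_c(\tilde{\mathcal{G}})\cap C^*(\tilde{\mathcal{G}})^+$$ extends to a densely defined lower semi-continuous trace on $C^*(\tilde{\mathcal{G}})\simeq C^*(\mathcal{G}*L)$.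
   Context: Iterated function system: $(T,d)$ is a complete metric space and $F_1,\dots,F_N:T\to T$ are maps for which there are constants $0<r_i\le R_i<1$ with $r_i d(t,t')\le d(F_i(t),F_i(t'))\le R_i d(t,t')$ for all $t,t'\in T$ (non-degeneracy); each $F_i$ is surjective, hence a homeomorphism. $K\subset T$ is the unique (non-empty) compact set with $K=F_1(K)\cup\dots\cup F_N(K)$. The open set condition: there exists a non-empty open set $O\subset T$ such that $\bigcup_i F_i(O)\subset O$ and $F_i(O)\cap F_j(O)=\varnothing$ if $i\ne j$. Words: $W=\{1,\dots,N\}$, $W^*=\bigcup_{n\in\mathbb{N}}W^n$, and $X=W^\infty$ is the space of infinite sequences with the topology generated by the cylinders $Z(\omega)=\{x\in X:x_i=\omega_i,\ i=1,\dots,|\omega|\}$, $\omega\in W^*$. The shift $\sigma(x_1x_2x_3\cdots)=x_2x_3\cdots$ is a local homeomorphism of $X$. For $\omega\in W^n$, $F_\omega=F_{\omega_n}\circ\dots\circ F_{\omega_1}$ and $F_\omega^{-1}=F_{\omega_1}^{-1}\circ\dots\circ F_{\omega_n}^{-1}$ (identity for the empty word). $x(k)=x_1\cdots x_k$. Fractafold bundle: for $\omega\in W^n$ put $L_n(\omega)=F_\omega^{-1}(K)$; for $n\ge0$ let $L_n=\bigsqcup_{\omega\in W^n}Z(\omega)\times L_n(\omega)\subset X\times T$ with the subspace topology. Then $L_n\subset L_{n+1}$, and $L=\bigcup_{n\ge0}L_n$ with the inductive limit topology: $U\subset L$ is open iff $U\cap L_n$ is open in $L_n$ for every $n\ge0$.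 Measures: $\mu$ is the unique Borel probability measure on $K$ with $\mu(A)=\frac1N\sum_{i=1}^N\mu(F_i^{-1}(A))$ for all Borel $A\subset K$. $\nu$ is the product probability measure on $X$ generated by the weights $\{1/N,\dots,1/N\}$ on $\{1,\dots,N\}$. Renault–Deaconu groupoid: for a local homeomorphism $\tau:Y\to Y$ of a Hausdorff space $Y$, $$\mathcal{G}(Y,\tau)=\{(x,m-n,y)\in Y\times\mathbb{Z}\times Y:\ m,n\ge 0,\ \tau^m(x)=\tau^n(y)\},$$ with $(x,m,y)(y,n,w)=(x,m+n,w)$, $(x,n,y)^{-1}=(y,-n,x)$, $r(x,n,y)=x$, $s(x,n,y)=y$ (unit space identified with $Y$ via $(x,0,x)\mapsto x$). A basis for the topology consists of the sets $\{(x,m-n,y):\tau^m(x)=\tau^n(y),\ x\in U,\ y\in V\}$, where $m,n\in\mathbb{N}$, $U,V\subset Y$ are open, $\tau^m|_U$ and $\tau^n|_V$ are injective, and $\tau^m(U)=\tau^n(V)$. Canonical action and action groupoid: $\mathcal{G}$ acts on $L$ by $(x,m-n,y)\cdot(y,t)=(x,F_{x(m)}^{-1}\circ F_{y(n)}(t))$ (with $\sigma^m(x)=\sigma^n(y)$); $\mathcal{G}*L=\{((x,m-n,y),(y,t)):(x,m-n,y)\in\mathcal{G},(y,t)\in L\}$ has the topology inherited from $\mathcal{G}\times L$, with $(\gamma_1,z_1)$, $(\gamma_2,z_2)$ composable iff $z_1=\gamma_2\cdot z_2$, product $(\gamma_1\gamma_2,z_2)$ and inverse $(\gamma,z)^{-1}=(\gamma^{-1},\gamma\cdot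 z)$. A $G$-set of an étale groupoid $G$ is a subset on which both $r$ and $s$ are injective; a measure $\lambda$ on $G^0$ is $G$-invariant if $\lambda(r(S))=\lambda(s(S))$ for every open $G$-set $S$. $C^*(G)$ is the full $C^*$-algebra of a locally compact étale groupoid $G$. In $\int_L f\,d\mu_\infty$, $f$ is restricted to the unit space $L$ of $\tilde{\mathcal{G}}$. *)

theory Defs
  imports "HOL-Probability.Probability"
begin

section \<open>Iterated function systems and symbolic space\<close>

definition nondegenerate_ifs :: "nat \<Rightarrow> (nat \<Rightarrow> 't::metric_space \<Rightarrow> 't) \<Rightarrow> bool" where
  "nondegenerate_ifs N F \<longleftrightarrow>
     (\<forall>i\<in>{1..N}. \<exists>r R. 0 < r \<and> r \<le> R \<and> R < 1 \<and>
        (\<forall>t t'. r * dist t t' \<le> dist (F i t) (F i t') \<and> dist (F i t) (F i t') \<le> R * dist t t'))"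

definition invariant_set :: "nat \<Rightarrow> (nat \<Rightarrow> 't::metric_space \<Rightarrow> 't) \<Rightarrow> 't set \<Rightarrow> bool" where
  "invariant_set N F K \<longleftrightarrow> K \<noteq> {} \<and> compact K \<and> K = (\<Union>i\<in>{1..N}. F i ` K)"

definition open_set_condition :: "nat \<Rightarrow> (nat \<Rightarrow> 't::metric_space \<Rightarrow> 't) \<Rightarrow> bool" where
  "open_set_condition N F \<longleftrightarrow>
     (\<exists>V. open V \<and> V \<noteq> {} \<and> (\<Union>i\<in>{1..N}. F i ` V) \<subseteq> V \<and>
        (\<forall>i\<in>{1..N}. \<forall>j\<in>{1..N}. i \<noteq> j \<longrightarrow> F i ` V \<inter> F j ` V = {}))"

text \<open>
  Words are lists and sequences are functions on \<^typ>\<open>nat\<close>, both indexed from \<open>0\<close>; the letter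
  \<open>x\<^sub>k\<close> of the usual notation is \<open>x (k - 1)\<close>.
\<close>

definition words :: "nat \<Rightarrow> nat \<Rightarrow> nat list set" where
  "words N n = {\<omega>. length \<omega> = n \<and> set \<omega> \<subseteq> {1..N}}"

definition seqs :: "nat \<Rightarrow> (nat \<Rightarrow> nat) set" where
  "seqs N = {x. \<forall>i. x i \<in> {1..N}}"

definition cylinder :: "nat \<Rightarrow> nat list \<Rightarrow> (nat \<Rightarrow> nat) set" where
  "cylinder N \<omega> = {x \<in> seqs N. \<forall>i<length \<omega>. x i = \<omega> ! i}"

definition seq_top :: "nat \<Rightarrow> (nat \<Rightarrow> nat) topology" where
  "seq_top N = topology_generated_by (cylinder N ` (\<Union>n. words N n))"

definition seq_shift :: "(nat \<Rightarrow> nat) \<Rightarrow> nat \<Rightarrow> nat" where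
  "seq_shift x = (\<lambda>i. x (Suc i))"

definition prefix_word :: "(nat \<Rightarrow> nat) \<Rightarrow> nat \<Rightarrow> nat list" where
  "prefix_word x k = map x [0..<k]"

text \<open>\<open>F\<^sub>\<omega> = F\<^bsub>\<omega>\<^sub>n\<^esub> \<circ> \<dots> \<circ> F\<^bsub>\<omega>\<^sub>1\<^esub>\<close>: the first letter is applied first.\<close>

definition word_map :: "(nat \<Rightarrow> 't \<Rightarrow> 't) \<Rightarrow> nat list \<Rightarrow> 't \<Rightarrow> 't" where
  "word_map F \<omega> = fold F \<omega>"

section \<open>The fractafold bundle\<close>

definition bundle_fibre :: "(nat \<Rightarrow> 't \<Rightarrow> 't) \<Rightarrow> 't set \<Rightarrow> nat list \<Rightarrow> 't set" where
  "bundle_fibre F K \<omega> = inv (word_map F \<omega>) ` K"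

definition bundle_level ::
  "nat \<Rightarrow> (nat \<Rightarrow> 't \<Rightarrow> 't) \<Rightarrow> 't set \<Rightarrow> nat \<Rightarrow> ((nat \<Rightarrow> nat) \<times> 't) set" where
  "bundle_level N F K n = (\<Union>\<omega>\<in>words N n. cylinder N \<omega> \<times> bundle_fibre F K \<omega>)"

definition bundle_level_top ::
  "nat \<Rightarrow> (nat \<Rightarrow> 't::topological_space \<Rightarrow> 't) \<Rightarrow> 't set \<Rightarrow> nat \<Rightarrow> ((nat \<Rightarrow> nat) \<times> 't) topology" where
  "bundle_level_top N F K n =
     subtopology (prod_topology (seq_top N) euclidean) (bundle_level N F K n)"

definition bundle_top ::
  "nat \<Rightarrow> (nat \<Rightarrow> 't::topological_space \<Rightarrow> 't) \<Rightarrow> 't set \<Rightarrow> ((nat \<Rightarrow> nat) \<times> 't) topology" where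
  "bundle_top N F K = topology (\<lambda>U. U \<subseteq> (\<Union>n. bundle_level N F K n) \<and>
     (\<forall>n. openin (bundle_level_top N F K n) (U \<inter> bundle_level N F K n)))"

lemma openin_bundle_top:
  "openin (bundle_top N F K) U \<longleftrightarrow> U \<subseteq> (\<Union>n. bundle_level N F K n) \<and>
     (\<forall>n. openin (bundle_level_top N F K n) (U \<inter> bundle_level N F K n))"
proof -
  let ?P = "\<lambda>U. U \<subseteq> (\<Union>n. bundle_level N F K n) \<and>
     (\<forall>n. openin (bundle_level_top N F K n) (U \<inter> bundle_level N F K n))"
  have "istopology ?P"
    unfolding istopology_def
  proof (intro conjI allI impI)
    fix S T n assume S: "?P S" and T: "?P T"
    show "S \<inter> T \<subseteq> (\<Union>n. bundle_level N F K n)" using S by blast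
    have "openin (bundle_level_top N F K n)
        ((S \<inter> bundle_level N F K n) \<inter> (T \<inter> bundle_level N F K n))"
      by (rule openin_Int) (use S T in blast)+
    moreover have "S \<inter> T \<inter> bundle_level N F K n =
        (S \<inter> bundle_level N F K n) \<inter> (T \<inter> bundle_level N F K n)" by blast
    ultimately show "openin (bundle_level_top N F K n) (S \<inter> T \<inter> bundle_level N F K n)"
      by simp
  next
    fix \<K> n assume \<K>: "\<forall>S\<in>\<K>. ?P S"
    show "\<Union>\<K> \<subseteq> (\<Union>n. bundle_level N F K n)" using \<K> by blast
    have "\<Union>\<K> \<inter> bundle_level N F K n = (\<Union>S\<in>\<K>. S \<inter> bundle_level N F K n)"
      by (rule Int_Union2)
    moreover have "openin (bundle_level_top N F K n) (\<Union>S\<in>\<K>. S \<inter> bundle_level N F K n)"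
      by (rule openin_Union) (use \<K> in blast)
    ultimately show "openin (bundle_level_top N F K n) (\<Union>\<K> \<inter> bundle_level N F K n)"
      by simp
  qed
  then show ?thesis
    unfolding bundle_top_def by (simp only: topology_inverse')
qed

definition bundle_shift ::
  "(nat \<Rightarrow> 't \<Rightarrow> 't) \<Rightarrow> (nat \<Rightarrow> nat) \<times> 't \<Rightarrow> (nat \<Rightarrow> nat) \<times> 't" where
  "bundle_shift F = (\<lambda>(x, t). (seq_shift x, F (x 0) t))"

section \<open>Topological groupoids\<close>

text \<open>
  The unit space is kept as a separate type \<open>'u\<close>, embedded into the arrows by \<open>unit\<close>.
\<close>

record ('g, 'u) top_groupoid =
  arrows :: "'g set"
  arrow_top :: "'g topology"
  unit_top :: "'u topology"
  rng :: "'g \<Rightarrow> 'u"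
  src :: "'g \<Rightarrow> 'u"
  unit :: "'u \<Rightarrow> 'g"
  gmult :: "'g \<Rightarrow> 'g \<Rightarrow> 'g"
  ginv :: "'g \<Rightarrow> 'g"

definition renault_deaconu ::
  "'y topology \<Rightarrow> ('y \<Rightarrow> 'y) \<Rightarrow> ('y \<times> int \<times> 'y, 'y) top_groupoid" where
  "renault_deaconu Y \<tau> = \<lparr>
     arrows = {(x, int m - int n, y) | x m n y.
                 x \<in> topspace Y \<and> y \<in> topspace Y \<and> (\<tau> ^^ m) x = (\<tau> ^^ n) y},
     arrow_top = topology_generated_by
       {{(x, int m - int n, y) | x y. (\<tau> ^^ m) x = (\<tau> ^^ n) y \<and> x \<in> U \<and> y \<in> V} | m n U V.
          openin Y U \<and> openin Y V \<and> inj_on (\<tau> ^^ m) U \<and> inj_on (\<tau> ^^ n) V \<and>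
          (\<tau> ^^ m) ` U = (\<tau> ^^ n) ` V},
     unit_top = Y,
     rng = (\<lambda>(x, k, y). x),
     src = (\<lambda>(x, k, y). y),
     unit = (\<lambda>x. (x, 0, x)),
     gmult = (\<lambda>(x, k, y) (y', l, w). (x, k + l, w)),
     ginv = (\<lambda>(x, k, y). (y, - k, x))\<rparr>"

definition action_groupoid ::
  "('g, 'u) top_groupoid \<Rightarrow> 'z topology \<Rightarrow> ('z \<Rightarrow> 'u) \<Rightarrow> ('g \<Rightarrow> 'z \<Rightarrow> 'z) \<Rightarrow> ('g \<times> 'z, 'z) top_groupoid"
  where
  "action_groupoid G Z p act = (let A = {(\<gamma>, z). \<gamma> \<in> arrows G \<and> z \<in> topspace Z \<and> src G \<gamma> = p z} in \<lparr>
     arrows = A,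
     arrow_top = subtopology (prod_topology (arrow_top G) Z) A,
     unit_top = Z,
     rng = (\<lambda>(\<gamma>, z). act \<gamma> z),
     src = (\<lambda>(\<gamma>, z). z),
     unit = (\<lambda>z. (unit G (p z), z)),
     gmult = (\<lambda>(\<gamma>\<^sub>1, z\<^sub>1) (\<gamma>\<^sub>2, z\<^sub>2). (gmult G \<gamma>\<^sub>1 \<gamma>\<^sub>2, z\<^sub>2)),
     ginv = (\<lambda>(\<gamma>, z). (ginv G \<gamma>, act \<gamma> z))\<rparr>)"

text \<open>
  An arrow of \<open>\<G>(X, \<sigma>)\<close> determines only the difference \<open>m - n\<close>.  As the \<open>F\<^sub>i\<close> are bijective, the
  value \<open>F\<^bsub>x(m)\<^esub>\<^sup>-\<^sup>1 (F\<^bsub>y(n)\<^esub> t)\<close> is the same for all admissible pairs \<open>(m, n)\<close>.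
\<close>

definition canonical_action ::
  "(nat \<Rightarrow> 't \<Rightarrow> 't) \<Rightarrow> (nat \<Rightarrow> nat) \<times> int \<times> (nat \<Rightarrow> nat) \<Rightarrow> (nat \<Rightarrow> nat) \<times> 't \<Rightarrow> (nat \<Rightarrow> nat) \<times> 't"
  where
  "canonical_action F = (\<lambda>(x, k, y) (y', t).
     let (m, n) = (SOME (m, n). k = int m - int n \<and> (seq_shift ^^ m) x = (seq_shift ^^ n) y)
     in (x, inv (word_map F (prefix_word x m)) (word_map F (prefix_word y n) t)))"

definition groupoid_iso ::
  "('g, 'u) top_groupoid \<Rightarrow> ('h, 'v) top_groupoid \<Rightarrow> ('g \<Rightarrow> 'h) \<Rightarrow> bool" where
  "groupoid_iso G H \<phi> \<longleftrightarrow>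
     bij_betw \<phi> (arrows G) (arrows H) \<and>
     homeomorphic_map (arrow_top G) (arrow_top H) \<phi> \<and>
     (\<forall>\<alpha>\<in>arrows G. \<forall>\<beta>\<in>arrows G. src G \<alpha> = rng G \<beta> \<longleftrightarrow> src H (\<phi> \<alpha>) = rng H (\<phi> \<beta>)) \<and>
     (\<forall>\<alpha>\<in>arrows G. \<forall>\<beta>\<in>arrows G. src G \<alpha> = rng G \<beta> \<longrightarrow>
        \<phi> (gmult G \<alpha> \<beta>) = gmult H (\<phi> \<alpha>) (\<phi> \<beta>))"

section \<open>Measures\<close>

definition is_borel_measure :: "'a topology \<Rightarrow> 'a measure \<Rightarrow> bool" where
  "is_borel_measure Y M \<longleftrightarrow> space M = topspace Y \<and> sets M = sigma_sets (topspace Y) {U. openin Y U}"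

definition open_G_set :: "('g, 'u) top_groupoid \<Rightarrow> 'g set \<Rightarrow> bool" where
  "open_G_set G S \<longleftrightarrow> openin (arrow_top G) S \<and> inj_on (rng G) S \<and> inj_on (src G) S"

definition groupoid_invariant :: "('g, 'u) top_groupoid \<Rightarrow> 'u measure \<Rightarrow> bool" where
  "groupoid_invariant G M \<longleftrightarrow>
     (\<forall>S. open_G_set G S \<longrightarrow> emeasure M (rng G ` S) = emeasure M (src G ` S))"

definition self_similar_measure ::
  "nat \<Rightarrow> (nat \<Rightarrow> 't::metric_space \<Rightarrow> 't) \<Rightarrow> 't set \<Rightarrow> 't measure \<Rightarrow> bool" where
  "self_similar_measure N F K \<mu> \<longleftrightarrow>
     is_borel_measure (top_of_set K) \<mu> \<and> prob_space \<mu> \<and>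
     (\<forall>A\<in>sets \<mu>. measure \<mu> A = (1 / real N) * (\<Sum>i=1..N. measure \<mu> (F i -` A \<inter> K)))"

definition uniform_seq_measure :: "nat \<Rightarrow> (nat \<Rightarrow> nat) measure" where
  "uniform_seq_measure N = PiM UNIV (\<lambda>_. uniform_count_measure {1..N})"

definition fractafold_measure ::
  "nat \<Rightarrow> (nat \<Rightarrow> 't::metric_space \<Rightarrow> 't) \<Rightarrow> 't set \<Rightarrow> 't measure \<Rightarrow> ((nat \<Rightarrow> nat) \<times> 't) measure \<Rightarrow> bool"
  where
  "fractafold_measure N F K \<mu> \<mu>\<^sub>L \<longleftrightarrow>
     is_borel_measure (bundle_top N F K) \<mu>\<^sub>L \<and>
     groupoid_invariant (renault_deaconu (bundle_top N F K) (bundle_shift F)) \<mu>\<^sub>L \<and>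
     (\<forall>n\<ge>1. emeasure \<mu>\<^sub>L (topspace (bundle_top N F K) - bundle_level N F K n) = \<infinity>) \<and>
     (\<forall>n. \<forall>\<omega>\<in>words N n. \<forall>U A.
        U \<times> A \<subseteq> cylinder N \<omega> \<times> bundle_fibre F K \<omega> \<longrightarrow> U \<times> A \<in> sets \<mu>\<^sub>L \<longrightarrow>
        emeasure \<mu>\<^sub>L (U \<times> A) =
          emeasure (uniform_seq_measure N) ((seq_shift ^^ n) ` U) * emeasure \<mu> (word_map F \<omega> ` A))"

section \<open>The convolution algebra of an etale groupoid\<close>

text \<open>Functions on the groupoid are extended by \<open>0\<close> to the whole arrow type.\<close>

definition Cc :: "('g, 'u) top_groupoid \<Rightarrow> ('g \<Rightarrow> complex) set" where
  "Cc G = {f. continuous_map (arrow_top G) euclidean f \<and> (\<forall>\<gamma>. \<gamma> \<notin> arrows G \<longrightarrow> f \<gamma> = 0) \<and>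
              compactin (arrow_top G) (arrow_top G closure_of {\<gamma>\<in>arrows G. f \<gamma> \<noteq> 0})}"

definition conv :: "('g, 'u) top_groupoid \<Rightarrow> ('g \<Rightarrow> complex) \<Rightarrow> ('g \<Rightarrow> complex) \<Rightarrow> 'g \<Rightarrow> complex" where
  "conv G f g \<gamma> =
     (\<Sum>\<^sub>\<infinity>(\<alpha>, \<beta>)\<in>{(\<alpha>, \<beta>). \<alpha> \<in> arrows G \<and> \<beta> \<in> arrows G \<and> src G \<alpha> = rng G \<beta> \<and> gmult G \<alpha> \<beta> = \<gamma>}.
        f \<alpha> * g \<beta>)"

definition invol :: "('g, 'u) top_groupoid \<Rightarrow> ('g \<Rightarrow> complex) \<Rightarrow> 'g \<Rightarrow> complex" where
  "invol G f \<gamma> = (if \<gamma> \<in> arrows G then cnj (f (ginv G \<gamma>)) else 0)"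

definition I_norm :: "('g, 'u) top_groupoid \<Rightarrow> ('g \<Rightarrow> complex) \<Rightarrow> real" where
  "I_norm G f = max
     (SUP u\<in>topspace (unit_top G). \<Sum>\<^sub>\<infinity>\<gamma>\<in>{\<gamma>\<in>arrows G. rng G \<gamma> = u}. cmod (f \<gamma>))
     (SUP u\<in>topspace (unit_top G). \<Sum>\<^sub>\<infinity>\<gamma>\<in>{\<gamma>\<in>arrows G. src G \<gamma> = u}. cmod (f \<gamma>))"

section \<open>Hilbert space representations and the full norm\<close>

text \<open>The Hilbert space \<open>\<ell>\<^sup>2(J)\<close>, as functions on the ambient type vanishing off \<open>J\<close>.\<close>

definition ell2 :: "'j set \<Rightarrow> ('j \<Rightarrow> complex) set" where
  "ell2 J = {\<xi>. (\<forall>j. j \<notin> J \<longrightarrow> \<xi> j = 0) \<and> (\<lambda>j. (cmod (\<xi> j))\<^sup>2) summable_on UNIV}"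

definition ell2_inner :: "('j \<Rightarrow> complex) \<Rightarrow> ('j \<Rightarrow> complex) \<Rightarrow> complex" where
  "ell2_inner \<xi> \<eta> = (\<Sum>\<^sub>\<infinity>j. \<xi> j * cnj (\<eta> j))"

definition ell2_norm :: "('j \<Rightarrow> complex) \<Rightarrow> real" where
  "ell2_norm \<xi> = sqrt (\<Sum>\<^sub>\<infinity>j. (cmod (\<xi> j))\<^sup>2)"

definition op_norm :: "'j set \<Rightarrow> (('j \<Rightarrow> complex) \<Rightarrow> 'j \<Rightarrow> complex) \<Rightarrow> real" where
  "op_norm J T = (SUP \<xi>\<in>{\<xi>\<in>ell2 J. ell2_norm \<xi> \<le> 1}. ell2_norm (T \<xi>))"

definition bounded_operator :: "'j set \<Rightarrow> (('j \<Rightarrow> complex) \<Rightarrow> 'j \<Rightarrow> complex) \<Rightarrow> bool" where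
  "bounded_operator J T \<longleftrightarrow>
     (\<forall>\<xi>\<in>ell2 J. T \<xi> \<in> ell2 J) \<and>
     (\<forall>\<xi>\<in>ell2 J. \<forall>\<eta>\<in>ell2 J. \<forall>a b. T (\<lambda>j. a * \<xi> j + b * \<eta> j) = (\<lambda>j. a * T \<xi> j + b * T \<eta> j)) \<and>
     (\<exists>C. \<forall>\<xi>\<in>ell2 J. ell2_norm (T \<xi>) \<le> C * ell2_norm \<xi>)"

text \<open>
  The *-representations of \<open>C\<^sub>c(G)\<close> by bounded operators on \<open>\<ell>\<^sup>2(J)\<close> that are bounded in Renault's
  sense, \<open>\<parallel>\<pi>(f)\<parallel> \<le> \<parallel>f\<parallel>\<^sub>I\<close>.
\<close>

definition bounded_rep ::
  "('g, 'u) top_groupoid \<Rightarrow> 'j set \<Rightarrow> (('g \<Rightarrow> complex) \<Rightarrow> ('j \<Rightarrow> complex) \<Rightarrow> 'j \<Rightarrow> complex) \<Rightarrow> bool" where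
  "bounded_rep G J \<pi> \<longleftrightarrow>
     (\<forall>f\<in>Cc G. bounded_operator J (\<pi> f) \<and> op_norm J (\<pi> f) \<le> I_norm G f) \<and>
     (\<forall>f\<in>Cc G. \<forall>g\<in>Cc G. \<forall>a b. \<forall>\<xi>\<in>ell2 J.
        \<pi> (\<lambda>\<gamma>. a * f \<gamma> + b * g \<gamma>) \<xi> = (\<lambda>j. a * \<pi> f \<xi> j + b * \<pi> g \<xi> j)) \<and>
     (\<forall>f\<in>Cc G. \<forall>g\<in>Cc G. \<forall>\<xi>\<in>ell2 J. \<pi> (conv G f g) \<xi> = \<pi> f (\<pi> g \<xi>)) \<and>
     (\<forall>f\<in>Cc G. \<forall>\<xi>\<in>ell2 J. \<forall>\<eta>\<in>ell2 J.
        ell2_inner (\<pi> f \<xi>) \<eta> = ell2_inner \<xi> (\<pi> (invol G f) \<eta>))"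

text \<open>
  The supremum of \<open>\<parallel>\<pi>(f)\<parallel>\<close> over all bounded representations on Hilbert spaces.  It suffices to let
  the Hilbert space range over \<open>\<ell>\<^sup>2(J)\<close> with \<open>J\<close> a set of functions on \<open>G\<close>:  every representation is a
  direct sum of cyclic and null ones, and a cyclic one acts on a space with a dense subset
  \<open>{\<pi>(f)\<xi> | f \<in> C\<^sub>c(G)}\<close>, hence (orthonormal bases being no larger than dense subsets when infinite)
  on a space unitarily equivalent to some such \<open>\<ell>\<^sup>2(J)\<close>.
\<close>

definition full_norm :: "('g, 'u) top_groupoid \<Rightarrow> ('g \<Rightarrow> complex) \<Rightarrow> real" where
  "full_norm G f = Sup {op_norm J (\<pi> f) | (J :: ('g \<Rightarrow> complex) set) \<pi>. bounded_rep G J \<pi>}"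

section \<open>The full C*-algebra\<close>

record 'a star_algebra =
  elems :: "'a set"
  s_add :: "'a \<Rightarrow> 'a \<Rightarrow> 'a"
  s_scale :: "complex \<Rightarrow> 'a \<Rightarrow> 'a"
  s_mult :: "'a \<Rightarrow> 'a \<Rightarrow> 'a"
  s_star :: "'a \<Rightarrow> 'a"
  s_norm :: "'a \<Rightarrow> real"

text \<open>
  \<open>C\<^sup>*(G)\<close> is the completion of \<open>C\<^sub>c(G)\<close>, realised by classes of sequences that are Cauchy in the
  full norm.
\<close>

definition Cc_cauchy :: "('g, 'u) top_groupoid \<Rightarrow> (nat \<Rightarrow> 'g \<Rightarrow> complex) set" where
  "Cc_cauchy G = {s. (\<forall>n. s n \<in> Cc G) \<and>
     (\<forall>e>0. \<exists>M. \<forall>m\<ge>M. \<forall>n\<ge>M. full_norm G (\<lambda>\<gamma>. s m \<gamma> - s n \<gamma>) < e)}"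

definition Cc_equiv ::
  "('g, 'u) top_groupoid \<Rightarrow> ((nat \<Rightarrow> 'g \<Rightarrow> complex) \<times> (nat \<Rightarrow> 'g \<Rightarrow> complex)) set" where
  "Cc_equiv G = {(s, s'). s \<in> Cc_cauchy G \<and> s' \<in> Cc_cauchy G \<and>
     (\<lambda>n. full_norm G (\<lambda>\<gamma>. s n \<gamma> - s' n \<gamma>)) \<longlonglongrightarrow> 0}"

definition full_cstar :: "('g, 'u) top_groupoid \<Rightarrow> (nat \<Rightarrow> 'g \<Rightarrow> complex) set star_algebra" where
  "full_cstar G = \<lparr>
     elems = Cc_cauchy G // Cc_equiv G,
     s_add = (\<lambda>A B. \<Union>a\<in>A. \<Union>b\<in>B. Cc_equiv G `` {\<lambda>n \<gamma>. a n \<gamma> + b n \<gamma>}),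
     s_scale = (\<lambda>c A. \<Union>a\<in>A. Cc_equiv G `` {\<lambda>n \<gamma>. c * a n \<gamma>}),
     s_mult = (\<lambda>A B. \<Union>a\<in>A. \<Union>b\<in>B. Cc_equiv G `` {\<lambda>n. conv G (a n) (b n)}),
     s_star = (\<lambda>A. \<Union>a\<in>A. Cc_equiv G `` {\<lambda>n. invol G (a n)}),
     s_norm = (\<lambda>A. THE c. \<forall>a\<in>A. (\<lambda>n. full_norm G (a n)) \<longlonglongrightarrow> c)\<rparr>"

definition Cc_embed :: "('g, 'u) top_groupoid \<Rightarrow> ('g \<Rightarrow> complex) \<Rightarrow> (nat \<Rightarrow> 'g \<Rightarrow> complex) set" where
  "Cc_embed G f = Cc_equiv G `` {\<lambda>n. f}"

definition star_iso :: "'a star_algebra \<Rightarrow> 'b star_algebra \<Rightarrow> ('a \<Rightarrow> 'b) \<Rightarrow> bool" where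
  "star_iso A B \<Psi> \<longleftrightarrow>
     bij_betw \<Psi> (elems A) (elems B) \<and>
     (\<forall>a\<in>elems A. \<forall>b\<in>elems A. \<Psi> (s_add A a b) = s_add B (\<Psi> a) (\<Psi> b) \<and>
        \<Psi> (s_mult A a b) = s_mult B (\<Psi> a) (\<Psi> b)) \<and>
     (\<forall>c. \<forall>a\<in>elems A. \<Psi> (s_scale A c a) = s_scale B c (\<Psi> a)) \<and>
     (\<forall>a\<in>elems A. \<Psi> (s_star A a) = s_star B (\<Psi> a) \<and> s_norm B (\<Psi> a) = s_norm A a)"

section \<open>Traces\<close>

definition pos_cone :: "'a star_algebra \<Rightarrow> 'a set" where
  "pos_cone A = {s_mult A (s_star A b) b | b. b \<in> elems A}"

definition s_dist :: "'a star_algebra \<Rightarrow> 'a \<Rightarrow> 'a \<Rightarrow> real" where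
  "s_dist A a b = s_norm A (s_add A a (s_scale A (- 1) b))"

definition is_trace :: "'a star_algebra \<Rightarrow> ('a \<Rightarrow> ennreal) \<Rightarrow> bool" where
  "is_trace A \<phi> \<longleftrightarrow>
     (\<forall>a\<in>pos_cone A. \<forall>b\<in>pos_cone A. \<phi> (s_add A a b) = \<phi> a + \<phi> b) \<and>
     (\<forall>c\<ge>0. \<forall>a\<in>pos_cone A. \<phi> (s_scale A (complex_of_real c) a) = ennreal c * \<phi> a) \<and>
     (\<forall>b\<in>elems A. \<phi> (s_mult A (s_star A b) b) = \<phi> (s_mult A b (s_star A b)))"

definition lower_semicontinuous_weight :: "'a star_algebra \<Rightarrow> ('a \<Rightarrow> ennreal) \<Rightarrow> bool" where
  "lower_semicontinuous_weight A \<phi> \<longleftrightarrow>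
     (\<forall>a\<in>pos_cone A. \<forall>c<\<phi> a. \<exists>e>0. \<forall>b\<in>pos_cone A. s_dist A a b < e \<longrightarrow> c < \<phi> b)"

definition densely_defined_weight :: "'a star_algebra \<Rightarrow> ('a \<Rightarrow> ennreal) \<Rightarrow> bool" where
  "densely_defined_weight A \<phi> \<longleftrightarrow>
     (\<forall>a\<in>pos_cone A. \<forall>e>0. \<exists>b\<in>pos_cone A. \<phi> b < \<infinity> \<and> s_dist A a b < e)"

text \<open>
  \<open>\<phi>\<close> extends \<open>f \<mapsto> \<integral> f d\<lambda>\<close> (\<open>f\<close> restricted to the unit space) from \<open>C\<^sub>c(G) \<inter> C\<^sup>*(G)\<^sup>+\<close>.  The equation
  entails that the integral of such an \<open>f\<close> is a nonnegative real.
\<close>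

definition extends_integral ::
  "('g, 'u) top_groupoid \<Rightarrow> 'u measure \<Rightarrow> ((nat \<Rightarrow> 'g \<Rightarrow> complex) set \<Rightarrow> ennreal) \<Rightarrow> bool" where
  "extends_integral G M \<phi> \<longleftrightarrow>
     (\<forall>f\<in>Cc G. Cc_embed G f \<in> pos_cone (full_cstar G) \<longrightarrow>
        integrable M (\<lambda>u. f (unit G u)) \<and> \<phi> (Cc_embed G f) < \<infinity> \<and>
        complex_of_real (enn2real (\<phi> (Cc_embed G f))) = (\<integral>u. f (unit G u) \<partial>M))"

end

theory Submission
  imports Defs
begin

text \<open>
  Since every \<open>F\<^sub>i(K)\<close> is open in \<open>K\<close>, the sets \<open>F\<^sub>\<omega>(K)\<close> are clopen in \<open>K\<close> and shrink, so \<open>L\<close> is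
  Hausdorff and zero-dimensional, and the groupoid of the local homeomorphism on \<open>L\<close> is covered by
  clopen bisections.  For such a groupoid the regular representation on the square-summable functions
  over a source fibre \<open>G\<^sub>u\<close> bounds \<open>\<Sum>\<^bsub>\<gamma>\<in>G\<^sub>u\<^esub> \<bar>f(\<gamma>)\<bar>\<^sup>2\<close> by the square of the full norm.  Hence every
  \<open>b \<in> C\<^sup>*(G)\<close> has a coefficient function on \<open>G\<close>, and that of \<open>b\<^sup>*b\<close> at a unit \<open>u\<close> is
  \<open>\<Sum>\<^bsub>\<gamma>\<in>G\<^sub>u\<^esub> \<bar>b(\<gamma>)\<bar>\<^sup>2\<close>.  The trace is the integral of the coefficients over the units: it is lower
  semicontinuous by monotone convergence, because coefficients are bounded by the norm, and it
  satisfies the trace identity because the support of \<open>b\<close> is a countable disjoint union of clopen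
  bisections, on each of which the superlevel sets of \<open>\<bar>b\<bar>\<^sup>2\<close> are open and so have range and source
  of equal measure.
\<close>

section \<open>Square-summable functions and the Schur test\<close>

text \<open>The full norm is a real supremum over representations on \<open>ell2 J\<close>, with
  \<open>J\<close> a set of functions on the arrow type. Such a supremum means something only for a
  nonempty bounded set, so the regular representations are needed already to know that some
  representation exists, and one that acts on another index set has to be moved along an injection.
  The algebras of isomorphic groupoids with different arrow types are comparable only because the
  function types embed into each other, which is settled by cardinal arithmetic. The positive cone
  consists of the products of an element with its adjoint, so no spectral theory enters: positivity
  and the trace identity are read off from square sums of coefficients. Countability comes from the
  element and not from the space: its coefficients live on the union of the supports of one Cauchy
  sequence of compactly supported functions. Clopen bisections replace partitions of unity, since a
  function cut off to a clopen set stays continuous.\<close>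

lemma ell2_norm_nonneg [simp]: "0 \<le> ell2_norm \<xi>"
  by (simp add: ell2_norm_def infsum_nonneg)

text \<open>Membership and the norm bound come from a single bound on finite Euclidean norms, so
  later estimates on \<open>ell2\<close> reduce to Minkowski and Cauchy-Schwarz for finite sums. The
  empty index set supplies \<open>0 \<le> c\<close>.\<close>

lemma ell2I:
  assumes "\<And>j. j \<notin> J \<Longrightarrow> \<xi> j = 0" "\<And>I. finite I \<Longrightarrow> L2_set (\<lambda>j. cmod (\<xi> j)) I \<le> c"
  shows "\<xi> \<in> ell2 J" "ell2_norm \<xi> \<le> c"
proof -
  have "0 \<le> c" using assms(2)[of "{}"] by simp
  have *: "(\<Sum>j\<in>I. (cmod (\<xi> j))\<^sup>2) \<le> c\<^sup>2" if "finite I" for I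
    using assms(2)[OF that] \<open>0 \<le> c\<close> by (auto simp: L2_set_def intro: real_le_lsqrt dest: sqrt_le_D)
  then have s: "(\<lambda>j. (cmod (\<xi> j))\<^sup>2) summable_on UNIV"
    by (intro nonneg_bounded_partial_sums_imp_summable_on[where C = "c\<^sup>2"]
          eventually_finite_subsets_at_top_weakI) auto
  then show "\<xi> \<in> ell2 J" using assms(1) by (auto simp: ell2_def)
  have "(\<Sum>\<^sub>\<infinity>j. (cmod (\<xi> j))\<^sup>2) \<le> c\<^sup>2"
    using s * by (intro infsum_le_finite_sums) auto
  then show "ell2_norm \<xi> \<le> c" using \<open>0 \<le> c\<close> by (auto simp: ell2_norm_def intro: real_le_lsqrt)
qed

lemma L2_set_le_ell2_norm:
  assumes "\<xi> \<in> ell2 J" "finite I"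
  shows "L2_set (\<lambda>j. cmod (\<xi> j)) I \<le> ell2_norm \<xi>"
  using assms unfolding L2_set_def ell2_norm_def ell2_def
  by (intro real_sqrt_le_mono finite_sum_le_infsum) auto

lemma ell2_vanish: "\<xi> \<in> ell2 J \<Longrightarrow> j \<notin> J \<Longrightarrow> \<xi> j = 0"
  by (simp add: ell2_def)

lemma ell2_norm_scale: "ell2_norm (\<lambda>j. a * \<xi> j) = cmod a * ell2_norm \<xi>"
  by (simp add: ell2_norm_def norm_mult power_mult_distrib infsum_cmult_right' real_sqrt_mult)

lemma ell2_scale:
  assumes "\<xi> \<in> ell2 J" shows "(\<lambda>j. a * \<xi> j) \<in> ell2 J"
  using assms by (auto simp: ell2_def norm_mult power_mult_distrib intro: summable_on_cmult_right)

lemma ell2_add: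
  assumes "\<xi> \<in> ell2 J" "\<eta> \<in> ell2 J"
  shows "(\<lambda>j. \<xi> j + \<eta> j) \<in> ell2 J" "ell2_norm (\<lambda>j. \<xi> j + \<eta> j) \<le> ell2_norm \<xi> + ell2_norm \<eta>"
proof -
  have "L2_set (\<lambda>j. cmod (\<xi> j + \<eta> j)) I \<le> ell2_norm \<xi> + ell2_norm \<eta>" if "finite I" for I
  proof -
    have "L2_set (\<lambda>j. cmod (\<xi> j + \<eta> j)) I \<le> L2_set (\<lambda>j. cmod (\<xi> j) + cmod (\<eta> j)) I"
      by (intro L2_set_mono) (auto simp: norm_triangle_ineq)
    also have "\<dots> \<le> L2_set (\<lambda>j. cmod (\<xi> j)) I + L2_set (\<lambda>j. cmod (\<eta> j)) I"
      by (rule L2_set_triangle_ineq)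
    also have "\<dots> \<le> ell2_norm \<xi> + ell2_norm \<eta>"
      by (intro add_mono L2_set_le_ell2_norm[OF assms(1)] L2_set_le_ell2_norm[OF assms(2)] that)
    finally show ?thesis .
  qed
  then show "(\<lambda>j. \<xi> j + \<eta> j) \<in> ell2 J" "ell2_norm (\<lambda>j. \<xi> j + \<eta> j) \<le> ell2_norm \<xi> + ell2_norm \<eta>"
    using assms by (auto intro!: ell2I[where c = "ell2_norm \<xi> + ell2_norm \<eta>"] simp: ell2_vanish)
qed

lemma ell2_lincomb:
  assumes "\<xi> \<in> ell2 J" "\<eta> \<in> ell2 J"
  shows "(\<lambda>j. a * \<xi> j + b * \<eta> j) \<in> ell2 J"
  using assms by (intro ell2_add ell2_scale)

lemma ell2_inner_self:
  assumes "\<xi> \<in> ell2 J"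
  shows "ell2_inner \<xi> \<xi> = complex_of_real ((ell2_norm \<xi>)\<^sup>2)"
proof -
  have "ell2_inner \<xi> \<xi> = (\<Sum>\<^sub>\<infinity>j. complex_of_real ((cmod (\<xi> j))\<^sup>2))"
    by (simp only: ell2_inner_def complex_norm_square)
  also have "\<dots> = complex_of_real (\<Sum>\<^sub>\<infinity>j. (cmod (\<xi> j))\<^sup>2)"
    using assms by (intro infsumI has_sum_of_real has_sum_infsum) (simp add: ell2_def)
  finally show ?thesis by (simp add: ell2_norm_def infsum_nonneg)
qed

lemma ell2_inner_cauchy_schwarz:
  assumes "\<xi> \<in> ell2 J" "\<eta> \<in> ell2 J"
  shows "cmod (ell2_inner \<xi> \<eta>) \<le> ell2_norm \<xi> * ell2_norm \<eta>"
proof -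
  have *: "(\<Sum>j\<in>I. cmod (\<xi> j * cnj (\<eta> j))) \<le> ell2_norm \<xi> * ell2_norm \<eta>" if "finite I" for I
  proof -
    have "(\<Sum>j\<in>I. cmod (\<xi> j * cnj (\<eta> j))) \<le> L2_set (\<lambda>j. cmod (\<xi> j)) I * L2_set (\<lambda>j. cmod (\<eta> j)) I"
      using L2_set_mult_ineq[of "\<lambda>j. cmod (\<xi> j)" "\<lambda>j. cmod (\<eta> j)" I] by (simp add: norm_mult)
    also have "\<dots> \<le> ell2_norm \<xi> * ell2_norm \<eta>"
      by (intro mult_mono L2_set_le_ell2_norm[OF assms(1)] L2_set_le_ell2_norm[OF assms(2)] that) auto
    finally show ?thesis .
  qed
  then have s: "(\<lambda>j. cmod (\<xi> j * cnj (\<eta> j))) summable_on UNIV"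
    by (intro nonneg_bounded_partial_sums_imp_summable_on[where C = "ell2_norm \<xi> * ell2_norm \<eta>"]
          eventually_finite_subsets_at_top_weakI) auto
  have "cmod (ell2_inner \<xi> \<eta>) \<le> (\<Sum>\<^sub>\<infinity>j. cmod (\<xi> j * cnj (\<eta> j)))"
    unfolding ell2_inner_def by (rule norm_infsum_bound[OF s])
  also have "\<dots> \<le> ell2_norm \<xi> * ell2_norm \<eta>"
    using s * by (intro infsum_le_finite_sums) auto
  finally show ?thesis .
qed

lemma ell2_zero: "(\<lambda>j. 0) \<in> ell2 J" "ell2_norm (\<lambda>j. 0) = 0"
  by (auto simp: ell2_def ell2_norm_def)

text \<open>A supremum in the reals is informative only for a bounded set. The constant in
  \<open>bounded_operator\<close> may be negative, hence the absolute value in the bound found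
  here.\<close>

lemma op_norm_bdd_above:
  assumes "bounded_operator J T"
  shows "bdd_above ((\<lambda>\<xi>. ell2_norm (T \<xi>)) ` {\<xi>\<in>ell2 J. ell2_norm \<xi> \<le> 1})"
proof -
  obtain C where C: "\<And>\<xi>. \<xi> \<in> ell2 J \<Longrightarrow> ell2_norm (T \<xi>) \<le> C * ell2_norm \<xi>"
    using assms unfolding bounded_operator_def by blast
  have "ell2_norm (T \<xi>) \<le> \<bar>C\<bar>" if "\<xi> \<in> ell2 J" "ell2_norm \<xi> \<le> 1" for \<xi>
  proof -
    have "C * ell2_norm \<xi> \<le> \<bar>C\<bar> * 1"
      by (rule mult_mono) (use that in auto)
    then show ?thesis using C[OF that(1)] by simp
  qed
  then show ?thesis by (auto simp: bdd_above_def)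
qed

lemma op_norm_nonneg:
  assumes "bounded_operator J T" shows "0 \<le> op_norm J T"
  unfolding op_norm_def
  by (rule cSUP_upper2[where x = "\<lambda>_. 0"]) (use op_norm_bdd_above[OF assms] in \<open>auto simp: ell2_zero\<close>)

lemma bounded_operator_scale:
  assumes "bounded_operator J T" "\<xi> \<in> ell2 J"
  shows "T (\<lambda>j. a * \<xi> j) = (\<lambda>j. a * T \<xi> j)"
proof -
  have "T (\<lambda>j. a * \<xi> j + 0 * \<xi> j) = (\<lambda>j. a * T \<xi> j + 0 * T \<xi> j)"
    using assms unfolding bounded_operator_def by blast
  then show ?thesis by simp
qed

text \<open>The supremum defining \<open>op_norm\<close> ranges over the unit ball, which is reached
  by rescaling. A vector of norm zero cannot be rescaled; for it, boundedness already forces the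
  image to have norm zero.\<close>

lemma ell2_norm_op_norm:
  assumes T: "bounded_operator J T" and \<xi>: "\<xi> \<in> ell2 J"
  shows "ell2_norm (T \<xi>) \<le> op_norm J T * ell2_norm \<xi>"
proof (cases "ell2_norm \<xi> = 0")
  case True
  with T \<xi> show ?thesis by (fastforce simp: bounded_operator_def)
next
  case False
  then have p: "ell2_norm \<xi> > 0" by (simp add: order_less_le)
  define a where "a = complex_of_real (inverse (ell2_norm \<xi>))"
  have a: "cmod a = inverse (ell2_norm \<xi>)" using p by (simp add: a_def norm_inverse)
  have "ell2_norm (T (\<lambda>j. a * \<xi> j)) \<le> op_norm J T"
    unfolding op_norm_def
    by (rule cSUP_upper[OF _ op_norm_bdd_above[OF T]])
       (use p \<xi> in \<open>auto simp: ell2_norm_scale ell2_scale a\<close>)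
  then have "inverse (ell2_norm \<xi>) * ell2_norm (T \<xi>) \<le> op_norm J T"
    using p by (simp add: bounded_operator_scale[OF T \<xi>] ell2_norm_scale a)
  then show ?thesis using p by (simp add: field_simps)
qed

lemma op_norm_le:
  assumes "0 \<le> C" "\<And>\<xi>. \<xi> \<in> ell2 J \<Longrightarrow> ell2_norm (T \<xi>) \<le> C * ell2_norm \<xi>"
  shows "op_norm J T \<le> C"
  unfolding op_norm_def
proof (rule cSUP_least)
  show "{\<xi> \<in> ell2 J. ell2_norm \<xi> \<le> 1} \<noteq> {}"
    by (auto intro!: exI[of _ "\<lambda>_. 0"] simp: ell2_zero)
next
  fix \<xi> assume "\<xi> \<in> {\<xi> \<in> ell2 J. ell2_norm \<xi> \<le> 1}"
  then have "ell2_norm (T \<xi>) \<le> C * ell2_norm \<xi>" "C * ell2_norm \<xi> \<le> C * 1"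
    using assms mult_left_mono[of "ell2_norm \<xi>" 1 C] by auto
  then show "ell2_norm (T \<xi>) \<le> C" by simp
qed

text \<open>The hypothesis of the Schur test, with one constant for rows and columns. The rows and
  columns are also finitely supported, so \<open>matrix_op\<close> is a finite sum and linearity and
  products need no convergence argument. Convolution by a compactly supported function on an etale
  groupoid has a matrix of this shape.\<close>

definition schur_matrix :: "'j set \<Rightarrow> real \<Rightarrow> ('j \<Rightarrow> 'j \<Rightarrow> complex) \<Rightarrow> bool" where
  "schur_matrix J C A \<longleftrightarrow>
     (\<forall>i j. A i j \<noteq> 0 \<longrightarrow> i \<in> J \<and> j \<in> J) \<and>
     (\<forall>i. finite {j. A i j \<noteq> 0} \<and> (\<Sum>j | A i j \<noteq> 0. cmod (A i j)) \<le> C) \<and>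
     (\<forall>j. finite {i. A i j \<noteq> 0} \<and> (\<Sum>i | A i j \<noteq> 0. cmod (A i j)) \<le> C)"

definition matrix_op :: "('j \<Rightarrow> 'j \<Rightarrow> complex) \<Rightarrow> ('j \<Rightarrow> complex) \<Rightarrow> 'j \<Rightarrow> complex" where
  "matrix_op A \<xi> i = (\<Sum>j | A i j \<noteq> 0. A i j * \<xi> j)"

lemma schur_matrix_nonneg: "schur_matrix J C A \<Longrightarrow> 0 \<le> C"
  unfolding schur_matrix_def
  by (rule order_trans[of _ "\<Sum>j | A undefined j \<noteq> 0. cmod (A undefined j)"]) (simp_all add: sum_nonneg)

lemma schur_matrix_adjoint: "schur_matrix J C A \<Longrightarrow> schur_matrix J C (\<lambda>i j. cnj (A j i))"
  by (simp add: schur_matrix_def)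

lemma schur_column_sum:
  assumes "schur_matrix J C A" "finite I"
  shows "(\<Sum>i\<in>I. cmod (A i j)) \<le> C"
proof -
  have "(\<Sum>i\<in>I. cmod (A i j)) = (\<Sum>i\<in>I \<inter> {i. A i j \<noteq> 0}. cmod (A i j))"
    by (rule sum.mono_neutral_right) (use assms in auto)
  also have "\<dots> \<le> (\<Sum>i | A i j \<noteq> 0. cmod (A i j))"
    by (rule sum_mono2) (use assms in \<open>auto simp: schur_matrix_def\<close>)
  finally show ?thesis using assms by (auto simp: schur_matrix_def intro: order_trans)
qed

text \<open>For fixed \<open>j\<close> the sum over \<open>i\<close> is part of a column sum, hence
  at most \<open>C\<close>; what remains is the square sum of the vector.\<close>

lemma schur_weighted_sum:
  assumes A: "schur_matrix J C A" and \<xi>: "\<xi> \<in> ell2 J'" and "finite I" "finite I'"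
  shows "(\<Sum>i\<in>I. \<Sum>j\<in>I'. cmod (A i j) * (cmod (\<xi> j))\<^sup>2) \<le> C * (ell2_norm \<xi>)\<^sup>2"
proof -
  have "(\<Sum>i\<in>I. \<Sum>j\<in>I'. cmod (A i j) * (cmod (\<xi> j))\<^sup>2) =
      (\<Sum>j\<in>I'. (\<Sum>i\<in>I. cmod (A i j)) * (cmod (\<xi> j))\<^sup>2)"
    by (subst sum.swap) (simp add: sum_distrib_right)
  also have "\<dots> \<le> (\<Sum>j\<in>I'. C * (cmod (\<xi> j))\<^sup>2)"
    by (intro sum_mono mult_right_mono schur_column_sum[OF A] assms) auto
  also have "\<dots> = C * (L2_set (\<lambda>j. cmod (\<xi> j)) I')\<^sup>2"
    by (simp add: sum_distrib_left L2_set_def sum_nonneg)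
  also have "\<dots> \<le> C * (ell2_norm \<xi>)\<^sup>2"
    by (intro mult_left_mono power_mono L2_set_le_ell2_norm[OF \<xi>] schur_matrix_nonneg[OF A] assms) auto
  finally show ?thesis .
qed

text \<open>The Schur test. Each modulus of an entry is split into two square roots, one kept alone
  and one attached to the vector; Cauchy-Schwarz in the row spends the row bound, and summing the
  squares over all rows spends the column bound.\<close>

lemma matrix_op_bounded:
  assumes A: "schur_matrix J C A" and \<xi>: "\<xi> \<in> ell2 J"
  shows "matrix_op A \<xi> \<in> ell2 J" "ell2_norm (matrix_op A \<xi>) \<le> C * ell2_norm \<xi>"
proof -
  have C: "0 \<le> C" by (rule schur_matrix_nonneg[OF A])
  have row: "(cmod (matrix_op A \<xi> i))\<^sup>2 \<le> C * (\<Sum>j | A i j \<noteq> 0. cmod (A i j) * (cmod (\<xi> j))\<^sup>2)" for i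
  proof -
    let ?S = "{j. A i j \<noteq> 0}"
    have "cmod (matrix_op A \<xi> i) \<le> (\<Sum>j\<in>?S. cmod (A i j) * cmod (\<xi> j))"
      unfolding matrix_op_def by (rule order_trans[OF norm_sum]) (simp add: norm_mult)
    also have "\<dots> = (\<Sum>j\<in>?S. \<bar>sqrt (cmod (A i j))\<bar> * \<bar>sqrt (cmod (A i j)) * cmod (\<xi> j)\<bar>)"
      by (intro sum.cong) (auto simp: mult.assoc[symmetric] abs_mult)
    also have "\<dots> \<le> L2_set (\<lambda>j. sqrt (cmod (A i j))) ?S * L2_set (\<lambda>j. sqrt (cmod (A i j)) * cmod (\<xi> j)) ?S"
      by (rule L2_set_mult_ineq)
    finally have "(cmod (matrix_op A \<xi> i))\<^sup>2 \<le>
        (L2_set (\<lambda>j. sqrt (cmod (A i j))) ?S * L2_set (\<lambda>j. sqrt (cmod (A i j)) * cmod (\<xi> j)) ?S)\<^sup>2"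
      by (intro power_mono) auto
    also have "\<dots> = (\<Sum>j\<in>?S. cmod (A i j)) * (\<Sum>j\<in>?S. cmod (A i j) * (cmod (\<xi> j))\<^sup>2)"
      by (simp add: L2_set_def power_mult_distrib sum_nonneg)
    also have "\<dots> \<le> C * (\<Sum>j\<in>?S. cmod (A i j) * (cmod (\<xi> j))\<^sup>2)"
      using A by (intro mult_right_mono) (auto simp: schur_matrix_def intro: sum_nonneg)
    finally show ?thesis .
  qed
  have "L2_set (\<lambda>i. cmod (matrix_op A \<xi> i)) I \<le> C * ell2_norm \<xi>" if I: "finite I" for I
  proof -
    define I' where "I' = (\<Union>i\<in>I. {j. A i j \<noteq> 0})"
    have fin: "finite I'" using A I by (auto simp: I'_def schur_matrix_def)
    have "(\<Sum>i\<in>I. (cmod (matrix_op A \<xi> i))\<^sup>2) \<le>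
        (\<Sum>i\<in>I. C * (\<Sum>j | A i j \<noteq> 0. cmod (A i j) * (cmod (\<xi> j))\<^sup>2))"
      by (intro sum_mono row)
    also have "\<dots> = C * (\<Sum>i\<in>I. \<Sum>j\<in>I'. cmod (A i j) * (cmod (\<xi> j))\<^sup>2)"
    proof -
      have "(\<Sum>j | A i j \<noteq> 0. cmod (A i j) * (cmod (\<xi> j))\<^sup>2) =
          (\<Sum>j\<in>I'. cmod (A i j) * (cmod (\<xi> j))\<^sup>2)" if "i \<in> I" for i
        by (rule sum.mono_neutral_left) (use fin that in \<open>auto simp: I'_def\<close>)
      then show ?thesis by (simp add: sum_distrib_left)
    qed
    also have "\<dots> \<le> C * (C * (ell2_norm \<xi>)\<^sup>2)"
      by (intro mult_left_mono schur_weighted_sum[OF A \<xi> I fin] C)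
    finally have "(\<Sum>i\<in>I. (cmod (matrix_op A \<xi> i))\<^sup>2) \<le> (C * ell2_norm \<xi>)\<^sup>2"
      by (simp add: power2_eq_square algebra_simps)
    then show ?thesis
      unfolding L2_set_def using C by (intro real_le_lsqrt) auto
  qed
  moreover have "matrix_op A \<xi> i = 0" if "i \<notin> J" for i
    using A that by (auto simp: matrix_op_def schur_matrix_def intro: sum.neutral)
  ultimately show "matrix_op A \<xi> \<in> ell2 J" "ell2_norm (matrix_op A \<xi>) \<le> C * ell2_norm \<xi>"
    by (auto intro: ell2I)
qed

lemma bounded_operator_matrix_op:
  assumes A: "schur_matrix J C A"
  shows "bounded_operator J (matrix_op A)" "op_norm J (matrix_op A) \<le> C"
proof -
  have "matrix_op A (\<lambda>j. a * \<xi> j + b * \<eta> j) = (\<lambda>j. a * matrix_op A \<xi> j + b * matrix_op A \<eta> j)" for a b \<xi> \<eta>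
    by (simp add: matrix_op_def fun_eq_iff sum_distrib_left sum.distrib ring_distribs mult_ac)
  then show "bounded_operator J (matrix_op A)"
    unfolding bounded_operator_def using matrix_op_bounded[OF A] by blast
  show "op_norm J (matrix_op A) \<le> C"
    using matrix_op_bounded[OF A] schur_matrix_nonneg[OF A] by (intro op_norm_le) auto
qed

lemma matrix_op_sum:
  assumes "finite I" "{j. A i j \<noteq> 0} \<subseteq> I"
  shows "matrix_op A \<xi> i = (\<Sum>j\<in>I. A i j * \<xi> j)"
  unfolding matrix_op_def by (rule sum.mono_neutral_left) (use assms in auto)

text \<open>The identity is an exchange of two infinite sums, so it rests on absolute summability of
  the double family. The product of the two vector entries is dominated by the sum of their squares,
  which leaves one Schur sum for \<open>A\<close> and one for its adjoint.\<close>

lemma matrix_op_adjoint: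
  assumes A: "schur_matrix J C A" and \<xi>: "\<xi> \<in> ell2 J" and \<eta>: "\<eta> \<in> ell2 J"
  shows "ell2_inner (matrix_op A \<xi>) \<eta> = ell2_inner \<xi> (matrix_op (\<lambda>i j. cnj (A j i)) \<eta>)"
proof -
  let ?f = "\<lambda>i j. A i j * \<xi> j * cnj (\<eta> i)"
  have C: "0 \<le> C" by (rule schur_matrix_nonneg[OF A])
  have bound: "(\<Sum>p\<in>P. cmod (case p of (i, j) \<Rightarrow> ?f i j)) \<le> C * (ell2_norm \<xi>)\<^sup>2 + C * (ell2_norm \<eta>)\<^sup>2"
    if "finite P" for P
  proof -
    define I where "I = fst ` P"
    define I' where "I' = snd ` P"
    have fin: "finite I" "finite I'" using that by (auto simp: I_def I'_def)
    have term_le: "cmod (?f i j) \<le> cmod (A i j) * (cmod (\<xi> j))\<^sup>2 + cmod (A i j) * (cmod (\<eta> i))\<^sup>2" for i j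
    proof -
      \<comment> \<open>A factor 1/2 is given away; only finiteness of the total matters.\<close>
      have "cmod (\<xi> j) * cmod (\<eta> i) \<le> (cmod (\<xi> j))\<^sup>2 + (cmod (\<eta> i))\<^sup>2"
        using sum_squares_bound[of "cmod (\<xi> j)" "cmod (\<eta> i)"]
          mult_nonneg_nonneg[OF norm_ge_zero[of "\<xi> j"] norm_ge_zero[of "\<eta> i"]] by linarith
      then have "cmod (A i j) * (cmod (\<xi> j) * cmod (\<eta> i)) \<le> cmod (A i j) * ((cmod (\<xi> j))\<^sup>2 + (cmod (\<eta> i))\<^sup>2)"
        by (rule mult_left_mono) simp
      then show ?thesis by (simp add: norm_mult algebra_simps)
    qed
    have "(\<Sum>p\<in>P. cmod (case p of (i, j) \<Rightarrow> ?f i j)) \<le> (\<Sum>p\<in>I\<times>I'. cmod (case p of (i, j) \<Rightarrow> ?f i j))"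
      by (rule sum_mono2) (use fin in \<open>auto simp: I_def I'_def intro: rev_image_eqI\<close>)
    also have "\<dots> = (\<Sum>i\<in>I. \<Sum>j\<in>I'. cmod (?f i j))"
      by (simp only: sum.cartesian_product case_prod_unfold)
    also have "\<dots> \<le> (\<Sum>i\<in>I. \<Sum>j\<in>I'. cmod (A i j) * (cmod (\<xi> j))\<^sup>2 + cmod (A i j) * (cmod (\<eta> i))\<^sup>2)"
      by (intro sum_mono term_le)
    also have "\<dots> = (\<Sum>i\<in>I. \<Sum>j\<in>I'. cmod (A i j) * (cmod (\<xi> j))\<^sup>2) +
        (\<Sum>j\<in>I'. \<Sum>i\<in>I. cmod (cnj (A i j)) * (cmod (\<eta> i))\<^sup>2)"
      by (simp only: sum.distrib complex_mod_cnj sum.swap[of _ I' I])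
    also have "\<dots> \<le> C * (ell2_norm \<xi>)\<^sup>2 + C * (ell2_norm \<eta>)\<^sup>2"
      by (intro add_mono schur_weighted_sum[OF A \<xi>] schur_weighted_sum[OF schur_matrix_adjoint[OF A] \<eta>] fin)
    finally show ?thesis .
  qed
  have "(\<lambda>p. cmod (case p of (i, j) \<Rightarrow> ?f i j)) summable_on (UNIV \<times> UNIV)"
    by (rule nonneg_bounded_partial_sums_imp_summable_on, simp,
        rule eventually_finite_subsets_at_top_weakI, rule bound)
  then have "(\<lambda>(i, j). ?f i j) summable_on (UNIV \<times> UNIV)"
    by (rule abs_summable_summable)
  then have swap: "(\<Sum>\<^sub>\<infinity>i. \<Sum>\<^sub>\<infinity>j. ?f i j) = (\<Sum>\<^sub>\<infinity>j. \<Sum>\<^sub>\<infinity>i. ?f i j)"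
    by (rule infsum_swap_banach)
  have "(\<Sum>\<^sub>\<infinity>j. ?f i j) = matrix_op A \<xi> i * cnj (\<eta> i)" for i
  proof -
    have "(\<Sum>\<^sub>\<infinity>j. ?f i j) = (\<Sum>\<^sub>\<infinity>j\<in>{j. A i j \<noteq> 0}. ?f i j)"
      by (rule infsum_cong_neutral) auto
    also have "\<dots> = matrix_op A \<xi> i * cnj (\<eta> i)"
      using A by (simp add: schur_matrix_def matrix_op_def sum_distrib_right)
    finally show ?thesis .
  qed
  moreover have "(\<Sum>\<^sub>\<infinity>i. ?f i j) = \<xi> j * cnj (matrix_op (\<lambda>i j. cnj (A j i)) \<eta> j)" for j
  proof -
    have "(\<Sum>\<^sub>\<infinity>i. ?f i j) = (\<Sum>\<^sub>\<infinity>i\<in>{i. A i j \<noteq> 0}. ?f i j)"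
      by (rule infsum_cong_neutral) auto
    also have "\<dots> = \<xi> j * cnj (matrix_op (\<lambda>i j. cnj (A j i)) \<eta> j)"
      using A by (simp add: schur_matrix_def matrix_op_def sum_distrib_left mult_ac)
    finally show ?thesis .
  qed
  ultimately show ?thesis using swap by (simp add: ell2_inner_def)
qed

section \<open>Transport of representations\<close>

lemma summable_on_push:
  fixes g :: "'a \<Rightarrow> 'b::{comm_monoid_add,t2_space}"
  assumes "inj_on \<iota> J" "\<And>k. k \<notin> \<iota> ` J \<Longrightarrow> f k = 0" "\<And>j. j \<in> J \<Longrightarrow> f (\<iota> j) = g j"
    "\<And>j. j \<notin> J \<Longrightarrow> g j = 0"
  shows "f summable_on UNIV \<longleftrightarrow> g summable_on UNIV" "infsum f UNIV = infsum g UNIV"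
proof -
  have "f summable_on UNIV \<longleftrightarrow> f summable_on (\<iota> ` J)"
    by (rule summable_on_cong_neutral) (use assms in auto)
  also have "\<dots> \<longleftrightarrow> (f \<circ> \<iota>) summable_on J" by (rule summable_on_reindex) fact
  also have "\<dots> \<longleftrightarrow> g summable_on UNIV"
    by (rule summable_on_cong_neutral) (use assms in auto)
  finally show "f summable_on UNIV \<longleftrightarrow> g summable_on UNIV" .
  have "infsum f UNIV = infsum f (\<iota> ` J)"
    by (rule infsum_cong_neutral) (use assms in auto)
  also have "\<dots> = infsum (f \<circ> \<iota>) J" by (rule infsum_reindex) fact
  also have "\<dots> = infsum g UNIV"
    by (rule infsum_cong_neutral) (use assms in auto)
  finally show "infsum f UNIV = infsum g UNIV" .
qed

text \<open>Serves two purposes. With \<open>S\<close> the identity it moves a representation to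
  another index type; with \<open>S\<close> the pullback along a groupoid isomorphism it also moves
  it to another groupoid. The new operators are conjugates of the old ones by the unitary that
  \<open>\<iota>\<close> induces, so the operator norms do not change.\<close>

lemma bounded_rep_transport:
  fixes G :: "('g, 'u) top_groupoid" and H :: "('h, 'v) top_groupoid"
    and \<iota> :: "'j \<Rightarrow> 'k" and S :: "('h \<Rightarrow> complex) \<Rightarrow> 'g \<Rightarrow> complex"
  assumes rep: "bounded_rep G J \<pi>" and inj: "inj_on \<iota> J"
    and S_Cc: "\<And>f. f \<in> Cc H \<Longrightarrow> S f \<in> Cc G"
    and S_lin: "\<And>f g a b. f \<in> Cc H \<Longrightarrow> g \<in> Cc H \<Longrightarrow>
       S (\<lambda>\<gamma>. a * f \<gamma> + b * g \<gamma>) = (\<lambda>\<gamma>. a * S f \<gamma> + b * S g \<gamma>)"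
    and S_conv: "\<And>f g. f \<in> Cc H \<Longrightarrow> g \<in> Cc H \<Longrightarrow> S (conv H f g) = conv G (S f) (S g)"
    and S_invol: "\<And>f. f \<in> Cc H \<Longrightarrow> S (invol H f) = invol G (S f)"
    and S_norm: "\<And>f. f \<in> Cc H \<Longrightarrow> I_norm G (S f) = I_norm H f"
  obtains \<pi>' where "bounded_rep H (\<iota> ` J) \<pi>'"
    and "\<And>f. f \<in> Cc H \<Longrightarrow> op_norm (\<iota> ` J) (\<pi>' f) = op_norm J (\<pi> (S f))"
proof -
  define pull where "pull = (\<lambda>(\<xi> :: 'k \<Rightarrow> complex) j. if j \<in> J then \<xi> (\<iota> j) else 0)"
  define push where "push = (\<lambda>(\<xi> :: 'j \<Rightarrow> complex) k. if k \<in> \<iota> ` J then \<xi> (the_inv_into J \<iota> k) else 0)"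
  have push_\<iota>: "push \<xi> (\<iota> j) = \<xi> j" if "j \<in> J" for \<xi> j
    using that inj by (simp add: push_def the_inv_into_f_f)
  have push_out: "push \<xi> k = 0" if "k \<notin> \<iota> ` J" for \<xi> k using that by (simp add: push_def)
  have pull_push: "pull (push \<xi>) = \<xi>" if "\<xi> \<in> ell2 J" for \<xi>
    using that by (auto simp: pull_def push_\<iota> ell2_vanish fun_eq_iff)
  have push_pull: "push (pull \<xi>) = \<xi>" if "\<xi> \<in> ell2 (\<iota> ` J)" for \<xi>
  proof
    fix k show "push (pull \<xi>) k = \<xi> k"
      by (cases "k \<in> \<iota> ` J") (use that in \<open>auto simp: pull_def push_\<iota> push_out ell2_vanish\<close>)
  qed
  have push_ell2: "push \<xi> \<in> ell2 (\<iota> ` J)" and push_norm: "ell2_norm (push \<xi>) = ell2_norm \<xi>"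
    if "\<xi> \<in> ell2 J" for \<xi>
    using summable_on_push[OF inj, of "\<lambda>k. (cmod (push \<xi> k))\<^sup>2" "\<lambda>j. (cmod (\<xi> j))\<^sup>2"] that
    by (auto simp: push_\<iota> push_out ell2_def ell2_norm_def)
  have pull_ell2: "pull \<xi> \<in> ell2 J" and pull_norm: "ell2_norm (pull \<xi>) = ell2_norm \<xi>"
    if "\<xi> \<in> ell2 (\<iota> ` J)" for \<xi>
    using summable_on_push[OF inj, of "\<lambda>k. (cmod (\<xi> k))\<^sup>2" "\<lambda>j. (cmod (pull \<xi> j))\<^sup>2"] that
    by (auto simp: pull_def ell2_def ell2_norm_def)
  have inner_pull: "ell2_inner (push \<xi>) \<eta> = ell2_inner \<xi> (pull \<eta>)" if "\<xi> \<in> ell2 J" for \<xi> \<eta>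
    using summable_on_push[OF inj, of "\<lambda>k. push \<xi> k * cnj (\<eta> k)" "\<lambda>j. \<xi> j * cnj (pull \<eta> j)"] that
    by (auto simp: push_\<iota> push_out pull_def ell2_inner_def ell2_vanish)
  have inner_push: "ell2_inner \<xi> (push \<eta>) = ell2_inner (pull \<xi>) \<eta>" if "\<eta> \<in> ell2 J" for \<xi> \<eta>
    using summable_on_push[OF inj, of "\<lambda>k. \<xi> k * cnj (push \<eta> k)" "\<lambda>j. pull \<xi> j * cnj (\<eta> j)"] that
    by (auto simp: push_\<iota> push_out pull_def ell2_inner_def ell2_vanish)
  have pull_lin: "pull (\<lambda>j. a * \<xi> j + b * \<eta> j) = (\<lambda>j. a * pull \<xi> j + b * pull \<eta> j)" for a b \<xi> \<eta>
    by (auto simp: pull_def)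
  have push_lin: "push (\<lambda>j. a * \<xi> j + b * \<eta> j) = (\<lambda>j. a * push \<xi> j + b * push \<eta> j)" for a b \<xi> \<eta>
    by (auto simp: push_def)
  define \<pi>' where "\<pi>' f \<xi> = push (\<pi> (S f) (pull \<xi>))" for f \<xi>
  have op: "bounded_operator J (\<pi> f)" "op_norm J (\<pi> f) \<le> I_norm G f" if "f \<in> Cc G" for f
    using rep that by (auto simp: bounded_rep_def)
  have \<pi>_ell2: "\<pi> f \<xi> \<in> ell2 J" if "f \<in> Cc G" "\<xi> \<in> ell2 J" for f \<xi>
    using op(1)[OF that(1)] that(2) by (simp add: bounded_operator_def)
  have norm_eq: "op_norm (\<iota> ` J) (\<pi>' f) = op_norm J (\<pi> (S f))" if f: "f \<in> Cc H" for f
  proof -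
    have "(\<lambda>\<xi>. ell2_norm (\<pi>' f \<xi>)) ` {\<xi> \<in> ell2 (\<iota> ` J). ell2_norm \<xi> \<le> 1} =
        (\<lambda>\<xi>. ell2_norm (\<pi> (S f) \<xi>)) ` {\<xi> \<in> ell2 J. ell2_norm \<xi> \<le> 1}" (is "?L = ?R")
    proof
      show "?L \<subseteq> ?R"
        using f by (auto simp: \<pi>'_def push_norm \<pi>_ell2 S_Cc pull_ell2 pull_norm)
      show "?R \<subseteq> ?L"
      proof
        fix y assume "y \<in> ?R"
        then obtain \<xi> where \<xi>: "\<xi> \<in> ell2 J" "ell2_norm \<xi> \<le> 1" "y = ell2_norm (\<pi> (S f) \<xi>)" by auto
        then show "y \<in> ?L"
          using f by (intro image_eqI[where x = "push \<xi>"])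
            (auto simp: \<pi>'_def push_norm \<pi>_ell2 S_Cc pull_push push_ell2)
      qed
    qed
    then show ?thesis by (simp add: op_norm_def)
  qed
  have r1: "bounded_operator (\<iota> ` J) (\<pi>' f)" if f: "f \<in> Cc H" for f
    unfolding bounded_operator_def
  proof (intro conjI ballI allI)
    fix \<xi> assume \<xi>: "\<xi> \<in> ell2 (\<iota> ` J)"
    show "\<pi>' f \<xi> \<in> ell2 (\<iota> ` J)"
      by (simp add: \<pi>'_def push_ell2 \<pi>_ell2 S_Cc f pull_ell2 \<xi>)
    fix \<eta> a b assume \<eta>: "\<eta> \<in> ell2 (\<iota> ` J)"
    have "\<pi> (S f) (\<lambda>j. a * pull \<xi> j + b * pull \<eta> j) = (\<lambda>j. a * \<pi> (S f) (pull \<xi>) j + b * \<pi> (S f) (pull \<eta>) j)"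
      using op(1)[OF S_Cc[OF f]] pull_ell2[OF \<xi>] pull_ell2[OF \<eta>] by (simp add: bounded_operator_def)
    then show "\<pi>' f (\<lambda>j. a * \<xi> j + b * \<eta> j) = (\<lambda>j. a * \<pi>' f \<xi> j + b * \<pi>' f \<eta> j)"
      by (simp add: \<pi>'_def pull_lin push_lin)
  next
    have "ell2_norm (\<pi>' f \<xi>) \<le> op_norm J (\<pi> (S f)) * ell2_norm \<xi>" if "\<xi> \<in> ell2 (\<iota> ` J)" for \<xi>
      using ell2_norm_op_norm[OF op(1)[OF S_Cc[OF f]] pull_ell2[OF that]] that f
      by (simp add: \<pi>'_def push_norm \<pi>_ell2 S_Cc pull_ell2 pull_norm)
    then show "\<exists>C. \<forall>\<xi>\<in>ell2 (\<iota> ` J). ell2_norm (\<pi>' f \<xi>) \<le> C * ell2_norm \<xi>" by blast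
  qed
  have r2: "\<pi>' (\<lambda>\<gamma>. a * f \<gamma> + b * g \<gamma>) \<xi> = (\<lambda>j. a * \<pi>' f \<xi> j + b * \<pi>' g \<xi> j)"
    if "f \<in> Cc H" "g \<in> Cc H" "\<xi> \<in> ell2 (\<iota> ` J)" for f g a b \<xi>
    using rep S_Cc[OF that(1)] S_Cc[OF that(2)] pull_ell2[OF that(3)] that
    by (simp add: bounded_rep_def \<pi>'_def S_lin push_lin)
  have r3: "\<pi>' (conv H f g) \<xi> = \<pi>' f (\<pi>' g \<xi>)"
    if "f \<in> Cc H" "g \<in> Cc H" "\<xi> \<in> ell2 (\<iota> ` J)" for f g \<xi>
    using rep S_Cc[OF that(1)] S_Cc[OF that(2)] pull_ell2[OF that(3)] that
    by (simp add: bounded_rep_def \<pi>'_def S_conv pull_push \<pi>_ell2)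
  have r4: "ell2_inner (\<pi>' f \<xi>) \<eta> = ell2_inner \<xi> (\<pi>' (invol H f) \<eta>)"
    if f: "f \<in> Cc H" and \<xi>: "\<xi> \<in> ell2 (\<iota> ` J)" and \<eta>: "\<eta> \<in> ell2 (\<iota> ` J)" for f \<xi> \<eta>
  proof -
    have "ell2_inner (\<pi>' f \<xi>) \<eta> = ell2_inner (\<pi> (S f) (pull \<xi>)) (pull \<eta>)"
      by (simp add: \<pi>'_def inner_pull \<pi>_ell2 S_Cc f pull_ell2 \<xi>)
    also have "\<dots> = ell2_inner (pull \<xi>) (\<pi> (invol G (S f)) (pull \<eta>))"
      using rep S_Cc[OF f] pull_ell2[OF \<xi>] pull_ell2[OF \<eta>] by (simp add: bounded_rep_def)
    also have "\<dots> = ell2_inner (push (pull \<xi>)) (push (\<pi> (invol G (S f)) (pull \<eta>)))"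
    proof -
      have "ell2_inner (push (pull \<xi>)) (push (\<pi> (invol G (S f)) (pull \<eta>))) =
          ell2_inner (pull \<xi>) (pull (push (\<pi> (invol G (S f)) (pull \<eta>))))"
        by (rule inner_pull[OF pull_ell2[OF \<xi>]])
      \<comment> \<open>Applying \<open>pull_push\<close> would require the right-hand vector to
        vanish off \<open>J\<close>, hence \<open>invol G (S f)\<close> to lie in
        \<open>Cc G\<close>, which is not among the assumptions. The left-hand vector vanishes off
        \<open>J\<close>, so the inner products agree anyway.\<close>
      also have "\<dots> = ell2_inner (pull \<xi>) (\<pi> (invol G (S f)) (pull \<eta>))"
        unfolding ell2_inner_def
        by (intro infsum_cong) (use ell2_vanish[OF pull_ell2[OF \<xi>]] in \<open>auto simp: pull_def push_\<iota>\<close>)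
      finally show ?thesis ..
    qed
    also have "\<dots> = ell2_inner \<xi> (\<pi>' (invol H f) \<eta>)"
      by (simp add: \<pi>'_def push_pull \<xi> S_invol f)
    finally show ?thesis .
  qed
  have "op_norm (\<iota> ` J) (\<pi>' f) \<le> I_norm H f" if "f \<in> Cc H" for f
    using norm_eq[OF that] op(2)[OF S_Cc[OF that]] S_norm[OF that] by simp
  then have "bounded_rep H (\<iota> ` J) \<pi>'"
    unfolding bounded_rep_def by (intro conjI ballI allI r1 r2 r3 r4)
  then show ?thesis using norm_eq that by blast
qed

text \<open>The set under the supremum gets a name because full norms on different groupoids are
  compared through it: equal sets have equal suprema, with no separate boundedness argument.\<close>

definition rep_norms :: "('g, 'u) top_groupoid \<Rightarrow> ('g \<Rightarrow> complex) \<Rightarrow> real set" where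
  "rep_norms G f = {op_norm J (\<pi> f) | (J :: ('g \<Rightarrow> complex) set) \<pi>. bounded_rep G J \<pi>}"

lemma full_norm_eq_Sup: "full_norm G f = Sup (rep_norms G f)"
  by (simp add: full_norm_def rep_norms_def)

text \<open>Every index type that injects into the functions on the arrows is admissible. The source
  fibres, which are sets of arrows, enter in this way.\<close>

lemma rep_normsI:
  fixes G :: "('g, 'u) top_groupoid" and J :: "'j set" and \<iota> :: "'j \<Rightarrow> 'g \<Rightarrow> complex"
  assumes "bounded_rep G J \<pi>" "inj_on \<iota> J" "f \<in> Cc G"
  shows "op_norm J (\<pi> f) \<in> rep_norms G f"
proof (rule bounded_rep_transport[OF assms(1,2), where S = "\<lambda>f. f" and H = G])
  fix \<pi>' assume r: "bounded_rep G (\<iota> ` J) \<pi>'" and "\<And>f. f \<in> Cc G \<Longrightarrow> op_norm (\<iota> ` J) (\<pi>' f) = op_norm J (\<pi> f)"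
  then have "op_norm J (\<pi> f) = op_norm (\<iota> ` J) (\<pi>' f)" using assms(3) by simp
  then show ?thesis using r unfolding rep_norms_def
    by (intro CollectI exI[of _ "\<iota> ` J"] exI[of _ \<pi>'] conjI)
qed auto

section \<open>Ample groupoids and their convolution algebra\<close>

lemma continuous_map_binop:
  fixes h :: "'a::topological_space \<Rightarrow> 'b::topological_space \<Rightarrow> 'c::topological_space"
  assumes "continuous_map X euclidean f" "continuous_map X euclidean g"
    and "continuous_on UNIV (\<lambda>p. h (fst p) (snd p))"
  shows "continuous_map X euclidean (\<lambda>x. h (f x) (g x))"
proof -
  have "continuous_map X euclidean (\<lambda>x. (f x, g x))"
    using continuous_map_pairedI[OF assms(1,2)] by simp
  from continuous_map_compose[OF this, of euclidean "\<lambda>p. h (fst p) (snd p)"] show ?thesis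
    using assms(3) by (simp add: o_def)
qed

text \<open>The record \<open>top_groupoid\<close> carries no laws, so they are collected here. Open
  range and source maps together with \<open>clopen_bisection\<close> express that the groupoid is
  etale with enough clopen bisections. A nonempty unit space provides a source fibre and with it a
  regular representation.\<close>

locale ample_groupoid =
  fixes G :: "('g, 'u) top_groupoid"
  assumes topspace_arrow: "topspace (arrow_top G) = arrows G"
    and rng_in: "\<gamma> \<in> arrows G \<Longrightarrow> rng G \<gamma> \<in> topspace (unit_top G)"
    and src_in: "\<gamma> \<in> arrows G \<Longrightarrow> src G \<gamma> \<in> topspace (unit_top G)"
    and unit_in: "u \<in> topspace (unit_top G) \<Longrightarrow> unit G u \<in> arrows G"
    and rng_unit: "u \<in> topspace (unit_top G) \<Longrightarrow> rng G (unit G u) = u"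
    and src_unit: "u \<in> topspace (unit_top G) \<Longrightarrow> src G (unit G u) = u"
    and mult_in: "\<alpha> \<in> arrows G \<Longrightarrow> \<beta> \<in> arrows G \<Longrightarrow> src G \<alpha> = rng G \<beta> \<Longrightarrow> gmult G \<alpha> \<beta> \<in> arrows G"
    and rng_mult: "\<alpha> \<in> arrows G \<Longrightarrow> \<beta> \<in> arrows G \<Longrightarrow> src G \<alpha> = rng G \<beta> \<Longrightarrow> rng G (gmult G \<alpha> \<beta>) = rng G \<alpha>"
    and src_mult: "\<alpha> \<in> arrows G \<Longrightarrow> \<beta> \<in> arrows G \<Longrightarrow> src G \<alpha> = rng G \<beta> \<Longrightarrow> src G (gmult G \<alpha> \<beta>) = src G \<beta>"
    and mult_assoc: "\<alpha> \<in> arrows G \<Longrightarrow> \<beta> \<in> arrows G \<Longrightarrow> \<gamma> \<in> arrows G \<Longrightarrow> src G \<alpha> = rng G \<beta> \<Longrightarrow>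
      src G \<beta> = rng G \<gamma> \<Longrightarrow> gmult G (gmult G \<alpha> \<beta>) \<gamma> = gmult G \<alpha> (gmult G \<beta> \<gamma>)"
    and unit_mult: "\<gamma> \<in> arrows G \<Longrightarrow> gmult G (unit G (rng G \<gamma>)) \<gamma> = \<gamma>"
    and mult_unit: "\<gamma> \<in> arrows G \<Longrightarrow> gmult G \<gamma> (unit G (src G \<gamma>)) = \<gamma>"
    and inv_in: "\<gamma> \<in> arrows G \<Longrightarrow> ginv G \<gamma> \<in> arrows G"
    and rng_inv: "\<gamma> \<in> arrows G \<Longrightarrow> rng G (ginv G \<gamma>) = src G \<gamma>"
    and src_inv: "\<gamma> \<in> arrows G \<Longrightarrow> src G (ginv G \<gamma>) = rng G \<gamma>"
    and inv_mult: "\<gamma> \<in> arrows G \<Longrightarrow> gmult G (ginv G \<gamma>) \<gamma> = unit G (src G \<gamma>)"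
    and mult_inv: "\<gamma> \<in> arrows G \<Longrightarrow> gmult G \<gamma> (ginv G \<gamma>) = unit G (rng G \<gamma>)"
    and units_nonempty: "topspace (unit_top G) \<noteq> {}"
    and Hausdorff_arrow: "Hausdorff_space (arrow_top G)"
    and Hausdorff_unit: "Hausdorff_space (unit_top G)"
    and continuous_rng: "continuous_map (arrow_top G) (unit_top G) (rng G)"
    and continuous_src: "continuous_map (arrow_top G) (unit_top G) (src G)"
    and continuous_unit: "continuous_map (unit_top G) (arrow_top G) (unit G)"
    and continuous_inv: "continuous_map (arrow_top G) (arrow_top G) (ginv G)"
    and continuous_mult: "continuous_map (subtopology (prod_topology (arrow_top G) (arrow_top G))
        {(\<alpha>, \<beta>). src G \<alpha> = rng G \<beta>}) (arrow_top G) (\<lambda>(\<alpha>, \<beta>). gmult G \<alpha> \<beta>)"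
    and open_rng: "open_map (arrow_top G) (unit_top G) (rng G)"
    and open_src: "open_map (arrow_top G) (unit_top G) (src G)"
    and clopen_bisection: "\<gamma> \<in> arrows G \<Longrightarrow> \<exists>B. \<gamma> \<in> B \<and> openin (arrow_top G) B \<and> closedin (arrow_top G) B \<and>
        inj_on (rng G) B \<and> inj_on (src G) B"
begin

section \<open>Bisections and the cancellation laws\<close>

definition bisection :: "'g set \<Rightarrow> bool" where
  "bisection B \<longleftrightarrow> openin (arrow_top G) B \<and> closedin (arrow_top G) B \<and> inj_on (rng G) B \<and> inj_on (src G) B"

lemma bisection_subset: "bisection B \<Longrightarrow> B \<subseteq> arrows G"
  using openin_subset topspace_arrow by (fastforce simp: bisection_def)

lemma inv_mult_cancel:
  assumes "\<alpha> \<in> arrows G" "\<beta> \<in> arrows G" "src G \<alpha> = rng G \<beta>"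
  shows "gmult G (ginv G \<alpha>) (gmult G \<alpha> \<beta>) = \<beta>"
  using mult_assoc[of "ginv G \<alpha>" \<alpha> \<beta>] assms by (simp add: inv_in src_inv inv_mult unit_mult)

lemma mult_inv_cancel:
  assumes "\<alpha> \<in> arrows G" "\<beta> \<in> arrows G" "rng G \<alpha> = rng G \<beta>"
  shows "gmult G \<alpha> (gmult G (ginv G \<alpha>) \<beta>) = \<beta>"
  using mult_assoc[of \<alpha> "ginv G \<alpha>" \<beta>] assms by (simp add: inv_in src_inv rng_inv mult_inv unit_mult)

lemma mult_cancel_inv:
  assumes "\<alpha> \<in> arrows G" "\<beta> \<in> arrows G" "src G \<alpha> = rng G \<beta>"
  shows "gmult G (gmult G \<alpha> \<beta>) (ginv G \<beta>) = \<alpha>"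
  using mult_assoc[of \<alpha> \<beta> "ginv G \<beta>"] mult_unit[of \<alpha>] assms
  by (simp add: inv_in rng_inv mult_inv)

lemma cancel_inv_mult:
  assumes "\<alpha> \<in> arrows G" "\<beta> \<in> arrows G" "src G \<alpha> = src G \<beta>"
  shows "gmult G (gmult G \<alpha> (ginv G \<beta>)) \<beta> = \<alpha>"
  using mult_assoc[of \<alpha> "ginv G \<beta>" \<beta>] mult_unit[of \<alpha>] assms
  by (simp add: inv_in rng_inv src_inv inv_mult)

lemma inv_inv: "\<gamma> \<in> arrows G \<Longrightarrow> ginv G (ginv G \<gamma>) = \<gamma>"
  using inv_mult_cancel[of "ginv G \<gamma>" \<gamma>] mult_unit[of "ginv G (ginv G \<gamma>)"]
  by (simp add: inv_in src_inv rng_inv inv_mult)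

lemma inv_mult_rev:
  assumes "\<alpha> \<in> arrows G" "\<beta> \<in> arrows G" "src G \<alpha> = rng G \<beta>"
  shows "ginv G (gmult G \<alpha> \<beta>) = gmult G (ginv G \<beta>) (ginv G \<alpha>)"
proof -
  let ?\<gamma> = "gmult G \<alpha> \<beta>" and ?\<delta> = "gmult G (ginv G \<beta>) (ginv G \<alpha>)"
  have \<gamma>: "?\<gamma> \<in> arrows G" "rng G ?\<gamma> = rng G \<alpha>" "src G ?\<gamma> = src G \<beta>"
    using assms by (auto simp: mult_in rng_mult src_mult)
  have \<delta>: "?\<delta> \<in> arrows G" "rng G ?\<delta> = src G \<beta>"
    using assms by (auto simp: mult_in rng_mult inv_in rng_inv src_inv)
  have "gmult G ?\<gamma> ?\<delta> = gmult G (gmult G ?\<gamma> (ginv G \<beta>)) (ginv G \<alpha>)"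
    using assms \<gamma> by (intro mult_assoc[symmetric]) (auto simp: inv_in rng_inv src_inv)
  also have "\<dots> = unit G (rng G ?\<gamma>)"
    using assms \<gamma> by (simp add: mult_cancel_inv mult_inv)
  finally have "gmult G (ginv G ?\<gamma>) (gmult G ?\<gamma> ?\<delta>) = ginv G ?\<gamma>"
    using \<gamma> mult_unit[OF inv_in[OF \<gamma>(1)]] by (simp add: src_inv)
  then show ?thesis using inv_mult_cancel[OF \<gamma>(1) \<delta>(1)] \<gamma> \<delta> by simp
qed

text \<open>Row \<open>i\<close> of the convolution matrix has at column \<open>j\<close> the value
  at the arrow \<open>gmult G i (ginv G j)\<close>. This substitution makes row sums into sums over
  a range fibre; \<open>src_fibre_bij\<close> does the same for columns and source fibres.\<close>

lemma rng_fibre_bij: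
  assumes "i \<in> arrows G"
  shows "bij_betw (\<lambda>j. gmult G i (ginv G j)) {j\<in>arrows G. src G j = src G i} {\<alpha>\<in>arrows G. rng G \<alpha> = rng G i}"
  by (rule bij_betw_byWitness[where f' = "\<lambda>\<alpha>. gmult G (ginv G \<alpha>) i"])
    (use assms in \<open>auto simp: mult_in rng_mult src_mult inv_in rng_inv src_inv inv_mult_rev inv_inv
       mult_inv_cancel cancel_inv_mult\<close>)

lemma src_fibre_bij:
  assumes "j \<in> arrows G"
  shows "bij_betw (\<lambda>i. gmult G i (ginv G j)) {i\<in>arrows G. src G i = src G j} {\<alpha>\<in>arrows G. src G \<alpha> = rng G j}"
  by (rule bij_betw_byWitness[where f' = "\<lambda>\<alpha>. gmult G \<alpha> j"])
    (use assms in \<open>auto simp: mult_in rng_mult src_mult inv_in rng_inv src_inv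
       mult_cancel_inv cancel_inv_mult\<close>)

section \<open>Compactly supported continuous functions\<close>

lemma CcI:
  assumes "continuous_map (arrow_top G) euclidean f" "\<And>\<gamma>. \<gamma> \<notin> arrows G \<Longrightarrow> f \<gamma> = 0"
    "compactin (arrow_top G) C" "\<And>\<gamma>. \<gamma> \<in> arrows G \<Longrightarrow> f \<gamma> \<noteq> 0 \<Longrightarrow> \<gamma> \<in> C"
  shows "f \<in> Cc G"
proof -
  \<comment> \<open>Hausdorffness lets any compact set that contains the support stand in for its
    closure, so closures of supports are never computed.\<close>
  have "closedin (arrow_top G) C"
    by (rule compactin_imp_closedin[OF Hausdorff_arrow assms(3)])
  then have "arrow_top G closure_of {\<gamma>\<in>arrows G. f \<gamma> \<noteq> 0} \<subseteq> C"
    using assms(4) by (intro closure_of_minimal) auto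
  then have "compactin (arrow_top G) (arrow_top G closure_of {\<gamma>\<in>arrows G. f \<gamma> \<noteq> 0})"
    by (rule closed_compactin[OF assms(3) _ closedin_closure_of])
  then show ?thesis using assms by (simp add: Cc_def)
qed

lemma Cc_support:
  assumes "f \<in> Cc G"
  shows "\<exists>C. compactin (arrow_top G) C \<and> C \<subseteq> arrows G \<and> (\<forall>\<gamma>. f \<gamma> \<noteq> 0 \<longrightarrow> \<gamma> \<in> C)"
proof (intro exI conjI allI impI)
  let ?S = "{\<gamma>\<in>arrows G. f \<gamma> \<noteq> 0}"
  show "compactin (arrow_top G) (arrow_top G closure_of ?S)" using assms by (simp add: Cc_def)
  show "arrow_top G closure_of ?S \<subseteq> arrows G"
    using closure_of_subset_topspace[of "arrow_top G" ?S] by (simp add: topspace_arrow)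
  fix \<gamma> assume "f \<gamma> \<noteq> 0"
  then have "\<gamma> \<in> ?S" using assms unfolding Cc_def by blast
  moreover have "?S \<subseteq> arrow_top G closure_of ?S"
    by (rule closure_of_subset) (auto simp: topspace_arrow)
  ultimately show "\<gamma> \<in> arrow_top G closure_of ?S" by (rule rev_subsetD)
qed

lemma Cc_continuous: "f \<in> Cc G \<Longrightarrow> continuous_map (arrow_top G) euclidean f"
  by (simp add: Cc_def)

lemma Cc_vanish: "f \<in> Cc G \<Longrightarrow> \<gamma> \<notin> arrows G \<Longrightarrow> f \<gamma> = 0"
  by (simp add: Cc_def)

lemma Cc_lincomb:
  assumes "f \<in> Cc G" "g \<in> Cc G"
  shows "(\<lambda>\<gamma>. a * f \<gamma> + b * g \<gamma>) \<in> Cc G"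
proof -
  obtain C where C: "compactin (arrow_top G) C" "\<forall>\<gamma>. f \<gamma> \<noteq> 0 \<longrightarrow> \<gamma> \<in> C"
    using Cc_support[OF assms(1)] by blast
  obtain D where D: "compactin (arrow_top G) D" "\<forall>\<gamma>. g \<gamma> \<noteq> 0 \<longrightarrow> \<gamma> \<in> D"
    using Cc_support[OF assms(2)] by blast
  show ?thesis
  proof (rule CcI)
    show "continuous_map (arrow_top G) euclidean (\<lambda>\<gamma>. a * f \<gamma> + b * g \<gamma>)"
      by (rule continuous_map_binop[where h = "\<lambda>x y. a * x + b * y", OF assms[THEN Cc_continuous]])
         (intro continuous_intros)
    show "compactin (arrow_top G) (C \<union> D)" by (rule compactin_Un[OF C(1) D(1)])
    fix \<gamma> assume "a * f \<gamma> + b * g \<gamma> \<noteq> 0"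
    then have "f \<gamma> \<noteq> 0 \<or> g \<gamma> \<noteq> 0" by auto
    then show "\<gamma> \<in> C \<union> D" using C(2) D(2) by blast
  qed (simp add: Cc_vanish[OF assms(1)] Cc_vanish[OF assms(2)])
qed

lemma Cc_diff: "f \<in> Cc G \<Longrightarrow> g \<in> Cc G \<Longrightarrow> (\<lambda>\<gamma>. f \<gamma> - g \<gamma>) \<in> Cc G"
  using Cc_lincomb[of f g 1 "-1"] by simp

lemma Cc_zero: "(\<lambda>\<gamma>. 0) \<in> Cc G"
  by (rule CcI[where C = "{}"]) auto

text \<open>Both \<open>B\<close> and its complement are open, so the cut-off function is continuous
  on each of two open pieces. This takes the place of multiplying by a partition of unity.\<close>

lemma Cc_restrict:
  assumes "f \<in> Cc G" "openin (arrow_top G) B" "closedin (arrow_top G) B"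
  shows "(\<lambda>\<gamma>. if \<gamma> \<in> B then f \<gamma> else 0) \<in> Cc G"
proof -
  obtain C where C: "compactin (arrow_top G) C" "\<forall>\<gamma>. f \<gamma> \<noteq> 0 \<longrightarrow> \<gamma> \<in> C"
    using Cc_support[OF assms(1)] by blast
  have "continuous_map (arrow_top G) euclidean (\<lambda>\<gamma>. if \<gamma> \<in> B then f \<gamma> else 0)"
    unfolding continuous_map_def
  proof (intro conjI allI impI)
    fix U :: "complex set" assume "openin euclidean U"
    then have "openin (arrow_top G) {\<gamma> \<in> topspace (arrow_top G). f \<gamma> \<in> U}"
      using Cc_continuous[OF assms(1)] by (simp add: continuous_map_def)
    then have "openin (arrow_top G) ((B \<inter> {\<gamma> \<in> topspace (arrow_top G). f \<gamma> \<in> U}) \<union>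
        (if 0 \<in> U then topspace (arrow_top G) - B else {}))"
      using assms by (auto intro: openin_diff)
    moreover have "{\<gamma> \<in> topspace (arrow_top G). (if \<gamma> \<in> B then f \<gamma> else 0) \<in> U} =
        (B \<inter> {\<gamma> \<in> topspace (arrow_top G). f \<gamma> \<in> U}) \<union> (if 0 \<in> U then topspace (arrow_top G) - B else {})"
      using openin_subset[OF assms(2)] by auto
    ultimately show "openin (arrow_top G) {\<gamma> \<in> topspace (arrow_top G). (if \<gamma> \<in> B then f \<gamma> else 0) \<in> U}"
      by simp
  qed auto
  then show ?thesis
    by (rule CcI[OF _ _ C(1)]) (use C(2) in \<open>auto simp: Cc_vanish[OF assms(1)] split: if_splits\<close>)
qed

lemma Cc_invol:
  assumes "f \<in> Cc G" shows "invol G f \<in> Cc G"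
proof -
  obtain C where C: "compactin (arrow_top G) C" "\<forall>\<gamma>. f \<gamma> \<noteq> 0 \<longrightarrow> \<gamma> \<in> C"
    using Cc_support[OF assms(1)] by blast
  show ?thesis
  proof (rule CcI[where C = "ginv G ` C"])
    have "continuous_map (arrow_top G) euclidean (\<lambda>\<gamma>. cnj (f (ginv G \<gamma>)))"
      using continuous_map_compose[OF continuous_map_compose[OF continuous_inv Cc_continuous[OF assms]], of euclidean cnj]
      by (simp add: o_def continuous_on_cnj)
    then show "continuous_map (arrow_top G) euclidean (invol G f)"
      by (rule continuous_map_eq) (simp add: invol_def topspace_arrow)
    show "compactin (arrow_top G) (ginv G ` C)"
      by (rule image_compactin[OF C(1) continuous_inv])
    fix \<gamma> assume "\<gamma> \<in> arrows G" "invol G f \<gamma> \<noteq> 0"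
    then show "\<gamma> \<in> ginv G ` C"
      using C(2)[rule_format, of "ginv G \<gamma>"] by (intro image_eqI[where x = "ginv G \<gamma>"]) (auto simp: invol_def inv_inv)
  qed (simp add: invol_def)
qed

lemma Cc_bounded:
  assumes "f \<in> Cc G" shows "\<exists>c\<ge>0. \<forall>\<gamma>. cmod (f \<gamma>) \<le> c"
proof -
  obtain C where C: "compactin (arrow_top G) C" "\<forall>\<gamma>. f \<gamma> \<noteq> 0 \<longrightarrow> \<gamma> \<in> C"
    using Cc_support[OF assms(1)] by blast
  have "compact (f ` C)" using image_compactin[OF C(1) Cc_continuous[OF assms]] by simp
  then obtain c where "0 < c" "\<And>y. y \<in> f ` C \<Longrightarrow> cmod y \<le> c"
    using compact_imp_bounded bounded_pos by metis
  then have "cmod (f \<gamma>) \<le> c" for \<gamma> using C(2) \<open>0 < c\<close> by (cases "f \<gamma> = 0") auto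
  then show ?thesis using \<open>0 < c\<close> by (intro exI[of _ c]) simp
qed

lemma compactin_bisections:
  assumes "compactin (arrow_top G) C"
  shows "\<exists>\<B>. finite \<B> \<and> (\<forall>B\<in>\<B>. bisection B) \<and> C \<subseteq> \<Union>\<B>"
proof -
  have "C \<subseteq> \<Union>{B. bisection B}"
    using compactin_subset_topspace[OF assms] clopen_bisection by (fastforce simp: topspace_arrow bisection_def)
  then obtain \<B> where "finite \<B>" "\<B> \<subseteq> {B. bisection B}" "C \<subseteq> \<Union>\<B>"
    using compactinD[OF assms, of "{B. bisection B}"] by (auto simp: bisection_def)
  then show ?thesis by blast
qed

text \<open>A compact support is covered by finitely many bisections, and each of them meets a fibre
  in at most one arrow. The number of bisections therefore bounds the cardinalities in all fibres at
  once.\<close>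

lemma Cc_fibres:
  assumes "f \<in> Cc G"
  shows "\<exists>k. \<forall>u. finite {\<gamma>\<in>arrows G. rng G \<gamma> = u \<and> f \<gamma> \<noteq> 0} \<and>
    card {\<gamma>\<in>arrows G. rng G \<gamma> = u \<and> f \<gamma> \<noteq> 0} \<le> k \<and>
    finite {\<gamma>\<in>arrows G. src G \<gamma> = u \<and> f \<gamma> \<noteq> 0} \<and>
    card {\<gamma>\<in>arrows G. src G \<gamma> = u \<and> f \<gamma> \<noteq> 0} \<le> k"
proof -
  obtain C where C: "compactin (arrow_top G) C" "\<forall>\<gamma>. f \<gamma> \<noteq> 0 \<longrightarrow> \<gamma> \<in> C"
    using Cc_support[OF assms(1)] by blast
  obtain \<B> where \<B>: "finite \<B>" "\<forall>B\<in>\<B>. bisection B" "C \<subseteq> \<Union>\<B>"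
    using compactin_bisections[OF C(1)] by blast
  have *: "finite {\<gamma>\<in>arrows G. p \<gamma> = u \<and> f \<gamma> \<noteq> 0} \<and> card {\<gamma>\<in>arrows G. p \<gamma> = u \<and> f \<gamma> \<noteq> 0} \<le> card \<B>"
    if p: "\<And>B. B \<in> \<B> \<Longrightarrow> inj_on p B" for p :: "'g \<Rightarrow> 'u" and u
  proof (intro conjI)
    let ?S = "{\<gamma>\<in>arrows G. p \<gamma> = u \<and> f \<gamma> \<noteq> 0}"
    define b where "b \<gamma> = (SOME B. B \<in> \<B> \<and> \<gamma> \<in> B)" for \<gamma>
    have b: "b \<gamma> \<in> \<B> \<and> \<gamma> \<in> b \<gamma>" if "\<gamma> \<in> ?S" for \<gamma>
      unfolding b_def by (rule someI_ex) (use that C(2) \<B>(3) in blast)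
    have inj: "inj_on b ?S"
    proof (rule inj_onI)
      fix \<alpha> \<beta> assume "\<alpha> \<in> ?S" "\<beta> \<in> ?S" "b \<alpha> = b \<beta>"
      then show "\<alpha> = \<beta>" using b[of \<alpha>] b[of \<beta>] p[of "b \<alpha>"] by (auto dest: inj_onD)
    qed
    have sub: "b ` ?S \<subseteq> \<B>" using b by auto
    show "finite ?S" by (rule inj_on_finite[OF inj sub \<B>(1)])
    show "card ?S \<le> card \<B>" by (rule card_inj_on_le[OF inj sub \<B>(1)])
  qed
  show ?thesis
    by (intro exI[of _ "card \<B>"] allI) (use *[of "rng G"] *[of "src G"] \<B>(2) in \<open>auto simp: bisection_def\<close>)
qed

text \<open>A fibre sum is below the real supremum only once the family is known to be bounded; the
  uniform number \<open>k\<close> of arrows per fibre times the bound \<open>c\<close> of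
  \<open>f\<close> does this.\<close>

lemma I_norm_ge:
  assumes f: "f \<in> Cc G" and u: "u \<in> topspace (unit_top G)"
  shows "(\<Sum>\<gamma> | \<gamma> \<in> arrows G \<and> rng G \<gamma> = u \<and> f \<gamma> \<noteq> 0. cmod (f \<gamma>)) \<le> I_norm G f"
    "(\<Sum>\<gamma> | \<gamma> \<in> arrows G \<and> src G \<gamma> = u \<and> f \<gamma> \<noteq> 0. cmod (f \<gamma>)) \<le> I_norm G f"
proof -
  obtain k where k: "\<forall>u. finite {\<gamma>\<in>arrows G. rng G \<gamma> = u \<and> f \<gamma> \<noteq> 0} \<and>
    card {\<gamma>\<in>arrows G. rng G \<gamma> = u \<and> f \<gamma> \<noteq> 0} \<le> k \<and>
    finite {\<gamma>\<in>arrows G. src G \<gamma> = u \<and> f \<gamma> \<noteq> 0} \<and>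
    card {\<gamma>\<in>arrows G. src G \<gamma> = u \<and> f \<gamma> \<noteq> 0} \<le> k"
    using Cc_fibres[OF f] by blast
  have kk: "finite {\<gamma>\<in>arrows G. rng G \<gamma> = u \<and> f \<gamma> \<noteq> 0}"
    "card {\<gamma>\<in>arrows G. rng G \<gamma> = u \<and> f \<gamma> \<noteq> 0} \<le> k"
    "finite {\<gamma>\<in>arrows G. src G \<gamma> = u \<and> f \<gamma> \<noteq> 0}"
    "card {\<gamma>\<in>arrows G. src G \<gamma> = u \<and> f \<gamma> \<noteq> 0} \<le> k" for u using k by auto
  obtain c where c: "0 \<le> c" "\<forall>\<gamma>. cmod (f \<gamma>) \<le> c" using Cc_bounded[OF f] by blast
  have eq: "(\<Sum>\<^sub>\<infinity>\<gamma>\<in>{\<gamma>\<in>arrows G. p \<gamma> = u}. cmod (f \<gamma>)) = (\<Sum>\<gamma> | \<gamma> \<in> arrows G \<and> p \<gamma> = u \<and> f \<gamma> \<noteq> 0. cmod (f \<gamma>))"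
    if "finite {\<gamma>\<in>arrows G. p \<gamma> = u \<and> f \<gamma> \<noteq> 0}" for p :: "'g \<Rightarrow> 'u" and u
  proof -
    have "(\<Sum>\<^sub>\<infinity>\<gamma>\<in>{\<gamma>\<in>arrows G. p \<gamma> = u}. cmod (f \<gamma>)) = (\<Sum>\<^sub>\<infinity>\<gamma>\<in>{\<gamma>\<in>arrows G. p \<gamma> = u \<and> f \<gamma> \<noteq> 0}. cmod (f \<gamma>))"
      by (rule infsum_cong_neutral) auto
    then show ?thesis using that by simp
  qed
  have le: "(\<Sum>\<gamma> | \<gamma> \<in> arrows G \<and> p \<gamma> = u \<and> f \<gamma> \<noteq> 0. cmod (f \<gamma>)) \<le> real k * c"
    if "card {\<gamma>\<in>arrows G. p \<gamma> = u \<and> f \<gamma> \<noteq> 0} \<le> k" for p :: "'g \<Rightarrow> 'u" and u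
  proof -
    have "(\<Sum>\<gamma> | \<gamma> \<in> arrows G \<and> p \<gamma> = u \<and> f \<gamma> \<noteq> 0. cmod (f \<gamma>)) \<le> real (card {\<gamma>\<in>arrows G. p \<gamma> = u \<and> f \<gamma> \<noteq> 0}) * c"
      by (rule sum_bounded_above) (use c in auto)
    also have "\<dots> \<le> real k * c" using that c by (intro mult_right_mono) auto
    finally show ?thesis .
  qed
  have "(\<Sum>\<gamma> | \<gamma> \<in> arrows G \<and> rng G \<gamma> = u \<and> f \<gamma> \<noteq> 0. cmod (f \<gamma>)) \<le>
      (SUP u\<in>topspace (unit_top G). \<Sum>\<^sub>\<infinity>\<gamma>\<in>{\<gamma>\<in>arrows G. rng G \<gamma> = u}. cmod (f \<gamma>))"
    unfolding eq[OF kk(1)] by (rule cSUP_upper[OF u bdd_aboveI2]) (rule le[OF kk(2)])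
  moreover have "(\<Sum>\<gamma> | \<gamma> \<in> arrows G \<and> src G \<gamma> = u \<and> f \<gamma> \<noteq> 0. cmod (f \<gamma>)) \<le>
      (SUP u\<in>topspace (unit_top G). \<Sum>\<^sub>\<infinity>\<gamma>\<in>{\<gamma>\<in>arrows G. src G \<gamma> = u}. cmod (f \<gamma>))"
    unfolding eq[OF kk(3)] by (rule cSUP_upper[OF u bdd_aboveI2]) (rule le[OF kk(4)])
  ultimately show "(\<Sum>\<gamma> | \<gamma> \<in> arrows G \<and> rng G \<gamma> = u \<and> f \<gamma> \<noteq> 0. cmod (f \<gamma>)) \<le> I_norm G f"
    "(\<Sum>\<gamma> | \<gamma> \<in> arrows G \<and> src G \<gamma> = u \<and> f \<gamma> \<noteq> 0. cmod (f \<gamma>)) \<le> I_norm G f"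
    unfolding I_norm_def by linarith+
qed

end

section \<open>Convolution of compactly supported functions\<close>

context ample_groupoid
begin

lemma finite_fibre:
  assumes "f \<in> Cc G"
  shows "finite {\<gamma>\<in>arrows G. rng G \<gamma> = u \<and> f \<gamma> \<noteq> 0}" "finite {\<gamma>\<in>arrows G. src G \<gamma> = u \<and> f \<gamma> \<noteq> 0}"
  using Cc_fibres[OF assms] by auto

text \<open>A factorisation of \<open>\<gamma>\<close> is determined by its first factor, which may
  be any arrow with the same range. The unordered sum over pairs thus becomes a finite sum over the
  support of \<open>f\<close> in one range fibre.\<close>

lemma conv_eq:
  assumes f: "f \<in> Cc G" and \<gamma>: "\<gamma> \<in> arrows G"
  shows "conv G f g \<gamma> =
    (\<Sum>\<alpha> | \<alpha> \<in> arrows G \<and> rng G \<alpha> = rng G \<gamma> \<and> f \<alpha> \<noteq> 0. f \<alpha> * g (gmult G (ginv G \<alpha>) \<gamma>))"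
proof -
  let ?P = "{(\<alpha>, \<beta>). \<alpha> \<in> arrows G \<and> \<beta> \<in> arrows G \<and> src G \<alpha> = rng G \<beta> \<and> gmult G \<alpha> \<beta> = \<gamma>}"
  let ?R = "{\<alpha>\<in>arrows G. rng G \<alpha> = rng G \<gamma>}"
  have bij: "bij_betw (\<lambda>\<alpha>. (\<alpha>, gmult G (ginv G \<alpha>) \<gamma>)) ?R ?P"
    by (rule bij_betw_byWitness[where f' = fst])
      (use \<gamma> in \<open>auto simp: inv_mult_cancel mult_inv_cancel rng_mult mult_in inv_in src_inv rng_inv\<close>)
  have "conv G f g \<gamma> = (\<Sum>\<^sub>\<infinity>\<alpha>\<in>?R. f \<alpha> * g (gmult G (ginv G \<alpha>) \<gamma>))"
    unfolding conv_def by (subst infsum_reindex_bij_betw[OF bij, symmetric]) simp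
  also have "\<dots> = (\<Sum>\<^sub>\<infinity>\<alpha>\<in>{\<alpha>\<in>arrows G. rng G \<alpha> = rng G \<gamma> \<and> f \<alpha> \<noteq> 0}. f \<alpha> * g (gmult G (ginv G \<alpha>) \<gamma>))"
    by (rule infsum_cong_neutral) auto
  finally show ?thesis using finite_fibre(1)[OF f] by simp
qed

lemma conv_vanish: "\<gamma> \<notin> arrows G \<Longrightarrow> conv G f g \<gamma> = 0"
proof -
  assume "\<gamma> \<notin> arrows G"
  then have e: "{(\<alpha>, \<beta>). \<alpha> \<in> arrows G \<and> \<beta> \<in> arrows G \<and> src G \<alpha> = rng G \<beta> \<and> gmult G \<alpha> \<beta> = \<gamma>} = {}"
    using mult_in by auto
  show ?thesis unfolding conv_def e by simp
qed

text \<open>Needed whenever functions with different supports are combined: their sums must run over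
  a common finite set.\<close>

lemma conv_eq_superset:
  assumes f: "f \<in> Cc G" and \<gamma>: "\<gamma> \<in> arrows G" and S: "finite S" "S \<subseteq> {\<alpha>\<in>arrows G. rng G \<alpha> = rng G \<gamma>}"
    "\<And>\<alpha>. \<alpha> \<in> arrows G \<Longrightarrow> rng G \<alpha> = rng G \<gamma> \<Longrightarrow> f \<alpha> \<noteq> 0 \<Longrightarrow> \<alpha> \<in> S"
  shows "conv G f g \<gamma> = (\<Sum>\<alpha>\<in>S. f \<alpha> * g (gmult G (ginv G \<alpha>) \<gamma>))"
  unfolding conv_eq[OF f \<gamma>] by (rule sum.mono_neutral_left) (use S in auto)

lemma conv_lincomb_left:
  assumes f: "f \<in> Cc G" and f': "f' \<in> Cc G"
  shows "conv G (\<lambda>\<gamma>. a * f \<gamma> + b * f' \<gamma>) g = (\<lambda>\<gamma>. a * conv G f g \<gamma> + b * conv G f' g \<gamma>)"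
proof
  fix \<gamma> show "conv G (\<lambda>\<gamma>. a * f \<gamma> + b * f' \<gamma>) g \<gamma> = a * conv G f g \<gamma> + b * conv G f' g \<gamma>"
  proof (cases "\<gamma> \<in> arrows G")
    case True
    let ?S = "{\<alpha>\<in>arrows G. rng G \<alpha> = rng G \<gamma> \<and> f \<alpha> \<noteq> 0} \<union> {\<alpha>\<in>arrows G. rng G \<alpha> = rng G \<gamma> \<and> f' \<alpha> \<noteq> 0}"
    have fin: "finite ?S" using finite_fibre(1)[OF f] finite_fibre(1)[OF f'] by simp
    have "conv G (\<lambda>\<gamma>. a * f \<gamma> + b * f' \<gamma>) g \<gamma> = (\<Sum>\<alpha>\<in>?S. (a * f \<alpha> + b * f' \<alpha>) * g (gmult G (ginv G \<alpha>) \<gamma>))"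
      by (rule conv_eq_superset[OF Cc_lincomb[OF f f'] True fin]) auto
    also have "\<dots> = a * (\<Sum>\<alpha>\<in>?S. f \<alpha> * g (gmult G (ginv G \<alpha>) \<gamma>)) + b * (\<Sum>\<alpha>\<in>?S. f' \<alpha> * g (gmult G (ginv G \<alpha>) \<gamma>))"
      by (simp only: sum_distrib_left sum.distrib[symmetric] ring_distribs mult.assoc)
    also have "(\<Sum>\<alpha>\<in>?S. f \<alpha> * g (gmult G (ginv G \<alpha>) \<gamma>)) = conv G f g \<gamma>"
      by (rule conv_eq_superset[OF f True fin, symmetric]) auto
    also have "(\<Sum>\<alpha>\<in>?S. f' \<alpha> * g (gmult G (ginv G \<alpha>) \<gamma>)) = conv G f' g \<gamma>"
      by (rule conv_eq_superset[OF f' True fin, symmetric]) auto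
    finally show ?thesis .
  qed (simp add: conv_vanish)
qed

lemma conv_lincomb_right:
  assumes f: "f \<in> Cc G"
  shows "conv G f (\<lambda>\<gamma>. a * g \<gamma> + b * g' \<gamma>) = (\<lambda>\<gamma>. a * conv G f g \<gamma> + b * conv G f g' \<gamma>)"
proof
  fix \<gamma> show "conv G f (\<lambda>\<gamma>. a * g \<gamma> + b * g' \<gamma>) \<gamma> = a * conv G f g \<gamma> + b * conv G f g' \<gamma>"
    by (cases "\<gamma> \<in> arrows G")
      (simp_all add: conv_vanish conv_eq[OF f] sum_distrib_left sum.distrib ring_distribs mult_ac)
qed

lemma conv_support:
  assumes f: "f \<in> Cc G" and "conv G f g \<gamma> \<noteq> 0"
  obtains \<alpha> \<beta> where "\<alpha> \<in> arrows G" "\<beta> \<in> arrows G" "src G \<alpha> = rng G \<beta>" "\<gamma> = gmult G \<alpha> \<beta>" "f \<alpha> \<noteq> 0" "g \<beta> \<noteq> 0"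
proof -
  have \<gamma>: "\<gamma> \<in> arrows G" using assms(2) conv_vanish by blast
  have "\<exists>\<alpha>\<in>{\<alpha>\<in>arrows G. rng G \<alpha> = rng G \<gamma> \<and> f \<alpha> \<noteq> 0}. f \<alpha> * g (gmult G (ginv G \<alpha>) \<gamma>) \<noteq> 0"
    using assms(2) unfolding conv_eq[OF f \<gamma>] by (meson sum.neutral)
  then obtain \<alpha> where "\<alpha> \<in> arrows G" "rng G \<alpha> = rng G \<gamma>" "f \<alpha> \<noteq> 0" "g (gmult G (ginv G \<alpha>) \<gamma>) \<noteq> 0"
    by auto
  then show ?thesis
    using \<gamma> by (intro that[of \<alpha> "gmult G (ginv G \<alpha>) \<gamma>"]) (auto simp: mult_in inv_in src_inv rng_inv rng_mult mult_inv_cancel)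
qed

text \<open>The support lies in the image under multiplication of the composable pairs from the two
  compact supports. Composable pairs form a closed set because the unit space is Hausdorff, so that
  image is compact.\<close>

lemma conv_supp_compact:
  assumes f: "f \<in> Cc G" and g: "g \<in> Cc G"
  shows "\<exists>C. compactin (arrow_top G) C \<and> (\<forall>\<gamma>. conv G f g \<gamma> \<noteq> 0 \<longrightarrow> \<gamma> \<in> C)"
proof -
  obtain C where C: "compactin (arrow_top G) C" "\<forall>\<gamma>. f \<gamma> \<noteq> 0 \<longrightarrow> \<gamma> \<in> C"
    using Cc_support[OF f] by blast
  obtain D where D: "compactin (arrow_top G) D" "\<forall>\<gamma>. g \<gamma> \<noteq> 0 \<longrightarrow> \<gamma> \<in> D"
    using Cc_support[OF g] by blast
  let ?T = "prod_topology (arrow_top G) (arrow_top G)"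
  let ?E = "{(\<alpha>, \<beta>). src G \<alpha> = rng G \<beta>}"
  have "closedin ?T {p \<in> topspace ?T. src G (fst p) = rng G (snd p)}"
    by (rule closedin_continuous_maps_eq[OF Hausdorff_unit])
       (auto intro: continuous_map_compose[OF continuous_map_fst continuous_src, unfolded o_def]
         continuous_map_compose[OF continuous_map_snd continuous_rng, unfolded o_def])
  moreover have "compactin ?T (C \<times> D)"
    using C(1) D(1) by (simp add: compactin_Times)
  ultimately have "compactin ?T ({p \<in> topspace ?T. src G (fst p) = rng G (snd p)} \<inter> C \<times> D)"
    by (rule closed_Int_compactin)
  then have "compactin (subtopology ?T ?E) ({p \<in> topspace ?T. src G (fst p) = rng G (snd p)} \<inter> C \<times> D)"
    by (auto simp: compactin_subtopology)
  from image_compactin[OF this continuous_mult]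
  have "compactin (arrow_top G) ((\<lambda>(\<alpha>, \<beta>). gmult G \<alpha> \<beta>) ` ({p \<in> topspace ?T. src G (fst p) = rng G (snd p)} \<inter> C \<times> D))" .
  moreover have "\<gamma> \<in> (\<lambda>(\<alpha>, \<beta>). gmult G \<alpha> \<beta>) ` ({p \<in> topspace ?T. src G (fst p) = rng G (snd p)} \<inter> C \<times> D)"
    if nz: "conv G f g \<gamma> \<noteq> 0" for \<gamma>
  proof -
    from nz obtain \<alpha> \<beta> where *: "\<alpha> \<in> arrows G" "\<beta> \<in> arrows G" "src G \<alpha> = rng G \<beta>" "\<gamma> = gmult G \<alpha> \<beta>" "f \<alpha> \<noteq> 0" "g \<beta> \<noteq> 0"
      by (rule conv_support[OF f])
    show ?thesis
      by (rule image_eqI[where x = "(\<alpha>, \<beta>)"]) (use * C(2) D(2) in \<open>auto simp: topspace_arrow\<close>)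
  qed
  ultimately show ?thesis by blast
qed

text \<open>When \<open>f\<close> lives on one bisection, the sum has a single term: the arrow of
  \<open>B\<close> with the same range as \<open>\<gamma>\<close>. The range map is a homeomorphism
  from \<open>B\<close> onto its open image, so its inverse \<open>\<rho>\<close> selects that arrow
  continuously.\<close>

lemma conv_continuous_bisection:
  assumes f: "f \<in> Cc G" and g: "g \<in> Cc G" and B: "bisection B" and sub: "\<And>\<gamma>. f \<gamma> \<noteq> 0 \<Longrightarrow> \<gamma> \<in> B"
  shows "continuous_map (arrow_top G) euclidean (conv G f g)"
proof -
  obtain C where C: "compactin (arrow_top G) C" "C \<subseteq> arrows G" "\<forall>\<gamma>. f \<gamma> \<noteq> 0 \<longrightarrow> \<gamma> \<in> C"
    using Cc_support[OF f] by blast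
  have B': "openin (arrow_top G) B" "closedin (arrow_top G) B" "inj_on (rng G) B" "B \<subseteq> arrows G"
    using B bisection_subset[OF B] by (auto simp: bisection_def)
  have CB: "compactin (arrow_top G) (B \<inter> C)" by (rule closed_Int_compactin[OF B'(2) C(1)])
  define U where "U = {\<gamma> \<in> topspace (arrow_top G). rng G \<gamma> \<in> rng G ` B}"
  \<comment> \<open>On \<open>U\<close> the bisection has an arrow of the required range, on
    \<open>V\<close> nothing in the support can contribute. Both sets are open, \<open>V\<close>
    because the compact set \<open>B \<inter> C\<close> has a closed image, and they cover the
    arrows; on the overlap the one-term formula gives zero.\<close>
  define V where "V = {\<gamma> \<in> topspace (arrow_top G). rng G \<gamma> \<in> topspace (unit_top G) - rng G ` (B \<inter> C)}"
  have rB: "openin (unit_top G) (rng G ` B)"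
    using open_rng B'(1) by (simp add: open_map_def)
  have U: "openin (arrow_top G) U"
    unfolding U_def by (rule openin_continuous_map_preimage[OF continuous_rng rB])
  have "closedin (unit_top G) (rng G ` (B \<inter> C))"
    by (rule compactin_imp_closedin[OF Hausdorff_unit image_compactin[OF CB continuous_rng]])
  then have V: "openin (arrow_top G) V"
    unfolding V_def by (intro openin_continuous_map_preimage[OF continuous_rng]) (simp add: openin_diff)
  have hom: "homeomorphic_map (subtopology (arrow_top G) B) (subtopology (unit_top G) (rng G ` B)) (rng G)"
  proof (rule bijective_open_imp_homeomorphic_map)
    show "continuous_map (subtopology (arrow_top G) B) (subtopology (unit_top G) (rng G ` B)) (rng G)"
      by (intro continuous_map_into_subtopology continuous_map_from_subtopology continuous_rng) auto
    show "open_map (subtopology (arrow_top G) B) (subtopology (unit_top G) (rng G ` B)) (rng G)"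
      unfolding open_map_def
    proof (intro allI impI)
      fix W assume "openin (subtopology (arrow_top G) B) W"
      then have "openin (arrow_top G) W" "W \<subseteq> B"
        using B'(1) by (auto simp: openin_open_subtopology)
      then show "openin (subtopology (unit_top G) (rng G ` B)) (rng G ` W)"
        using open_rng rB by (auto simp: open_map_def openin_open_subtopology)
    qed
    show "rng G ` topspace (subtopology (arrow_top G) B) = topspace (subtopology (unit_top G) (rng G ` B))"
      using B'(4) rng_in by (auto simp: topspace_arrow)
    show "inj_on (rng G) (topspace (subtopology (arrow_top G) B))"
      by (rule inj_on_subset[OF B'(3)]) auto
  qed
  then obtain \<rho> where \<rho>: "continuous_map (subtopology (unit_top G) (rng G ` B)) (subtopology (arrow_top G) B) \<rho>"
    and "\<forall>\<alpha>\<in>topspace (subtopology (arrow_top G) B). \<rho> (rng G \<alpha>) = \<alpha>"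
    by (auto simp: homeomorphic_map_maps homeomorphic_maps_def)
  then have \<rho>_rng: "\<rho> (rng G \<alpha>) = \<alpha>" if "\<alpha> \<in> B" for \<alpha>
    using that B'(4) by (auto simp: topspace_arrow)
  have conv_U: "conv G f g \<gamma> = f (\<rho> (rng G \<gamma>)) * g (gmult G (ginv G (\<rho> (rng G \<gamma>))) \<gamma>)" if "\<gamma> \<in> U" for \<gamma>
  proof -
    have "rng G \<gamma> \<in> rng G ` B" and \<gamma>: "\<gamma> \<in> arrows G"
      using that by (auto simp: U_def topspace_arrow)
    then obtain \<alpha> where \<alpha>: "\<alpha> \<in> B" "rng G \<alpha> = rng G \<gamma>" "\<gamma> \<in> arrows G"
      by (metis imageE)
    have "conv G f g \<gamma> = (\<Sum>\<alpha>\<in>{\<alpha>}. f \<alpha> * g (gmult G (ginv G \<alpha>) \<gamma>))"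
      by (rule conv_eq_superset[OF f \<alpha>(3)]) (use \<alpha> sub B'(4) in \<open>auto intro: inj_onD[OF B'(3)]\<close>)
    then show ?thesis using \<rho>_rng[OF \<alpha>(1)] \<alpha>(2) by simp
  qed
  have conv_V: "conv G f g \<gamma> = 0" if "\<gamma> \<in> V" for \<gamma>
  proof (rule ccontr)
    assume "conv G f g \<gamma> \<noteq> 0"
    then obtain \<alpha> \<beta> where *: "\<alpha> \<in> arrows G" "\<beta> \<in> arrows G" "src G \<alpha> = rng G \<beta>" "\<gamma> = gmult G \<alpha> \<beta>" "f \<alpha> \<noteq> 0"
      by (rule conv_support[OF f])
    then have "rng G \<gamma> = rng G \<alpha>" "\<alpha> \<in> B \<inter> C" using sub C(3) by (auto simp: rng_mult)
    then show False using that by (auto simp: V_def)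
  qed
  have UV: "x \<in> U \<or> x \<in> V" if x: "x \<in> topspace (arrow_top G)" for x
    using x rng_in by (auto simp: U_def V_def topspace_arrow)
  have r: "continuous_map (subtopology (arrow_top G) U) (arrow_top G) (\<lambda>\<gamma>. \<rho> (rng G \<gamma>))"
  proof -
    have "continuous_map (subtopology (arrow_top G) U) (subtopology (unit_top G) (rng G ` B)) (rng G)"
      by (intro continuous_map_into_subtopology continuous_map_from_subtopology continuous_rng)
        (auto simp: U_def)
    from continuous_map_compose[OF this \<rho>] show ?thesis
      by (simp add: o_def continuous_map_in_subtopology)
  qed
  have \<rho>_props: "\<rho> (rng G \<gamma>) \<in> arrows G \<and> rng G (\<rho> (rng G \<gamma>)) = rng G \<gamma>" if "\<gamma> \<in> U" for \<gamma>
    using that \<rho>_rng B'(4) by (auto simp: U_def)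
  have m: "continuous_map (subtopology (arrow_top G) U) (arrow_top G) (\<lambda>\<gamma>. gmult G (ginv G (\<rho> (rng G \<gamma>))) \<gamma>)"
  proof -
    have "continuous_map (subtopology (arrow_top G) U) (prod_topology (arrow_top G) (arrow_top G))
        (\<lambda>\<gamma>. (ginv G (\<rho> (rng G \<gamma>)), \<gamma>))"
      by (intro continuous_map_pairedI continuous_map_from_subtopology continuous_map_id[unfolded id_def]
          continuous_map_compose[OF r continuous_inv, unfolded o_def])
    then have "continuous_map (subtopology (arrow_top G) U) (subtopology (prod_topology (arrow_top G) (arrow_top G))
        {(\<alpha>, \<beta>). src G \<alpha> = rng G \<beta>}) (\<lambda>\<gamma>. (ginv G (\<rho> (rng G \<gamma>)), \<gamma>))"
      by (rule continuous_map_into_subtopology) (use \<rho>_props in \<open>auto simp: src_inv\<close>)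
    from continuous_map_compose[OF this continuous_mult] show ?thesis by (simp add: o_def)
  qed
  have cU: "continuous_map (subtopology (arrow_top G) U) euclidean
      (\<lambda>\<gamma>. f (\<rho> (rng G \<gamma>)) * g (gmult G (ginv G (\<rho> (rng G \<gamma>))) \<gamma>))"
    by (rule continuous_map_binop[OF continuous_map_compose[OF r Cc_continuous[OF f], unfolded o_def]
          continuous_map_compose[OF m Cc_continuous[OF g], unfolded o_def]]) (intro continuous_intros)
  let ?T = "\<lambda>b. if b then U else V"
  let ?h = "\<lambda>b \<gamma>. if b then f (\<rho> (rng G \<gamma>)) * g (gmult G (ginv G (\<rho> (rng G \<gamma>))) \<gamma>) else 0"
  show ?thesis
  proof (rule pasting_lemma[where I = UNIV and T = ?T and f = ?h])
    show "openin (arrow_top G) (?T b)" for b using U V by simp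
    show "continuous_map (subtopology (arrow_top G) (?T b)) euclidean (?h b)" for b
      using cU by (cases b) auto
    show "?h i x = ?h j x" if "x \<in> topspace (arrow_top G) \<inter> ?T i \<inter> ?T j" for i j x
      using that conv_U[of x] conv_V[of x] by (cases i; cases j) auto
    show "\<exists>j. j \<in> UNIV \<and> x \<in> ?T j \<and> conv G f g x = ?h j x" if "x \<in> topspace (arrow_top G)" for x
      using UV[OF that] conv_U[of x] conv_V[of x] by (metis (full_types) UNIV_I)
  qed
qed

lemma Cc_conv:
  assumes f: "f \<in> Cc G" and g: "g \<in> Cc G"
  shows "conv G f g \<in> Cc G"
proof -
  obtain C where C: "compactin (arrow_top G) C" "\<forall>\<gamma>. conv G f g \<gamma> \<noteq> 0 \<longrightarrow> \<gamma> \<in> C"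
    using conv_supp_compact[OF f g] by blast
  \<comment> \<open>The function varies in the induction because each step splits off the part on
    one bisection and continues with the rest.\<close>
  have *: "continuous_map (arrow_top G) euclidean (conv G f g)"
    if "finite \<B>" "\<forall>B\<in>\<B>. bisection B" "f \<in> Cc G" "\<forall>\<gamma>. f \<gamma> \<noteq> 0 \<longrightarrow> \<gamma> \<in> \<Union>\<B>" for \<B> f
    using that
  proof (induction \<B> arbitrary: f)
    case empty
    then have "f = (\<lambda>_. 0)" by auto
    moreover have "conv G (\<lambda>_. 0) g = (\<lambda>_. 0)" by (simp add: conv_def fun_eq_iff case_prod_unfold)
    ultimately show ?case by simp
  next
    case (insert B \<B>)
    have B: "bisection B" "openin (arrow_top G) B" "closedin (arrow_top G) B"
      using insert.prems by (auto simp: bisection_def)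
    let ?B' = "topspace (arrow_top G) - B"
    let ?f1 = "\<lambda>\<gamma>. if \<gamma> \<in> B then f \<gamma> else 0" and ?f2 = "\<lambda>\<gamma>. if \<gamma> \<in> ?B' then f \<gamma> else 0"
    have f12: "?f1 \<in> Cc G" "?f2 \<in> Cc G"
      by (rule Cc_restrict[OF insert.prems(2)]; use B in \<open>simp add: openin_diff closedin_diff\<close>)+
    have "f = (\<lambda>\<gamma>. 1 * ?f1 \<gamma> + 1 * ?f2 \<gamma>)"
      using Cc_vanish[OF insert.prems(2)] by (auto simp: fun_eq_iff topspace_arrow)
    then have eq: "conv G f g = (\<lambda>\<gamma>. 1 * conv G ?f1 g \<gamma> + 1 * conv G ?f2 g \<gamma>)"
      using conv_lincomb_left[OF f12, of 1 1 g] by metis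
    have "continuous_map (arrow_top G) euclidean (conv G ?f1 g)"
      by (rule conv_continuous_bisection[OF f12(1) g B(1)]) (auto split: if_splits)
    moreover have "continuous_map (arrow_top G) euclidean (conv G ?f2 g)"
      by (rule insert.IH[OF _ f12(2)]) (use insert.prems in \<open>auto split: if_splits\<close>)
    ultimately show ?case
      unfolding eq by (rule continuous_map_binop) (intro continuous_intros)
  qed
  obtain D where D: "compactin (arrow_top G) D" "\<forall>\<gamma>. f \<gamma> \<noteq> 0 \<longrightarrow> \<gamma> \<in> D"
    using Cc_support[OF f] by blast
  obtain \<B> where \<B>: "finite \<B>" "\<forall>B\<in>\<B>. bisection B" "D \<subseteq> \<Union>\<B>"
    using compactin_bisections[OF D(1)] by blast
  have "continuous_map (arrow_top G) euclidean (conv G f g)"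
    by (rule *[OF \<B>(1,2) f]) (use D(2) \<B>(3) in blast)
  then show ?thesis by (rule CcI[OF _ _ C(1)]) (use C(2) conv_vanish in auto)
qed

end

section \<open>The regular representations\<close>

context ample_groupoid
begin

lemma inv_unit: "u \<in> topspace (unit_top G) \<Longrightarrow> ginv G (unit G u) = unit G u"
  using inv_mult[of "unit G u"] mult_unit[of "ginv G (unit G u)"]
  by (simp add: unit_in src_unit rng_unit src_inv inv_in)

text \<open>The matrix of left convolution by \<open>f\<close> on the square-summable functions over
  the source fibre of \<open>u\<close>, extended by zero to all pairs of arrows.\<close>

definition regular_matrix :: "'u \<Rightarrow> ('g \<Rightarrow> complex) \<Rightarrow> 'g \<Rightarrow> 'g \<Rightarrow> complex" where
  "regular_matrix u f i j =
     (if i \<in> arrows G \<and> j \<in> arrows G \<and> src G i = u \<and> src G j = u then f (gmult G i (ginv G j)) else 0)"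

text \<open>Row sums are sums of \<open>f\<close> over range fibres and column sums are sums over
  source fibres, and the I-norm is the larger of the two suprema. This is why the regular
  representation satisfies Renault's bound.\<close>

lemma schur_regular_matrix:
  assumes f: "f \<in> Cc G" and u: "u \<in> topspace (unit_top G)"
  shows "schur_matrix {\<gamma>\<in>arrows G. src G \<gamma> = u} (I_norm G f) (regular_matrix u f)"
proof -
  let ?J = "{\<gamma>\<in>arrows G. src G \<gamma> = u}"
  let ?M = "regular_matrix u f"
  have nonneg: "0 \<le> I_norm G f"
    by (rule order_trans[OF sum_nonneg I_norm_ge(1)[OF f u]]) simp
  have row: "finite {j. ?M i j \<noteq> 0} \<and> (\<Sum>j | ?M i j \<noteq> 0. cmod (?M i j)) \<le> I_norm G f" for i
  proof (cases "i \<in> ?J")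
    case True
    then have i: "i \<in> arrows G" "src G i = u" by auto
    let ?T = "{\<alpha>\<in>arrows G. rng G \<alpha> = rng G i \<and> f \<alpha> \<noteq> 0}"
    have bij: "bij_betw (\<lambda>j. gmult G i (ginv G j)) {j. ?M i j \<noteq> 0} ?T"
    proof -
      have "bij_betw (\<lambda>j. gmult G i (ginv G j)) {j \<in> {j\<in>arrows G. src G j = src G i}. f (gmult G i (ginv G j)) \<noteq> 0}
          {\<alpha> \<in> {\<alpha>\<in>arrows G. rng G \<alpha> = rng G i}. f \<alpha> \<noteq> 0}"
        by (rule bij_betw_Collect[OF rng_fibre_bij[OF i(1)]]) simp
      moreover have "{j \<in> {j\<in>arrows G. src G j = src G i}. f (gmult G i (ginv G j)) \<noteq> 0} = {j. ?M i j \<noteq> 0}"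
        using i by (auto simp: regular_matrix_def)
      ultimately show ?thesis by simp
    qed
    have "finite {j. ?M i j \<noteq> 0}"
      using bij_betw_finite[OF bij] finite_fibre(1)[OF f] by simp
    moreover have "(\<Sum>j | ?M i j \<noteq> 0. cmod (?M i j)) = (\<Sum>\<alpha>\<in>?T. cmod (f \<alpha>))"
      by (subst sum.reindex_bij_betw[OF bij, symmetric], rule sum.cong)
         (auto simp: regular_matrix_def split: if_splits)
    ultimately show ?thesis using I_norm_ge(1)[OF f rng_in[OF i(1)]] by simp
  next
    case False
    then have "?M i j = 0" for j by (auto simp: regular_matrix_def)
    then show ?thesis using nonneg by simp
  qed
  have col: "finite {i. ?M i j \<noteq> 0} \<and> (\<Sum>i | ?M i j \<noteq> 0. cmod (?M i j)) \<le> I_norm G f" for j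
  proof (cases "j \<in> ?J")
    case True
    then have j: "j \<in> arrows G" "src G j = u" by auto
    let ?T = "{\<alpha>\<in>arrows G. src G \<alpha> = rng G j \<and> f \<alpha> \<noteq> 0}"
    have bij: "bij_betw (\<lambda>i. gmult G i (ginv G j)) {i. ?M i j \<noteq> 0} ?T"
    proof -
      have "bij_betw (\<lambda>i. gmult G i (ginv G j)) {i \<in> {i\<in>arrows G. src G i = src G j}. f (gmult G i (ginv G j)) \<noteq> 0}
          {\<alpha> \<in> {\<alpha>\<in>arrows G. src G \<alpha> = rng G j}. f \<alpha> \<noteq> 0}"
        by (rule bij_betw_Collect[OF src_fibre_bij[OF j(1)]]) simp
      moreover have "{i \<in> {i\<in>arrows G. src G i = src G j}. f (gmult G i (ginv G j)) \<noteq> 0} = {i. ?M i j \<noteq> 0}"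
        using j by (auto simp: regular_matrix_def)
      ultimately show ?thesis by simp
    qed
    have "finite {i. ?M i j \<noteq> 0}"
      using bij_betw_finite[OF bij] finite_fibre(2)[OF f] by simp
    moreover have "(\<Sum>i | ?M i j \<noteq> 0. cmod (?M i j)) = (\<Sum>\<alpha>\<in>?T. cmod (f \<alpha>))"
      by (subst sum.reindex_bij_betw[OF bij, symmetric], rule sum.cong)
         (auto simp: regular_matrix_def split: if_splits)
    ultimately show ?thesis using I_norm_ge(2)[OF f rng_in[OF j(1)]] by simp
  next
    case False
    then have "?M i j = 0" for i by (auto simp: regular_matrix_def)
    then show ?thesis using nonneg by simp
  qed
  show ?thesis
    unfolding schur_matrix_def using row col by (auto simp: regular_matrix_def split: if_splits)
qed

text \<open>Substituting \<open>gmult G i (ginv G j)\<close> for the first factor of the convolution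
  leaves \<open>gmult G j (ginv G k)\<close> as the second one, which is exactly a matrix
  product.\<close>

lemma regular_matrix_conv:
  assumes f: "f \<in> Cc G" and u: "u \<in> topspace (unit_top G)"
  shows "regular_matrix u (conv G f g) i k = (\<Sum>j | regular_matrix u f i j \<noteq> 0. regular_matrix u f i j * regular_matrix u g j k)"
proof (cases "i \<in> arrows G \<and> k \<in> arrows G \<and> src G i = u \<and> src G k = u")
  case True
  then have i: "i \<in> arrows G" "src G i = u" and k: "k \<in> arrows G" "src G k = u" by auto
  let ?T = "{\<alpha>\<in>arrows G. rng G \<alpha> = rng G i \<and> f \<alpha> \<noteq> 0}"
  have bij: "bij_betw (\<lambda>j. gmult G i (ginv G j)) {j. regular_matrix u f i j \<noteq> 0} ?T"
  proof -
    have "bij_betw (\<lambda>j. gmult G i (ginv G j)) {j \<in> {j\<in>arrows G. src G j = src G i}. f (gmult G i (ginv G j)) \<noteq> 0}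
        {\<alpha> \<in> {\<alpha>\<in>arrows G. rng G \<alpha> = rng G i}. f \<alpha> \<noteq> 0}"
      by (rule bij_betw_Collect[OF rng_fibre_bij[OF i(1)]]) simp
    moreover have "{j \<in> {j\<in>arrows G. src G j = src G i}. f (gmult G i (ginv G j)) \<noteq> 0} = {j. regular_matrix u f i j \<noteq> 0}"
      using i by (auto simp: regular_matrix_def)
    ultimately show ?thesis by simp
  qed
  have "regular_matrix u (conv G f g) i k = conv G f g (gmult G i (ginv G k))"
    using i k by (simp add: regular_matrix_def)
  also have "\<dots> = (\<Sum>\<alpha>\<in>?T. f \<alpha> * g (gmult G (ginv G \<alpha>) (gmult G i (ginv G k))))"
    using i k by (subst conv_eq[OF f]) (auto simp: mult_in inv_in rng_inv rng_mult)
  also have "\<dots> = (\<Sum>j | regular_matrix u f i j \<noteq> 0. f (gmult G i (ginv G j)) *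
      g (gmult G (ginv G (gmult G i (ginv G j))) (gmult G i (ginv G k))))"
    by (rule sum.reindex_bij_betw[OF bij, symmetric])
  also have "\<dots> = (\<Sum>j | regular_matrix u f i j \<noteq> 0. regular_matrix u f i j * regular_matrix u g j k)"
  proof (rule sum.cong)
    fix j assume "j \<in> {j. regular_matrix u f i j \<noteq> 0}"
    then have j: "j \<in> arrows G" "src G j = u" by (auto simp: regular_matrix_def split: if_splits)
    have "gmult G (ginv G (gmult G i (ginv G j))) (gmult G i (ginv G k)) =
        gmult G (gmult G j (ginv G i)) (gmult G i (ginv G k))"
      using i j by (simp add: inv_mult_rev inv_in rng_inv inv_inv)
    also have "\<dots> = gmult G j (gmult G (ginv G i) (gmult G i (ginv G k)))"
      using i j k by (intro mult_assoc) (auto simp: inv_in rng_inv src_inv mult_in rng_mult)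
    also have "\<dots> = gmult G j (ginv G k)"
      using i k by (simp add: inv_mult_cancel inv_in rng_inv)
    finally show "f (gmult G i (ginv G j)) * g (gmult G (ginv G (gmult G i (ginv G j))) (gmult G i (ginv G k))) =
        regular_matrix u f i j * regular_matrix u g j k"
      using i j k by (simp add: regular_matrix_def)
  qed simp
  finally show ?thesis .
next
  case False
  then have "regular_matrix u f i j * regular_matrix u g j k = 0" for j by (auto simp: regular_matrix_def)
  moreover have "regular_matrix u (conv G f g) i k = 0" using False by (auto simp: regular_matrix_def)
  ultimately show ?thesis by (simp only: sum.neutral_const)
qed

lemma bounded_rep_regular:
  assumes u: "u \<in> topspace (unit_top G)"
  shows "bounded_rep G {\<gamma>\<in>arrows G. src G \<gamma> = u} (\<lambda>f. matrix_op (regular_matrix u f))"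
proof -
  let ?J = "{\<gamma>\<in>arrows G. src G \<gamma> = u}"
  have schur: "schur_matrix ?J (I_norm G f) (regular_matrix u f)" if "f \<in> Cc G" for f
    by (rule schur_regular_matrix[OF that u])
  have fin: "finite {j. regular_matrix u f i j \<noteq> 0}" if "f \<in> Cc G" for f i
    using schur[OF that] by (simp add: schur_matrix_def)
  have lin: "matrix_op (regular_matrix u (\<lambda>\<gamma>. a * f \<gamma> + b * g \<gamma>)) \<xi> =
      (\<lambda>j. a * matrix_op (regular_matrix u f) \<xi> j + b * matrix_op (regular_matrix u g) \<xi> j)"
    if f: "f \<in> Cc G" and g: "g \<in> Cc G" for f g a b \<xi>
  proof
    fix i
    let ?I = "{j. regular_matrix u f i j \<noteq> 0} \<union> {j. regular_matrix u g i j \<noteq> 0}"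
    have I: "finite ?I" using fin[OF f] fin[OF g] by simp
    have e: "regular_matrix u (\<lambda>\<gamma>. a * f \<gamma> + b * g \<gamma>) i j = a * regular_matrix u f i j + b * regular_matrix u g i j" for j
      by (simp add: regular_matrix_def)
    have "matrix_op (regular_matrix u (\<lambda>\<gamma>. a * f \<gamma> + b * g \<gamma>)) \<xi> i =
        (\<Sum>j\<in>?I. (a * regular_matrix u f i j + b * regular_matrix u g i j) * \<xi> j)"
      by (subst matrix_op_sum[OF I]) (auto simp: e)
    also have "\<dots> = a * (\<Sum>j\<in>?I. regular_matrix u f i j * \<xi> j) + b * (\<Sum>j\<in>?I. regular_matrix u g i j * \<xi> j)"
      by (simp only: sum_distrib_left sum.distrib[symmetric] ring_distribs mult.assoc)
    also have "(\<Sum>j\<in>?I. regular_matrix u f i j * \<xi> j) = matrix_op (regular_matrix u f) \<xi> i"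
      by (rule matrix_op_sum[OF I, symmetric]) auto
    also have "(\<Sum>j\<in>?I. regular_matrix u g i j * \<xi> j) = matrix_op (regular_matrix u g) \<xi> i"
      by (rule matrix_op_sum[OF I, symmetric]) auto
    finally show "matrix_op (regular_matrix u (\<lambda>\<gamma>. a * f \<gamma> + b * g \<gamma>)) \<xi> i =
        a * matrix_op (regular_matrix u f) \<xi> i + b * matrix_op (regular_matrix u g) \<xi> i" .
  qed
  have mult: "matrix_op (regular_matrix u (conv G f g)) \<xi> = matrix_op (regular_matrix u f) (matrix_op (regular_matrix u g) \<xi>)"
    if f: "f \<in> Cc G" and g: "g \<in> Cc G" for f g \<xi>
  proof
    fix i
    let ?R = "{j. regular_matrix u f i j \<noteq> 0}"
    \<comment> \<open>Including the support of the row of the product spares the argument that it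
      already lies in the first union.\<close>
    let ?I = "(\<Union>j\<in>?R. {k. regular_matrix u g j k \<noteq> 0}) \<union> {k. regular_matrix u (conv G f g) i k \<noteq> 0}"
    have I: "finite ?I" using fin[OF f] fin[OF g] fin[OF Cc_conv[OF f g]] by simp
    have "matrix_op (regular_matrix u f) (matrix_op (regular_matrix u g) \<xi>) i =
        (\<Sum>j\<in>?R. regular_matrix u f i j * matrix_op (regular_matrix u g) \<xi> j)"
      by (simp add: matrix_op_def)
    also have "\<dots> = (\<Sum>j\<in>?R. regular_matrix u f i j * (\<Sum>k\<in>?I. regular_matrix u g j k * \<xi> k))"
      by (intro sum.cong refl arg_cong2[where f = "(*)"] matrix_op_sum[OF I]) auto
    also have "\<dots> = (\<Sum>k\<in>?I. (\<Sum>j\<in>?R. regular_matrix u f i j * regular_matrix u g j k) * \<xi> k)"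
      by (simp only: sum_distrib_left sum_distrib_right mult.assoc) (rule sum.swap)
    also have "\<dots> = (\<Sum>k\<in>?I. regular_matrix u (conv G f g) i k * \<xi> k)"
      by (simp only: regular_matrix_conv[OF f u])
    also have "\<dots> = matrix_op (regular_matrix u (conv G f g)) \<xi> i"
      by (rule matrix_op_sum[OF I, symmetric]) auto
    finally show "matrix_op (regular_matrix u (conv G f g)) \<xi> i = matrix_op (regular_matrix u f) (matrix_op (regular_matrix u g) \<xi>) i" ..
  qed
  have adj: "ell2_inner (matrix_op (regular_matrix u f) \<xi>) \<eta> = ell2_inner \<xi> (matrix_op (regular_matrix u (invol G f)) \<eta>)"
    if f: "f \<in> Cc G" and "\<xi> \<in> ell2 ?J" "\<eta> \<in> ell2 ?J" for f \<xi> \<eta>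
  proof -
    have "regular_matrix u (invol G f) = (\<lambda>i j. cnj (regular_matrix u f j i))"
      by (auto simp: fun_eq_iff regular_matrix_def invol_def mult_in inv_in rng_inv inv_mult_rev inv_inv)
    then show ?thesis using matrix_op_adjoint[OF schur[OF f] that(2,3)] by simp
  qed
  show ?thesis
    unfolding bounded_rep_def
  proof (intro conjI ballI allI)
    fix f assume f: "f \<in> Cc G"
    show "bounded_operator ?J (matrix_op (regular_matrix u f))" "op_norm ?J (matrix_op (regular_matrix u f)) \<le> I_norm G f"
      by (rule bounded_operator_matrix_op[OF schur[OF f]])+
  qed (rule lin mult adj; assumption)+
qed

text \<open>The operator is applied to the unit vector at \<open>unit G u\<close>: its image is the
  restriction of \<open>f\<close> to the source fibre, whose norm is thus at most the operator
  norm.\<close>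

lemma L2_set_src_fibre_le_op_norm:
  assumes f: "f \<in> Cc G" and u: "u \<in> topspace (unit_top G)" and I: "finite I" "I \<subseteq> {\<gamma>\<in>arrows G. src G \<gamma> = u}"
  shows "L2_set (\<lambda>\<gamma>. cmod (f \<gamma>)) I \<le> op_norm {\<gamma>\<in>arrows G. src G \<gamma> = u} (matrix_op (regular_matrix u f))"
proof -
  let ?J = "{\<gamma>\<in>arrows G. src G \<gamma> = u}"
  let ?M = "regular_matrix u f"
  define \<delta> :: "'g \<Rightarrow> complex" where "\<delta> = (\<lambda>\<gamma>. if \<gamma> = unit G u then 1 else 0)"
  have d1: "L2_set (\<lambda>j. cmod (\<delta> j)) I' \<le> 1" if "finite I'" for I'
  proof -
    have "(\<Sum>j\<in>I'. (cmod (\<delta> j))\<^sup>2) = (\<Sum>j\<in>I'. if j = unit G u then 1 else 0)"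
      by (rule sum.cong) (auto simp: \<delta>_def)
    then show ?thesis using that by (simp add: L2_set_def sum.delta')
  qed
  have d2: "\<delta> j = 0" if "j \<notin> ?J" for j
    using that u by (auto simp: \<delta>_def unit_in src_unit)
  have \<delta>: "\<delta> \<in> ell2 ?J" "ell2_norm \<delta> \<le> 1"
    by (rule ell2I, erule d2, erule d1)+
  have "matrix_op ?M \<delta> i = f i" if "i \<in> ?J" for i
  proof -
    have "?M i (unit G u) = f i"
      using that u mult_unit[of i] by (auto simp: regular_matrix_def unit_in src_unit inv_unit)
    moreover have "matrix_op ?M \<delta> i = (\<Sum>j | ?M i j \<noteq> 0. if j = unit G u then ?M i (unit G u) else 0)"
      unfolding matrix_op_def by (rule sum.cong) (auto simp: \<delta>_def)
    moreover have "finite {j. ?M i j \<noteq> 0}"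
      using schur_regular_matrix[OF f u] by (simp add: schur_matrix_def)
    ultimately show ?thesis by (auto simp: sum.delta')
  qed
  then have "L2_set (\<lambda>\<gamma>. cmod (f \<gamma>)) I = L2_set (\<lambda>\<gamma>. cmod (matrix_op ?M \<delta> \<gamma>)) I"
    using I by (intro L2_set_cong) auto
  also have "\<dots> \<le> ell2_norm (matrix_op ?M \<delta>)"
    by (rule L2_set_le_ell2_norm[OF matrix_op_bounded(1)[OF schur_regular_matrix[OF f u] \<delta>(1)] I(1)])
  also have "\<dots> \<le> op_norm ?J (matrix_op ?M) * ell2_norm \<delta>"
    by (rule ell2_norm_op_norm[OF bounded_operator_matrix_op(1)[OF schur_regular_matrix[OF f u]] \<delta>(1)])
  also have "\<dots> \<le> op_norm ?J (matrix_op ?M)"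
    by (rule mult_left_le[OF \<delta>(2) op_norm_nonneg[OF bounded_operator_matrix_op(1)[OF schur_regular_matrix[OF f u]]]])
  finally show ?thesis .
qed

end

section \<open>The full norm and the completion\<close>

text \<open>The form in which operations on the completion are evaluated: both arguments are classes
  of the same relation.\<close>

lemma UN_equiv_class_pair:
  assumes "equiv A r" "congruent2 r r (\<lambda>a b. h a b)" "a \<in> A" "b \<in> A"
  shows "(\<Union>x\<in>r``{a}. \<Union>y\<in>r``{b}. h x y) = h a b"
  by (rule UN_equiv_class2[OF assms(1,1,2-4)])

context ample_groupoid
begin

lemma bounded_repD:
  assumes "bounded_rep G J \<pi>" "f \<in> Cc G"
  shows "bounded_operator J (\<pi> f)" "op_norm J (\<pi> f) \<le> I_norm G f"
    "\<xi> \<in> ell2 J \<Longrightarrow> \<pi> f \<xi> \<in> ell2 J"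
    "\<xi> \<in> ell2 J \<Longrightarrow> ell2_norm (\<pi> f \<xi>) \<le> op_norm J (\<pi> f) * ell2_norm \<xi>"
    "0 \<le> op_norm J (\<pi> f)"
proof -
  show op: "bounded_operator J (\<pi> f)" "op_norm J (\<pi> f) \<le> I_norm G f"
    using assms by (simp_all add: bounded_rep_def)
  show "\<xi> \<in> ell2 J \<Longrightarrow> \<pi> f \<xi> \<in> ell2 J" using op(1) by (simp add: bounded_operator_def)
  show "\<xi> \<in> ell2 J \<Longrightarrow> ell2_norm (\<pi> f \<xi>) \<le> op_norm J (\<pi> f) * ell2_norm \<xi>"
    by (rule ell2_norm_op_norm[OF op(1)])
  show "0 \<le> op_norm J (\<pi> f)" by (rule op_norm_nonneg[OF op(1)])
qed

lemma rep_norms_bdd_above: "f \<in> Cc G \<Longrightarrow> bdd_above (rep_norms G f)"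
  by (rule bdd_aboveI[where M = "I_norm G f"]) (auto simp: rep_norms_def bounded_repD)

lemma full_norm_upper:
  fixes J :: "'j set" and \<iota> :: "'j \<Rightarrow> 'g \<Rightarrow> complex"
  assumes "f \<in> Cc G" "bounded_rep G J \<pi>" "inj_on \<iota> J"
  shows "op_norm J (\<pi> f) \<le> full_norm G f"
  unfolding full_norm_eq_Sup
  by (rule cSup_upper[OF rep_normsI[OF assms(2,3,1)] rep_norms_bdd_above[OF assms(1)]])

text \<open>The arrows of the fibre become admissible indices by sending each to its indicator
  function. This estimate is the only link from the abstract full norm to values of
  functions.\<close>

lemma L2_set_src_fibre_le:
  assumes f: "f \<in> Cc G" and u: "u \<in> topspace (unit_top G)" and I: "finite I" "I \<subseteq> {\<gamma>\<in>arrows G. src G \<gamma> = u}"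
  shows "L2_set (\<lambda>\<gamma>. cmod (f \<gamma>)) I \<le> full_norm G f"
proof -
  have "inj_on (\<lambda>\<gamma> \<gamma>'. if \<gamma>' = \<gamma> then 1 else 0 :: complex) {\<gamma>\<in>arrows G. src G \<gamma> = u}"
    by (rule inj_onI) (metis zero_neq_one)
  from full_norm_upper[OF f bounded_rep_regular[OF u] this] L2_set_src_fibre_le_op_norm[OF f u I]
  show ?thesis by linarith
qed

text \<open>A bound for all representations bounds the supremum only if there is at least one; the
  regular representation at some unit is the witness.\<close>

lemma full_norm_least:
  assumes "f \<in> Cc G" "\<And>(J :: ('g \<Rightarrow> complex) set) \<pi>. bounded_rep G J \<pi> \<Longrightarrow> op_norm J (\<pi> f) \<le> c"
  shows "full_norm G f \<le> c"
proof -
  obtain u where u: "u \<in> topspace (unit_top G)" using units_nonempty by blast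
  have inj: "inj_on (\<lambda>\<gamma> \<gamma>'. if \<gamma>' = \<gamma> then 1 else 0 :: complex) {\<gamma>\<in>arrows G. src G \<gamma> = u}"
    by (rule inj_onI) (metis zero_neq_one)
  have "rep_norms G f \<noteq> {}" using rep_normsI[OF bounded_rep_regular[OF u] inj assms(1)] by blast
  then show ?thesis
    unfolding full_norm_eq_Sup
    by (rule cSup_least) (use assms(2) in \<open>auto simp: rep_norms_def\<close>)
qed

lemma full_norm_upper': "f \<in> Cc G \<Longrightarrow> bounded_rep G J \<pi> \<Longrightarrow> op_norm J (\<pi> f) \<le> full_norm G f"
  for J :: "('g \<Rightarrow> complex) set"
  by (rule full_norm_upper[where \<iota> = "\<lambda>x. x"]) auto

lemma full_norm_nonneg [simp]: "f \<in> Cc G \<Longrightarrow> 0 \<le> full_norm G f"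
  using L2_set_src_fibre_le[of f _ "{}"] units_nonempty by (metis L2_set_empty all_not_in_conv empty_subsetI finite.emptyI)

lemma cmod_le_full_norm:
  assumes "f \<in> Cc G" shows "cmod (f \<gamma>) \<le> full_norm G f"
proof (cases "\<gamma> \<in> arrows G")
  case True
  then show ?thesis using L2_set_src_fibre_le[OF assms src_in[OF True], of "{\<gamma>}"] by simp
next
  case False
  then show ?thesis using assms by (simp add: Cc_vanish[OF assms])
qed

lemma full_norm_lincomb:
  assumes f: "f \<in> Cc G" and g: "g \<in> Cc G"
  shows "full_norm G (\<lambda>\<gamma>. a * f \<gamma> + b * g \<gamma>) \<le> cmod a * full_norm G f + cmod b * full_norm G g"
proof (rule full_norm_least[OF Cc_lincomb[OF f g]])
  fix J :: "('g \<Rightarrow> complex) set" and \<pi> assume r: "bounded_rep G J \<pi>"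
  show "op_norm J (\<pi> (\<lambda>\<gamma>. a * f \<gamma> + b * g \<gamma>)) \<le> cmod a * full_norm G f + cmod b * full_norm G g"
  proof (rule op_norm_le)
    fix \<xi> assume \<xi>: "\<xi> \<in> ell2 J"
    have "ell2_norm (\<pi> (\<lambda>\<gamma>. a * f \<gamma> + b * g \<gamma>) \<xi>) = ell2_norm (\<lambda>j. a * \<pi> f \<xi> j + b * \<pi> g \<xi> j)"
      using r f g \<xi> by (simp add: bounded_rep_def)
    also have "\<dots> \<le> cmod a * ell2_norm (\<pi> f \<xi>) + cmod b * ell2_norm (\<pi> g \<xi>)"
      using ell2_add(2)[OF ell2_scale[OF bounded_repD(3)[OF r f \<xi>], of a] ell2_scale[OF bounded_repD(3)[OF r g \<xi>], of b]]
      by (simp add: ell2_norm_scale)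
    also have "\<dots> \<le> cmod a * (full_norm G f * ell2_norm \<xi>) + cmod b * (full_norm G g * ell2_norm \<xi>)"
      using bounded_repD(4)[OF r f \<xi>] bounded_repD(4)[OF r g \<xi>] full_norm_upper'[OF f r] full_norm_upper'[OF g r]
      by (intro add_mono mult_left_mono)
        (auto intro: order_trans[OF _ mult_right_mono[OF _ ell2_norm_nonneg]])
    finally show "ell2_norm (\<pi> (\<lambda>\<gamma>. a * f \<gamma> + b * g \<gamma>) \<xi>) \<le> (cmod a * full_norm G f + cmod b * full_norm G g) * ell2_norm \<xi>"
      by (simp add: algebra_simps)
  qed (use f g in simp)
qed

lemma full_norm_conv:
  assumes f: "f \<in> Cc G" and g: "g \<in> Cc G"
  shows "full_norm G (conv G f g) \<le> full_norm G f * full_norm G g"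
proof (rule full_norm_least[OF Cc_conv[OF f g]])
  fix J :: "('g \<Rightarrow> complex) set" and \<pi> assume r: "bounded_rep G J \<pi>"
  show "op_norm J (\<pi> (conv G f g)) \<le> full_norm G f * full_norm G g"
  proof (rule op_norm_le)
    fix \<xi> assume \<xi>: "\<xi> \<in> ell2 J"
    have "ell2_norm (\<pi> (conv G f g) \<xi>) = ell2_norm (\<pi> f (\<pi> g \<xi>))"
      using r f g \<xi> by (simp add: bounded_rep_def)
    also have "\<dots> \<le> op_norm J (\<pi> f) * (op_norm J (\<pi> g) * ell2_norm \<xi>)"
      using bounded_repD(4)[OF r f bounded_repD(3)[OF r g \<xi>]] mult_left_mono[OF bounded_repD(4)[OF r g \<xi>] bounded_repD(5)[OF r f]]
      by linarith
    also have "\<dots> \<le> full_norm G f * (full_norm G g * ell2_norm \<xi>)"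
      using full_norm_upper'[OF f r] full_norm_upper'[OF g r] bounded_repD(5)[OF r f] bounded_repD(5)[OF r g] f g
      by (intro mult_mono mult_nonneg_nonneg) auto
    finally show "ell2_norm (\<pi> (conv G f g) \<xi>) \<le> full_norm G f * full_norm G g * ell2_norm \<xi>" by simp
  qed (use f g in simp)
qed

text \<open>With \<open>\<eta>\<close> the image of \<open>\<xi>\<close> under the adjoint operator,
  the square of the norm of \<open>\<eta>\<close> is the inner product of
  \<open>\<pi> f \<eta>\<close> with \<open>\<xi>\<close>. Cauchy-Schwarz produces one factor norm
  of \<open>\<eta>\<close> on the right, which cancels unless it is zero.\<close>

lemma full_norm_invol:
  assumes f: "f \<in> Cc G"
  shows "full_norm G (invol G f) \<le> full_norm G f"
proof (rule full_norm_least[OF Cc_invol[OF f]])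
  fix J :: "('g \<Rightarrow> complex) set" and \<pi> assume r: "bounded_rep G J \<pi>"
  note f' = Cc_invol[OF f]
  show "op_norm J (\<pi> (invol G f)) \<le> full_norm G f"
  proof (rule op_norm_le)
    fix \<xi> assume \<xi>: "\<xi> \<in> ell2 J"
    let ?\<eta> = "\<pi> (invol G f) \<xi>"
    have \<eta>: "?\<eta> \<in> ell2 J" by (rule bounded_repD(3)[OF r f' \<xi>])
    have "ell2_inner (\<pi> f ?\<eta>) \<xi> = ell2_inner ?\<eta> ?\<eta>"
      using r f \<xi> \<eta> by (simp add: bounded_rep_def)
    then have "(ell2_norm ?\<eta>)\<^sup>2 = cmod (ell2_inner (\<pi> f ?\<eta>) \<xi>)"
      by (simp add: ell2_inner_self[OF \<eta>] norm_power)
    also have "\<dots> \<le> ell2_norm (\<pi> f ?\<eta>) * ell2_norm \<xi>"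
      by (rule ell2_inner_cauchy_schwarz[OF bounded_repD(3)[OF r f \<eta>] \<xi>])
    also have "\<dots> \<le> (op_norm J (\<pi> f) * ell2_norm ?\<eta>) * ell2_norm \<xi>"
      by (rule mult_right_mono[OF bounded_repD(4)[OF r f \<eta>]]) simp
    also have "\<dots> \<le> (full_norm G f * ell2_norm ?\<eta>) * ell2_norm \<xi>"
      by (intro mult_right_mono full_norm_upper'[OF f r]) auto
    finally have *: "ell2_norm ?\<eta> * ell2_norm ?\<eta> \<le> ell2_norm ?\<eta> * (full_norm G f * ell2_norm \<xi>)"
      by (simp add: power2_eq_square mult_ac)
    show "ell2_norm ?\<eta> \<le> full_norm G f * ell2_norm \<xi>"
    proof (cases "ell2_norm ?\<eta> = 0")
      case True
      then show ?thesis using f by simp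
    next
      case False
      then have "0 < ell2_norm ?\<eta>" using ell2_norm_nonneg[of ?\<eta>] by linarith
      then show ?thesis using * by simp
    qed
  qed (use f in simp)
qed

lemma full_norm_diff_triangle:
  assumes "f \<in> Cc G" "g \<in> Cc G" "h \<in> Cc G"
  shows "full_norm G (\<lambda>\<gamma>. f \<gamma> - h \<gamma>) \<le> full_norm G (\<lambda>\<gamma>. f \<gamma> - g \<gamma>) + full_norm G (\<lambda>\<gamma>. g \<gamma> - h \<gamma>)"
  using full_norm_lincomb[OF Cc_diff[OF assms(1,2)] Cc_diff[OF assms(2,3)], of 1 1] by simp

lemma full_norm_diff_commute:
  assumes "f \<in> Cc G" "g \<in> Cc G"
  shows "full_norm G (\<lambda>\<gamma>. f \<gamma> - g \<gamma>) = full_norm G (\<lambda>\<gamma>. g \<gamma> - f \<gamma>)"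
  using full_norm_lincomb[OF Cc_diff[OF assms] Cc_diff[OF assms], of "-1" 0]
    full_norm_lincomb[OF Cc_diff[OF assms(2,1)] Cc_diff[OF assms(2,1)], of "-1" 0] by simp

lemma full_norm_zero: "full_norm G (\<lambda>\<gamma>. 0) = 0"
  using full_norm_lincomb[OF Cc_zero Cc_zero, of 0 0] full_norm_nonneg[OF Cc_zero] by simp

lemma full_norm_le_add_diff:
  assumes "f \<in> Cc G" "g \<in> Cc G"
  shows "full_norm G f \<le> full_norm G g + full_norm G (\<lambda>\<gamma>. f \<gamma> - g \<gamma>)"
  using full_norm_lincomb[OF assms(2) Cc_diff[OF assms], of 1 1] by simp

lemma full_norm_diff_abs:
  assumes "f \<in> Cc G" "g \<in> Cc G"
  shows "\<bar>full_norm G f - full_norm G g\<bar> \<le> full_norm G (\<lambda>\<gamma>. f \<gamma> - g \<gamma>)"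
  using full_norm_le_add_diff[OF assms] full_norm_le_add_diff[OF assms(2,1)]
    full_norm_diff_commute[OF assms] by linarith

lemma full_norm_conv_diff:
  assumes "f \<in> Cc G" "g \<in> Cc G" "f' \<in> Cc G" "g' \<in> Cc G"
  shows "full_norm G (\<lambda>\<gamma>. conv G f g \<gamma> - conv G f' g' \<gamma>) \<le>
    full_norm G (\<lambda>\<gamma>. f \<gamma> - f' \<gamma>) * full_norm G g + full_norm G f' * full_norm G (\<lambda>\<gamma>. g \<gamma> - g' \<gamma>)"
proof -
  have "conv G (\<lambda>\<gamma>. f \<gamma> - f' \<gamma>) g = (\<lambda>\<gamma>. conv G f g \<gamma> - conv G f' g \<gamma>)"
    using conv_lincomb_left[OF assms(1,3), of 1 "-1" g] by simp
  moreover have "conv G f' (\<lambda>\<gamma>. g \<gamma> - g' \<gamma>) = (\<lambda>\<gamma>. conv G f' g \<gamma> - conv G f' g' \<gamma>)"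
    using conv_lincomb_right[OF assms(3), of 1 g "-1" g'] by simp
  ultimately have "full_norm G (\<lambda>\<gamma>. conv G f g \<gamma> - conv G f' g \<gamma>) \<le> full_norm G (\<lambda>\<gamma>. f \<gamma> - f' \<gamma>) * full_norm G g"
    "full_norm G (\<lambda>\<gamma>. conv G f' g \<gamma> - conv G f' g' \<gamma>) \<le> full_norm G f' * full_norm G (\<lambda>\<gamma>. g \<gamma> - g' \<gamma>)"
    using full_norm_conv[OF Cc_diff[OF assms(1,3)] assms(2)] full_norm_conv[OF assms(3) Cc_diff[OF assms(2,4)]] by simp_all
  then show ?thesis
    using full_norm_diff_triangle[OF Cc_conv[OF assms(1,2)] Cc_conv[OF assms(3,2)] Cc_conv[OF assms(3,4)]] by linarith
qed

lemma full_norm_invol_diff: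
  assumes "f \<in> Cc G" "g \<in> Cc G"
  shows "full_norm G (\<lambda>\<gamma>. invol G f \<gamma> - invol G g \<gamma>) \<le> full_norm G (\<lambda>\<gamma>. f \<gamma> - g \<gamma>)"
proof -
  have "invol G (\<lambda>\<gamma>. f \<gamma> - g \<gamma>) = (\<lambda>\<gamma>. invol G f \<gamma> - invol G g \<gamma>)" by (auto simp: invol_def)
  then show ?thesis using full_norm_invol[OF Cc_diff[OF assms]] by simp
qed

section \<open>Cauchy sequences in the full norm and their equivalence\<close>

lemma cauchyD: "s \<in> Cc_cauchy G \<Longrightarrow> s n \<in> Cc G"
  by (simp add: Cc_cauchy_def)

lemma cauchy_bounded:
  assumes "s \<in> Cc_cauchy G" shows "\<exists>c\<ge>0. \<forall>n. full_norm G (s n) \<le> c"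
proof -
  obtain M where M: "\<forall>m\<ge>M. \<forall>n\<ge>M. full_norm G (\<lambda>\<gamma>. s m \<gamma> - s n \<gamma>) < 1"
    using assms unfolding Cc_cauchy_def by (auto dest: spec[of _ 1])
  define c where "c = (\<Sum>n\<le>M. full_norm G (s n)) + 1"
  have "full_norm G (s n) \<le> c" for n
  proof (cases "n \<le> M")
    case True
    then have "full_norm G (s n) \<le> (\<Sum>n\<le>M. full_norm G (s n))"
      using assms by (intro member_le_sum) (auto simp: cauchyD)
    then show ?thesis by (simp add: c_def)
  next
    case False
    have "full_norm G (s M) \<le> (\<Sum>n\<le>M. full_norm G (s n))"
      using assms by (intro member_le_sum) (auto simp: cauchyD)
    moreover have "full_norm G (\<lambda>\<gamma>. s n \<gamma> - s M \<gamma>) < 1" using M False by auto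
    ultimately show ?thesis
      using full_norm_le_add_diff[OF cauchyD[OF assms] cauchyD[OF assms], of n M] by (simp add: c_def)
  qed
  moreover have "0 \<le> c" using assms unfolding c_def by (intro add_nonneg_nonneg sum_nonneg) (auto simp: cauchyD)
  ultimately show ?thesis by blast
qed

text \<open>Linear combinations, products and adjoints are all Lipschitz in this sense, so a single
  epsilon argument serves the three. For products the constants are bounds of the two
  sequences.\<close>

lemma cauchyI:
  assumes "\<And>n. s n \<in> Cc G" "a \<in> Cc_cauchy G" "b \<in> Cc_cauchy G" "0 \<le> c" "0 \<le> d"
    "\<And>m n. full_norm G (\<lambda>\<gamma>. s m \<gamma> - s n \<gamma>) \<le>
      c * full_norm G (\<lambda>\<gamma>. a m \<gamma> - a n \<gamma>) + d * full_norm G (\<lambda>\<gamma>. b m \<gamma> - b n \<gamma>)"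
  shows "s \<in> Cc_cauchy G"
  unfolding Cc_cauchy_def
proof (intro CollectI conjI allI impI assms(1))
  fix e :: real assume "0 < e"
  \<comment> \<open>The summand 1 keeps the denominator positive when both constants vanish and
    makes the final inequality strict.\<close>
  define e' where "e' = e / (c + d + 1)"
  have "0 < e'" using \<open>0 < e\<close> assms(4,5) by (simp add: e'_def)
  obtain M1 where M1: "\<forall>m\<ge>M1. \<forall>n\<ge>M1. full_norm G (\<lambda>\<gamma>. a m \<gamma> - a n \<gamma>) < e'"
    using assms(2) \<open>0 < e'\<close> unfolding Cc_cauchy_def by blast
  obtain M2 where M2: "\<forall>m\<ge>M2. \<forall>n\<ge>M2. full_norm G (\<lambda>\<gamma>. b m \<gamma> - b n \<gamma>) < e'"
    using assms(3) \<open>0 < e'\<close> unfolding Cc_cauchy_def by blast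
  have "full_norm G (\<lambda>\<gamma>. s m \<gamma> - s n \<gamma>) < e" if "m \<ge> max M1 M2" "n \<ge> max M1 M2" for m n
  proof -
    have "full_norm G (\<lambda>\<gamma>. s m \<gamma> - s n \<gamma>) \<le> c * e' + d * e'"
      by (rule order_trans[OF assms(6)], intro add_mono mult_left_mono assms(4,5) less_imp_le[of "full_norm _ _"])
         (use M1 M2 that in auto)
    also have "\<dots> < (c + d + 1) * e'" using \<open>0 < e'\<close> by (simp add: algebra_simps)
    also have "\<dots> = e" using assms(4,5) by (simp add: e'_def)
    finally show ?thesis .
  qed
  then show "\<exists>M. \<forall>m\<ge>M. \<forall>n\<ge>M. full_norm G (\<lambda>\<gamma>. s m \<gamma> - s n \<gamma>) < e" by blast
qed

lemma cauchy_lincomb: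
  assumes a: "a \<in> Cc_cauchy G" and b: "b \<in> Cc_cauchy G"
  shows "(\<lambda>n \<gamma>. c * a n \<gamma> + d * b n \<gamma>) \<in> Cc_cauchy G"
proof (rule cauchyI[OF _ a b])
  fix m n
  have "(\<lambda>\<gamma>. c * a m \<gamma> + d * b m \<gamma> - (c * a n \<gamma> + d * b n \<gamma>)) = (\<lambda>\<gamma>. c * (a m \<gamma> - a n \<gamma>) + d * (b m \<gamma> - b n \<gamma>))"
    by (simp add: fun_eq_iff algebra_simps)
  then show "full_norm G (\<lambda>\<gamma>. c * a m \<gamma> + d * b m \<gamma> - (c * a n \<gamma> + d * b n \<gamma>)) \<le>
      cmod c * full_norm G (\<lambda>\<gamma>. a m \<gamma> - a n \<gamma>) + cmod d * full_norm G (\<lambda>\<gamma>. b m \<gamma> - b n \<gamma>)"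
    using full_norm_lincomb[OF Cc_diff[OF cauchyD[OF a] cauchyD[OF a]] Cc_diff[OF cauchyD[OF b] cauchyD[OF b]]] by simp
qed (auto intro: Cc_lincomb cauchyD[OF a] cauchyD[OF b])

lemma cauchy_const: "f \<in> Cc G \<Longrightarrow> (\<lambda>n. f) \<in> Cc_cauchy G"
  by (simp add: Cc_cauchy_def full_norm_zero)

lemma cauchy_conv:
  assumes a: "a \<in> Cc_cauchy G" and b: "b \<in> Cc_cauchy G"
  shows "(\<lambda>n. conv G (a n) (b n)) \<in> Cc_cauchy G"
proof -
  obtain c d where c: "0 \<le> c" "\<forall>n. full_norm G (a n) \<le> c" and d: "0 \<le> d" "\<forall>n. full_norm G (b n) \<le> d"
    using cauchy_bounded[OF a] cauchy_bounded[OF b] by blast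
  show ?thesis
  proof (rule cauchyI[OF _ a b d(1) c(1)])
    fix m n
    have "full_norm G (\<lambda>\<gamma>. a m \<gamma> - a n \<gamma>) * full_norm G (b m) + full_norm G (a n) * full_norm G (\<lambda>\<gamma>. b m \<gamma> - b n \<gamma>) \<le>
        d * full_norm G (\<lambda>\<gamma>. a m \<gamma> - a n \<gamma>) + c * full_norm G (\<lambda>\<gamma>. b m \<gamma> - b n \<gamma>)"
      using c d a b by (simp only: mult.commute[of _ "full_norm G (b m)"], intro add_mono mult_right_mono)
        (auto simp: cauchyD Cc_diff)
    then show "full_norm G (\<lambda>\<gamma>. conv G (a m) (b m) \<gamma> - conv G (a n) (b n) \<gamma>) \<le>
        d * full_norm G (\<lambda>\<gamma>. a m \<gamma> - a n \<gamma>) + c * full_norm G (\<lambda>\<gamma>. b m \<gamma> - b n \<gamma>)"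
      using full_norm_conv_diff[OF cauchyD[OF a] cauchyD[OF b] cauchyD[OF a] cauchyD[OF b], of m m n n] by linarith
  qed (rule Cc_conv[OF cauchyD[OF a] cauchyD[OF b]])
qed

lemma cauchy_invol:
  assumes a: "a \<in> Cc_cauchy G" shows "(\<lambda>n. invol G (a n)) \<in> Cc_cauchy G"
proof (rule cauchyI[OF _ a a, where c = 1 and d = 0])
  fix m n show "full_norm G (\<lambda>\<gamma>. invol G (a m) \<gamma> - invol G (a n) \<gamma>) \<le>
      1 * full_norm G (\<lambda>\<gamma>. a m \<gamma> - a n \<gamma>) + 0 * full_norm G (\<lambda>\<gamma>. a m \<gamma> - a n \<gamma>)"
    using full_norm_invol_diff[OF cauchyD[OF a] cauchyD[OF a]] by simp
qed (auto intro: Cc_invol cauchyD[OF a])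

lemma equivI:
  assumes "s \<in> Cc_cauchy G" "s' \<in> Cc_cauchy G" "h \<longlonglongrightarrow> 0"
    "\<And>n. full_norm G (\<lambda>\<gamma>. s n \<gamma> - s' n \<gamma>) \<le> h n"
  shows "(s, s') \<in> Cc_equiv G"
proof -
  have "(\<lambda>n. full_norm G (\<lambda>\<gamma>. s n \<gamma> - s' n \<gamma>)) \<longlonglongrightarrow> 0"
    by (rule tendsto_sandwich[OF _ _ tendsto_const assms(3)])
       (use assms in \<open>auto simp: cauchyD Cc_diff\<close>)
  then show ?thesis using assms by (simp add: Cc_equiv_def)
qed

lemma equivD:
  assumes "(s, s') \<in> Cc_equiv G"
  shows "s \<in> Cc_cauchy G" "s' \<in> Cc_cauchy G" "(\<lambda>n. full_norm G (\<lambda>\<gamma>. s n \<gamma> - s' n \<gamma>)) \<longlonglongrightarrow> 0"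
  using assms by (auto simp: Cc_equiv_def)

lemma equiv_refl: "s \<in> Cc_cauchy G \<Longrightarrow> (s, s) \<in> Cc_equiv G"
  by (simp add: Cc_equiv_def full_norm_zero)

lemma equiv_Cc_equiv: "equiv (Cc_cauchy G) (Cc_equiv G)"
proof (rule Equiv_Relations.equivI)
  show "Cc_equiv G \<subseteq> Cc_cauchy G \<times> Cc_cauchy G" by (auto dest: equivD)
  show "refl_on (Cc_cauchy G) (Cc_equiv G)"
    by (rule refl_onI) (auto simp: equiv_refl equivD)
  show "sym (Cc_equiv G)"
  proof (rule symI)
    fix s s' assume r: "(s, s') \<in> Cc_equiv G"
    have "(\<lambda>n. full_norm G (\<lambda>\<gamma>. s' n \<gamma> - s n \<gamma>)) = (\<lambda>n. full_norm G (\<lambda>\<gamma>. s n \<gamma> - s' n \<gamma>))"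
      by (intro ext full_norm_diff_commute cauchyD equivD[OF r])
    then show "(s', s) \<in> Cc_equiv G" using r by (simp add: Cc_equiv_def)
  qed
  show "trans (Cc_equiv G)"
  proof (rule transI)
    fix s t u assume st: "(s, t) \<in> Cc_equiv G" and tu: "(t, u) \<in> Cc_equiv G"
    note m = equivD(1,2)[OF st] equivD(1,2)[OF tu]
    have "(\<lambda>n. full_norm G (\<lambda>\<gamma>. s n \<gamma> - t n \<gamma>) + full_norm G (\<lambda>\<gamma>. t n \<gamma> - u n \<gamma>)) \<longlonglongrightarrow> 0 + 0"
      by (intro tendsto_add equivD[OF st] equivD[OF tu])
    then show "(s, u) \<in> Cc_equiv G"
      using m by (intro equivI[where h = "\<lambda>n. full_norm G (\<lambda>\<gamma>. s n \<gamma> - t n \<gamma>) + full_norm G (\<lambda>\<gamma>. t n \<gamma> - u n \<gamma>)"])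
        (auto intro: full_norm_diff_triangle cauchyD)
  qed
qed

lemma equiv_lincomb:
  assumes r: "(a, a') \<in> Cc_equiv G" and r': "(b, b') \<in> Cc_equiv G"
  shows "(\<lambda>n \<gamma>. c * a n \<gamma> + d * b n \<gamma>, \<lambda>n \<gamma>. c * a' n \<gamma> + d * b' n \<gamma>) \<in> Cc_equiv G"
proof (rule equivI)
  note m = equivD(1,2)[OF r] equivD(1,2)[OF r']
  show "(\<lambda>n \<gamma>. c * a n \<gamma> + d * b n \<gamma>) \<in> Cc_cauchy G" "(\<lambda>n \<gamma>. c * a' n \<gamma> + d * b' n \<gamma>) \<in> Cc_cauchy G"
    using m by (auto intro: cauchy_lincomb)
  have "(\<lambda>n. cmod c * full_norm G (\<lambda>\<gamma>. a n \<gamma> - a' n \<gamma>) + cmod d * full_norm G (\<lambda>\<gamma>. b n \<gamma> - b' n \<gamma>)) \<longlonglongrightarrow> cmod c * 0 + cmod d * 0"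
    by (intro tendsto_intros equivD(3)[OF r] equivD(3)[OF r'])
  then show "(\<lambda>n. cmod c * full_norm G (\<lambda>\<gamma>. a n \<gamma> - a' n \<gamma>) + cmod d * full_norm G (\<lambda>\<gamma>. b n \<gamma> - b' n \<gamma>)) \<longlonglongrightarrow> 0" by simp
  fix n
  have "(\<lambda>\<gamma>. c * a n \<gamma> + d * b n \<gamma> - (c * a' n \<gamma> + d * b' n \<gamma>)) = (\<lambda>\<gamma>. c * (a n \<gamma> - a' n \<gamma>) + d * (b n \<gamma> - b' n \<gamma>))"
    by (simp add: fun_eq_iff algebra_simps)
  then show "full_norm G (\<lambda>\<gamma>. c * a n \<gamma> + d * b n \<gamma> - (c * a' n \<gamma> + d * b' n \<gamma>)) \<le>
      cmod c * full_norm G (\<lambda>\<gamma>. a n \<gamma> - a' n \<gamma>) + cmod d * full_norm G (\<lambda>\<gamma>. b n \<gamma> - b' n \<gamma>)"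
    using full_norm_lincomb[OF Cc_diff[OF cauchyD[OF m(1)] cauchyD[OF m(2)]] Cc_diff[OF cauchyD[OF m(3)] cauchyD[OF m(4)]]] by simp
qed

lemma equiv_conv:
  assumes r: "(a, a') \<in> Cc_equiv G" and r': "(b, b') \<in> Cc_equiv G"
  shows "(\<lambda>n. conv G (a n) (b n), \<lambda>n. conv G (a' n) (b' n)) \<in> Cc_equiv G"
proof -
  note m = equivD(1,2)[OF r] equivD(1,2)[OF r']
  obtain c d where c: "0 \<le> c" "\<forall>n. full_norm G (a' n) \<le> c" and d: "0 \<le> d" "\<forall>n. full_norm G (b n) \<le> d"
    using cauchy_bounded[OF m(2)] cauchy_bounded[OF m(3)] by blast
  show ?thesis
  proof (rule equivI[OF cauchy_conv[OF m(1,3)] cauchy_conv[OF m(2,4)]])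
    have "(\<lambda>n. full_norm G (\<lambda>\<gamma>. a n \<gamma> - a' n \<gamma>) * d + c * full_norm G (\<lambda>\<gamma>. b n \<gamma> - b' n \<gamma>)) \<longlonglongrightarrow> 0 * d + c * 0"
      by (intro tendsto_intros equivD(3)[OF r] equivD(3)[OF r'])
    then show "(\<lambda>n. full_norm G (\<lambda>\<gamma>. a n \<gamma> - a' n \<gamma>) * d + c * full_norm G (\<lambda>\<gamma>. b n \<gamma> - b' n \<gamma>)) \<longlonglongrightarrow> 0" by simp
    fix n
    have "full_norm G (\<lambda>\<gamma>. a n \<gamma> - a' n \<gamma>) * full_norm G (b n) + full_norm G (a' n) * full_norm G (\<lambda>\<gamma>. b n \<gamma> - b' n \<gamma>) \<le>
        full_norm G (\<lambda>\<gamma>. a n \<gamma> - a' n \<gamma>) * d + c * full_norm G (\<lambda>\<gamma>. b n \<gamma> - b' n \<gamma>)"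
      using c d m by (intro add_mono mult_right_mono mult_left_mono) (auto simp: cauchyD Cc_diff)
    then show "full_norm G (\<lambda>\<gamma>. conv G (a n) (b n) \<gamma> - conv G (a' n) (b' n) \<gamma>) \<le>
        full_norm G (\<lambda>\<gamma>. a n \<gamma> - a' n \<gamma>) * d + c * full_norm G (\<lambda>\<gamma>. b n \<gamma> - b' n \<gamma>)"
      using full_norm_conv_diff[OF cauchyD[OF m(1)] cauchyD[OF m(3)] cauchyD[OF m(2)] cauchyD[OF m(4)], of n n n n] by linarith
  qed
qed

lemma equiv_invol:
  assumes r: "(a, a') \<in> Cc_equiv G"
  shows "(\<lambda>n. invol G (a n), \<lambda>n. invol G (a' n)) \<in> Cc_equiv G"
  by (rule equivI[OF cauchy_invol[OF equivD(1)[OF r]] cauchy_invol[OF equivD(2)[OF r]] equivD(3)[OF r]])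
     (rule full_norm_invol_diff[OF cauchyD[OF equivD(1)[OF r]] cauchyD[OF equivD(2)[OF r]]])

section \<open>Operations, norm and distance on the completion\<close>

abbreviation cls :: "(nat \<Rightarrow> 'g \<Rightarrow> complex) \<Rightarrow> (nat \<Rightarrow> 'g \<Rightarrow> complex) set" where
  "cls s \<equiv> Cc_equiv G `` {s}"

lemma cls_eq: "(s, s') \<in> Cc_equiv G \<Longrightarrow> cls s = cls s'"
  by (rule equiv_class_eq[OF equiv_Cc_equiv])

lemma elems_full_cstar: "elems (full_cstar G) = {cls s | s. s \<in> Cc_cauchy G}"
  by (auto simp: full_cstar_def quotient_def)

lemma s_add_cls:
  assumes "a \<in> Cc_cauchy G" "b \<in> Cc_cauchy G"
  shows "s_add (full_cstar G) (cls a) (cls b) = cls (\<lambda>n \<gamma>. a n \<gamma> + b n \<gamma>)"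
proof -
  have "congruent2 (Cc_equiv G) (Cc_equiv G) (\<lambda>a b. cls (\<lambda>n \<gamma>. a n \<gamma> + b n \<gamma>))"
    using equiv_lincomb[where c = 1 and d = 1] by (intro congruent2I' cls_eq) simp
  from UN_equiv_class_pair[OF equiv_Cc_equiv this assms] show ?thesis by (simp add: full_cstar_def)
qed

lemma s_mult_cls:
  assumes "a \<in> Cc_cauchy G" "b \<in> Cc_cauchy G"
  shows "s_mult (full_cstar G) (cls a) (cls b) = cls (\<lambda>n. conv G (a n) (b n))"
proof -
  have "congruent2 (Cc_equiv G) (Cc_equiv G) (\<lambda>a b. cls (\<lambda>n. conv G (a n) (b n)))"
    by (intro congruent2I' cls_eq equiv_conv)
  from UN_equiv_class_pair[OF equiv_Cc_equiv this assms] show ?thesis by (simp add: full_cstar_def)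
qed

lemma s_scale_cls:
  assumes "a \<in> Cc_cauchy G"
  shows "s_scale (full_cstar G) c (cls a) = cls (\<lambda>n \<gamma>. c * a n \<gamma>)"
proof -
  have "congruent (Cc_equiv G) (\<lambda>a. cls (\<lambda>n \<gamma>. c * a n \<gamma>))"
    using equiv_lincomb[where c = c and d = 0] by (intro congruentI cls_eq) fastforce
  from UN_equiv_class[OF equiv_Cc_equiv this assms] show ?thesis by (simp add: full_cstar_def)
qed

lemma s_star_cls:
  assumes "a \<in> Cc_cauchy G"
  shows "s_star (full_cstar G) (cls a) = cls (\<lambda>n. invol G (a n))"
proof -
  have "congruent (Cc_equiv G) (\<lambda>a. cls (\<lambda>n. invol G (a n)))"
    by (intro congruentI cls_eq equiv_invol)
  from UN_equiv_class[OF equiv_Cc_equiv this assms] show ?thesis by (simp add: full_cstar_def)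
qed

text \<open>The definite description denotes because the norms converge and every representative has
  the same limit. Both facts follow from the reverse triangle inequality.\<close>

lemma s_norm_cls:
  assumes a: "a \<in> Cc_cauchy G"
  shows "(\<lambda>n. full_norm G (a n)) \<longlonglongrightarrow> s_norm (full_cstar G) (cls a)"
proof -
  have "Cauchy (\<lambda>n. full_norm G (a n))"
    unfolding Cauchy_def dist_real_def
  proof (intro allI impI)
    fix e :: real assume "0 < e"
    then obtain M where M: "\<forall>m\<ge>M. \<forall>n\<ge>M. full_norm G (\<lambda>\<gamma>. a m \<gamma> - a n \<gamma>) < e"
      using a unfolding Cc_cauchy_def by blast
    then show "\<exists>M. \<forall>m\<ge>M. \<forall>n\<ge>M. \<bar>full_norm G (a m) - full_norm G (a n)\<bar> < e"
      using full_norm_diff_abs[OF cauchyD[OF a] cauchyD[OF a]] by (meson order_le_less_trans)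
  qed
  then obtain c where c: "(\<lambda>n. full_norm G (a n)) \<longlonglongrightarrow> c"
    using Cauchy_convergent convergent_def by blast
  have all: "(\<lambda>n. full_norm G (a' n)) \<longlonglongrightarrow> c" if "a' \<in> cls a" for a'
  proof -
    have r: "(a, a') \<in> Cc_equiv G" using that by simp
    have "(\<lambda>n. full_norm G (a n) - full_norm G (a' n)) \<longlonglongrightarrow> 0"
      by (rule Lim_null_comparison[OF _ equivD(3)[OF r]])
         (simp add: full_norm_diff_abs[OF cauchyD[OF equivD(1)[OF r]] cauchyD[OF equivD(2)[OF r]]])
    from tendsto_diff[OF c this] show ?thesis by simp
  qed
  have "s_norm (full_cstar G) (cls a) = (THE c. \<forall>a'\<in>cls a. (\<lambda>n. full_norm G (a' n)) \<longlonglongrightarrow> c)"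
    by (simp add: full_cstar_def)
  also have "\<dots> = c"
  proof (rule the_equality)
    show "\<forall>a'\<in>cls a. (\<lambda>n. full_norm G (a' n)) \<longlonglongrightarrow> c" using all by blast
    fix c' assume "\<forall>a'\<in>cls a. (\<lambda>n. full_norm G (a' n)) \<longlonglongrightarrow> c'"
    then have "(\<lambda>n. full_norm G (a n)) \<longlonglongrightarrow> c'" using equiv_refl[OF a] by blast
    then show "c' = c" using c LIMSEQ_unique by blast
  qed
  finally show ?thesis using c by simp
qed

lemma s_dist_cls:
  assumes a: "a \<in> Cc_cauchy G" and b: "b \<in> Cc_cauchy G"
  shows "(\<lambda>n. full_norm G (\<lambda>\<gamma>. a n \<gamma> - b n \<gamma>)) \<longlonglongrightarrow> s_dist (full_cstar G) (cls a) (cls b)"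
proof -
  have b': "(\<lambda>n \<gamma>. - 1 * b n \<gamma>) \<in> Cc_cauchy G"
    using cauchy_lincomb[OF b b, of "-1" 0] by simp
  have d: "(\<lambda>n \<gamma>. a n \<gamma> + - 1 * b n \<gamma>) \<in> Cc_cauchy G"
    using cauchy_lincomb[OF a b, of 1 "-1"] by simp
  show ?thesis
    unfolding s_dist_def s_scale_cls[OF b] s_add_cls[OF a b'] using s_norm_cls[OF d] by simp
qed

lemma pos_cone_cls:
  "pos_cone (full_cstar G) = {cls (\<lambda>n. conv G (invol G (b n)) (b n)) | b. b \<in> Cc_cauchy G}"
proof -
  have "s_mult (full_cstar G) (s_star (full_cstar G) (cls b)) (cls b) = cls (\<lambda>n. conv G (invol G (b n)) (b n))"
    if "b \<in> Cc_cauchy G" for b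
    using that by (simp add: s_star_cls s_mult_cls cauchy_invol)
  then show ?thesis unfolding pos_cone_def elems_full_cstar by (auto; metis)
qed

end

section \<open>Coefficients of elements of the completion\<close>

text \<open>The layer-cake formula: by Fubini, which uses sigma-finiteness, the integral of the
  positive part is the integral over \<open>t \<ge> 0\<close> of the measures of the strict
  superlevel sets. Invariance of a measure is a statement about open sets only; this lemma turns it
  into one about integrals.\<close>

lemma nn_integral_eq_of_superlevel:
  fixes f g :: "'a \<Rightarrow> real"
  assumes "sigma_finite_measure M" and [measurable]: "f \<in> borel_measurable M" "g \<in> borel_measurable M"
    and eq: "\<And>t. 0 \<le> t \<Longrightarrow> emeasure M {x\<in>space M. t < f x} = emeasure M {x\<in>space M. t < g x}"
  shows "(\<integral>\<^sup>+x. ennreal (f x) \<partial>M) = (\<integral>\<^sup>+x. ennreal (g x) \<partial>M)"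
proof -
  interpret sigma_finite_measure M by fact
  interpret P: pair_sigma_finite M lborel ..
  have layer: "(\<integral>\<^sup>+x. ennreal (f x) \<partial>M) =
      (\<integral>\<^sup>+t. indicator {0..} t * emeasure M {x\<in>space M. t < f x} \<partial>lborel)"
    if [measurable]: "f \<in> borel_measurable M" for f :: "'a \<Rightarrow> real"
  proof -
    have "(\<integral>\<^sup>+x. ennreal (f x) \<partial>M) = (\<integral>\<^sup>+x. (\<integral>\<^sup>+t. (if 0 \<le> t \<and> t < f x then 1 else 0) \<partial>lborel) \<partial>M)"
    proof (rule nn_integral_cong)
      fix x
      have "(\<integral>\<^sup>+t. (if 0 \<le> t \<and> t < f x then 1 else 0) \<partial>lborel) = (\<integral>\<^sup>+t. indicator {0..<f x} t \<partial>lborel)"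
        by (rule nn_integral_cong) (auto split: split_indicator)
      also have "\<dots> = ennreal (f x)" by (cases "0 \<le> f x") (simp_all add: ennreal_neg)
      finally show "ennreal (f x) = (\<integral>\<^sup>+t. (if 0 \<le> t \<and> t < f x then 1 else 0) \<partial>lborel)" ..
    qed
    also have "\<dots> = (\<integral>\<^sup>+t. (\<integral>\<^sup>+x. (if 0 \<le> t \<and> t < f x then 1 else 0) \<partial>M) \<partial>lborel)"
      by (rule P.Fubini'[symmetric]) measurable
    also have "\<dots> = (\<integral>\<^sup>+t. indicator {0..} t * emeasure M {x\<in>space M. t < f x} \<partial>lborel)"
    proof (rule nn_integral_cong)
      fix t :: real
      have "(\<integral>\<^sup>+x. (if 0 \<le> t \<and> t < f x then 1 else 0) \<partial>M) =
          (\<integral>\<^sup>+x. indicator {0..} t * indicator {x\<in>space M. t < f x} x \<partial>M)"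
        by (rule nn_integral_cong) (auto split: split_indicator)
      also have "\<dots> = indicator {0..} t * emeasure M {x\<in>space M. t < f x}"
        by (subst nn_integral_cmult_indicator) auto
      finally show "(\<integral>\<^sup>+x. (if 0 \<le> t \<and> t < f x then 1 else 0) \<partial>M) =
          indicator {0..} t * emeasure M {x\<in>space M. t < f x}" .
    qed
    finally show ?thesis .
  qed
  show ?thesis
    unfolding layer[OF assms(2)] layer[OF assms(3)]
    by (rule nn_integral_cong) (auto split: split_indicator simp: eq)
qed

context ample_groupoid
begin

text \<open>Evaluation at an arrow is bounded by the full norm, hence extends continuously to the
  completion. The representative picked by \<open>SOME\<close> is immaterial, as
  \<open>coef_cls\<close> shows.\<close>

definition coef :: "(nat \<Rightarrow> 'g \<Rightarrow> complex) set \<Rightarrow> 'g \<Rightarrow> complex" where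
  "coef A \<gamma> = lim (\<lambda>n. (SOME a. a \<in> A) n \<gamma>)"

lemma coef_cls:
  assumes a: "a \<in> Cc_cauchy G"
  shows "(\<lambda>n. a n \<gamma>) \<longlonglongrightarrow> coef (cls a) \<gamma>"
proof -
  define a' where "a' = (SOME a'. a' \<in> cls a)"
  have "a' \<in> cls a" unfolding a'_def by (rule someI[of _ a]) (simp add: equiv_refl[OF a])
  then have r: "(a, a') \<in> Cc_equiv G" by simp
  have "Cauchy (\<lambda>n. a n \<gamma>)"
    unfolding Cauchy_def dist_norm
  proof (intro allI impI)
    fix e :: real assume "0 < e"
    then obtain M where M: "\<forall>m\<ge>M. \<forall>n\<ge>M. full_norm G (\<lambda>\<gamma>. a m \<gamma> - a n \<gamma>) < e"
      using a unfolding Cc_cauchy_def by blast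
    then show "\<exists>M. \<forall>m\<ge>M. \<forall>n\<ge>M. cmod (a m \<gamma> - a n \<gamma>) < e"
      using cmod_le_full_norm[OF Cc_diff[OF cauchyD[OF a] cauchyD[OF a]]] by (meson order_le_less_trans)
  qed
  then obtain c where c: "(\<lambda>n. a n \<gamma>) \<longlonglongrightarrow> c"
    using Cauchy_convergent convergent_def by blast
  have "(\<lambda>n. a n \<gamma> - a' n \<gamma>) \<longlonglongrightarrow> 0"
    by (rule Lim_null_comparison[OF _ equivD(3)[OF r]])
       (simp add: cmod_le_full_norm[OF Cc_diff[OF cauchyD[OF equivD(1)[OF r]] cauchyD[OF equivD(2)[OF r]]]])
  from tendsto_diff[OF c this] have "(\<lambda>n. a' n \<gamma>) \<longlonglongrightarrow> c" by simp
  then have "coef (cls a) \<gamma> = c" unfolding coef_def a'_def by (rule limI)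
  then show ?thesis using c by simp
qed

lemma coef_unique: "a \<in> Cc_cauchy G \<Longrightarrow> (\<lambda>n. a n \<gamma>) \<longlonglongrightarrow> c \<Longrightarrow> coef (cls a) \<gamma> = c"
  using coef_cls LIMSEQ_unique by blast

lemma coef_const: "f \<in> Cc G \<Longrightarrow> coef (cls (\<lambda>n. f)) \<gamma> = f \<gamma>"
  by (rule coef_unique[OF cauchy_const]) auto

lemma coef_diff_le:
  assumes a: "a \<in> Cc_cauchy G" and b: "b \<in> Cc_cauchy G"
  shows "cmod (coef (cls a) \<gamma> - coef (cls b) \<gamma>) \<le> s_dist (full_cstar G) (cls a) (cls b)"
proof (rule LIMSEQ_le[OF _ s_dist_cls[OF a b]])
  show "(\<lambda>n. cmod (a n \<gamma> - b n \<gamma>)) \<longlonglongrightarrow> cmod (coef (cls a) \<gamma> - coef (cls b) \<gamma>)"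
    by (intro tendsto_norm tendsto_diff coef_cls a b)
  show "\<exists>N. \<forall>n\<ge>N. cmod (a n \<gamma> - b n \<gamma>) \<le> full_norm G (\<lambda>\<gamma>. a n \<gamma> - b n \<gamma>)"
    using cmod_le_full_norm[OF Cc_diff[OF cauchyD[OF a] cauchyD[OF b]]] by blast
qed

lemma coef_uniform:
  assumes a: "a \<in> Cc_cauchy G" and "0 < e"
  shows "\<exists>M. \<forall>n\<ge>M. \<forall>\<gamma>. cmod (a n \<gamma> - coef (cls a) \<gamma>) \<le> e"
proof -
  obtain M where M: "\<forall>m\<ge>M. \<forall>n\<ge>M. full_norm G (\<lambda>\<gamma>. a m \<gamma> - a n \<gamma>) < e"
    using assms unfolding Cc_cauchy_def by blast
  have "cmod (a n \<gamma> - coef (cls a) \<gamma>) \<le> e" if "n \<ge> M" for n \<gamma>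
  proof (rule LIMSEQ_le_const2)
    show "(\<lambda>m. cmod (a n \<gamma> - a m \<gamma>)) \<longlonglongrightarrow> cmod (a n \<gamma> - coef (cls a) \<gamma>)"
      by (intro tendsto_norm tendsto_diff tendsto_const coef_cls a)
    have "cmod (a n \<gamma> - a m \<gamma>) \<le> e" if "m \<ge> M" for m
      using M \<open>n \<ge> M\<close> that cmod_le_full_norm[OF Cc_diff[OF cauchyD[OF a, of n] cauchyD[OF a, of m]], of \<gamma>]
      by (meson less_imp_le order_trans)
    then show "\<exists>N. \<forall>m\<ge>N. cmod (a n \<gamma> - a m \<gamma>) \<le> e" by blast
  qed
  then show ?thesis by blast
qed

text \<open>The coefficient function is a uniform limit of continuous functions. Only openness of
  its superlevel sets is used later, so this is proved directly.\<close>

lemma open_coef_superlevel: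
  assumes a: "a \<in> Cc_cauchy G"
  shows "openin (arrow_top G) {\<gamma>\<in>arrows G. t < cmod (coef (cls a) \<gamma>)}"
proof (subst openin_subopen, intro ballI)
  fix \<gamma>\<^sub>0 assume \<gamma>\<^sub>0: "\<gamma>\<^sub>0 \<in> {\<gamma>\<in>arrows G. t < cmod (coef (cls a) \<gamma>)}"
  \<comment> \<open>One third of the gap is spent on the approximation at the centre, one third on
    the approximation at the nearby arrow, and the last keeps the inequality at the centre
    strict.\<close>
  define e where "e = (cmod (coef (cls a) \<gamma>\<^sub>0) - t) / 3"
  have e: "0 < e" "cmod (coef (cls a) \<gamma>\<^sub>0) = t + 3 * e" using \<gamma>\<^sub>0 by (auto simp: e_def field_simps)
  obtain n where n: "\<forall>\<gamma>. cmod (a n \<gamma> - coef (cls a) \<gamma>) \<le> e"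
    using coef_uniform[OF a e(1)] by blast
  have near: "\<bar>cmod (a n \<gamma>) - cmod (coef (cls a) \<gamma>)\<bar> \<le> e" for \<gamma>
    using n norm_triangle_ineq3[of "a n \<gamma>" "coef (cls a) \<gamma>"] by (meson order_trans)
  let ?T = "{\<gamma> \<in> topspace (arrow_top G). a n \<gamma> \<in> {z. t + e < cmod z}}"
  have "open {z. t + e < cmod z}" by (intro open_Collect_less continuous_intros)
  then have "openin (arrow_top G) ?T"
    by (intro openin_continuous_map_preimage[OF Cc_continuous[OF cauchyD[OF a]]]) simp
  moreover have "\<gamma>\<^sub>0 \<in> ?T" using \<gamma>\<^sub>0 near[of \<gamma>\<^sub>0] e by (auto simp: topspace_arrow)
  moreover have "?T \<subseteq> {\<gamma>\<in>arrows G. t < cmod (coef (cls a) \<gamma>)}"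
  proof
    fix \<gamma> assume "\<gamma> \<in> ?T"
    then show "\<gamma> \<in> {\<gamma>\<in>arrows G. t < cmod (coef (cls a) \<gamma>)}" using near[of \<gamma>] by (auto simp: topspace_arrow)
  qed
  ultimately show "\<exists>T. openin (arrow_top G) T \<and> \<gamma>\<^sub>0 \<in> T \<and> T \<subseteq> {\<gamma>\<in>arrows G. t < cmod (coef (cls a) \<gamma>)}"
    by blast
qed

section \<open>Square sums over source and range fibres\<close>

definition src_res :: "'u \<Rightarrow> ('g \<Rightarrow> complex) \<Rightarrow> 'g \<Rightarrow> complex" where
  "src_res u f \<gamma> = (if \<gamma> \<in> arrows G \<and> src G \<gamma> = u then f \<gamma> else 0)"

lemma L2_set_src_res_le:
  assumes f: "f \<in> Cc G" and u: "u \<in> topspace (unit_top G)" and I: "finite I"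
  shows "L2_set (\<lambda>\<gamma>. cmod (src_res u f \<gamma>)) I \<le> full_norm G f"
proof -
  have "L2_set (\<lambda>\<gamma>. cmod (src_res u f \<gamma>)) I = L2_set (\<lambda>\<gamma>. cmod (f \<gamma>)) (I \<inter> {\<gamma>\<in>arrows G. src G \<gamma> = u})"
    unfolding L2_set_def using I
    by (intro arg_cong[where f = sqrt] sum.mono_neutral_cong_right) (auto simp: src_res_def)
  also have "\<dots> \<le> full_norm G f"
    by (rule L2_set_src_fibre_le[OF f u]) (use I in auto)
  finally show ?thesis .
qed

text \<open>On each source fibre the full norm dominates the square-sum norm, so the restricted
  functions are Cauchy there. Letting \<open>m\<close> tend to infinity in the Cauchy estimate on a
  finite set of arrows identifies the limit with the coefficients.\<close>

lemma src_res_coef: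
  assumes a: "a \<in> Cc_cauchy G" and u: "u \<in> topspace (unit_top G)"
  shows "src_res u (coef (cls a)) \<in> ell2 UNIV"
    "(\<lambda>n. ell2_norm (src_res u (a n))) \<longlonglongrightarrow> ell2_norm (src_res u (coef (cls a)))"
proof -
  let ?j = "coef (cls a)"
  have an: "src_res u (a n) \<in> ell2 UNIV" for n
    by (rule ell2I[OF _ L2_set_src_res_le[OF cauchyD[OF a] u]]) auto
  have near: "\<exists>M. \<forall>n\<ge>M. (\<lambda>\<gamma>. src_res u (a n) \<gamma> - src_res u ?j \<gamma>) \<in> ell2 UNIV \<and>
      ell2_norm (\<lambda>\<gamma>. src_res u (a n) \<gamma> - src_res u ?j \<gamma>) \<le> e" if "0 < e" for e
  proof -
    obtain M where M: "\<forall>m\<ge>M. \<forall>n\<ge>M. full_norm G (\<lambda>\<gamma>. a m \<gamma> - a n \<gamma>) < e"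
      using a \<open>0 < e\<close> unfolding Cc_cauchy_def by blast
    have "L2_set (\<lambda>\<gamma>. cmod (src_res u (a n) \<gamma> - src_res u ?j \<gamma>)) I \<le> e" if "n \<ge> M" "finite I" for n I
    proof (rule LIMSEQ_le_const2)
      have "(\<lambda>m. src_res u (a m) \<gamma>) \<longlonglongrightarrow> src_res u ?j \<gamma>" for \<gamma>
        using coef_cls[OF a, of \<gamma>] by (cases "\<gamma> \<in> arrows G \<and> src G \<gamma> = u") (auto simp: src_res_def)
      then show "(\<lambda>m. L2_set (\<lambda>\<gamma>. cmod (src_res u (a n) \<gamma> - src_res u (a m) \<gamma>)) I) \<longlonglongrightarrow>
          L2_set (\<lambda>\<gamma>. cmod (src_res u (a n) \<gamma> - src_res u ?j \<gamma>)) I"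
        unfolding L2_set_def by (intro tendsto_intros)
      have "L2_set (\<lambda>\<gamma>. cmod (src_res u (a n) \<gamma> - src_res u (a m) \<gamma>)) I \<le> e" if "m \<ge> M" for m
      proof -
        have "src_res u (\<lambda>\<gamma>. a n \<gamma> - a m \<gamma>) = (\<lambda>\<gamma>. src_res u (a n) \<gamma> - src_res u (a m) \<gamma>)"
          by (auto simp: src_res_def)
        then have "L2_set (\<lambda>\<gamma>. cmod (src_res u (a n) \<gamma> - src_res u (a m) \<gamma>)) I \<le> full_norm G (\<lambda>\<gamma>. a n \<gamma> - a m \<gamma>)"
          using L2_set_src_res_le[OF Cc_diff[OF cauchyD[OF a] cauchyD[OF a]] u \<open>finite I\<close>, of n m] by simp
        then show ?thesis using M \<open>n \<ge> M\<close> that by (meson less_imp_le order_trans)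
      qed
      then show "\<exists>N. \<forall>m\<ge>N. L2_set (\<lambda>\<gamma>. cmod (src_res u (a n) \<gamma> - src_res u (a m) \<gamma>)) I \<le> e" by blast
    qed
    then have "(\<lambda>\<gamma>. src_res u (a n) \<gamma> - src_res u ?j \<gamma>) \<in> ell2 UNIV \<and>
      ell2_norm (\<lambda>\<gamma>. src_res u (a n) \<gamma> - src_res u ?j \<gamma>) \<le> e" if "n \<ge> M" for n
      using that by (intro conjI ell2I) auto
    then show ?thesis by blast
  qed
  obtain n0 where n0: "(\<lambda>\<gamma>. src_res u (a n0) \<gamma> - src_res u ?j \<gamma>) \<in> ell2 UNIV"
    using near[of 1] by auto
  show j: "src_res u ?j \<in> ell2 UNIV"
    using ell2_lincomb[OF an n0, of 1 n0 "-1"] by simp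
  show "(\<lambda>n. ell2_norm (src_res u (a n))) \<longlonglongrightarrow> ell2_norm (src_res u ?j)"
  proof (rule LIMSEQ_I)
    fix e :: real assume "0 < e"
    obtain M where M: "\<forall>n\<ge>M. (\<lambda>\<gamma>. src_res u (a n) \<gamma> - src_res u ?j \<gamma>) \<in> ell2 UNIV \<and>
      ell2_norm (\<lambda>\<gamma>. src_res u (a n) \<gamma> - src_res u ?j \<gamma>) \<le> e / 2" using near[of "e / 2"] \<open>0 < e\<close> by auto
    have "norm (ell2_norm (src_res u (a n)) - ell2_norm (src_res u ?j)) < e" if "n \<ge> M" for n
    proof -
      let ?d = "\<lambda>\<gamma>. src_res u (a n) \<gamma> - src_res u ?j \<gamma>"
      have d: "?d \<in> ell2 UNIV" "ell2_norm ?d \<le> e / 2" using M that by auto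
      have "ell2_norm (src_res u (a n)) \<le> ell2_norm (src_res u ?j) + ell2_norm ?d"
        using ell2_add(2)[OF j d(1)] by simp
      moreover have "ell2_norm (\<lambda>\<gamma>. (-1) * ?d \<gamma>) = ell2_norm ?d" by (subst ell2_norm_scale) simp
      moreover have "ell2_norm (src_res u ?j) \<le> ell2_norm (src_res u (a n)) + ell2_norm (\<lambda>\<gamma>. (-1) * ?d \<gamma>)"
        using ell2_add(2)[OF an ell2_scale[OF d(1)], of n "-1"] by simp
      ultimately show ?thesis using d(2) \<open>0 < e\<close> by (simp add: abs_le_iff abs_less_iff)
    qed
    then show "\<exists>N. \<forall>n\<ge>N. norm (ell2_norm (src_res u (a n)) - ell2_norm (src_res u ?j)) < e" by blast
  qed
qed

lemma conv_invol_unit: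
  assumes f: "f \<in> Cc G" and u: "u \<in> topspace (unit_top G)"
  shows "conv G (invol G f) f (unit G u) = complex_of_real ((ell2_norm (src_res u f))\<^sup>2)"
proof -
  let ?R = "{\<alpha>\<in>arrows G. rng G \<alpha> = u \<and> invol G f \<alpha> \<noteq> 0}" and ?S = "{\<gamma>\<in>arrows G. src G \<gamma> = u \<and> f \<gamma> \<noteq> 0}"
  have bij: "bij_betw (ginv G) ?S ?R"
    by (rule bij_betw_byWitness[where f' = "ginv G"]) (auto simp: inv_in rng_inv src_inv inv_inv invol_def)
  have "conv G (invol G f) f (unit G u) = (\<Sum>\<alpha>\<in>?R. invol G f \<alpha> * f (gmult G (ginv G \<alpha>) (unit G u)))"
    using u by (subst conv_eq[OF Cc_invol[OF f]]) (auto simp: unit_in rng_unit)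
  also have "\<dots> = (\<Sum>\<gamma>\<in>?S. invol G f (ginv G \<gamma>) * f (gmult G (ginv G (ginv G \<gamma>)) (unit G u)))"
    by (rule sum.reindex_bij_betw[OF bij, symmetric])
  also have "\<dots> = (\<Sum>\<gamma>\<in>?S. complex_of_real ((cmod (f \<gamma>))\<^sup>2))"
  proof (rule sum.cong)
    fix \<gamma> assume "\<gamma> \<in> ?S"
    then have "\<gamma> \<in> arrows G" "gmult G \<gamma> (unit G u) = \<gamma>" using mult_unit[of \<gamma>] by auto
    then show "invol G f (ginv G \<gamma>) * f (gmult G (ginv G (ginv G \<gamma>)) (unit G u)) = complex_of_real ((cmod (f \<gamma>))\<^sup>2)"
      by (simp add: invol_def inv_in inv_inv complex_norm_square mult.commute del: of_real_power)
  qed simp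
  also have "\<dots> = complex_of_real (\<Sum>\<gamma>\<in>?S. (cmod (f \<gamma>))\<^sup>2)" by simp
  also have "(\<Sum>\<gamma>\<in>?S. (cmod (f \<gamma>))\<^sup>2) = (\<Sum>\<^sub>\<infinity>\<gamma>. (cmod (src_res u f \<gamma>))\<^sup>2)"
  proof -
    have "(\<Sum>\<^sub>\<infinity>\<gamma>. (cmod (src_res u f \<gamma>))\<^sup>2) = (\<Sum>\<^sub>\<infinity>\<gamma>\<in>?S. (cmod (f \<gamma>))\<^sup>2)"
      by (rule infsum_cong_neutral) (auto simp: src_res_def)
    then show ?thesis using finite_fibre(2)[OF f] by simp
  qed
  finally show ?thesis by (simp add: ell2_norm_def infsum_nonneg)
qed

text \<open>Pointwise convergence of \<open>b n\<close> alone would bound the square sum only from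
  one side; equality comes from the convergence of the norms on the fibre.\<close>

lemma coef_pos:
  assumes b: "b \<in> Cc_cauchy G" and u: "u \<in> topspace (unit_top G)"
  shows "coef (cls (\<lambda>n. conv G (invol G (b n)) (b n))) (unit G u) =
    complex_of_real (\<Sum>\<^sub>\<infinity>\<gamma>\<in>{\<gamma>\<in>arrows G. src G \<gamma> = u}. (cmod (coef (cls b) \<gamma>))\<^sup>2)"
    "(\<lambda>\<gamma>. (cmod (coef (cls b) \<gamma>))\<^sup>2) summable_on {\<gamma>\<in>arrows G. src G \<gamma> = u}"
proof -
  let ?j = "coef (cls b)"
  have "(\<lambda>n. conv G (invol G (b n)) (b n) (unit G u)) \<longlonglongrightarrow> complex_of_real ((ell2_norm (src_res u ?j))\<^sup>2)"
    unfolding conv_invol_unit[OF cauchyD[OF b] u] by (intro tendsto_intros src_res_coef(2)[OF b u])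
  then have "coef (cls (\<lambda>n. conv G (invol G (b n)) (b n))) (unit G u) = complex_of_real ((ell2_norm (src_res u ?j))\<^sup>2)"
    by (rule coef_unique[OF cauchy_conv[OF cauchy_invol[OF b] b]])
  moreover have "(ell2_norm (src_res u ?j))\<^sup>2 = (\<Sum>\<^sub>\<infinity>\<gamma>. (cmod (src_res u ?j \<gamma>))\<^sup>2)"
    by (simp add: ell2_norm_def infsum_nonneg)
  moreover have "(\<Sum>\<^sub>\<infinity>\<gamma>. (cmod (src_res u ?j \<gamma>))\<^sup>2) = (\<Sum>\<^sub>\<infinity>\<gamma>\<in>{\<gamma>\<in>arrows G. src G \<gamma> = u}. (cmod (?j \<gamma>))\<^sup>2)"
    by (rule infsum_cong_neutral) (auto simp: src_res_def)
  ultimately show "coef (cls (\<lambda>n. conv G (invol G (b n)) (b n))) (unit G u) =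
    complex_of_real (\<Sum>\<^sub>\<infinity>\<gamma>\<in>{\<gamma>\<in>arrows G. src G \<gamma> = u}. (cmod (?j \<gamma>))\<^sup>2)" by simp
  have "(\<lambda>\<gamma>. (cmod (src_res u ?j \<gamma>))\<^sup>2) summable_on UNIV"
    using src_res_coef(1)[OF b u] by (simp add: ell2_def)
  also have "?this \<longleftrightarrow> (\<lambda>\<gamma>. (cmod (?j \<gamma>))\<^sup>2) summable_on {\<gamma>\<in>arrows G. src G \<gamma> = u}"
    by (rule summable_on_cong_neutral) (auto simp: src_res_def)
  finally show "(\<lambda>\<gamma>. (cmod (?j \<gamma>))\<^sup>2) summable_on {\<gamma>\<in>arrows G. src G \<gamma> = u}" .
qed

text \<open>Inversion exchanges source and range fibres and conjugates the coefficients, so this is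
  \<open>coef_pos\<close> applied to the adjoint sequence.\<close>

lemma coef_pos_rng:
  assumes b: "b \<in> Cc_cauchy G" and u: "u \<in> topspace (unit_top G)"
  shows "coef (cls (\<lambda>n. conv G (b n) (invol G (b n)))) (unit G u) =
    complex_of_real (\<Sum>\<^sub>\<infinity>\<gamma>\<in>{\<gamma>\<in>arrows G. rng G \<gamma> = u}. (cmod (coef (cls b) \<gamma>))\<^sup>2)"
    "(\<lambda>\<gamma>. (cmod (coef (cls b) \<gamma>))\<^sup>2) summable_on {\<gamma>\<in>arrows G. rng G \<gamma> = u}"
proof -
  let ?c = "\<lambda>n. invol G (b n)"
  have c: "?c \<in> Cc_cauchy G" by (rule cauchy_invol[OF b])
  have cc: "invol G (?c n) = b n" for n
    using Cc_vanish[OF cauchyD[OF b]] by (auto simp: invol_def fun_eq_iff inv_in inv_inv)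
  have bij: "bij_betw (ginv G) {\<gamma>\<in>arrows G. rng G \<gamma> = u} {\<gamma>\<in>arrows G. src G \<gamma> = u}"
    by (rule bij_betw_byWitness[where f' = "ginv G"]) (auto simp: inv_in rng_inv src_inv inv_inv)
  have "coef (cls ?c) (ginv G \<gamma>) = cnj (coef (cls b) \<gamma>)" if "\<gamma> \<in> arrows G" for \<gamma>
    using that tendsto_cnj[OF coef_cls[OF b, of \<gamma>]]
    by (intro coef_unique[OF c]) (simp add: invol_def inv_in inv_inv)
  then have e: "(cmod (coef (cls ?c) (ginv G \<gamma>)))\<^sup>2 = (cmod (coef (cls b) \<gamma>))\<^sup>2" if "\<gamma> \<in> {\<gamma>\<in>arrows G. rng G \<gamma> = u}" for \<gamma>
    using that by simp
  show "coef (cls (\<lambda>n. conv G (b n) (invol G (b n)))) (unit G u) =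
    complex_of_real (\<Sum>\<^sub>\<infinity>\<gamma>\<in>{\<gamma>\<in>arrows G. rng G \<gamma> = u}. (cmod (coef (cls b) \<gamma>))\<^sup>2)"
    using coef_pos(1)[OF c u]
    unfolding infsum_reindex_bij_betw[OF bij, of "\<lambda>\<gamma>. (cmod (coef (cls ?c) \<gamma>))\<^sup>2", symmetric]
    by (subst (asm) infsum_cong[where f = "\<lambda>\<gamma>. (cmod (coef (cls ?c) (ginv G \<gamma>)))\<^sup>2"]) (rule e, simp_all add: cc)
  show "(\<lambda>\<gamma>. (cmod (coef (cls b) \<gamma>))\<^sup>2) summable_on {\<gamma>\<in>arrows G. rng G \<gamma> = u}"
    using coef_pos(2)[OF c u]
    unfolding summable_on_reindex_bij_betw[OF bij, of "\<lambda>\<gamma>. (cmod (coef (cls ?c) \<gamma>))\<^sup>2", symmetric]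
    by (subst (asm) summable_on_cong) (rule e)
qed

text \<open>A nonzero coefficient is the limit of values that are not all zero, so it sits in the
  support of some \<open>a n\<close>, which finitely many bisections cover. Successive differences
  in an enumeration of all these bisections stay clopen, and injectivity passes to subsets.\<close>

lemma disjoint_bisections:
  assumes a: "a \<in> Cc_cauchy G"
  shows "\<exists>D :: nat \<Rightarrow> 'g set. (\<forall>i. bisection (D i)) \<and> disjoint_family D \<and>
    (\<forall>\<gamma>. coef (cls a) \<gamma> \<noteq> 0 \<longrightarrow> \<gamma> \<in> (\<Union>i. D i))"
proof -
  have "\<exists>\<B>. finite \<B> \<and> (\<forall>B\<in>\<B>. bisection B) \<and> (\<forall>\<gamma>. a n \<gamma> \<noteq> 0 \<longrightarrow> \<gamma> \<in> \<Union>\<B>)" for n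
  proof -
    obtain C where C: "compactin (arrow_top G) C" "\<forall>\<gamma>. a n \<gamma> \<noteq> 0 \<longrightarrow> \<gamma> \<in> C"
      using Cc_support[OF cauchyD[OF a]] by blast
    obtain \<B> where "finite \<B>" "\<forall>B\<in>\<B>. bisection B" "C \<subseteq> \<Union>\<B>" using compactin_bisections[OF C(1)] by blast
    then show ?thesis using C(2) by (intro exI[of _ \<B>]) blast
  qed
  then obtain \<B> where \<B>: "\<And>n. finite (\<B> n)" "\<And>n. \<forall>B\<in>\<B> n. bisection B" "\<And>n. \<forall>\<gamma>. a n \<gamma> \<noteq> 0 \<longrightarrow> \<gamma> \<in> \<Union>(\<B> n)"
    by metis
  \<comment> \<open>The empty set, itself a bisection, is added so that the family is nonempty and
    can be enumerated by the naturals.\<close>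
  define \<C> where "\<C> = insert {} (\<Union>n. \<B> n)"
  have "countable \<C>" "\<C> \<noteq> {}" using \<B>(1) by (auto simp: \<C>_def countable_finite)
  define B where "B = from_nat_into \<C>"
  have B: "range B = \<C>" unfolding B_def by (rule range_from_nat_into) fact+
  have bis: "bisection (B i)" for i
  proof -
    have "B i \<in> \<C>" using B by blast
    then show ?thesis using \<B>(2) by (auto simp: \<C>_def bisection_def)
  qed
  have "bisection (disjointed B i)" for i
  proof -
    have "openin (arrow_top G) (B i - (\<Union>k\<in>{0..<i}. B k))" "closedin (arrow_top G) (B i - (\<Union>k\<in>{0..<i}. B k))"
      using bis by (auto intro!: openin_diff closedin_diff closedin_Union openin_Union simp: bisection_def)
    then show ?thesis
      using bis[of i] by (auto simp: disjointed_def bisection_def intro: inj_on_diff)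
  qed
  moreover have "\<gamma> \<in> (\<Union>i. disjointed B i)" if "coef (cls a) \<gamma> \<noteq> 0" for \<gamma>
  proof -
    have "\<exists>n. a n \<gamma> \<noteq> 0"
    proof (rule ccontr)
      assume "\<nexists>n. a n \<gamma> \<noteq> 0"
      then have "coef (cls a) \<gamma> = 0" by (intro coef_unique[OF a]) simp
      then show False using that by simp
    qed
    then obtain n where "a n \<gamma> \<noteq> 0" by blast
    then have "\<gamma> \<in> \<Union>(\<B> n)" using \<B>(3)[of n] by simp
    then have "\<gamma> \<in> \<Union>\<C>" by (auto simp: \<C>_def)
    then show ?thesis using B by (simp add: UN_disjointed_eq)
  qed
  ultimately show ?thesis using disjoint_family_disjointed by blast
qed

end

section \<open>The trace of an invariant measure\<close>

text \<open>Finiteness on compact sets makes compactly supported functions integrable over the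
  units. Sigma-finiteness enters through the layer-cake formula.\<close>

locale ample_groupoid_measure = ample_groupoid G for G :: "('g, 'u) top_groupoid" +
  fixes M :: "'u measure"
  assumes borel_M: "is_borel_measure (unit_top G) M"
    and invariant_M: "groupoid_invariant G M"
    and sigma_finite_M: "sigma_finite_measure M"
    and compact_finite: "compactin (unit_top G) C \<Longrightarrow> emeasure M C < \<infinity>"
begin

lemma space_M: "space M = topspace (unit_top G)"
  using borel_M by (simp add: is_borel_measure_def)

lemma open_sets_M: "openin (unit_top G) U \<Longrightarrow> U \<in> sets M"
  using borel_M by (auto simp: is_borel_measure_def intro: sigma_sets.Basic)

lemma compact_sets_M: "compactin (unit_top G) C \<Longrightarrow> C \<in> sets M"
proof -
  assume "compactin (unit_top G) C"
  then have "closedin (unit_top G) C" by (rule compactin_imp_closedin[OF Hausdorff_unit])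
  then have "openin (unit_top G) (topspace (unit_top G) - C)" "C \<subseteq> topspace (unit_top G)"
    by (auto simp: closedin_def)
  then have "space M - (topspace (unit_top G) - C) \<in> sets M" "space M - (topspace (unit_top G) - C) = C"
    using open_sets_M by (auto simp: space_M)
  then show ?thesis by simp
qed

lemma Cc_unit_measurable:
  assumes "f \<in> Cc G" shows "(\<lambda>u. f (unit G u)) \<in> borel_measurable M"
proof (rule borel_measurableI)
  fix S :: "complex set" assume "open S"
  then have "openin (unit_top G) {u \<in> topspace (unit_top G). (f \<circ> unit G) u \<in> S}"
    by (intro openin_continuous_map_preimage[OF continuous_map_compose[OF continuous_unit Cc_continuous[OF assms]]]) simp
  from open_sets_M[OF this] show "(\<lambda>u. f (unit G u)) -` S \<inter> space M \<in> sets M"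
    by (simp add: space_M vimage_def Int_def conj_commute)
qed

lemma coef_measurable:
  assumes a: "a \<in> Cc_cauchy G"
  shows "(\<lambda>u. coef (cls a) (unit G u)) \<in> borel_measurable M"
  by (rule borel_measurable_LIMSEQ_metric[OF Cc_unit_measurable[OF cauchyD[OF a]] coef_cls[OF a]])

lemma Cc_unit_integrable:
  assumes f: "f \<in> Cc G" shows "integrable M (\<lambda>u. f (unit G u))"
proof -
  obtain C where C: "compactin (arrow_top G) C" "\<forall>\<gamma>. f \<gamma> \<noteq> 0 \<longrightarrow> \<gamma> \<in> C"
    using Cc_support[OF f] by blast
  obtain c where c: "0 \<le> c" "\<forall>\<gamma>. cmod (f \<gamma>) \<le> c" using Cc_bounded[OF f] by blast
  have K: "compactin (unit_top G) (src G ` C)" by (rule image_compactin[OF C(1) continuous_src])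
  have "integrable M (\<lambda>u. c * indicator (src G ` C) u)"
    using compact_sets_M[OF K] compact_finite[OF K] by (intro integrable_mult_right) (simp add: integrable_indicator_iff)
  then show ?thesis
  proof (rule Bochner_Integration.integrable_bound)
    show "(\<lambda>u. f (unit G u)) \<in> borel_measurable M" by (rule Cc_unit_measurable[OF f])
    show "AE u in M. norm (f (unit G u)) \<le> norm (c * indicator (src G ` C) u :: real)"
    proof (rule AE_I2)
      fix u assume u: "u \<in> space M"
      show "norm (f (unit G u)) \<le> norm (c * indicator (src G ` C) u :: real)"
      proof (cases "f (unit G u) = 0")
        case False
        then have "unit G u \<in> C" using C(2) by blast
        then have "src G (unit G u) \<in> src G ` C" by blast
        then have "u \<in> src G ` C" using u src_unit by (simp add: space_M)
        then show ?thesis using c by simp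
      qed simp
    qed
  qed
qed

text \<open>Defined on all classes by discarding imaginary and negative parts. On the positive cone
  the coefficients at units are nonnegative reals, so nothing is discarded there.\<close>

definition weight :: "(nat \<Rightarrow> 'g \<Rightarrow> complex) set \<Rightarrow> ennreal" where
  "weight A = (\<integral>\<^sup>+u. ennreal (Re (coef A (unit G u))) \<partial>M)"

lemma pos_coef_nonneg:
  assumes "A \<in> pos_cone (full_cstar G)" "u \<in> space M"
  shows "0 \<le> Re (coef A (unit G u))" "Im (coef A (unit G u)) = 0"
  using assms coef_pos(1) by (auto simp: pos_cone_cls space_M infsum_nonneg)

lemma pos_cone_cauchy:
  assumes "A \<in> pos_cone (full_cstar G)"
  obtains a where "a \<in> Cc_cauchy G" "A = cls a"
  using assms cauchy_conv[OF cauchy_invol] by (auto simp: pos_cone_cls)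

text \<open>Each \<open>D i\<close> contains at most one arrow of the fibre, so sending an arrow to
  the index of its piece is injective. The unordered sum over the fibre becomes a series over the
  indices, with zero at the pieces that miss the fibre.\<close>

lemma fibre_sum_suminf:
  fixes D :: "nat \<Rightarrow> 'g set" and p :: "'g \<Rightarrow> 'u" and h :: "'g \<Rightarrow> real"
  assumes "disjoint_family D" "\<And>i. inj_on p (D i)" "\<And>i. D i \<subseteq> arrows G"
    "\<And>\<gamma>. h \<gamma> \<noteq> 0 \<Longrightarrow> \<gamma> \<in> (\<Union>i. D i)" "\<And>\<gamma>. 0 \<le> h \<gamma>"
    "h summable_on {\<gamma>\<in>arrows G. p \<gamma> = u}"
  shows "(\<Sum>i. ennreal (\<Sum>\<gamma> | \<gamma> \<in> D i \<and> p \<gamma> = u. h \<gamma>)) = ennreal (\<Sum>\<^sub>\<infinity>\<gamma>\<in>{\<gamma>\<in>arrows G. p \<gamma> = u}. h \<gamma>)"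
proof -
  let ?\<Gamma> = "{\<gamma> \<in> (\<Union>i. D i). p \<gamma> = u}"
  define k where "k \<gamma> = (SOME i. \<gamma> \<in> D i)" for \<gamma>
  have k: "\<gamma> \<in> D (k \<gamma>)" if "\<gamma> \<in> ?\<Gamma>" for \<gamma>
    unfolding k_def by (rule someI_ex) (use that in blast)
  have single: "{\<gamma>'. \<gamma>' \<in> D (k \<gamma>) \<and> p \<gamma>' = u} = {\<gamma>}" if "\<gamma> \<in> ?\<Gamma>" for \<gamma>
    using k[OF that] that by (auto intro: inj_onD[OF assms(2)])
  have inj: "inj_on k ?\<Gamma>"
  proof (rule inj_onI)
    fix \<alpha> \<beta> assume *: "\<alpha> \<in> ?\<Gamma>" "\<beta> \<in> ?\<Gamma>" "k \<alpha> = k \<beta>"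
    have "{\<alpha>} = {\<beta>}" using single[OF *(1)] single[OF *(2)] unfolding *(3) by (rule trans[OF sym])
    then show "\<alpha> = \<beta>" by (rule singleton_inject)
  qed
  let ?g = "\<lambda>\<gamma>. if \<gamma> \<in> ?\<Gamma> then h \<gamma> else 0"
  let ?f = "\<lambda>i. \<Sum>\<gamma> | \<gamma> \<in> D i \<and> p \<gamma> = u. h \<gamma>"
  have p1: "?f i = 0" if "i \<notin> k ` ?\<Gamma>" for i
  proof -
    have "{\<gamma>. \<gamma> \<in> D i \<and> p \<gamma> = u} = {}"
    proof (rule ccontr)
      assume "{\<gamma>. \<gamma> \<in> D i \<and> p \<gamma> = u} \<noteq> {}"
      then obtain \<gamma> where \<gamma>: "\<gamma> \<in> D i" "p \<gamma> = u" by blast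
      then have "\<gamma> \<in> ?\<Gamma>" by blast
      moreover have "k \<gamma> = i"
        using k[OF \<open>\<gamma> \<in> ?\<Gamma>\<close>] \<gamma>(1) disjoint_family_onD[OF assms(1), of "k \<gamma>" i] by blast
      ultimately show False using that by blast
    qed
    then show ?thesis by (simp only: sum.empty)
  qed
  have p2: "?f (k \<gamma>) = ?g \<gamma>" if "\<gamma> \<in> ?\<Gamma>" for \<gamma>
    using that by (simp only: single[OF that]) simp
  have p3: "?g \<gamma> = 0" if "\<gamma> \<notin> ?\<Gamma>" for \<gamma> using that by (simp only: if_False)
  have push: "?f summable_on UNIV \<longleftrightarrow> ?g summable_on UNIV" "infsum ?f UNIV = infsum ?g UNIV"
    by (rule summable_on_push[OF inj], erule p1, erule p2, erule p3)+
  have nz: "h \<gamma> = 0" if "\<gamma> \<notin> (\<Union>i. D i)" for \<gamma> using assms(4)[of \<gamma>] that by blast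
  have \<Gamma>: "\<gamma> \<in> {\<gamma>\<in>arrows G. p \<gamma> = u}" if "\<gamma> \<in> ?\<Gamma>" for \<gamma> using that assms(3) by blast
  have "h summable_on {\<gamma>\<in>arrows G. p \<gamma> = u} \<longleftrightarrow> ?g summable_on UNIV"
    by (rule summable_on_cong_neutral) (use \<Gamma> nz in auto)
  moreover have "infsum h {\<gamma>\<in>arrows G. p \<gamma> = u} = infsum ?g UNIV"
    by (rule infsum_cong_neutral) (use \<Gamma> nz in auto)
  ultimately have "(?f has_sum infsum h {\<gamma>\<in>arrows G. p \<gamma> = u}) UNIV"
    using push assms(6) by (simp add: has_sum_iff)
  from has_sum_imp_sums[OF this] show ?thesis
    by (intro suminf_ennreal_eq sum_nonneg assms(5))
qed

text \<open>The inner sum is the squared modulus at the one arrow of \<open>D\<close> over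
  \<open>u\<close>, or an empty sum. Since \<open>0 \<le> t\<close>, points with an empty sum never
  exceed the threshold, and the square root of \<open>t\<close> passes from the square to the
  modulus.\<close>

lemma bisection_superlevel:
  fixes p :: "'g \<Rightarrow> 'u"
  assumes D: "D \<subseteq> arrows G" "inj_on p D" and p: "\<And>\<gamma>. \<gamma> \<in> arrows G \<Longrightarrow> p \<gamma> \<in> topspace (unit_top G)" and "0 \<le> t"
  shows "{u\<in>space M. t < (\<Sum>\<gamma> | \<gamma> \<in> D \<and> p \<gamma> = u. (cmod (f \<gamma>))\<^sup>2)} = p ` (D \<inter> {\<gamma>\<in>arrows G. sqrt t < cmod (f \<gamma>)})"
    (is "?L = ?R")
proof -
  have single: "(\<Sum>\<gamma>' | \<gamma>' \<in> D \<and> p \<gamma>' = p \<gamma>. (cmod (f \<gamma>'))\<^sup>2) = (cmod (f \<gamma>))\<^sup>2" if "\<gamma> \<in> D" for \<gamma>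
  proof -
    have "{\<gamma>'. \<gamma>' \<in> D \<and> p \<gamma>' = p \<gamma>} = {\<gamma>}" using that by (auto intro: inj_onD[OF D(2)])
    then show ?thesis by simp
  qed
  have sq: "t < (cmod z)\<^sup>2 \<longleftrightarrow> sqrt t < cmod z" for z :: complex
    using \<open>0 \<le> t\<close> by (metis norm_ge_zero real_sqrt_less_iff real_sqrt_unique)
  show ?thesis
  proof (intro equalityI subsetI)
    fix u assume u: "u \<in> ?L"
    have "{\<gamma>. \<gamma> \<in> D \<and> p \<gamma> = u} \<noteq> {}"
    proof
      assume "{\<gamma>. \<gamma> \<in> D \<and> p \<gamma> = u} = {}"
      with u \<open>0 \<le> t\<close> show False by (simp only: mem_Collect_eq sum.empty) simp
    qed
    then obtain \<gamma> where "\<gamma> \<in> D" "u = p \<gamma>" by blast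
    with u show "u \<in> ?R" using single[OF \<open>\<gamma> \<in> D\<close>] D(1) by (auto simp: sq)
  next
    fix u assume "u \<in> ?R"
    then obtain \<gamma> where "\<gamma> \<in> D" "u = p \<gamma>" "sqrt t < cmod (f \<gamma>)" by blast
    then show "u \<in> ?L" using single[OF \<open>\<gamma> \<in> D\<close>] p D(1) by (auto simp: sq space_M)
  qed
qed

text \<open>On one piece \<open>D i\<close>, the superlevel sets of the two fibre sums are the
  source and the range of one and the same open G-set, so invariance equates their measures. The
  pieces are then added up under the integral.\<close>

lemma nn_integral_src_rng:
  assumes b: "b \<in> Cc_cauchy G"
  shows "(\<integral>\<^sup>+u. ennreal (\<Sum>\<^sub>\<infinity>\<gamma>\<in>{\<gamma>\<in>arrows G. src G \<gamma> = u}. (cmod (coef (cls b) \<gamma>))\<^sup>2) \<partial>M) =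
    (\<integral>\<^sup>+u. ennreal (\<Sum>\<^sub>\<infinity>\<gamma>\<in>{\<gamma>\<in>arrows G. rng G \<gamma> = u}. (cmod (coef (cls b) \<gamma>))\<^sup>2) \<partial>M)"
proof -
  let ?h = "\<lambda>\<gamma>. (cmod (coef (cls b) \<gamma>))\<^sup>2"
  obtain D :: "nat \<Rightarrow> 'g set" where D: "\<forall>i. bisection (D i)" "disjoint_family D"
    "\<forall>\<gamma>. coef (cls b) \<gamma> \<noteq> 0 \<longrightarrow> \<gamma> \<in> (\<Union>i. D i)" using disjoint_bisections[OF b] by blast
  have D': "openin (arrow_top G) (D i)" "inj_on (src G) (D i)" "inj_on (rng G) (D i)" "D i \<subseteq> arrows G" for i
    using D(1) bisection_subset by (auto simp: bisection_def)
  let ?s = "\<lambda>i u. \<Sum>\<gamma> | \<gamma> \<in> D i \<and> src G \<gamma> = u. ?h \<gamma>" and ?r = "\<lambda>i u. \<Sum>\<gamma> | \<gamma> \<in> D i \<and> rng G \<gamma> = u. ?h \<gamma>"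
  let ?P = "\<lambda>i t. D i \<inter> {\<gamma>\<in>arrows G. sqrt t < cmod (coef (cls b) \<gamma>)}"
  have P: "openin (arrow_top G) (?P i t)" for i t
    by (rule openin_Int[OF D'(1) open_coef_superlevel[OF b]])
  have ls: "{u\<in>space M. t < ?s i u} = src G ` ?P i t" and lr: "{u\<in>space M. t < ?r i u} = rng G ` ?P i t"
    if "0 \<le> t" for i t
    by (rule bisection_superlevel[OF D'(4,2) src_in that], assumption)
       (rule bisection_superlevel[OF D'(4,3) rng_in that], assumption)
  \<comment> \<open>Measurability asks about every threshold, while the description by images of
    open sets covers only nonnegative ones.\<close>
  have neg: "{u\<in>space M. t < sum ?h (X u)} = space M" if "t < 0" for t and X :: "'u \<Rightarrow> 'g set"
    using that by (auto intro!: less_le_trans[OF that sum_nonneg])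
  have Ps: "src G ` ?P i t \<in> sets M" and Pr: "rng G ` ?P i t \<in> sets M" for i t
    using open_src open_rng P[of i t] by (auto simp: open_map_def intro!: open_sets_M)
  have ms: "?s i \<in> borel_measurable M" for i
    unfolding borel_measurable_iff_greater
  proof
    fix t show "{u\<in>space M. t < ?s i u} \<in> sets M"
      by (cases "t < 0") (simp only: neg sets.top, simp only: not_less ls Ps)
  qed
  have mr: "?r i \<in> borel_measurable M" for i
    unfolding borel_measurable_iff_greater
  proof
    fix t show "{u\<in>space M. t < ?r i u} \<in> sets M"
      by (cases "t < 0") (simp only: neg sets.top, simp only: not_less lr Pr)
  qed
  have eq: "(\<integral>\<^sup>+u. ennreal (?s i u) \<partial>M) = (\<integral>\<^sup>+u. ennreal (?r i u) \<partial>M)" for i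
  proof (rule nn_integral_eq_of_superlevel[OF sigma_finite_M ms mr])
    fix t :: real assume "0 \<le> t"
    have "open_G_set G (?P i t)"
      unfolding open_G_set_def using P D'(2,3)[of i] by (auto intro: inj_on_subset)
    then show "emeasure M {u\<in>space M. t < ?s i u} = emeasure M {u\<in>space M. t < ?r i u}"
      unfolding ls[OF \<open>0 \<le> t\<close>] lr[OF \<open>0 \<le> t\<close>] using invariant_M by (simp add: groupoid_invariant_def)
  qed
  have nz: "\<gamma> \<in> (\<Union>i. D i)" if "?h \<gamma> \<noteq> 0" for \<gamma> using that D(3) by auto
  have "(\<integral>\<^sup>+u. ennreal (\<Sum>\<^sub>\<infinity>\<gamma>\<in>{\<gamma>\<in>arrows G. src G \<gamma> = u}. ?h \<gamma>) \<partial>M) = (\<integral>\<^sup>+u. (\<Sum>i. ennreal (?s i u)) \<partial>M)"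
    by (intro nn_integral_cong fibre_sum_suminf[symmetric] D(2) D' nz coef_pos(2)[OF b])
       (auto simp: space_M)
  also have "\<dots> = (\<Sum>i. \<integral>\<^sup>+u. ennreal (?s i u) \<partial>M)"
    using ms by (intro nn_integral_suminf) auto
  also have "\<dots> = (\<Sum>i. \<integral>\<^sup>+u. ennreal (?r i u) \<partial>M)" by (simp only: eq)
  also have "\<dots> = (\<integral>\<^sup>+u. (\<Sum>i. ennreal (?r i u)) \<partial>M)"
    using mr by (intro nn_integral_suminf[symmetric]) auto
  also have "\<dots> = (\<integral>\<^sup>+u. ennreal (\<Sum>\<^sub>\<infinity>\<gamma>\<in>{\<gamma>\<in>arrows G. rng G \<gamma> = u}. ?h \<gamma>) \<partial>M)"
    by (intro nn_integral_cong fibre_sum_suminf D(2) D' nz coef_pos_rng(2)[OF b])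
       (auto simp: space_M)
  finally show ?thesis .
qed

lemma weight_star_mult:
  assumes b: "b \<in> Cc_cauchy G"
  shows "weight (cls (\<lambda>n. conv G (invol G (b n)) (b n))) = weight (cls (\<lambda>n. conv G (b n) (invol G (b n))))"
proof -
  have "weight (cls (\<lambda>n. conv G (invol G (b n)) (b n))) =
      (\<integral>\<^sup>+u. ennreal (\<Sum>\<^sub>\<infinity>\<gamma>\<in>{\<gamma>\<in>arrows G. src G \<gamma> = u}. (cmod (coef (cls b) \<gamma>))\<^sup>2) \<partial>M)"
    unfolding weight_def by (intro nn_integral_cong) (simp add: coef_pos(1)[OF b] space_M)
  also have "\<dots> = (\<integral>\<^sup>+u. ennreal (\<Sum>\<^sub>\<infinity>\<gamma>\<in>{\<gamma>\<in>arrows G. rng G \<gamma> = u}. (cmod (coef (cls b) \<gamma>))\<^sup>2) \<partial>M)"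
    by (rule nn_integral_src_rng[OF b])
  also have "\<dots> = weight (cls (\<lambda>n. conv G (b n) (invol G (b n))))"
    unfolding weight_def by (intro nn_integral_cong) (simp add: coef_pos_rng(1)[OF b] space_M)
  finally show ?thesis .
qed

lemma is_trace_weight: "is_trace (full_cstar G) weight"
  unfolding is_trace_def
proof (intro conjI ballI allI impI)
  fix A B assume A: "A \<in> pos_cone (full_cstar G)" and B: "B \<in> pos_cone (full_cstar G)"
  obtain a where a: "a \<in> Cc_cauchy G" "A = cls a" by (rule pos_cone_cauchy[OF A])
  obtain b where b: "b \<in> Cc_cauchy G" "B = cls b" by (rule pos_cone_cauchy[OF B])
  have ab: "(\<lambda>n \<gamma>. a n \<gamma> + b n \<gamma>) \<in> Cc_cauchy G"
    using cauchy_lincomb[OF a(1) b(1), of 1 1] by simp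
  have "coef (cls (\<lambda>n \<gamma>. a n \<gamma> + b n \<gamma>)) \<gamma> = coef A \<gamma> + coef B \<gamma>" for \<gamma>
    unfolding a(2) b(2) by (rule coef_unique[OF ab]) (intro tendsto_add coef_cls a b)
  then have "weight (s_add (full_cstar G) A B) = (\<integral>\<^sup>+u. ennreal (Re (coef A (unit G u)) + Re (coef B (unit G u))) \<partial>M)"
    by (simp add: a(2) b(2) s_add_cls[OF a(1) b(1)] weight_def)
  also have "\<dots> = (\<integral>\<^sup>+u. ennreal (Re (coef A (unit G u))) + ennreal (Re (coef B (unit G u))) \<partial>M)"
    using pos_coef_nonneg(1)[OF A] pos_coef_nonneg(1)[OF B] by (intro nn_integral_cong ennreal_plus) auto
  also have "\<dots> = weight A + weight B"
    unfolding weight_def a(2) b(2) using coef_measurable[OF a(1)] coef_measurable[OF b(1)]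
    by (intro nn_integral_add) auto
  finally show "weight (s_add (full_cstar G) A B) = weight A + weight B" .
next
  fix c :: real and A assume "0 \<le> c" and A: "A \<in> pos_cone (full_cstar G)"
  obtain a where a: "a \<in> Cc_cauchy G" "A = cls a" by (rule pos_cone_cauchy[OF A])
  have ca: "(\<lambda>n \<gamma>. complex_of_real c * a n \<gamma>) \<in> Cc_cauchy G"
    using cauchy_lincomb[OF a(1) a(1), of "complex_of_real c" 0] by simp
  have "coef (cls (\<lambda>n \<gamma>. complex_of_real c * a n \<gamma>)) \<gamma> = complex_of_real c * coef A \<gamma>" for \<gamma>
    unfolding a(2) by (rule coef_unique[OF ca]) (intro tendsto_mult tendsto_const coef_cls a)
  then have "weight (s_scale (full_cstar G) (complex_of_real c) A) = (\<integral>\<^sup>+u. ennreal c * ennreal (Re (coef A (unit G u))) \<partial>M)"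
    using pos_coef_nonneg(1)[OF A] \<open>0 \<le> c\<close>
    by (auto simp: a(2) s_scale_cls[OF a(1)] weight_def ennreal_mult intro!: nn_integral_cong)
  also have "\<dots> = ennreal c * weight A"
    unfolding weight_def a(2) using coef_measurable[OF a(1)] by (intro nn_integral_cmult) auto
  finally show "weight (s_scale (full_cstar G) (complex_of_real c) A) = ennreal c * weight A" .
next
  fix B assume "B \<in> elems (full_cstar G)"
  then obtain b where b: "b \<in> Cc_cauchy G" "B = cls b" by (auto simp: elems_full_cstar)
  show "weight (s_mult (full_cstar G) (s_star (full_cstar G) B) B) = weight (s_mult (full_cstar G) B (s_star (full_cstar G) B))"
    by (simp add: b s_star_cls s_mult_cls cauchy_invol weight_star_mult)
qed

text \<open>Coefficients at units move by at most the distance of the elements. Lowering the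
  coefficient of \<open>A\<close> by \<open>?e k\<close> and truncating at zero gives integrals that
  increase to the weight, so one of them exceeds \<open>c\<close>; every positive element within
  distance \<open>?e k\<close> dominates it pointwise.\<close>

lemma lower_semicontinuous_weight_weight: "lower_semicontinuous_weight (full_cstar G) weight"
  unfolding lower_semicontinuous_weight_def
proof (intro ballI allI impI)
  fix A c assume A: "A \<in> pos_cone (full_cstar G)" and c: "c < weight A"
  obtain a where a: "a \<in> Cc_cauchy G" "A = cls a" by (rule pos_cone_cauchy[OF A])
  let ?g = "\<lambda>u. Re (coef A (unit G u))"
  let ?e = "\<lambda>k. inverse (real (Suc k))"
  have m: "?g \<in> borel_measurable M" using coef_measurable[OF a(1)] unfolding a(2) by measurable
  have "(\<lambda>k. \<integral>\<^sup>+u. ennreal (?g u - ?e k) \<partial>M) \<longlonglongrightarrow> (\<integral>\<^sup>+u. ennreal (?g u) \<partial>M)"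
  proof (rule nn_integral_LIMSEQ)
    show "incseq (\<lambda>k u. ennreal (?g u - ?e k))"
      by (auto simp: incseq_def le_fun_def intro!: ennreal_leI le_imp_inverse_le)
    show "(\<lambda>u. ennreal (?g u - ?e k)) \<in> borel_measurable M" for k using m by measurable
    show "(\<lambda>k. ennreal (?g u - ?e k)) \<longlonglongrightarrow> ennreal (?g u)" for u
      using tendsto_diff[OF tendsto_const LIMSEQ_inverse_real_of_nat, of "?g u"] by (intro tendsto_ennrealI) simp
  qed
  from order_tendstoD(1)[OF this, of c] c obtain k where k: "c < (\<integral>\<^sup>+u. ennreal (?g u - ?e k) \<partial>M)"
    by (auto simp: weight_def eventually_sequentially)
  have "c < weight B" if B: "B \<in> pos_cone (full_cstar G)" and d: "s_dist (full_cstar G) A B < ?e k" for B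
  proof -
    obtain b where b: "b \<in> Cc_cauchy G" "B = cls b" by (rule pos_cone_cauchy[OF B])
    have "?g u - ?e k \<le> Re (coef B (unit G u))" for u
      using coef_diff_le[OF a(1) b(1), of "unit G u"] d complex_Re_le_cmod[of "coef A (unit G u) - coef B (unit G u)"]
      by (simp add: a(2) b(2))
    then have "(\<integral>\<^sup>+u. ennreal (?g u - ?e k) \<partial>M) \<le> weight B"
      unfolding weight_def by (intro nn_integral_mono ennreal_leI)
    with k show ?thesis by simp
  qed
  then show "\<exists>e>0. \<forall>B\<in>pos_cone (full_cstar G). s_dist (full_cstar G) A B < e \<longrightarrow> c < weight B"
    by (intro exI[of _ "?e k"]) auto
qed

lemma weight_const_finite:
  assumes f: "f \<in> Cc G" shows "weight (cls (\<lambda>n. f)) < \<infinity>"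
proof -
  have "weight (cls (\<lambda>n. f)) \<le> (\<integral>\<^sup>+u. ennreal (norm (f (unit G u))) \<partial>M)"
    unfolding weight_def coef_const[OF f] by (intro nn_integral_mono ennreal_leI complex_Re_le_cmod)
  also have "\<dots> < \<infinity>" using Cc_unit_integrable[OF f] by (simp add: integrable_iff_bounded)
  finally show ?thesis .
qed

text \<open>The approximant is the product of one term \<open>b n\<close> with its adjoint. It is
  positive by its form, and has finite weight because it is a compactly supported function.\<close>

lemma densely_defined_weight_weight: "densely_defined_weight (full_cstar G) weight"
  unfolding densely_defined_weight_def
proof (intro ballI allI impI)
  fix A and e :: real assume A: "A \<in> pos_cone (full_cstar G)" and "0 < e"
  then obtain b where b: "b \<in> Cc_cauchy G" "A = cls (\<lambda>n. conv G (invol G (b n)) (b n))"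
    by (auto simp: pos_cone_cls)
  let ?a = "\<lambda>n. conv G (invol G (b n)) (b n)"
  have a: "?a \<in> Cc_cauchy G" by (rule cauchy_conv[OF cauchy_invol[OF b(1)] b(1)])
  have "0 < e / 2" using \<open>0 < e\<close> by simp
  then obtain n where "\<forall>m\<ge>n. \<forall>k\<ge>n. full_norm G (\<lambda>\<gamma>. ?a m \<gamma> - ?a k \<gamma>) < e / 2"
    using a unfolding Cc_cauchy_def by blast
  then have n: "\<forall>m\<ge>n. full_norm G (\<lambda>\<gamma>. ?a m \<gamma> - ?a n \<gamma>) < e / 2" by simp
  let ?B = "cls (\<lambda>_. ?a n)"
  have "?B \<in> pos_cone (full_cstar G)"
    unfolding pos_cone_cls using cauchy_const[OF cauchyD[OF b(1)], of n] by (auto intro!: exI[of _ "\<lambda>_. b n"])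
  moreover have "weight ?B < \<infinity>" by (rule weight_const_finite[OF cauchyD[OF a]])
  moreover have "s_dist (full_cstar G) A ?B \<le> e / 2"
    unfolding b(2)
    by (rule LIMSEQ_le_const2[OF s_dist_cls[OF a cauchy_const[OF cauchyD[OF a]]]])
       (use n in \<open>auto intro!: exI[of _ n] less_imp_le\<close>)
  ultimately show "\<exists>B\<in>pos_cone (full_cstar G). weight B < \<infinity> \<and> s_dist (full_cstar G) A B < e"
    using \<open>0 < e\<close> by (intro bexI[of _ ?B]) auto
qed

text \<open>Positivity of the class of \<open>f\<close> forces \<open>f\<close> to be real and
  nonnegative at the units, where the coefficient of the class is \<open>f\<close> itself. Hence the
  extended nonnegative integral and the complex one agree.\<close>

lemma extends_integral_weight: "extends_integral G M weight"
  unfolding extends_integral_def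
proof (intro ballI impI conjI)
  fix f assume f: "f \<in> Cc G" and pos: "Cc_embed G f \<in> pos_cone (full_cstar G)"
  show int: "integrable M (\<lambda>u. f (unit G u))" by (rule Cc_unit_integrable[OF f])
  show "weight (Cc_embed G f) < \<infinity>" using weight_const_finite[OF f] by (simp add: Cc_embed_def)
  have nn: "0 \<le> Re (f (unit G u))" "f (unit G u) = complex_of_real (Re (f (unit G u)))" if "u \<in> space M" for u
    using pos_coef_nonneg[OF pos that] by (simp_all add: Cc_embed_def coef_const[OF f] complex_eq_iff)
  have "enn2real (weight (Cc_embed G f)) = (\<integral>u. Re (f (unit G u)) \<partial>M)"
    unfolding weight_def Cc_embed_def coef_const[OF f]
    by (rule integral_eq_nn_integral[symmetric]) (use int nn(1) in auto)
  then have "complex_of_real (enn2real (weight (Cc_embed G f))) = (\<integral>u. complex_of_real (Re (f (unit G u))) \<partial>M)"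
    by simp
  also have "\<dots> = (\<integral>u. f (unit G u) \<partial>M)"
    by (rule Bochner_Integration.integral_cong) (use nn(2) in auto)
  finally show "complex_of_real (enn2real (weight (Cc_embed G f))) = (\<integral>u. f (unit G u) \<partial>M)" .
qed

end

section \<open>Isomorphic groupoids\<close>

text \<open>Both groupoids share their unit space, and \<open>\<Phi>\<close> preserves ranges and
  sources exactly. The fibres over each unit then correspond, and with them the sums in the I-norm.
  The groupoid laws are asked of \<open>G\<close> only; \<open>flip\<close> carries them
  over.\<close>

locale groupoid_transport =
  fixes G :: "('g, 'u) top_groupoid" and H :: "('h, 'u) top_groupoid"
    and \<Phi> :: "'g \<Rightarrow> 'h" and \<Psi> :: "'h \<Rightarrow> 'g"
  assumes topspace_G: "topspace (arrow_top G) = arrows G"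
    and topspace_H: "topspace (arrow_top H) = arrows H"
    and homeo: "homeomorphic_maps (arrow_top G) (arrow_top H) \<Phi> \<Psi>"
    and units_eq: "unit_top G = unit_top H"
    and rng_\<Phi>: "\<gamma> \<in> arrows G \<Longrightarrow> rng H (\<Phi> \<gamma>) = rng G \<gamma>"
    and src_\<Phi>: "\<gamma> \<in> arrows G \<Longrightarrow> src H (\<Phi> \<gamma>) = src G \<gamma>"
    and mult_G: "\<alpha> \<in> arrows G \<Longrightarrow> \<beta> \<in> arrows G \<Longrightarrow> src G \<alpha> = rng G \<beta> \<Longrightarrow> gmult G \<alpha> \<beta> \<in> arrows G"
    and \<Phi>_mult: "\<alpha> \<in> arrows G \<Longrightarrow> \<beta> \<in> arrows G \<Longrightarrow> src G \<alpha> = rng G \<beta> \<Longrightarrow>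
      \<Phi> (gmult G \<alpha> \<beta>) = gmult H (\<Phi> \<alpha>) (\<Phi> \<beta>)"
    and inv_G: "\<gamma> \<in> arrows G \<Longrightarrow> ginv G \<gamma> \<in> arrows G"
    and \<Phi>_inv: "\<gamma> \<in> arrows G \<Longrightarrow> \<Phi> (ginv G \<gamma>) = ginv H (\<Phi> \<gamma>)"
begin

lemma \<Phi>_in: "\<gamma> \<in> arrows G \<Longrightarrow> \<Phi> \<gamma> \<in> arrows H"
  using homeo topspace_G topspace_H by (auto simp: homeomorphic_maps_def continuous_map_def Pi_iff)

lemma \<Psi>_in: "\<eta> \<in> arrows H \<Longrightarrow> \<Psi> \<eta> \<in> arrows G"
  using homeo topspace_G topspace_H by (auto simp: homeomorphic_maps_def continuous_map_def Pi_iff)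

lemma \<Psi>_\<Phi>: "\<gamma> \<in> arrows G \<Longrightarrow> \<Psi> (\<Phi> \<gamma>) = \<gamma>"
  using homeo topspace_G by (auto simp: homeomorphic_maps_def)

lemma \<Phi>_\<Psi>: "\<eta> \<in> arrows H \<Longrightarrow> \<Phi> (\<Psi> \<eta>) = \<eta>"
  using homeo topspace_H by (auto simp: homeomorphic_maps_def)

lemma flip: "groupoid_transport H G \<Psi> \<Phi>"
proof
  fix \<eta> assume \<eta>: "\<eta> \<in> arrows H"
  show "rng G (\<Psi> \<eta>) = rng H \<eta>" using rng_\<Phi>[OF \<Psi>_in[OF \<eta>]] by (simp add: \<Phi>_\<Psi> \<eta>)
  show "src G (\<Psi> \<eta>) = src H \<eta>" using src_\<Phi>[OF \<Psi>_in[OF \<eta>]] by (simp add: \<Phi>_\<Psi> \<eta>)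
  have *: "\<Phi> (ginv G (\<Psi> \<eta>)) = ginv H \<eta>" using \<Phi>_inv[OF \<Psi>_in[OF \<eta>]] by (simp add: \<Phi>_\<Psi> \<eta>)
  show "ginv H \<eta> \<in> arrows H" using \<Phi>_in[OF inv_G[OF \<Psi>_in[OF \<eta>]]] * by simp
  show "\<Psi> (ginv H \<eta>) = ginv G (\<Psi> \<eta>)" using \<Psi>_\<Phi>[OF inv_G[OF \<Psi>_in[OF \<eta>]]] * by simp
next
  fix \<alpha> \<beta> assume h: "\<alpha> \<in> arrows H" "\<beta> \<in> arrows H" "src H \<alpha> = rng H \<beta>"
  have c: "src G (\<Psi> \<alpha>) = rng G (\<Psi> \<beta>)"
    using h src_\<Phi>[OF \<Psi>_in[OF h(1)]] rng_\<Phi>[OF \<Psi>_in[OF h(2)]] by (simp add: \<Phi>_\<Psi>)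
  note m = mult_G[OF \<Psi>_in[OF h(1)] \<Psi>_in[OF h(2)] c]
  have *: "\<Phi> (gmult G (\<Psi> \<alpha>) (\<Psi> \<beta>)) = gmult H \<alpha> \<beta>"
    using \<Phi>_mult[OF \<Psi>_in[OF h(1)] \<Psi>_in[OF h(2)] c] h by (simp add: \<Phi>_\<Psi>)
  show "gmult H \<alpha> \<beta> \<in> arrows H" using \<Phi>_in[OF m] * by simp
  show "\<Psi> (gmult H \<alpha> \<beta>) = gmult G (\<Psi> \<alpha>) (\<Psi> \<beta>)" using \<Psi>_\<Phi>[OF m] * by simp
qed (simp_all add: topspace_G topspace_H units_eq homeomorphic_maps_sym[THEN iffD1, OF homeo])

section \<open>Pullback of functions and of representations\<close>

definition pullback :: "('h \<Rightarrow> complex) \<Rightarrow> 'g \<Rightarrow> complex" where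
  "pullback f \<gamma> = (if \<gamma> \<in> arrows G then f (\<Phi> \<gamma>) else 0)"

lemma pullback_lin: "pullback (\<lambda>\<gamma>. a * f \<gamma> + b * g \<gamma>) = (\<lambda>\<gamma>. a * pullback f \<gamma> + b * pullback g \<gamma>)"
  by (auto simp: pullback_def)

lemma pullback_Cc:
  assumes f: "f \<in> Cc H" shows "pullback f \<in> Cc G"
proof -
  let ?S = "{\<eta>\<in>arrows H. f \<eta> \<noteq> 0}" and ?R = "{\<gamma>\<in>arrows G. pullback f \<gamma> \<noteq> 0}"
  have cont: "continuous_map (arrow_top G) (arrow_top H) \<Phi>" "continuous_map (arrow_top H) (arrow_top G) \<Psi>"
    using homeo by (auto simp: homeomorphic_maps_def)
  have "continuous_map (arrow_top H) euclidean f" using f by (simp add: Cc_def)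
  from continuous_map_compose[OF cont(1) this] have "continuous_map (arrow_top G) euclidean (pullback f)"
    by (rule continuous_map_eq) (simp add: pullback_def topspace_G)
  moreover have "arrow_top G closure_of ?R = \<Psi> ` (arrow_top H closure_of ?S)"
  proof -
    have "?R = \<Psi> ` ?S"
    proof (intro equalityI subsetI)
      fix \<gamma> assume "\<gamma> \<in> ?R"
      then show "\<gamma> \<in> \<Psi> ` ?S" by (intro image_eqI[where x = "\<Phi> \<gamma>"]) (auto simp: pullback_def \<Phi>_in \<Psi>_\<Phi>)
    next
      fix \<gamma> assume "\<gamma> \<in> \<Psi> ` ?S"
      then show "\<gamma> \<in> ?R" by (auto simp: pullback_def \<Psi>_in \<Phi>_\<Psi>)
    qed
    moreover have "homeomorphic_map (arrow_top H) (arrow_top G) \<Psi>"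
      using homeomorphic_maps_sym[THEN iffD1, OF homeo] unfolding homeomorphic_map_maps by blast
    ultimately show ?thesis
      using homeomorphic_map_closure_of[of "arrow_top H" "arrow_top G" \<Psi> ?S] by (auto simp: topspace_H)
  qed
  moreover have "compactin (arrow_top G) (\<Psi> ` (arrow_top H closure_of ?S))"
    by (rule image_compactin[OF _ cont(2)]) (use f in \<open>simp add: Cc_def\<close>)
  ultimately show ?thesis by (simp add: Cc_def pullback_def)
qed

lemma pullback_conv: "pullback (conv H f g) = conv G (pullback f) (pullback g)"
proof
  fix \<gamma>
  let ?P = "{(\<alpha>, \<beta>). \<alpha> \<in> arrows G \<and> \<beta> \<in> arrows G \<and> src G \<alpha> = rng G \<beta> \<and> gmult G \<alpha> \<beta> = \<gamma>}"
  let ?Q = "{(\<alpha>, \<beta>). \<alpha> \<in> arrows H \<and> \<beta> \<in> arrows H \<and> src H \<alpha> = rng H \<beta> \<and> gmult H \<alpha> \<beta> = \<Phi> \<gamma>}"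
  interpret flip: groupoid_transport H G \<Psi> \<Phi> by (rule flip)
  show "pullback (conv H f g) \<gamma> = conv G (pullback f) (pullback g) \<gamma>"
  proof (cases "\<gamma> \<in> arrows G")
    case True
    have bij: "bij_betw (\<lambda>(\<alpha>, \<beta>). (\<Phi> \<alpha>, \<Phi> \<beta>)) ?P ?Q"
    proof (rule bij_betw_byWitness[where f' = "\<lambda>(\<alpha>, \<beta>). (\<Psi> \<alpha>, \<Psi> \<beta>)"])
      show "(\<lambda>(\<alpha>, \<beta>). (\<Phi> \<alpha>, \<Phi> \<beta>)) ` ?P \<subseteq> ?Q"
        by (auto simp: \<Phi>_in src_\<Phi> rng_\<Phi> \<Phi>_mult)
      show "(\<lambda>(\<alpha>, \<beta>). (\<Psi> \<alpha>, \<Psi> \<beta>)) ` ?Q \<subseteq> ?P"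
        using True by (auto simp: \<Psi>_in flip.src_\<Phi> flip.rng_\<Phi> flip.\<Phi>_mult[symmetric] \<Psi>_\<Phi>)
    qed (auto simp: \<Psi>_\<Phi> \<Phi>_\<Psi>)
    have "conv G (pullback f) (pullback g) \<gamma> = (\<Sum>\<^sub>\<infinity>p\<in>?P. (\<lambda>(\<alpha>, \<beta>). f \<alpha> * g \<beta>) ((\<lambda>(\<alpha>, \<beta>). (\<Phi> \<alpha>, \<Phi> \<beta>)) p))"
      unfolding conv_def by (rule infsum_cong) (auto simp: pullback_def)
    also have "\<dots> = conv H f g (\<Phi> \<gamma>)"
      unfolding conv_def by (rule infsum_reindex_bij_betw[OF bij])
    finally show ?thesis using True by (simp add: pullback_def)
  next
    case False
    then have e: "?P = {}" using mult_G by auto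
    show ?thesis unfolding conv_def e using False by (simp add: pullback_def)
  qed
qed

lemma pullback_invol: "pullback (invol H f) = invol G (pullback f)"
  by (auto simp: fun_eq_iff pullback_def invol_def \<Phi>_in inv_G \<Phi>_inv)

lemma pullback_I_norm: "I_norm G (pullback f) = I_norm H f"
proof -
  have "(\<Sum>\<^sub>\<infinity>\<gamma>\<in>{\<gamma>\<in>arrows G. p \<gamma> = u}. cmod (pullback f \<gamma>)) = (\<Sum>\<^sub>\<infinity>\<eta>\<in>{\<eta>\<in>arrows H. q \<eta> = u}. cmod (f \<eta>))"
    if pq: "\<And>\<gamma>. \<gamma> \<in> arrows G \<Longrightarrow> q (\<Phi> \<gamma>) = p \<gamma>" for p :: "'g \<Rightarrow> 'u" and q u
  proof -
    have "q \<eta> = p (\<Psi> \<eta>)" if "\<eta> \<in> arrows H" for \<eta>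
      using pq[OF \<Psi>_in[OF that]] by (simp add: \<Phi>_\<Psi> that)
    then have bij: "bij_betw \<Phi> {\<gamma>\<in>arrows G. p \<gamma> = u} {\<eta>\<in>arrows H. q \<eta> = u}"
      by (intro bij_betw_byWitness[where f' = \<Psi>]) (auto simp: \<Phi>_in \<Psi>_in \<Psi>_\<Phi> \<Phi>_\<Psi> pq)
    have "(\<Sum>\<^sub>\<infinity>\<gamma>\<in>{\<gamma>\<in>arrows G. p \<gamma> = u}. cmod (pullback f \<gamma>)) = (\<Sum>\<^sub>\<infinity>\<gamma>\<in>{\<gamma>\<in>arrows G. p \<gamma> = u}. cmod (f (\<Phi> \<gamma>)))"
      by (rule infsum_cong) (auto simp: pullback_def)
    also have "\<dots> = (\<Sum>\<^sub>\<infinity>\<eta>\<in>{\<eta>\<in>arrows H. q \<eta> = u}. cmod (f \<eta>))" by (rule infsum_reindex_bij_betw[OF bij])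
    finally show ?thesis .
  qed
  from this[of "rng H" "rng G"] this[of "src H" "src G"] show ?thesis
    by (simp add: I_norm_def units_eq rng_\<Phi> src_\<Phi>)
qed

text \<open>A representation of \<open>Cc G\<close> composed with the pullback represents
  \<open>Cc H\<close>; the map \<open>\<kappa>\<close> moves its index set into the functions on the
  arrows of \<open>H\<close>. The opposite inclusion is the same lemma for the flipped
  situation.\<close>

lemma rep_norms_pullback:
  fixes \<kappa> :: "('g \<Rightarrow> complex) \<Rightarrow> 'h \<Rightarrow> complex"
  assumes "inj \<kappa>" and f: "f \<in> Cc H"
  shows "rep_norms G (pullback f) \<subseteq> rep_norms H f"
proof
  fix y assume "y \<in> rep_norms G (pullback f)"
  then obtain J \<pi> where y: "y = op_norm J (\<pi> (pullback f))" and r: "bounded_rep G (J :: ('g \<Rightarrow> complex) set) \<pi>"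
    by (auto simp: rep_norms_def)
  obtain \<pi>' where \<pi>': "bounded_rep H (\<kappa> ` J) \<pi>'" "\<And>f. f \<in> Cc H \<Longrightarrow> op_norm (\<kappa> ` J) (\<pi>' f) = op_norm J (\<pi> (pullback f))"
    by (rule bounded_rep_transport[OF r inj_on_subset[OF assms(1) subset_UNIV], where H = H and S = pullback])
       (auto intro: pullback_Cc pullback_lin pullback_conv pullback_invol pullback_I_norm)
  have "y = op_norm (\<kappa> ` J) (\<pi>' f)" using y \<pi>'(2)[OF f] by simp
  with \<pi>'(1) show "y \<in> rep_norms H f"
    unfolding rep_norms_def by (intro CollectI exI[of _ "\<kappa> ` J"] exI[of _ \<pi>'] conjI)
qed

end

text \<open>Precomposition with a left inverse of \<open>e\<close> is injective because that left
  inverse is surjective.\<close>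

lemma inj_function_space:
  fixes e :: "'a \<Rightarrow> 'b" assumes "inj e"
  shows "\<exists>\<kappa> :: ('a \<Rightarrow> 'c) \<Rightarrow> 'b \<Rightarrow> 'c. inj \<kappa>"
proof
  have "surj (inv e)" by (rule inj_imp_surj_inv[OF assms])
  then show "inj (\<lambda>f :: 'a \<Rightarrow> 'c. f \<circ> inv e)"
    by (intro injI) (metis surj_fun_eq)
qed

context groupoid_transport
begin

text \<open>Pulling back along the inverse map acts term by term on Cauchy sequences and preserves
  the full norm, so it maps equivalence classes onto equivalence classes. The injections in both
  directions are what makes the two full norms equal. Only \<open>G\<close> is assumed to be ample;
  what is needed about \<open>H\<close> is carried over from there.\<close>

lemma star_iso_full_cstar:
  fixes e :: "'g \<Rightarrow> 'h" and e' :: "'h \<Rightarrow> 'g"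
  assumes e: "inj e" "inj e'" and amp: "ample_groupoid G"
  shows "\<exists>\<Theta>. star_iso (full_cstar G) (full_cstar H) \<Theta>"
proof -
  interpret G: ample_groupoid G by fact
  interpret flip: groupoid_transport H G \<Psi> \<Phi> by (rule flip)
  define S where "S = pullback"
  define T where "T = flip.pullback"
  obtain \<kappa> :: "('g \<Rightarrow> complex) \<Rightarrow> 'h \<Rightarrow> complex" where \<kappa>: "inj \<kappa>"
    using inj_function_space[OF e(1), where 'c = complex] by blast
  obtain \<kappa>' :: "('h \<Rightarrow> complex) \<Rightarrow> 'g \<Rightarrow> complex" where \<kappa>': "inj \<kappa>'"
    using inj_function_space[OF e(2), where 'c = complex] by blast
  have ST: "S (T f) = f" if "f \<in> Cc G" for f
    using that by (auto simp: S_def T_def pullback_def flip.pullback_def fun_eq_iff \<Phi>_in \<Psi>_\<Phi> Cc_def)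
  have TS: "T (S f) = f" if "f \<in> Cc H" for f
    using that by (auto simp: S_def T_def pullback_def flip.pullback_def fun_eq_iff \<Psi>_in \<Phi>_\<Psi> Cc_def)
  have S_Cc: "S f \<in> Cc G" if "f \<in> Cc H" for f using pullback_Cc[OF that] by (simp add: S_def)
  have T_Cc: "T f \<in> Cc H" if "f \<in> Cc G" for f using flip.pullback_Cc[OF that] by (simp add: T_def)
  have T_lin: "T (\<lambda>\<gamma>. a * f \<gamma> + b * g \<gamma>) = (\<lambda>\<gamma>. a * T f \<gamma> + b * T g \<gamma>)" for a b f g
    using flip.pullback_lin by (simp add: T_def)
  have S_lin: "S (\<lambda>\<gamma>. a * f \<gamma> + b * g \<gamma>) = (\<lambda>\<gamma>. a * S f \<gamma> + b * S g \<gamma>)" for a b f g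
    using pullback_lin by (simp add: S_def)
  have T_add: "T (\<lambda>\<gamma>. f \<gamma> + g \<gamma>) = (\<lambda>\<gamma>. T f \<gamma> + T g \<gamma>)" for f g using T_lin[of 1 f 1 g] by simp
  have T_diff: "T (\<lambda>\<gamma>. f \<gamma> - g \<gamma>) = (\<lambda>\<gamma>. T f \<gamma> - T g \<gamma>)" for f g using T_lin[of 1 f "-1" g] by simp
  have S_diff: "S (\<lambda>\<gamma>. f \<gamma> - g \<gamma>) = (\<lambda>\<gamma>. S f \<gamma> - S g \<gamma>)" for f g using S_lin[of 1 f "-1" g] by simp
  have T_scale: "T (\<lambda>\<gamma>. c * f \<gamma>) = (\<lambda>\<gamma>. c * T f \<gamma>)" for c f using T_lin[of c f 0 f] by simp
  have T_conv: "T (conv G f g) = conv H (T f) (T g)" for f g by (simp add: T_def flip.pullback_conv)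
  have T_invol: "T (invol G f) = invol H (T f)" for f by (simp add: T_def flip.pullback_invol)
  have T_norm: "full_norm H (T f) = full_norm G f" if f: "f \<in> Cc G" for f
  proof -
    have "rep_norms H (T f) \<subseteq> rep_norms G f"
      using flip.rep_norms_pullback[OF \<kappa>' f] by (simp add: T_def)
    moreover have "rep_norms G f \<subseteq> rep_norms H (T f)"
      using rep_norms_pullback[OF \<kappa> T_Cc[OF f]] ST[OF f] by (simp add: S_def)
    ultimately show ?thesis by (simp add: full_norm_eq_Sup)
  qed
  have H_diff: "full_norm H (\<lambda>\<gamma>. T f \<gamma> - T g \<gamma>) = full_norm G (\<lambda>\<gamma>. f \<gamma> - g \<gamma>)" if "f \<in> Cc G" "g \<in> Cc G" for f g
    using T_norm[OF G.Cc_diff[OF that]] by (simp add: T_diff)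
  define T' where "T' s = (\<lambda>n::nat. T (s n))" for s
  define S' where "S' s = (\<lambda>n::nat. S (s n))" for s
  have S'T': "S' (T' s) = s" if "s \<in> Cc_cauchy G" for s
    using that by (simp add: S'_def T'_def fun_eq_iff ST G.cauchyD)
  have T'S': "T' (S' s) = s" if "s \<in> Cc_cauchy H" for s
    using that by (simp add: S'_def T'_def fun_eq_iff TS Cc_cauchy_def)
  have T'_cauchy: "T' s \<in> Cc_cauchy H" if "s \<in> Cc_cauchy G" for s
    using that by (simp add: T'_def Cc_cauchy_def T_Cc H_diff)
  have S'_cauchy: "S' s \<in> Cc_cauchy G" if s: "s \<in> Cc_cauchy H" for s
  proof -
    have Cc: "S (s n) \<in> Cc G" "T (S (s n)) = s n" for n using s by (simp_all add: Cc_cauchy_def S_Cc TS)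
    have "full_norm G (\<lambda>\<gamma>. S (s m) \<gamma> - S (s n) \<gamma>) = full_norm H (\<lambda>\<gamma>. s m \<gamma> - s n \<gamma>)" for m n
      using H_diff[OF Cc(1)[of m] Cc(1)[of n]] by (simp add: Cc(2))
    then show ?thesis using s by (simp add: S'_def Cc_cauchy_def S_Cc)
  qed
  have equiv_iff: "(T' s, T' s') \<in> Cc_equiv H \<longleftrightarrow> (s, s') \<in> Cc_equiv G" if "s \<in> Cc_cauchy G" "s' \<in> Cc_cauchy G" for s s'
    using that T'_cauchy[OF that(1)] T'_cauchy[OF that(2)]
    by (simp add: Cc_equiv_def) (simp add: T'_def H_diff G.cauchyD)
  define \<Theta> where "\<Theta> A = T' ` A" for A
  have T'_cls: "T' ` (Cc_equiv G `` {s}) = Cc_equiv H `` {T' s}" if s: "s \<in> Cc_cauchy G" for s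
  proof (intro equalityI subsetI)
    fix t assume "t \<in> T' ` (Cc_equiv G `` {s})"
    then obtain s' where "(s, s') \<in> Cc_equiv G" "t = T' s'" by auto
    then show "t \<in> Cc_equiv H `` {T' s}" using equiv_iff[OF s G.equivD(2)] by auto
  next
    fix t assume "t \<in> Cc_equiv H `` {T' s}"
    then have t: "(T' s, t) \<in> Cc_equiv H" "t \<in> Cc_cauchy H" by (auto simp: Cc_equiv_def)
    then have "(s, S' t) \<in> Cc_equiv G" using equiv_iff[OF s S'_cauchy[OF t(2)]] by (simp add: T'S')
    then show "t \<in> T' ` (Cc_equiv G `` {s})" using T'S'[OF t(2)] by (intro image_eqI[where x = "S' t"]) auto
  qed
  have \<Theta>_cls: "\<Theta> (G.cls s) = Cc_equiv H `` {T' s}" if "s \<in> Cc_cauchy G" for s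
    using T'_cls[OF that] by (simp add: \<Theta>_def)
  have cls_sub: "G.cls s \<subseteq> Cc_cauchy G" for s by (auto dest: G.equivD)
  have "bij_betw \<Theta> (elems (full_cstar G)) (elems (full_cstar H))"
  proof (rule bij_betw_byWitness[where f' = "image S'"])
    show "\<forall>A\<in>elems (full_cstar G). S' ` \<Theta> A = A"
    proof
      fix A assume "A \<in> elems (full_cstar G)"
      then have "A \<subseteq> Cc_cauchy G" using cls_sub by (auto simp: G.elems_full_cstar)
      then have "S' (T' a) = a" if "a \<in> A" for a using S'T' that by blast
      then show "S' ` \<Theta> A = A" by (simp add: \<Theta>_def image_image)
    qed
    show "\<forall>B\<in>elems (full_cstar H). \<Theta> (S' ` B) = B"
    proof
      fix B assume "B \<in> elems (full_cstar H)"
      then have "B \<subseteq> Cc_cauchy H" by (auto simp: full_cstar_def quotient_def Cc_equiv_def)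
      then have "T' (S' b) = b" if "b \<in> B" for b using T'S' that by blast
      then show "\<Theta> (S' ` B) = B" by (simp add: \<Theta>_def image_image)
    qed
    show "\<Theta> ` elems (full_cstar G) \<subseteq> elems (full_cstar H)"
      using \<Theta>_cls T'_cauchy by (auto simp: G.elems_full_cstar full_cstar_def quotient_def)
    show "image S' ` elems (full_cstar H) \<subseteq> elems (full_cstar G)"
    proof
      fix A assume "A \<in> image S' ` elems (full_cstar H)"
      then obtain t where t: "t \<in> Cc_cauchy H" "A = S' ` (Cc_equiv H `` {t})"
        by (auto simp: full_cstar_def quotient_def)
      have "A = S' ` T' ` G.cls (S' t)"
        unfolding t(2) T'_cls[OF S'_cauchy[OF t(1)]] T'S'[OF t(1)] ..
      also have "\<dots> = G.cls (S' t)"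
      proof -
        have "S' (T' a) = a" if "a \<in> G.cls (S' t)" for a using S'T' cls_sub that by blast
        then show ?thesis by (simp add: image_image)
      qed
      finally show "A \<in> elems (full_cstar G)" using S'_cauchy[OF t(1)] by (auto simp: G.elems_full_cstar)
    qed
  qed
  moreover have "\<Theta> (s_add (full_cstar G) A B) = s_add (full_cstar H) (\<Theta> A) (\<Theta> B) \<and>
      \<Theta> (s_mult (full_cstar G) A B) = s_mult (full_cstar H) (\<Theta> A) (\<Theta> B)"
    if "A \<in> elems (full_cstar G)" "B \<in> elems (full_cstar G)" for A B
  proof -
    have sub: "A \<subseteq> Cc_cauchy G" "B \<subseteq> Cc_cauchy G" using that cls_sub by (auto simp: G.elems_full_cstar)
    have 1: "T' ` G.cls (\<lambda>n \<gamma>. a n \<gamma> + b n \<gamma>) = Cc_equiv H `` {\<lambda>n \<gamma>. T' a n \<gamma> + T' b n \<gamma>}"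
      and 2: "T' ` G.cls (\<lambda>n. conv G (a n) (b n)) = Cc_equiv H `` {\<lambda>n. conv H (T' a n) (T' b n)}"
      if "a \<in> A" "b \<in> B" for a b
    proof -
      have c: "a \<in> Cc_cauchy G" "b \<in> Cc_cauchy G" using sub that by auto
      have "(\<lambda>n \<gamma>. a n \<gamma> + b n \<gamma>) \<in> Cc_cauchy G" using G.cauchy_lincomb[OF c, of 1 1] by simp
      from T'_cls[OF this] show "T' ` G.cls (\<lambda>n \<gamma>. a n \<gamma> + b n \<gamma>) = Cc_equiv H `` {\<lambda>n \<gamma>. T' a n \<gamma> + T' b n \<gamma>}"
        by (simp add: T'_def T_add)
      from T'_cls[OF G.cauchy_conv[OF c]]
      show "T' ` G.cls (\<lambda>n. conv G (a n) (b n)) = Cc_equiv H `` {\<lambda>n. conv H (T' a n) (T' b n)}"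
        by (simp add: T'_def T_conv)
    qed
    have "\<Theta> (s_add (full_cstar G) A B) = (\<Union>a\<in>A. \<Union>b\<in>B. T' ` G.cls (\<lambda>n \<gamma>. a n \<gamma> + b n \<gamma>))"
      unfolding \<Theta>_def full_cstar_def by (simp add: image_UN)
    moreover have "\<Theta> (s_mult (full_cstar G) A B) = (\<Union>a\<in>A. \<Union>b\<in>B. T' ` G.cls (\<lambda>n. conv G (a n) (b n)))"
      unfolding \<Theta>_def full_cstar_def by (simp add: image_UN)
    ultimately show ?thesis
      unfolding full_cstar_def[of H] using 1 2 by (simp add: \<Theta>_def)
  qed
  moreover have "\<Theta> (s_scale (full_cstar G) c A) = s_scale (full_cstar H) c (\<Theta> A)"
    if "A \<in> elems (full_cstar G)" for c A
  proof -
    have sub: "A \<subseteq> Cc_cauchy G" using that cls_sub by (auto simp: G.elems_full_cstar)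
    have 1: "T' ` G.cls (\<lambda>n \<gamma>. c * a n \<gamma>) = Cc_equiv H `` {\<lambda>n \<gamma>. c * T' a n \<gamma>}" if "a \<in> A" for a
    proof -
      have a: "a \<in> Cc_cauchy G" using sub that by auto
      have "(\<lambda>n \<gamma>. c * a n \<gamma>) \<in> Cc_cauchy G" using G.cauchy_lincomb[OF a a, of c 0] by simp
      from T'_cls[OF this] show ?thesis by (simp add: T'_def T_scale)
    qed
    have "\<Theta> (s_scale (full_cstar G) c A) = (\<Union>a\<in>A. T' ` G.cls (\<lambda>n \<gamma>. c * a n \<gamma>))"
      unfolding \<Theta>_def full_cstar_def by (simp add: image_UN)
    then show ?thesis unfolding full_cstar_def[of H] using 1 by (simp add: \<Theta>_def)
  qed
  moreover have "\<Theta> (s_star (full_cstar G) A) = s_star (full_cstar H) (\<Theta> A) \<and>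
      s_norm (full_cstar H) (\<Theta> A) = s_norm (full_cstar G) A"
    if "A \<in> elems (full_cstar G)" for A
  proof
    have sub: "A \<subseteq> Cc_cauchy G" using that cls_sub by (auto simp: G.elems_full_cstar)
    have 1: "T' ` G.cls (\<lambda>n. invol G (a n)) = Cc_equiv H `` {\<lambda>n. invol H (T' a n)}" if "a \<in> A" for a
    proof -
      have a: "a \<in> Cc_cauchy G" using sub that by auto
      from T'_cls[OF G.cauchy_invol[OF a]] show ?thesis by (simp add: T'_def T_invol)
    qed
    have "\<Theta> (s_star (full_cstar G) A) = (\<Union>a\<in>A. T' ` G.cls (\<lambda>n. invol G (a n)))"
      unfolding \<Theta>_def full_cstar_def by (simp add: image_UN)
    then show "\<Theta> (s_star (full_cstar G) A) = s_star (full_cstar H) (\<Theta> A)"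
      unfolding full_cstar_def[of H] using 1 by (simp add: \<Theta>_def)
    have "(\<lambda>n. full_norm H (T' a n)) = (\<lambda>n. full_norm G (a n))" if "a \<in> A" for a
    proof -
      have a: "a \<in> Cc_cauchy G" using sub that by auto
      show ?thesis using T_norm[OF G.cauchyD[OF a]] by (simp add: T'_def)
    qed
    then show "s_norm (full_cstar H) (\<Theta> A) = s_norm (full_cstar G) A"
      by (simp add: full_cstar_def \<Theta>_def)
  qed
  ultimately have "star_iso (full_cstar G) (full_cstar H) \<Theta>"
    unfolding star_iso_def by blast
  then show ?thesis by blast
qed

end

section \<open>Renault--Deaconu groupoids of local homeomorphisms\<close>

lemma continuous_mapI_nbhd:
  assumes "\<And>x. x \<in> topspace X \<Longrightarrow> f x \<in> topspace Y"
    and "\<And>x \<Omega>. x \<in> topspace X \<Longrightarrow> openin Y \<Omega> \<Longrightarrow> f x \<in> \<Omega> \<Longrightarrow> \<exists>T. openin X T \<and> x \<in> T \<and> f ` T \<subseteq> \<Omega>"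
  shows "continuous_map X Y f"
  unfolding continuous_map_def
proof (intro conjI allI impI)
  fix \<Omega> assume \<Omega>: "openin Y \<Omega>"
  show "openin X {x \<in> topspace X. f x \<in> \<Omega>}"
  proof (subst openin_subopen, intro ballI)
    fix x assume "x \<in> {x \<in> topspace X. f x \<in> \<Omega>}"
    then obtain T where T: "openin X T" "x \<in> T" "f ` T \<subseteq> \<Omega>" using assms(2)[OF _ \<Omega>] by blast
    then show "\<exists>T. openin X T \<and> x \<in> T \<and> T \<subseteq> {x \<in> topspace X. f x \<in> \<Omega>}"
      using openin_subset[OF T(1)] by blast
  qed
qed (use assms(1) in blast)

text \<open>Instantiated twice, with the shift on sequences and with the shift on the bundle, so
  that the groupoid of the base and that of the bundle share one development. The base of clopen
  sets is the source of the clopen bisections.\<close>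

locale local_homeo_zero_dim =
  fixes Y :: "'y topology" and \<tau> :: "'y \<Rightarrow> 'y"
  assumes Hausdorff: "Hausdorff_space Y"
    and nonempty: "topspace Y \<noteq> {}"
    and continuous: "continuous_map Y Y \<tau>"
    and open_map: "open_map Y Y \<tau>"
    and locally_inj: "x \<in> topspace Y \<Longrightarrow> \<exists>U. openin Y U \<and> x \<in> U \<and> inj_on \<tau> U"
    and clopen_base: "openin Y U \<Longrightarrow> x \<in> U \<Longrightarrow> \<exists>V. openin Y V \<and> closedin Y V \<and> x \<in> V \<and> V \<subseteq> U"
begin

abbreviation GY :: "('y \<times> int \<times> 'y, 'y) top_groupoid" where "GY \<equiv> renault_deaconu Y \<tau>"

lemma continuous_pow: "continuous_map Y Y (\<tau> ^^ m)"
proof (induction m)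
  case (Suc m)
  from continuous_map_compose[OF Suc continuous] show ?case by (simp add: o_def)
qed simp

lemma open_map_pow: "open_map Y Y (\<tau> ^^ m)"
proof (induction m)
  case (Suc m)
  from open_map_compose[OF Suc open_map] show ?case by (simp add: o_def)
qed (simp add: open_map_def)

lemma pow_in: "x \<in> topspace Y \<Longrightarrow> (\<tau> ^^ m) x \<in> topspace Y"
  using continuous_pow[of m] by (auto simp: continuous_map_def)

lemma open_pow_image: "openin Y U \<Longrightarrow> openin Y ((\<tau> ^^ m) ` U)"
  using open_map_pow[of m] by (auto simp: open_map_def)

lemma open_pow_preimage: "openin Y W \<Longrightarrow> openin Y {x \<in> topspace Y. (\<tau> ^^ m) x \<in> W}"
  by (rule openin_continuous_map_preimage[OF continuous_pow])

lemma locally_inj_pow: "x \<in> topspace Y \<Longrightarrow> \<exists>U. openin Y U \<and> x \<in> U \<and> inj_on (\<tau> ^^ m) U"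
proof (induction m)
  case 0
  then show ?case by (auto intro!: exI[of _ "topspace Y"])
next
  case (Suc m)
  then obtain U where U: "openin Y U" "x \<in> U" "inj_on (\<tau> ^^ m) U" by auto
  obtain V where V: "openin Y V" "(\<tau> ^^ m) x \<in> V" "inj_on \<tau> V"
    using locally_inj[OF pow_in[OF Suc.prems]] by blast
  let ?W = "U \<inter> {x \<in> topspace Y. (\<tau> ^^ m) x \<in> V}"
  have "inj_on (\<tau> ^^ Suc m) ?W"
  proof (rule inj_onI)
    fix a b assume ab: "a \<in> ?W" "b \<in> ?W" "(\<tau> ^^ Suc m) a = (\<tau> ^^ Suc m) b"
    then have "(\<tau> ^^ m) a = (\<tau> ^^ m) b" using inj_onD[OF V(3), of "(\<tau> ^^ m) a" "(\<tau> ^^ m) b"] by auto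
    then show "a = b" using inj_onD[OF U(3)] ab by auto
  qed
  then show ?case using U V Suc.prems open_pow_preimage[OF V(1)] by (intro exI[of _ ?W]) (auto simp: o_def)
qed

lemma clopen_inj_pow:
  assumes "x \<in> topspace Y" shows "\<exists>U. openin Y U \<and> closedin Y U \<and> x \<in> U \<and> inj_on (\<tau> ^^ m) U"
proof -
  obtain U where U: "openin Y U" "x \<in> U" "inj_on (\<tau> ^^ m) U" using locally_inj_pow[OF assms] by blast
  obtain V where "openin Y V" "closedin Y V" "x \<in> V" "V \<subseteq> U" using clopen_base[OF U(1,2)] by blast
  then show ?thesis using inj_on_subset[OF U(3)] by blast
qed

text \<open>The basic sets of the Renault-Deaconu topology without the conditions on injectivity and
  equal images. They are more convenient to handle and are open whenever \<open>U\<close> and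
  \<open>V\<close> are.\<close>

definition Z :: "nat \<Rightarrow> nat \<Rightarrow> 'y set \<Rightarrow> 'y set \<Rightarrow> ('y \<times> int \<times> 'y) set" where
  "Z m n U V = {(x, int m - int n, y) | x y. (\<tau> ^^ m) x = (\<tau> ^^ n) y \<and> x \<in> U \<and> y \<in> V}"

lemma Z_iff: "(x, k, y) \<in> Z m n U V \<longleftrightarrow> k = int m - int n \<and> (\<tau> ^^ m) x = (\<tau> ^^ n) y \<and> x \<in> U \<and> y \<in> V"
  by (auto simp: Z_def)

lemma arrows_iff: "(x, k, y) \<in> arrows GY \<longleftrightarrow> x \<in> topspace Y \<and> y \<in> topspace Y \<and>
    (\<exists>m n. k = int m - int n \<and> (\<tau> ^^ m) x = (\<tau> ^^ n) y)"
  by (auto simp: renault_deaconu_def)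

lemma arrowsI: "(\<tau> ^^ m) x = (\<tau> ^^ n) y \<Longrightarrow> x \<in> topspace Y \<Longrightarrow> y \<in> topspace Y \<Longrightarrow> (x, int m - int n, y) \<in> arrows GY"
  unfolding arrows_iff by blast

lemma Z_subset: "U \<subseteq> topspace Y \<Longrightarrow> V \<subseteq> topspace Y \<Longrightarrow> Z m n U V \<subseteq> arrows GY"
  by (auto simp: Z_def intro!: arrowsI)

lemma GY_simps [simp]:
  "unit_top GY = Y" "rng GY = (\<lambda>(x, k, y). x)" "src GY = (\<lambda>(x, k, y). y)" "unit GY = (\<lambda>x. (x, 0, x))"
  "gmult GY = (\<lambda>(x, k, y) (y', l, w). (x, k + l, w))" "ginv GY = (\<lambda>(x, k, y). (y, - k, x))"
  by (simp_all add: renault_deaconu_def)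

definition basis :: "('y \<times> int \<times> 'y) set set" where
  "basis = {Z m n U V | m n U V. openin Y U \<and> openin Y V \<and> inj_on (\<tau> ^^ m) U \<and> inj_on (\<tau> ^^ n) V \<and>
    (\<tau> ^^ m) ` U = (\<tau> ^^ n) ` V}"

lemma arrow_top_eq: "arrow_top GY = topology_generated_by basis"
  by (simp add: renault_deaconu_def basis_def Z_def)

text \<open>Around a given arrow, \<open>U\<close> and \<open>V\<close> are shrunk first to sets on
  which the powers are injective, and then to the preimages of the intersection \<open>W\<close> of
  the two open images. The shrunken sets satisfy the conditions of \<open>basis\<close>.\<close>

lemma openin_Z:
  assumes U: "openin Y U" and V: "openin Y V" shows "openin (arrow_top GY) (Z m n U V)"
proof (subst openin_subopen, intro ballI)
  fix \<gamma> assume "\<gamma> \<in> Z m n U V"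
  then obtain x y where xy: "\<gamma> = (x, int m - int n, y)" "(\<tau> ^^ m) x = (\<tau> ^^ n) y" "x \<in> U" "y \<in> V"
    by (auto simp: Z_def)
  have in_Y: "x \<in> topspace Y" "y \<in> topspace Y" using xy openin_subset[OF U] openin_subset[OF V] by auto
  obtain U1 where U1: "openin Y U1" "x \<in> U1" "inj_on (\<tau> ^^ m) U1" using locally_inj_pow[OF in_Y(1)] by blast
  obtain V1 where V1: "openin Y V1" "y \<in> V1" "inj_on (\<tau> ^^ n) V1" using locally_inj_pow[OF in_Y(2)] by blast
  define W where "W = (\<tau> ^^ m) ` (U \<inter> U1) \<inter> (\<tau> ^^ n) ` (V \<inter> V1)"
  have W: "openin Y W" unfolding W_def by (intro openin_Int open_pow_image U V U1 V1)
  define U2 where "U2 = (U \<inter> U1) \<inter> {x \<in> topspace Y. (\<tau> ^^ m) x \<in> W}"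
  define V2 where "V2 = (V \<inter> V1) \<inter> {x \<in> topspace Y. (\<tau> ^^ n) x \<in> W}"
  have o: "openin Y U2" "openin Y V2" unfolding U2_def V2_def by (intro openin_Int open_pow_preimage U V U1 V1 W)+
  have i: "inj_on (\<tau> ^^ m) U2" "inj_on (\<tau> ^^ n) V2"
    using U1(3) V1(3) by (auto simp: U2_def V2_def intro: inj_on_subset)
  have "W \<subseteq> (\<tau> ^^ m) ` U2"
  proof
    fix w assume w: "w \<in> W"
    then obtain a where a: "a \<in> U \<inter> U1" "w = (\<tau> ^^ m) a" unfolding W_def by blast
    then have "a \<in> U2" using w openin_subset[OF U1(1)] by (auto simp: U2_def)
    then show "w \<in> (\<tau> ^^ m) ` U2" using a(2) by (rule rev_image_eqI)
  qed
  moreover have "W \<subseteq> (\<tau> ^^ n) ` V2"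
  proof
    fix w assume w: "w \<in> W"
    then obtain a where a: "a \<in> V \<inter> V1" "w = (\<tau> ^^ n) a" unfolding W_def by blast
    then have "a \<in> V2" using w openin_subset[OF V1(1)] by (auto simp: V2_def)
    then show "w \<in> (\<tau> ^^ n) ` V2" using a(2) by (rule rev_image_eqI)
  qed
  moreover have "(\<tau> ^^ m) ` U2 \<subseteq> W" "(\<tau> ^^ n) ` V2 \<subseteq> W" unfolding U2_def V2_def by blast+
  ultimately have "(\<tau> ^^ m) ` U2 = (\<tau> ^^ n) ` V2" by blast
  then have "Z m n U2 V2 \<in> basis"
    using o i unfolding basis_def by (intro CollectI exI[of _ m] exI[of _ n] exI[of _ U2] exI[of _ V2] conjI refl)
  then have "openin (arrow_top GY) (Z m n U2 V2)"
    unfolding arrow_top_eq by (rule topology_generated_by_Basis)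
  moreover have "(\<tau> ^^ m) x \<in> (\<tau> ^^ m) ` (U \<inter> U1)" "(\<tau> ^^ n) y \<in> (\<tau> ^^ n) ` (V \<inter> V1)"
    using xy(3,4) U1(2) V1(2) by blast+
  then have "(\<tau> ^^ m) x \<in> W" using xy(2) by (simp add: W_def)
  then have "\<gamma> \<in> Z m n U2 V2" using xy U1(2) V1(2) in_Y by (auto simp: Z_iff U2_def V2_def)
  moreover have "Z m n U2 V2 \<subseteq> Z m n U V" by (auto simp: Z_def U2_def V2_def)
  ultimately show "\<exists>T. openin (arrow_top GY) T \<and> \<gamma> \<in> T \<and> T \<subseteq> Z m n U V" by blast
qed

lemma topspace_GY: "topspace (arrow_top GY) = arrows GY"
proof
  have "X \<subseteq> arrows GY" if X: "X \<in> basis" for X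
  proof -
    obtain m n U V where "X = Z m n U V" "openin Y U" "openin Y V" using X unfolding basis_def by blast
    then show ?thesis using Z_subset openin_subset by metis
  qed
  then show "topspace (arrow_top GY) \<subseteq> arrows GY"
    by (auto simp: arrow_top_eq topology_generated_by_topspace)
  show "arrows GY \<subseteq> topspace (arrow_top GY)"
  proof
    fix \<gamma> assume "\<gamma> \<in> arrows GY"
    moreover obtain x k y where "\<gamma> = (x, k, y)" by (cases \<gamma>)
    ultimately obtain m n where "\<gamma> \<in> Z m n (topspace Y) (topspace Y)" by (auto simp: arrows_iff Z_iff)
    then show "\<gamma> \<in> topspace (arrow_top GY)"
      using openin_subset[OF openin_Z[OF openin_topspace openin_topspace]] by blast
  qed
qed

text \<open>An arrow determines only the difference of its exponents, and an open set may be
  presented with another pair \<open>m'\<close>, \<open>n'\<close>. The neighbourhood can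
  nevertheless be taken with the prescribed pair: larger prescribed exponents are lowered by local
  injectivity of the surplus power, and smaller ones are raised by applying the missing power to
  both sides.\<close>

lemma nbhd_Z:
  assumes "openin (arrow_top GY) \<Omega>" "(x, int m - int n, y) \<in> \<Omega>" "(\<tau> ^^ m) x = (\<tau> ^^ n) y"
  shows "\<exists>U V. openin Y U \<and> openin Y V \<and> x \<in> U \<and> y \<in> V \<and> Z m n U V \<subseteq> \<Omega>"
proof -
  have "generate_topology_on basis \<Omega>"
    using assms(1) by (simp add: arrow_top_eq openin_topology_generated_by_iff)
  then show ?thesis using assms(2)
  proof (induction rule: generate_topology_on.induct)
    case Empty
    then show ?case by simp
  next
    case (Int a b)
    then obtain U V U' V' where "openin Y U" "openin Y V" "x \<in> U" "y \<in> V" "Z m n U V \<subseteq> a"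
      "openin Y U'" "openin Y V'" "x \<in> U'" "y \<in> V'" "Z m n U' V' \<subseteq> b" by blast
    then show ?case by (intro exI[of _ "U \<inter> U'"] exI[of _ "V \<inter> V'"]) (auto simp: Z_def)
  next
    case (UN K)
    then obtain k where k: "k \<in> K" "(x, int m - int n, y) \<in> k" by blast
    from UN.IH[OF k] k(1) show ?case by blast
  next
    case (Basis s)
    then obtain m' n' U' V' where s: "s = Z m' n' U' V'" "openin Y U'" "openin Y V'"
      by (auto simp: basis_def)
    have e: "int m - int n = int m' - int n'" "(\<tau> ^^ m') x = (\<tau> ^^ n') y" "x \<in> U'" "y \<in> V'"
      using Basis.prems by (auto simp: s(1) Z_iff)
    have in_Y: "x \<in> topspace Y" "y \<in> topspace Y" using e openin_subset[OF s(2)] openin_subset[OF s(3)] by auto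
    show ?case
    proof (cases "m' \<le> m")
      case True
      define j where "j = m - m'"
      have j: "m = j + m'" "n = j + n'" using True e(1) by (auto simp: j_def)
      obtain W where W: "openin Y W" "(\<tau> ^^ m') x \<in> W" "inj_on (\<tau> ^^ j) W"
        using locally_inj_pow[OF pow_in[OF in_Y(1)]] by blast
      let ?U = "U' \<inter> {x \<in> topspace Y. (\<tau> ^^ m') x \<in> W}" and ?V = "V' \<inter> {x \<in> topspace Y. (\<tau> ^^ n') x \<in> W}"
      have "Z m n ?U ?V \<subseteq> s"
        using inj_onD[OF W(3)] by (auto simp: s(1) Z_def j funpow_add)
      moreover have "openin Y ?U" "openin Y ?V" by (intro openin_Int s open_pow_preimage W)+
      ultimately show ?thesis using W(2) e in_Y by (intro exI[of _ ?U] exI[of _ ?V]) auto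
    next
      case False
      define j where "j = m' - m"
      have j: "m' = j + m" "n' = j + n" using False e(1) by (auto simp: j_def)
      have "Z m n U' V' \<subseteq> s" by (auto simp: s(1) Z_def j funpow_add)
      then show ?thesis using s e by blast
    qed
  qed
qed

lemma arrow_cases:
  assumes "\<gamma> \<in> arrows GY"
  obtains x y m n where "\<gamma> = (x, int m - int n, y)" "(\<tau> ^^ m) x = (\<tau> ^^ n) y" "x \<in> topspace Y" "y \<in> topspace Y"
proof -
  obtain x k y where "\<gamma> = (x, k, y)" by (cases \<gamma>)
  then show ?thesis using assms that by (auto simp: arrows_iff)
qed

text \<open>Two composable arrows may be presented with different exponents at the middle point.
  Raising the first pair by \<open>p\<close> and the second by \<open>n\<close> makes these equal,
  after which the product is immediate.\<close>

lemma composable_cases: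
  assumes "(x, k, y) \<in> arrows GY" "(y, l, w) \<in> arrows GY"
  obtains m n q where "k = int m - int n" "l = int n - int q" "(\<tau> ^^ m) x = (\<tau> ^^ n) y" "(\<tau> ^^ n) y = (\<tau> ^^ q) w"
proof -
  obtain m n where mn: "k = int m - int n" "(\<tau> ^^ m) x = (\<tau> ^^ n) y" using assms(1) by (auto simp: arrows_iff)
  obtain p q where pq: "l = int p - int q" "(\<tau> ^^ p) y = (\<tau> ^^ q) w" using assms(2) by (auto simp: arrows_iff)
  show ?thesis
  proof (rule that[of "p + m" "p + n" "n + q"])
    show "(\<tau> ^^ (p + m)) x = (\<tau> ^^ (p + n)) y" using mn(2) by (simp add: funpow_add)
    have "(\<tau> ^^ (n + p)) y = (\<tau> ^^ (n + q)) w" using pq(2) by (simp add: funpow_add)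
    then show "(\<tau> ^^ (p + n)) y = (\<tau> ^^ (n + q)) w" by (simp add: add.commute)
  qed (use mn pq in auto)
qed

section \<open>The structure maps of the Renault-Deaconu groupoid\<close>

lemma openin_rng_preimage: "openin Y U \<Longrightarrow> openin (arrow_top GY) {\<gamma> \<in> arrows GY. rng GY \<gamma> \<in> U}"
proof -
  assume U: "openin Y U"
  have "{\<gamma> \<in> arrows GY. rng GY \<gamma> \<in> U} = (\<Union>m. \<Union>n. Z m n U (topspace Y))"
  proof (intro equalityI subsetI)
    fix \<gamma> assume "\<gamma> \<in> (\<Union>m. \<Union>n. Z m n U (topspace Y))"
    then obtain m n where \<gamma>: "\<gamma> \<in> Z m n U (topspace Y)" by blast
    then have "\<gamma> \<in> arrows GY" using Z_subset[OF openin_subset[OF U] subset_refl, of m n] by blast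
    then show "\<gamma> \<in> {\<gamma> \<in> arrows GY. rng GY \<gamma> \<in> U}" using \<gamma> by (auto simp: Z_def)
  qed (auto simp: arrows_iff Z_iff)
  then show ?thesis using openin_Z[OF U openin_topspace] by (simp add: openin_Union) (blast intro: openin_Union)
qed

lemma openin_src_preimage: "openin Y U \<Longrightarrow> openin (arrow_top GY) {\<gamma> \<in> arrows GY. src GY \<gamma> \<in> U}"
proof -
  assume U: "openin Y U"
  have "{\<gamma> \<in> arrows GY. src GY \<gamma> \<in> U} = (\<Union>m. \<Union>n. Z m n (topspace Y) U)"
  proof (intro equalityI subsetI)
    fix \<gamma> assume "\<gamma> \<in> (\<Union>m. \<Union>n. Z m n (topspace Y) U)"
    then obtain m n where \<gamma>: "\<gamma> \<in> Z m n (topspace Y) U" by blast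
    then have "\<gamma> \<in> arrows GY" using Z_subset[OF subset_refl openin_subset[OF U], of m n] by blast
    then show "\<gamma> \<in> {\<gamma> \<in> arrows GY. src GY \<gamma> \<in> U}" using \<gamma> by (auto simp: Z_def)
  qed (auto simp: arrows_iff Z_iff)
  then show ?thesis using openin_Z[OF openin_topspace U] by (simp add: openin_Union) (blast intro: openin_Union)
qed

lemma continuous_rng_GY: "continuous_map (arrow_top GY) Y (rng GY)"
  unfolding continuous_map_def topspace_GY using openin_rng_preimage by (auto simp: arrows_iff)

lemma continuous_src_GY: "continuous_map (arrow_top GY) Y (src GY)"
  unfolding continuous_map_def topspace_GY using openin_src_preimage by (auto simp: arrows_iff)

lemma open_rng_GY: "open_map (arrow_top GY) Y (rng GY)"
  unfolding open_map_def
proof (intro allI impI, subst openin_subopen, intro ballI)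
  fix \<Omega> u assume \<Omega>: "openin (arrow_top GY) \<Omega>" and "u \<in> rng GY ` \<Omega>"
  then obtain \<gamma> where \<gamma>: "\<gamma> \<in> \<Omega>" "u = rng GY \<gamma>" by blast
  have "\<gamma> \<in> arrows GY" using \<gamma>(1) openin_subset[OF \<Omega>] topspace_GY by auto
  then obtain x y m n where xy: "\<gamma> = (x, int m - int n, y)" "(\<tau> ^^ m) x = (\<tau> ^^ n) y" "x \<in> topspace Y"
    by (rule arrow_cases)
  obtain U V where UV: "openin Y U" "openin Y V" "x \<in> U" "y \<in> V" "Z m n U V \<subseteq> \<Omega>"
    using nbhd_Z[OF \<Omega> _ xy(2)] \<gamma>(1) xy(1) by auto
  let ?T = "U \<inter> {x \<in> topspace Y. (\<tau> ^^ m) x \<in> (\<tau> ^^ n) ` V}"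
  have "?T \<subseteq> rng GY ` Z m n U V" by (force simp: Z_def image_iff)
  moreover have "openin Y ?T" by (intro openin_Int UV open_pow_preimage open_pow_image)
  moreover have "u \<in> ?T" using xy \<gamma>(2) UV by auto
  ultimately show "\<exists>T. openin Y T \<and> u \<in> T \<and> T \<subseteq> rng GY ` \<Omega>" using UV(5) by (meson image_mono subset_trans)
qed

lemma open_src_GY: "open_map (arrow_top GY) Y (src GY)"
  unfolding open_map_def
proof (intro allI impI, subst openin_subopen, intro ballI)
  fix \<Omega> u assume \<Omega>: "openin (arrow_top GY) \<Omega>" and "u \<in> src GY ` \<Omega>"
  then obtain \<gamma> where \<gamma>: "\<gamma> \<in> \<Omega>" "u = src GY \<gamma>" by blast
  have "\<gamma> \<in> arrows GY" using \<gamma>(1) openin_subset[OF \<Omega>] topspace_GY by auto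
  then obtain x y m n where xy: "\<gamma> = (x, int m - int n, y)" "(\<tau> ^^ m) x = (\<tau> ^^ n) y" "x \<in> topspace Y" "y \<in> topspace Y"
    by (rule arrow_cases)
  obtain U V where UV: "openin Y U" "openin Y V" "x \<in> U" "y \<in> V" "Z m n U V \<subseteq> \<Omega>"
    using nbhd_Z[OF \<Omega> _ xy(2)] \<gamma>(1) xy(1) by auto
  let ?T = "V \<inter> {y \<in> topspace Y. (\<tau> ^^ n) y \<in> (\<tau> ^^ m) ` U}"
  have "?T \<subseteq> src GY ` Z m n U V" by (force simp: Z_def image_iff)
  moreover have "openin Y ?T" by (intro openin_Int UV open_pow_preimage open_pow_image)
  moreover have "(\<tau> ^^ n) y \<in> (\<tau> ^^ m) ` U" using xy(2) UV(3) by (metis imageI)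
  then have "u \<in> ?T" using xy \<gamma>(2) UV by auto
  ultimately show "\<exists>T. openin Y T \<and> u \<in> T \<and> T \<subseteq> src GY ` \<Omega>" using UV(5) by (meson image_mono subset_trans)
qed

lemma continuous_inv_GY: "continuous_map (arrow_top GY) (arrow_top GY) (ginv GY)"
proof (rule continuous_mapI_nbhd)
  fix \<gamma> assume "\<gamma> \<in> topspace (arrow_top GY)"
  then have "\<gamma> \<in> arrows GY" by (simp add: topspace_GY)
  then obtain x y m n where xy: "\<gamma> = (x, int m - int n, y)" "(\<tau> ^^ m) x = (\<tau> ^^ n) y" "x \<in> topspace Y" "y \<in> topspace Y"
    by (rule arrow_cases)
  have "(y, int n - int m, x) \<in> arrows GY"
    using arrowsI[OF xy(2)[symmetric]] xy by simp
  then show "ginv GY \<gamma> \<in> topspace (arrow_top GY)" by (simp add: topspace_GY xy(1))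
  fix \<Omega> assume \<Omega>: "openin (arrow_top GY) \<Omega>" "ginv GY \<gamma> \<in> \<Omega>"
  then obtain U V where UV: "openin Y U" "openin Y V" "y \<in> U" "x \<in> V" "Z n m U V \<subseteq> \<Omega>"
    using nbhd_Z[OF \<Omega>(1) _ xy(2)[symmetric]] xy(1) by auto
  have "ginv GY ` Z m n V U \<subseteq> Z n m U V" by (auto simp: Z_def)
  then show "\<exists>T. openin (arrow_top GY) T \<and> \<gamma> \<in> T \<and> ginv GY ` T \<subseteq> \<Omega>"
    using UV xy openin_Z[OF UV(2,1), of m n] by (intro exI[of _ "Z m n V U"]) (auto simp: Z_iff)
qed

lemma continuous_unit_GY: "continuous_map Y (arrow_top GY) (unit GY)"
proof (rule continuous_mapI_nbhd)
  fix u assume u: "u \<in> topspace Y"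
  show "unit GY u \<in> topspace (arrow_top GY)"
    using u by (auto simp: topspace_GY arrows_iff intro!: exI[of _ "0::nat"])
  fix \<Omega> assume \<Omega>: "openin (arrow_top GY) \<Omega>" "unit GY u \<in> \<Omega>"
  obtain U V where UV: "openin Y U" "openin Y V" "u \<in> U" "u \<in> V" "Z 0 0 U V \<subseteq> \<Omega>"
    using nbhd_Z[OF \<Omega>(1), of u 0 0 u] \<Omega>(2) by auto
  have "unit GY ` (U \<inter> V) \<subseteq> Z 0 0 U V" by (auto simp: Z_def)
  then show "\<exists>T. openin Y T \<and> u \<in> T \<and> unit GY ` T \<subseteq> \<Omega>"
    using UV by (intro exI[of _ "U \<inter> V"]) auto
qed

lemma continuous_mult_GY:
  "continuous_map (subtopology (prod_topology (arrow_top GY) (arrow_top GY)) {(\<alpha>, \<beta>). src GY \<alpha> = rng GY \<beta>})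
    (arrow_top GY) (\<lambda>(\<alpha>, \<beta>). gmult GY \<alpha> \<beta>)"
proof (rule continuous_mapI_nbhd)
  let ?X = "subtopology (prod_topology (arrow_top GY) (arrow_top GY)) {(\<alpha>, \<beta>). src GY \<alpha> = rng GY \<beta>}"
  fix p assume p: "p \<in> topspace ?X"
  obtain x k y y' l w where p_eq: "p = ((x, k, y), (y', l, w))" by (cases p) auto
  have a: "(x, k, y) \<in> arrows GY" "(y, l, w) \<in> arrows GY" "y' = y"
    using p by (auto simp: p_eq topspace_GY)
  obtain m n q where mnq: "k = int m - int n" "l = int n - int q" "(\<tau> ^^ m) x = (\<tau> ^^ n) y" "(\<tau> ^^ n) y = (\<tau> ^^ q) w"
    by (rule composable_cases[OF a(1,2)])
  have in_Y: "x \<in> topspace Y" "y \<in> topspace Y" "w \<in> topspace Y" using a by (auto simp: arrows_iff)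
  have kl: "k + l = int m - int q" using mnq by simp
  have "(x, k + l, w) \<in> arrows GY" unfolding kl using mnq in_Y by (intro arrowsI) auto
  then show "(\<lambda>(\<alpha>, \<beta>). gmult GY \<alpha> \<beta>) p \<in> topspace (arrow_top GY)" by (simp add: p_eq topspace_GY)
  fix \<Omega> assume \<Omega>: "openin (arrow_top GY) \<Omega>" "(\<lambda>(\<alpha>, \<beta>). gmult GY \<alpha> \<beta>) p \<in> \<Omega>"
  then have "(x, int m - int q, w) \<in> \<Omega>" by (simp add: p_eq kl)
  then obtain U V where UV: "openin Y U" "openin Y V" "x \<in> U" "w \<in> V" "Z m q U V \<subseteq> \<Omega>"
    using nbhd_Z[OF \<Omega>(1), of x m q w] mnq by auto
  let ?T = "(Z m n U (topspace Y) \<times> Z n q (topspace Y) V) \<inter> {(\<alpha>, \<beta>). src GY \<alpha> = rng GY \<beta>}"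
  have "openin (prod_topology (arrow_top GY) (arrow_top GY)) (Z m n U (topspace Y) \<times> Z n q (topspace Y) V)"
    using UV by (simp add: openin_prod_Times_iff openin_Z)
  then have "openin ?X ?T" by (rule openin_subtopology_Int)
  moreover have "p \<in> ?T" using mnq in_Y UV by (auto simp: p_eq a(3) Z_iff)
  moreover have "(\<lambda>(\<alpha>, \<beta>). gmult GY \<alpha> \<beta>) ` ?T \<subseteq> Z m q U V" by (auto simp: Z_def)
  ultimately show "\<exists>T. openin ?X T \<and> p \<in> T \<and> (\<lambda>(\<alpha>, \<beta>). gmult GY \<alpha> \<beta>) ` T \<subseteq> \<Omega>"
    using UV(5) by (meson subset_trans)
qed

text \<open>Distinct arrows differ in an end point, separated in \<open>Y\<close>, or in the
  integer, which is constant on each set \<open>Z\<close>.\<close>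

lemma Hausdorff_GY: "Hausdorff_space (arrow_top GY)"
  unfolding Hausdorff_space_def
proof (intro allI impI, elim conjE)
  fix \<gamma> \<gamma>' assume g: "\<gamma> \<in> topspace (arrow_top GY)" "\<gamma>' \<in> topspace (arrow_top GY)" "\<gamma> \<noteq> \<gamma>'"
  obtain x y m n where xy: "\<gamma> = (x, int m - int n, y)" "(\<tau> ^^ m) x = (\<tau> ^^ n) y" "x \<in> topspace Y" "y \<in> topspace Y"
    by (rule arrow_cases[OF g(1)[unfolded topspace_GY]])
  obtain x' y' m' n' where xy': "\<gamma>' = (x', int m' - int n', y')" "(\<tau> ^^ m') x' = (\<tau> ^^ n') y'" "x' \<in> topspace Y" "y' \<in> topspace Y"
    by (rule arrow_cases[OF g(2)[unfolded topspace_GY]])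
  note sep = Hausdorff[unfolded Hausdorff_space_def, rule_format]
  consider "x \<noteq> x'" | "y \<noteq> y'" | "int m - int n \<noteq> int m' - int n'" using g(3) xy(1) xy'(1) by auto
  then show "\<exists>U V. openin (arrow_top GY) U \<and> openin (arrow_top GY) V \<and> \<gamma> \<in> U \<and> \<gamma>' \<in> V \<and> disjnt U V"
  proof cases
    case 1
    obtain U V where "openin Y U" "openin Y V" "x \<in> U" "x' \<in> V" "disjnt U V"
      using sep[of x x'] 1 xy xy' by blast
    then show ?thesis
      using g xy(1) xy'(1) topspace_GY openin_rng_preimage[of U] openin_rng_preimage[of V]
      by (intro exI[of _ "{\<gamma> \<in> arrows GY. rng GY \<gamma> \<in> U}"] exI[of _ "{\<gamma> \<in> arrows GY. rng GY \<gamma> \<in> V}"])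
        (auto simp: disjnt_iff)
  next
    case 2
    obtain U V where "openin Y U" "openin Y V" "y \<in> U" "y' \<in> V" "disjnt U V"
      using sep[of y y'] 2 xy xy' by blast
    then show ?thesis
      using g xy(1) xy'(1) topspace_GY openin_src_preimage[of U] openin_src_preimage[of V]
      by (intro exI[of _ "{\<gamma> \<in> arrows GY. src GY \<gamma> \<in> U}"] exI[of _ "{\<gamma> \<in> arrows GY. src GY \<gamma> \<in> V}"])
        (auto simp: disjnt_iff)
  next
    case 3
    let ?U = "Z m n (topspace Y) (topspace Y)" and ?V = "Z m' n' (topspace Y) (topspace Y)"
    have "disjnt ?U ?V" using 3 by (auto simp: disjnt_iff Z_def)
    moreover have "\<gamma> \<in> ?U" "\<gamma>' \<in> ?V" using xy xy' by (auto simp: Z_iff)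
    ultimately show ?thesis using openin_Z[OF openin_topspace openin_topspace] by blast
  qed
qed

text \<open>Failure of each defining condition is open. An end point outside is handled by
  continuity of range and source, a wrong integer by its local constancy, and with the right integer
  but different images Hausdorffness of \<open>Y\<close> separates the images.\<close>

lemma closedin_Z:
  assumes U: "closedin Y U" and V: "closedin Y V"
  shows "closedin (arrow_top GY) (Z m n U V)"
proof -
  have sub: "Z m n U V \<subseteq> arrows GY"
    by (rule Z_subset[OF closedin_subset[OF U] closedin_subset[OF V]])
  have "openin (arrow_top GY) (arrows GY - Z m n U V)"
  proof (subst openin_subopen, intro ballI)
    fix \<gamma> assume \<gamma>: "\<gamma> \<in> arrows GY - Z m n U V"
    then have "\<gamma> \<in> arrows GY" by simp
    then obtain x y p q where xy: "\<gamma> = (x, int p - int q, y)" "(\<tau> ^^ p) x = (\<tau> ^^ q) y" "x \<in> topspace Y" "y \<in> topspace Y"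
      by (rule arrow_cases)
    consider "x \<notin> U" | "y \<notin> V" | "int p - int q \<noteq> int m - int n" | "int p - int q = int m - int n" "(\<tau> ^^ m) x \<noteq> (\<tau> ^^ n) y"
      using \<gamma> xy(1) by (auto simp: Z_iff)
    then show "\<exists>T. openin (arrow_top GY) T \<and> \<gamma> \<in> T \<and> T \<subseteq> arrows GY - Z m n U V"
    proof cases
      case 1
      then show ?thesis using openin_rng_preimage[of "topspace Y - U"] U xy \<gamma>
        by (intro exI[of _ "{\<gamma> \<in> arrows GY. rng GY \<gamma> \<in> topspace Y - U}"]) (auto simp: Z_def closedin_def)
    next
      case 2
      then show ?thesis using openin_src_preimage[of "topspace Y - V"] V xy \<gamma>
        by (intro exI[of _ "{\<gamma> \<in> arrows GY. src GY \<gamma> \<in> topspace Y - V}"]) (auto simp: Z_def closedin_def)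
    next
      case 3
      let ?T = "Z p q (topspace Y) (topspace Y)"
      have "?T \<subseteq> arrows GY - Z m n U V" using 3 Z_subset[of "topspace Y" "topspace Y" p q] by (auto simp: Z_def)
      moreover have "\<gamma> \<in> ?T" using xy by (auto simp: Z_iff)
      ultimately show ?thesis using openin_Z[OF openin_topspace openin_topspace] by blast
    next
      case 4
      obtain P Q where PQ: "openin Y P" "openin Y Q" "(\<tau> ^^ m) x \<in> P" "(\<tau> ^^ n) y \<in> Q" "disjnt P Q"
        using Hausdorff[unfolded Hausdorff_space_def, rule_format, of "(\<tau> ^^ m) x" "(\<tau> ^^ n) y"] 4(2) pow_in xy by blast
      let ?T = "Z p q {x \<in> topspace Y. (\<tau> ^^ m) x \<in> P} {y \<in> topspace Y. (\<tau> ^^ n) y \<in> Q}"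
      have "openin (arrow_top GY) ?T" by (intro openin_Z open_pow_preimage PQ)
      moreover have "\<gamma> \<in> ?T" using xy PQ by (auto simp: Z_iff)
      moreover have "?T \<subseteq> arrows GY" by (rule Z_subset) auto
      then have "?T \<subseteq> arrows GY - Z m n U V" using PQ(5) by (auto simp: Z_def disjnt_iff)
      ultimately show ?thesis by blast
    qed
  qed
  then show ?thesis using sub by (simp add: closedin_def topspace_GY)
qed

text \<open>If \<open>U\<close> and \<open>V\<close> are clopen and the powers are injective on
  them, each coordinate of an arrow in \<open>Z m n U V\<close> determines the other.\<close>

lemma clopen_bisection_GY:
  assumes "\<gamma> \<in> arrows GY"
  shows "\<exists>B. \<gamma> \<in> B \<and> openin (arrow_top GY) B \<and> closedin (arrow_top GY) B \<and> inj_on (rng GY) B \<and> inj_on (src GY) B"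
proof -
  obtain x y m n where xy: "\<gamma> = (x, int m - int n, y)" "(\<tau> ^^ m) x = (\<tau> ^^ n) y" "x \<in> topspace Y" "y \<in> topspace Y"
    by (rule arrow_cases[OF assms])
  obtain U where U: "openin Y U" "closedin Y U" "x \<in> U" "inj_on (\<tau> ^^ m) U" using clopen_inj_pow[OF xy(3)] by blast
  obtain V where V: "openin Y V" "closedin Y V" "y \<in> V" "inj_on (\<tau> ^^ n) V" using clopen_inj_pow[OF xy(4)] by blast
  have "inj_on (rng GY) (Z m n U V)"
  proof (rule inj_onI)
    fix \<alpha> \<beta> assume "\<alpha> \<in> Z m n U V" "\<beta> \<in> Z m n U V" "rng GY \<alpha> = rng GY \<beta>"
    then obtain a b b' where *: "\<alpha> = (a, int m - int n, b)" "\<beta> = (a, int m - int n, b')"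
      "(\<tau> ^^ n) b = (\<tau> ^^ n) b'" "b \<in> V" "b' \<in> V" by (auto simp: Z_def)
    then show "\<alpha> = \<beta>" using inj_onD[OF V(4) *(3-5)] by simp
  qed
  moreover have "inj_on (src GY) (Z m n U V)"
  proof (rule inj_onI)
    fix \<alpha> \<beta> assume "\<alpha> \<in> Z m n U V" "\<beta> \<in> Z m n U V" "src GY \<alpha> = src GY \<beta>"
    then obtain a a' b where *: "\<alpha> = (a, int m - int n, b)" "\<beta> = (a', int m - int n, b)"
      "(\<tau> ^^ m) a = (\<tau> ^^ m) a'" "a \<in> U" "a' \<in> U" by (auto simp: Z_def)
    then show "\<alpha> = \<beta>" using inj_onD[OF U(4) *(3-5)] by simp
  qed
  moreover have "\<gamma> \<in> Z m n U V" using xy U(3) V(3) by (simp add: Z_iff)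
  ultimately show ?thesis
    using openin_Z[OF U(1) V(1)] closedin_Z[OF U(2) V(2)] by blast
qed

lemma ample_groupoid_GY: "ample_groupoid GY"
proof
  show "topspace (arrow_top GY) = arrows GY" by (rule topspace_GY)
  show "topspace (unit_top GY) \<noteq> {}" using nonempty by simp
  show "Hausdorff_space (arrow_top GY)" by (rule Hausdorff_GY)
  show "Hausdorff_space (unit_top GY)" using Hausdorff by simp
  show "continuous_map (arrow_top GY) (unit_top GY) (rng GY)" using continuous_rng_GY by simp
  show "continuous_map (arrow_top GY) (unit_top GY) (src GY)" using continuous_src_GY by simp
  show "continuous_map (unit_top GY) (arrow_top GY) (unit GY)" using continuous_unit_GY by simp
  show "continuous_map (arrow_top GY) (arrow_top GY) (ginv GY)" by (rule continuous_inv_GY)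
  show "continuous_map (subtopology (prod_topology (arrow_top GY) (arrow_top GY)) {(\<alpha>, \<beta>). src GY \<alpha> = rng GY \<beta>})
    (arrow_top GY) (\<lambda>(\<alpha>, \<beta>). gmult GY \<alpha> \<beta>)" by (rule continuous_mult_GY)
  show "open_map (arrow_top GY) (unit_top GY) (rng GY)" using open_rng_GY by simp
  show "open_map (arrow_top GY) (unit_top GY) (src GY)" using open_src_GY by simp
next
  fix \<alpha> \<beta> assume a: "\<alpha> \<in> arrows GY" "\<beta> \<in> arrows GY" "src GY \<alpha> = rng GY \<beta>"
  obtain x k y l w where eq: "\<alpha> = (x, k, y)" "\<beta> = (y, l, w)" using a(3) by (cases \<alpha>; cases \<beta>) auto
  obtain m n q where mnq: "k = int m - int n" "l = int n - int q" "(\<tau> ^^ m) x = (\<tau> ^^ n) y" "(\<tau> ^^ n) y = (\<tau> ^^ q) w"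
    by (rule composable_cases[OF a(1,2)[unfolded eq]])
  have kl: "k + l = int m - int q" using mnq by simp
  have "(x, k + l, w) \<in> arrows GY" unfolding kl using mnq a by (intro arrowsI) (auto simp: eq arrows_iff)
  then show "gmult GY \<alpha> \<beta> \<in> arrows GY" by (simp add: eq)
next
  fix \<gamma> assume "\<gamma> \<in> arrows GY"
  then show "\<exists>B. \<gamma> \<in> B \<and> openin (arrow_top GY) B \<and> closedin (arrow_top GY) B \<and> inj_on (rng GY) B \<and> inj_on (src GY) B"
    by (rule clopen_bisection_GY)
next
  fix \<gamma> assume "\<gamma> \<in> arrows GY"
  then obtain x y m n where xy: "\<gamma> = (x, int m - int n, y)" "(\<tau> ^^ m) x = (\<tau> ^^ n) y" "x \<in> topspace Y" "y \<in> topspace Y"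
    by (rule arrow_cases)
  then show "ginv GY \<gamma> \<in> arrows GY" using arrowsI[OF xy(2)[symmetric]] by simp
next
  fix u assume "u \<in> topspace (unit_top GY)"
  then show "unit GY u \<in> arrows GY" by (auto simp: arrows_iff intro!: exI[of _ "0::nat"])
qed (auto simp: arrows_iff)

end

section \<open>The fractafold bundle\<close>

text \<open>A cylinder is named by one of its points and a length instead of a word, so that
  comparing prefixes becomes comparing values of functions.\<close>

definition cyl :: "nat \<Rightarrow> (nat \<Rightarrow> nat) \<Rightarrow> nat \<Rightarrow> (nat \<Rightarrow> nat) set" where
  "cyl N x n = {y \<in> seqs N. \<forall>i<n. y i = x i}"

lemma cyl_eq_cylinder: "cyl N x n = cylinder N (prefix_word x n)"
  by (auto simp: cyl_def cylinder_def prefix_word_def)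

lemma prefix_word_words: "x \<in> seqs N \<Longrightarrow> prefix_word x n \<in> words N n"
  by (auto simp: prefix_word_def words_def seqs_def)

lemma cyl_antimono: "m \<le> n \<Longrightarrow> cyl N x n \<subseteq> cyl N x m"
  by (auto simp: cyl_def)

lemma cyl_refl: "x \<in> seqs N \<Longrightarrow> x \<in> cyl N x n"
  by (simp add: cyl_def)

lemma cyl_eq: "y \<in> cyl N x n \<Longrightarrow> cyl N y n = cyl N x n"
  by (auto simp: cyl_def)

lemma cylinder_eq_cyl: "\<omega> \<in> words N n \<Longrightarrow> x \<in> cylinder N \<omega> \<Longrightarrow> cylinder N \<omega> = cyl N x n \<and> prefix_word x n = \<omega>"
  by (auto simp: cylinder_def cyl_def words_def prefix_word_def intro!: nth_equalityI)

text \<open>Cylinders around one point are nested, so finite intersections of generators add nothing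
  and the cylinders form a base.\<close>

lemma openin_seq_top:
  "openin (seq_top N) U \<longleftrightarrow> U \<subseteq> seqs N \<and> (\<forall>x\<in>U. \<exists>n. cyl N x n \<subseteq> U)"
proof
  assume "openin (seq_top N) U"
  then have "generate_topology_on (cylinder N ` (\<Union>n. words N n)) U"
    by (simp add: seq_top_def openin_topology_generated_by_iff)
  then show "U \<subseteq> seqs N \<and> (\<forall>x\<in>U. \<exists>n. cyl N x n \<subseteq> U)"
  proof (induction rule: generate_topology_on.induct)
    case (Int a b)
    have "\<exists>n. cyl N x n \<subseteq> a \<inter> b" if x: "x \<in> a \<inter> b" for x
    proof -
      obtain m n where "cyl N x m \<subseteq> a" "cyl N x n \<subseteq> b" using Int x by blast
      then have "cyl N x (max m n) \<subseteq> a \<inter> b"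
        using cyl_antimono[of m "max m n" N x] cyl_antimono[of n "max m n" N x] by auto
      then show ?thesis ..
    qed
    then show ?case using Int by blast
  next
    case (UN K)
    then show ?case by (meson Sup_least Union_iff Union_upper order_trans)
  next
    case (Basis s)
    then obtain \<omega> n where s: "\<omega> \<in> words N n" "s = cylinder N \<omega>" by blast
    have "cyl N x n \<subseteq> s" if "x \<in> s" for x using cylinder_eq_cyl[OF s(1)] that s(2) by simp
    moreover have "s \<subseteq> seqs N" by (auto simp: s(2) cylinder_def)
    ultimately show ?case by blast
  qed simp
next
  assume U: "U \<subseteq> seqs N \<and> (\<forall>x\<in>U. \<exists>n. cyl N x n \<subseteq> U)"
  show "openin (seq_top N) U"
  proof (subst openin_subopen, intro ballI)
    fix x assume x: "x \<in> U"
    then obtain n where n: "cyl N x n \<subseteq> U" using U by blast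
    have "x \<in> seqs N" using U x by blast
    then have "openin (seq_top N) (cyl N x n)"
      unfolding seq_top_def cyl_eq_cylinder
      by (intro topology_generated_by_Basis) (use prefix_word_words in blast)
    then show "\<exists>T. openin (seq_top N) T \<and> x \<in> T \<and> T \<subseteq> U" using n cyl_refl[OF \<open>x \<in> seqs N\<close>] by blast
  qed
qed

lemma topspace_seq_top: "topspace (seq_top N) = seqs N"
proof -
  have "openin (seq_top N) (seqs N)" by (auto simp: openin_seq_top cyl_def)
  moreover have "topspace (seq_top N) \<subseteq> seqs N" using openin_seq_top openin_topspace by blast
  ultimately show ?thesis using openin_subset by blast
qed

lemma openin_cyl: "openin (seq_top N) (cyl N x n)"
  unfolding openin_seq_top
proof (intro conjI ballI)
  fix y assume "y \<in> cyl N x n"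
  then show "\<exists>m. cyl N y m \<subseteq> cyl N x n" using cyl_eq by (intro exI[of _ n]) blast
qed (auto simp: cyl_def)

lemma seq_shift_pow: "(seq_shift ^^ n) x i = x (i + n)"
  by (induction n arbitrary: i) (auto simp: seq_shift_def)

lemma seq_shift_seqs: "x \<in> seqs N \<Longrightarrow> seq_shift x \<in> seqs N"
  by (auto simp: seqs_def seq_shift_def)

text \<open>The map belonging to the first \<open>n\<close> letters of \<open>x\<close>. It is the
  second coordinate of the \<open>n\<close>-th iterate of the bundle shift, and obeys a recursion at
  either end of the prefix.\<close>

definition pw :: "(nat \<Rightarrow> 't \<Rightarrow> 't) \<Rightarrow> (nat \<Rightarrow> nat) \<Rightarrow> nat \<Rightarrow> 't \<Rightarrow> 't" where
  "pw F x n = word_map F (prefix_word x n)"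

lemma pw_0 [simp]: "pw F x 0 t = t"
  by (simp add: pw_def word_map_def prefix_word_def)

lemma pw_Suc: "pw F x (Suc n) t = F (x n) (pw F x n t)"
  by (simp add: pw_def word_map_def prefix_word_def)

lemma pw_Suc_shift: "pw F x (Suc n) t = pw F (seq_shift x) n (F (x 0) t)"
  by (induction n) (simp_all add: pw_Suc seq_shift_def)

lemma pw_cong: "(\<And>i. i < n \<Longrightarrow> x i = y i) \<Longrightarrow> pw F x n = pw F y n"
  unfolding pw_def prefix_word_def by (intro arg_cong[where f = "word_map F"] map_cong) auto

lemma pw_cyl: "y \<in> cyl N x m \<Longrightarrow> n \<le> m \<Longrightarrow> pw F y n = pw F x n"
  by (rule pw_cong) (auto simp: cyl_def)

lemma bundle_shift_pow: "(bundle_shift F ^^ n) (x, t) = ((seq_shift ^^ n) x, pw F x n t)"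
proof (induction n)
  case (Suc n)
  have "(seq_shift ^^ n) x 0 = x n" by (simp add: seq_shift_pow)
  then show ?case using Suc by (simp add: bundle_shift_def pw_Suc)
qed simp

lemma continuous_on_nonexpansive:
  fixes f :: "'a::metric_space \<Rightarrow> 'b::metric_space"
  assumes "\<And>x y. dist (f x) (f y) \<le> dist x y" shows "continuous_on S f"
  unfolding continuous_on_iff
proof (intro ballI allI impI)
  fix x and e :: real assume "0 < e"
  then show "\<exists>d>0. \<forall>x'\<in>S. dist x' x < d \<longrightarrow> dist (f x') (f x) < e"
    by (intro exI[of _ e]) (auto intro: order_le_less_trans[OF assms])
qed

locale fractafold_bundle =
  fixes N :: nat and F :: "nat \<Rightarrow> 't::metric_space \<Rightarrow> 't" and K :: "'t set"
  assumes N: "1 \<le> N"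
    and nondegenerate: "nondegenerate_ifs N F"
    and surj_F: "\<forall>i\<in>{1..N}. surj (F i)"
    and invariant: "invariant_set N F K"
    and open_images: "\<forall>i\<in>{1..N}. openin (top_of_set K) (F i ` K)"
begin

abbreviation "L \<equiv> bundle_top N F K"
abbreviation "level n \<equiv> bundle_level N F K n"

lemma F_lipschitz:
  assumes "i \<in> {1..N}"
  shows "\<exists>r R. 0 < r \<and> 0 \<le> R \<and> R < 1 \<and> (\<forall>t t'. r * dist t t' \<le> dist (F i t) (F i t')) \<and>
    (\<forall>t t'. dist (F i t) (F i t') \<le> R * dist t t')"
proof -
  obtain r R where "0 < r" "r \<le> R" "R < 1"
    "\<forall>t t'. r * dist t t' \<le> dist (F i t) (F i t') \<and> dist (F i t) (F i t') \<le> R * dist t t'"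
    using nondegenerate assms unfolding nondegenerate_ifs_def by blast
  then show ?thesis by (intro exI[of _ r] exI[of _ R]) auto
qed

lemma F_nonexpansive:
  assumes "i \<in> {1..N}" shows "dist (F i t) (F i t') \<le> dist t t'"
proof -
  obtain R where R: "0 \<le> R" "R < 1" "\<forall>t t'. dist (F i t) (F i t') \<le> R * dist t t'"
    using F_lipschitz[OF assms] by blast
  have "R * dist t t' \<le> 1 * dist t t'" using R by (intro mult_right_mono) auto
  with R(3) show ?thesis by (metis mult_1 order_trans)
qed

lemma inj_F: "i \<in> {1..N} \<Longrightarrow> inj (F i)"
proof (rule injI)
  fix t t' assume i: "i \<in> {1..N}" and eq: "F i t = F i t'"
  obtain r where "0 < r" "\<forall>t t'. r * dist t t' \<le> dist (F i t) (F i t')" using F_lipschitz[OF i] by blast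
  then have "r * dist t t' \<le> dist (F i t) (F i t')" "0 < r" by auto
  then have "dist t t' \<le> 0" using eq by (simp add: mult_le_0_iff)
  then show "t = t'" by simp
qed

lemma bij_F: "i \<in> {1..N} \<Longrightarrow> bij (F i)"
  using inj_F surj_F by (simp add: bij_def)

lemma K: "compact K" "K \<noteq> {}" "K = (\<Union>i\<in>{1..N}. F i ` K)"
  using invariant by (auto simp: invariant_set_def)

lemma F_K: "i \<in> {1..N} \<Longrightarrow> t \<in> K \<Longrightarrow> F i t \<in> K"
  using K(3) by blast

lemma seqsD: "x \<in> seqs N \<Longrightarrow> x i \<in> {1..N}"
  by (simp add: seqs_def)

lemma F_seqs_K: "x \<in> seqs N \<Longrightarrow> t \<in> K \<Longrightarrow> F (x n) t \<in> K"
  by (rule F_K[OF seqsD])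

lemma bij_word_map: "set \<omega> \<subseteq> {1..N} \<Longrightarrow> bij (word_map F \<omega>)"
proof (induction \<omega>)
  case Nil
  have "word_map F [] = id" by (simp add: word_map_def fun_eq_iff)
  then show ?case by (simp only: bij_id)
next
  case (Cons i \<omega>)
  have "word_map F (i # \<omega>) = word_map F \<omega> \<circ> F i" by (simp add: word_map_def)
  moreover have "bij (word_map F \<omega>)" "bij (F i)" using Cons bij_F[of i] by auto
  ultimately show ?case by (simp only: bij_comp)
qed

lemma bij_pw: "x \<in> seqs N \<Longrightarrow> bij (pw F x n)"
  unfolding pw_def by (rule bij_word_map) (auto simp: prefix_word_def seqs_def)

lemma pw_nonexpansive: "x \<in> seqs N \<Longrightarrow> dist (pw F x n t) (pw F x n t') \<le> dist t t'"
  by (induction n) (auto simp: pw_Suc intro: order_trans[OF F_nonexpansive[OF seqsD]])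

lemma pw_expansive:
  assumes "x \<in> seqs N" shows "\<exists>r>0. \<forall>t t'. r * dist t t' \<le> dist (pw F x n t) (pw F x n t')"
proof (induction n)
  case 0
  show ?case by (intro exI[of _ 1]) simp
next
  case (Suc n)
  then obtain r where r: "r > 0" "\<forall>t t'. r * dist t t' \<le> dist (pw F x n t) (pw F x n t')" by blast
  obtain r' where r': "r' > 0" "\<forall>t t'. r' * dist t t' \<le> dist (F (x n) t) (F (x n) t')"
    using F_lipschitz[OF seqsD[OF assms, of n]] by blast
  have "r' * r * dist t t' \<le> dist (pw F x (Suc n) t) (pw F x (Suc n) t')" for t t'
  proof -
    have "r' * (r * dist t t') \<le> r' * dist (pw F x n t) (pw F x n t')"
      using r r'(1) by (intro mult_left_mono) auto
    also have "\<dots> \<le> dist (pw F x (Suc n) t) (pw F x (Suc n) t')" using r'(2) by (simp add: pw_Suc)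
    finally show ?thesis by (simp add: mult.assoc)
  qed
  then show ?case using r(1) r'(1) by (intro exI[of _ "r' * r"]) simp
qed

text \<open>Since the word maps are bijective, lying in the inverse image of \<open>K\<close> under
  the prefix of \<open>x\<close> is one equation-free condition on \<open>t\<close>. Words and
  fibres disappear from everything that follows.\<close>

lemma level_iff: "(x, t) \<in> level n \<longleftrightarrow> x \<in> seqs N \<and> pw F x n t \<in> K"
proof
  assume "(x, t) \<in> level n"
  then obtain \<omega> where \<omega>: "\<omega> \<in> words N n" "x \<in> cylinder N \<omega>" "t \<in> inv (word_map F \<omega>) ` K"
    by (auto simp: bundle_level_def bundle_fibre_def)
  have "prefix_word x n = \<omega>" using cylinder_eq_cyl[OF \<omega>(1,2)] by simp
  moreover have "bij (word_map F \<omega>)" using \<omega>(1) by (intro bij_word_map) (simp add: words_def)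
  ultimately have "pw F x n t \<in> K" using \<omega>(3) by (auto simp: pw_def bij_is_surj surj_f_inv_f)
  moreover have "x \<in> seqs N" using \<omega>(2) by (simp add: cylinder_def)
  ultimately show "x \<in> seqs N \<and> pw F x n t \<in> K" by blast
next
  assume x: "x \<in> seqs N \<and> pw F x n t \<in> K"
  have "t = inv (pw F x n) (pw F x n t)" using bij_pw[of x n] x by (simp add: bij_is_inj)
  then have "t \<in> bundle_fibre F K (prefix_word x n)" using x unfolding bundle_fibre_def pw_def by blast
  moreover have "x \<in> cylinder N (prefix_word x n)" using x cyl_refl cyl_eq_cylinder by blast
  ultimately show "(x, t) \<in> level n" using x prefix_word_words unfolding bundle_level_def by blast
qed

lemma level_mono: "m \<le> n \<Longrightarrow> level m \<subseteq> level n"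
proof (induction n rule: dec_induct)
  case (step n)
  have "level n \<subseteq> level (Suc n)" by (auto simp: level_iff pw_Suc F_seqs_K)
  then show ?case using step by blast
qed simp

section \<open>The inductive limit topology on the bundle\<close>

lemma topspace_L: "topspace L = (\<Union>n. level n)"
proof
  show "topspace L \<subseteq> (\<Union>n. level n)" using openin_topspace[of L] unfolding openin_bundle_top by (rule conjunct1)
  have "openin L (\<Union>n. level n)"
    unfolding openin_bundle_top
  proof (intro conjI allI)
    fix n
    have "(\<Union>n. level n) \<inter> level n = topspace (bundle_level_top N F K n)"
      by (auto simp: bundle_level_top_def topspace_seq_top level_iff)
    then show "openin (bundle_level_top N F K n) ((\<Union>n. level n) \<inter> level n)" by simp
  qed simp
  then show "(\<Union>n. level n) \<subseteq> topspace L" by (rule openin_subset)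
qed

lemma topspace_L_fst: "(x, t) \<in> topspace L \<Longrightarrow> x \<in> seqs N"
  by (auto simp: topspace_L level_iff)

text \<open>States that \<open>U\<close> contains a basic neighbourhood of the point relative to
  level \<open>p\<close>: a cylinder times a ball, intersected with that level.\<close>

definition nbhd_in :: "((nat \<Rightarrow> nat) \<times> 't) set \<Rightarrow> nat \<Rightarrow> (nat \<Rightarrow> nat) \<Rightarrow> 't \<Rightarrow> bool" where
  "nbhd_in U p x t \<longleftrightarrow> (\<exists>m e. 0 < e \<and> (\<forall>y\<in>cyl N x m. \<forall>s. (y, s) \<in> level p \<and> dist s t < e \<longrightarrow> (y, s) \<in> U))"

lemma openin_level_top:
  "openin (bundle_level_top N F K p) (U \<inter> level p) \<longleftrightarrow> (\<forall>x t. (x, t) \<in> U \<inter> level p \<longrightarrow> nbhd_in U p x t)"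
proof
  assume "openin (bundle_level_top N F K p) (U \<inter> level p)"
  then obtain W where W: "openin (prod_topology (seq_top N) euclidean) W" "U \<inter> level p = W \<inter> level p"
    by (auto simp: bundle_level_top_def openin_subtopology)
  show "\<forall>x t. (x, t) \<in> U \<inter> level p \<longrightarrow> nbhd_in U p x t"
  proof (intro allI impI)
    fix x t assume "(x, t) \<in> U \<inter> level p"
    then have "(x, t) \<in> W" using W(2) by blast
    from W(1)[unfolded openin_prod_topology_alt, rule_format, OF this]
    obtain A B where AB: "openin (seq_top N) A" "open B" "x \<in> A" "t \<in> B" "A \<times> B \<subseteq> W"
      by (auto simp only: open_openin)
    obtain m where m: "cyl N x m \<subseteq> A" using AB(1,3) unfolding openin_seq_top by blast
    obtain e where e: "0 < e" "ball t e \<subseteq> B" using AB(2,4) openE by blast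
    show "nbhd_in U p x t"
      unfolding nbhd_in_def
    proof (intro exI conjI ballI allI impI)
      show "0 < e" by fact
      fix y s assume y: "y \<in> cyl N x m" and s: "(y, s) \<in> level p \<and> dist s t < e"
      have "s \<in> ball t e" using s by (simp add: dist_commute)
      then have "(y, s) \<in> W" using y m e(2) AB(5) by blast
      then show "(y, s) \<in> U" using s W(2) by blast
    qed
  qed
next
  assume H: "\<forall>x t. (x, t) \<in> U \<inter> level p \<longrightarrow> nbhd_in U p x t"
  show "openin (bundle_level_top N F K p) (U \<inter> level p)"
  proof (subst openin_subopen, intro ballI)
    fix z assume z: "z \<in> U \<inter> level p"
    obtain x t where xt: "z = (x, t)" by (cases z)
    obtain m e where me: "0 < e" "\<forall>y\<in>cyl N x m. \<forall>s. (y, s) \<in> level p \<and> dist s t < e \<longrightarrow> (y, s) \<in> U"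
      using H z xt unfolding nbhd_in_def by blast
    have "openin (prod_topology (seq_top N) euclidean) (cyl N x m \<times> ball t e)"
      by (simp add: openin_prod_Times_iff openin_cyl)
    then have "openin (bundle_level_top N F K p) ((cyl N x m \<times> ball t e) \<inter> level p)"
      unfolding bundle_level_top_def by (rule openin_subtopology_Int)
    moreover have "z \<in> (cyl N x m \<times> ball t e) \<inter> level p"
      using z me(1) cyl_refl by (auto simp: xt level_iff)
    moreover have "(cyl N x m \<times> ball t e) \<inter> level p \<subseteq> U \<inter> level p"
    proof
      fix v assume v: "v \<in> (cyl N x m \<times> ball t e) \<inter> level p"
      obtain y s where ys: "v = (y, s)" by (cases v)
      have "y \<in> cyl N x m" "dist s t < e" "(y, s) \<in> level p" using v by (auto simp: ys dist_commute)
      then show "v \<in> U \<inter> level p" using me(2) ys by blast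
    qed
    ultimately show "\<exists>T. openin (bundle_level_top N F K p) T \<and> z \<in> T \<and> T \<subseteq> U \<inter> level p" by blast
  qed
qed

text \<open>If level \<open>p\<close> is itself a neighbourhood of the point inside level
  \<open>q\<close>, neighbourhoods relative to \<open>p\<close> are neighbourhoods relative to
  \<open>q\<close>.\<close>

lemma nbhd_in_trans:
  assumes "nbhd_in U p x t" "nbhd_in (level p) q x t" shows "nbhd_in U q x t"
proof -
  obtain m e where me: "0 < e" "\<forall>y\<in>cyl N x m. \<forall>s. (y, s) \<in> level p \<and> dist s t < e \<longrightarrow> (y, s) \<in> U"
    using assms(1) unfolding nbhd_in_def by blast
  obtain n d where nd: "0 < d" "\<forall>y\<in>cyl N x n. \<forall>s. (y, s) \<in> level q \<and> dist s t < d \<longrightarrow> (y, s) \<in> level p"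
    using assms(2) unfolding nbhd_in_def by blast
  show ?thesis
    unfolding nbhd_in_def
  proof (intro exI conjI ballI allI impI)
    show "0 < min e d" using me(1) nd(1) by simp
    fix y s assume y: "y \<in> cyl N x (max m n)" and s: "(y, s) \<in> level q \<and> dist s t < min e d"
    have "y \<in> cyl N x m" "y \<in> cyl N x n" using y cyl_antimono[of m "max m n" N x] cyl_antimono[of n "max m n" N x] by auto
    then show "(y, s) \<in> U" using me(2) nd(2) s by simp
  qed
qed

lemma level_nbhd_Suc:
  assumes "(x, t) \<in> level p" shows "nbhd_in (level p) (Suc p) x t"
proof -
  have x: "x \<in> seqs N" "pw F x p t \<in> K" using assms by (auto simp: level_iff)
  have "openin (top_of_set K) (F (x p) ` K)" using open_images seqsD[OF x(1)] by blast
  moreover have "pw F x (Suc p) t \<in> F (x p) ` K" using x(2) by (simp add: pw_Suc)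
  ultimately obtain e where e: "0 < e" "\<And>k. k \<in> K \<Longrightarrow> dist k (pw F x (Suc p) t) < e \<Longrightarrow> k \<in> F (x p) ` K"
    by (metis openin_euclidean_subtopology_iff)
  have "(y, s) \<in> level p" if y: "y \<in> cyl N x (Suc p)" and s: "(y, s) \<in> level (Suc p)" "dist s t < e" for y s
  proof -
    have eq: "pw F y (Suc p) = pw F x (Suc p)" "pw F y p = pw F x p" using y by (auto intro: pw_cyl)
    have "dist (pw F x (Suc p) s) (pw F x (Suc p) t) < e"
      using pw_nonexpansive[OF x(1), of "Suc p" s t] s(2) by linarith
    then have "pw F x (Suc p) s \<in> F (x p) ` K" using e(2) s(1) eq by (simp add: level_iff)
    then have "pw F x p s \<in> K" using inj_F[OF seqsD[OF x(1)]] by (auto simp: pw_Suc dest: injD)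
    then show ?thesis using s(1) eq by (simp add: level_iff)
  qed
  then show ?thesis unfolding nbhd_in_def using e(1) by (intro exI[of _ "Suc p"] exI[of _ e]) blast
qed

lemma level_nbhd:
  assumes "(x, t) \<in> level p" shows "nbhd_in (level p) q x t"
proof (cases "q \<le> p")
  case True
  then show ?thesis unfolding nbhd_in_def using level_mono[OF True] by (intro exI[of _ 0] exI[of _ 1]) auto
next
  case False
  then have "p \<le> q" by simp
  then show ?thesis
  proof (induction q rule: dec_induct)
    case base
    show ?case unfolding nbhd_in_def by (intro exI[of _ 0] exI[of _ 1]) auto
  next
    case (step q)
    have "(x, t) \<in> level q" using assms level_mono[OF step.hyps(1)] by blast
    then show ?case using nbhd_in_trans[OF step.IH level_nbhd_Suc] by blast
  qed
qed

text \<open>The inductive limit asks for openness on every level. Because each level is open in all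
  others above it, one level containing the point is enough.\<close>

lemma openin_L:
  "openin L U \<longleftrightarrow> U \<subseteq> topspace L \<and> (\<forall>x t. (x, t) \<in> U \<longrightarrow> (\<exists>p. (x, t) \<in> level p \<and> nbhd_in U p x t))"
proof
  assume "openin L U"
  then have U: "U \<subseteq> topspace L" "\<forall>n. openin (bundle_level_top N F K n) (U \<inter> level n)"
    by (auto simp: openin_bundle_top topspace_L)
  then show "U \<subseteq> topspace L \<and> (\<forall>x t. (x, t) \<in> U \<longrightarrow> (\<exists>p. (x, t) \<in> level p \<and> nbhd_in U p x t))"
    unfolding openin_level_top topspace_L by blast
next
  assume U: "U \<subseteq> topspace L \<and> (\<forall>x t. (x, t) \<in> U \<longrightarrow> (\<exists>p. (x, t) \<in> level p \<and> nbhd_in U p x t))"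
  have "nbhd_in U q x t" if h: "(x, t) \<in> U \<inter> level q" for q x t
  proof -
    obtain p where "(x, t) \<in> level p" "nbhd_in U p x t" using U h by blast
    then show ?thesis using nbhd_in_trans level_nbhd by blast
  qed
  then show "openin L U" using U unfolding openin_bundle_top openin_level_top topspace_L by blast
qed

lemma openin_L_nbhd: "openin L U \<Longrightarrow> (x, t) \<in> U \<Longrightarrow> (x, t) \<in> level q \<Longrightarrow> nbhd_in U q x t"
  using openin_level_top[of q U] by (auto simp: openin_bundle_top)

lemma openin_L_prod:
  assumes "openin (prod_topology (seq_top N) euclidean) W" shows "openin L (W \<inter> topspace L)"
  unfolding openin_bundle_top
proof (intro conjI allI)
  show "W \<inter> topspace L \<subseteq> (\<Union>n. level n)" by (auto simp: topspace_L)
  fix n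
  have "W \<inter> topspace L \<inter> level n = W \<inter> level n" by (auto simp: topspace_L)
  then show "openin (bundle_level_top N F K n) (W \<inter> topspace L \<inter> level n)"
    using assms by (simp add: bundle_level_top_def openin_subtopology_Int)
qed

lemma openin_level: "openin L (level p)"
  unfolding openin_L using level_nbhd by (auto simp: topspace_L)

section \<open>The bundle shift is a local homeomorphism\<close>

lemma bundle_shift_level: "x \<in> seqs N \<Longrightarrow> bundle_shift F (x, t) \<in> level n \<longleftrightarrow> (x, t) \<in> level (Suc n)"
  by (simp add: bundle_shift_def level_iff pw_Suc_shift seq_shift_seqs)

lemma continuous_bundle_shift: "continuous_map L L (bundle_shift F)"
proof (rule continuous_mapI_nbhd)
  fix z assume z: "z \<in> topspace L"
  obtain x t where xt: "z = (x, t)" by (cases z)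
  have x: "x \<in> seqs N" using z topspace_L_fst by (simp add: xt)
  obtain q where "(x, t) \<in> level q" using z by (auto simp: topspace_L xt)
  \<comment> \<open>The shift lowers the level by one, so the source is considered one level higher
    than its image.\<close>
  then have q: "(x, t) \<in> level (Suc q)" using level_mono[of q "Suc q"] by auto
  then have q': "bundle_shift F (x, t) \<in> level q" using bundle_shift_level[OF x] by blast
  then show "bundle_shift F z \<in> topspace L" by (auto simp: topspace_L xt)
  fix V assume V: "openin L V" "bundle_shift F z \<in> V"
  obtain x' t' where x't': "bundle_shift F (x, t) = (x', t')" by (cases "bundle_shift F (x, t)")
  have e': "x' = seq_shift x" "t' = F (x 0) t" using x't' by (auto simp: bundle_shift_def)
  have "nbhd_in V q x' t'" using openin_L_nbhd[OF V(1), of x' t' q] V(2) q' by (simp add: xt x't')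
  then obtain m e where me: "0 < e" "\<forall>y\<in>cyl N x' m. \<forall>s. (y, s) \<in> level q \<and> dist s t' < e \<longrightarrow> (y, s) \<in> V"
    unfolding nbhd_in_def by blast
  let ?T = "(cyl N x (Suc m) \<times> ball t e) \<inter> topspace L \<inter> level (Suc q)"
  have "openin (prod_topology (seq_top N) euclidean) (cyl N x (Suc m) \<times> ball t e)"
    by (simp add: openin_prod_Times_iff openin_cyl)
  then have "openin L ?T" by (intro openin_Int openin_L_prod openin_level)
  moreover have "z \<in> ?T" using z me(1) q cyl_refl[OF x] by (simp add: xt)
  moreover have "bundle_shift F ` ?T \<subseteq> V"
  proof
    fix w assume "w \<in> bundle_shift F ` ?T"
    then obtain y s where ys: "w = bundle_shift F (y, s)" "y \<in> cyl N x (Suc m)" "dist s t < e" "(y, s) \<in> level (Suc q)"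
      by (auto simp: dist_commute)
    have y: "y \<in> seqs N" "y 0 = x 0" "seq_shift y \<in> cyl N x' m"
      using ys(2) by (auto simp: cyl_def e' seq_shift_def seqs_def)
    have "dist (F (x 0) s) t' < e" using F_nonexpansive[OF seqsD[OF x], of 0 s t] ys(3) by (simp add: e')
    moreover have "(seq_shift y, F (x 0) s) \<in> level q"
      using bundle_shift_level[OF y(1), of s q] ys(4) y(2) by (simp add: bundle_shift_def)
    ultimately have "(seq_shift y, F (x 0) s) \<in> V" using me(2) y(3) by blast
    then show "w \<in> V" using y(2) by (simp add: ys(1) bundle_shift_def)
  qed
  ultimately show "\<exists>T. openin L T \<and> z \<in> T \<and> bundle_shift F ` T \<subseteq> V" by blast
qed

text \<open>A point near the image is lifted by putting the first letter of \<open>x\<close> in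
  front and choosing a preimage under \<open>F (x 0)\<close>, which is surjective. The lower
  Lipschitz bound \<open>r\<close> keeps the lifted point within \<open>e\<close> if the given one
  is within \<open>r * e\<close>.\<close>

lemma open_bundle_shift: "open_map L L (bundle_shift F)"
  unfolding open_map_def
proof (intro allI impI)
  fix U assume U: "openin L U"
  show "openin L (bundle_shift F ` U)"
    unfolding openin_L
  proof (intro conjI allI impI)
    show "bundle_shift F ` U \<subseteq> topspace L"
      using openin_subset[OF U] continuous_bundle_shift by (auto simp: continuous_map_def)
    fix x' t' assume "(x', t') \<in> bundle_shift F ` U"
    then obtain x t where xt: "(x, t) \<in> U" "bundle_shift F (x, t) = (x', t')" by auto
    have in_L: "(x, t) \<in> topspace L" using openin_subset[OF U] xt(1) by blast
    have x: "x \<in> seqs N" by (rule topspace_L_fst[OF in_L])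
    have e': "x' = seq_shift x" "t' = F (x 0) t" using xt(2) by (auto simp: bundle_shift_def)
    obtain q where "(x, t) \<in> level q" using in_L by (auto simp: topspace_L)
    then have q: "(x, t) \<in> level (Suc q)" using level_mono[of q "Suc q"] by auto
    then have q': "(x', t') \<in> level q" using bundle_shift_level[OF x, of t q] xt(2) by simp
    obtain m e where me: "0 < e" "\<forall>y\<in>cyl N x m. \<forall>s. (y, s) \<in> level (Suc q) \<and> dist s t < e \<longrightarrow> (y, s) \<in> U"
      using openin_L_nbhd[OF U xt(1) q] unfolding nbhd_in_def by blast
    obtain r where r: "0 < r" "\<forall>t t'. r * dist t t' \<le> dist (F (x 0) t) (F (x 0) t')"
      using F_lipschitz[OF seqsD[OF x, of 0]] by blast
    have "(y', s') \<in> bundle_shift F ` U" if y': "y' \<in> cyl N x' m" and s': "(y', s') \<in> level q" "dist s' t' < r * e" for y' s'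
    proof -
      define y where "y i = (case i of 0 \<Rightarrow> x 0 | Suc j \<Rightarrow> y' j)" for i
      have y: "y \<in> seqs N" "y \<in> cyl N x m" "seq_shift y = y'" "y 0 = x 0"
        using y' seqsD[OF x, of 0] by (auto simp: y_def seqs_def cyl_def e' seq_shift_def split: nat.splits)
      obtain s where s: "s' = F (x 0) s" using surj_F seqsD[OF x, of 0] by (metis surjD)
      have sh: "bundle_shift F (y, s) = (y', s')" using y(3,4) s by (simp add: bundle_shift_def)
      have "r * dist s t \<le> dist s' t'" using r(2) by (simp add: s e')
      then have "r * dist s t < r * e" using s'(2) by linarith
      then have "dist s t < e" using r(1) by simp
      moreover have "(y, s) \<in> level (Suc q)" using bundle_shift_level[OF y(1), of s q] s'(1) sh by simp
      ultimately have "(y, s) \<in> U" using me(2) y(2) by blast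
      then show ?thesis using sh by force
    qed
    then have "nbhd_in (bundle_shift F ` U) q x' t'"
      unfolding nbhd_in_def using me(1) r(1) by (intro exI[of _ m] exI[of _ "r * e"]) auto
    then show "\<exists>p. (x', t') \<in> level p \<and> nbhd_in (bundle_shift F ` U) p x' t'" using q' by blast
  qed
qed

lemma openin_L_cyl: "openin L ((cyl N x m \<times> UNIV) \<inter> topspace L)"
  by (rule openin_L_prod) (simp add: openin_prod_Times_iff openin_cyl)

lemma bundle_shift_inj: "inj_on (bundle_shift F) ((cyl N x 1 \<times> UNIV) \<inter> topspace L)"
proof (rule inj_onI)
  fix a b assume ab: "a \<in> (cyl N x 1 \<times> UNIV) \<inter> topspace L" "b \<in> (cyl N x 1 \<times> UNIV) \<inter> topspace L" "bundle_shift F a = bundle_shift F b"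
  obtain y s y' s' where eq: "a = (y, s)" "b = (y', s')" by (cases a; cases b)
  have y: "y \<in> seqs N" "y 0 = y' 0" using ab(1,2) by (auto simp: eq cyl_def)
  have sh: "seq_shift y = seq_shift y'" "F (y 0) s = F (y 0) s'" using ab(3) y(2) by (auto simp: eq bundle_shift_def)
  have "y i = y' i" for i
    using y(2) fun_cong[OF sh(1), of "i - 1"] by (cases i) (auto simp: seq_shift_def)
  moreover have "s = s'" using sh(2) inj_F[OF seqsD[OF y(1)]] by (auto dest: injD)
  ultimately show "a = b" by (auto simp: eq)
qed

section \<open>Separation and clopen neighbourhoods in the bundle\<close>

lemma Hausdorff_L: "Hausdorff_space L"
  unfolding Hausdorff_space_def
proof (intro allI impI, elim conjE)
  fix a b assume ab: "a \<in> topspace L" "b \<in> topspace L" "a \<noteq> b"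
  obtain x t y s where eq: "a = (x, t)" "b = (y, s)" by (cases a; cases b)
  have xy: "x \<in> seqs N" "y \<in> seqs N" using topspace_L_fst[of x t] topspace_L_fst[of y s] ab by (simp_all add: eq)
  show "\<exists>U V. openin L U \<and> openin L V \<and> a \<in> U \<and> b \<in> V \<and> disjnt U V"
  proof (cases "x = y")
    case False
    then obtain i where "x i \<noteq> y i" by (auto simp: fun_eq_iff)
    then have "cyl N x (Suc i) \<inter> cyl N y (Suc i) = {}" by (auto simp: cyl_def)
    then have "disjnt ((cyl N x (Suc i) \<times> UNIV) \<inter> topspace L) ((cyl N y (Suc i) \<times> UNIV) \<inter> topspace L)"
      unfolding disjnt_def by blast
    moreover have "a \<in> (cyl N x (Suc i) \<times> UNIV) \<inter> topspace L" "b \<in> (cyl N y (Suc i) \<times> UNIV) \<inter> topspace L"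
      using ab xy by (simp_all add: eq cyl_refl)
    ultimately show ?thesis using openin_L_cyl by blast
  next
    case True
    then have "t \<noteq> s" using ab(3) by (simp add: eq)
    then obtain A B where AB: "open A" "open B" "t \<in> A" "s \<in> B" "A \<inter> B = {}" using hausdorff[of t s] by auto
    have "openin L ((seqs N \<times> A) \<inter> topspace L)" "openin L ((seqs N \<times> B) \<inter> topspace L)"
      using AB(1,2) openin_topspace[of "seq_top N"]
      by (intro openin_L_prod; simp add: openin_prod_Times_iff topspace_seq_top)+
    moreover have "disjnt ((seqs N \<times> A) \<inter> topspace L) ((seqs N \<times> B) \<inter> topspace L)"
      unfolding disjnt_def using AB(5) by blast
    moreover have "a \<in> (seqs N \<times> A) \<inter> topspace L" "b \<in> (seqs N \<times> B) \<inter> topspace L"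
      using ab xy AB by (simp_all add: eq)
    ultimately show ?thesis by blast
  qed
qed

text \<open>By induction the sets obtained are images of \<open>K\<close> under compositions of
  \<open>n\<close> of the maps; their diameters shrink by the largest contraction ratio
  \<open>\<rho>\<close> at each step, starting from the bound \<open>D\<close> for
  \<open>K\<close>.\<close>

lemma K_clopen_small:
  assumes "0 < e" "k \<in> K"
  shows "\<exists>C. k \<in> C \<and> C \<subseteq> K \<and> compact C \<and> openin (top_of_set K) C \<and> (\<forall>a\<in>C. \<forall>b\<in>C. dist a b < e)"
proof -
  have "\<forall>i\<in>{1..N}. \<exists>R. 0 \<le> R \<and> R < 1 \<and> (\<forall>t t'. dist (F i t) (F i t') \<le> R * dist t t')"
  proof
    fix i assume "i \<in> {1..N}"
    then show "\<exists>R. 0 \<le> R \<and> R < 1 \<and> (\<forall>t t'. dist (F i t) (F i t') \<le> R * dist t t')"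
      using F_lipschitz by blast
  qed
  then obtain R where R: "\<forall>i\<in>{1..N}. 0 \<le> R i \<and> R i < 1 \<and> (\<forall>t t'. dist (F i t) (F i t') \<le> R i * dist t t')"
    by (rule bchoice[THEN exE])
  define \<rho> where "\<rho> = Max (R ` {1..N})"
  have ne: "R ` {1..N} \<noteq> {}" using N by auto
  have \<rho>: "R i \<le> \<rho>" if "i \<in> {1..N}" for i using that by (simp add: \<rho>_def)
  have "\<rho> \<in> R ` {1..N}" unfolding \<rho>_def by (rule Max_in) (use ne in auto)
  then have \<rho>01: "0 \<le> \<rho>" "\<rho> < 1" using R by auto
  obtain D where D: "\<And>a b. a \<in> K \<Longrightarrow> b \<in> K \<Longrightarrow> dist a b \<le> D"
    using compact_imp_bounded[OF K(1)] by (auto simp: bounded_two_points)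
  have "\<exists>C. k \<in> C \<and> C \<subseteq> K \<and> compact C \<and> openin (top_of_set K) C \<and> (\<forall>a\<in>C. \<forall>b\<in>C. dist a b \<le> \<rho> ^ n * D)"
    if "k \<in> K" for n k
    using that
  proof (induction n arbitrary: k)
    case 0
    then show ?case using K(1) D by (intro exI[of _ K]) auto
  next
    case (Suc n)
    obtain i k' where i: "i \<in> {1..N}" "k' \<in> K" "k = F i k'" using Suc.prems K(3) by blast
    obtain C where C: "k' \<in> C" "C \<subseteq> K" "compact C" "openin (top_of_set K) C" "\<forall>a\<in>C. \<forall>b\<in>C. dist a b \<le> \<rho> ^ n * D"
      using Suc.IH[OF i(2)] by blast
    have cont: "continuous_on UNIV (F i)"
      by (rule continuous_on_nonexpansive[OF F_nonexpansive[OF i(1)]])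
    have "openin (top_of_set K) (F i ` C)"
    proof -
      \<comment> \<open>Openness in \<open>K\<close> is inherited through the complement: removing
        the compact image of \<open>K - C\<close> from the open set \<open>F i\<close>
        K\<open>leaves exactly\<close>F i \<open>C\<close>, by injectivity.\<close>
      have "compact (F i ` (K - C))"
      proof (rule compact_continuous_image)
        show "continuous_on (K - C) (F i)" by (rule continuous_on_subset[OF cont]) simp
        have "closedin (top_of_set K) (K - C)" using C(2,4) by (simp add: closedin_def double_diff)
        then show "compact (K - C)" using K(1) closedin_compact by blast
      qed
      then have "closedin (top_of_set K) (F i ` (K - C))"
        using F_K[OF i(1)] by (intro closed_subset compact_imp_closed) auto
      then have "openin (top_of_set K) (K - F i ` (K - C))"
        using openin_diff[of "top_of_set K" K] by simp
      moreover have "openin (top_of_set K) (F i ` K)" using open_images i(1) by blast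
      ultimately have "openin (top_of_set K) (F i ` K \<inter> (K - F i ` (K - C)))" by (rule openin_Int[rotated])
      moreover have "F i ` K \<inter> (K - F i ` (K - C)) = F i ` C"
      proof -
        have "F i ` (K - C) = F i ` K - F i ` C"
          using inj_F[OF i(1)] by (simp add: image_set_diff)
        then show ?thesis using C(2) F_K[OF i(1)] by blast
      qed
      ultimately show ?thesis by simp
    qed
    moreover have "dist a b \<le> \<rho> ^ Suc n * D" if ab: "a \<in> F i ` C" "b \<in> F i ` C" for a b
    proof -
      obtain a' b' where a'b': "a' \<in> C" "b' \<in> C" "a = F i a'" "b = F i b'" using ab by blast
      have "dist a b \<le> R i * dist a' b'" using R i(1) by (simp add: a'b')
      also have "\<dots> \<le> \<rho> * dist a' b'" using \<rho>[OF i(1)] by (simp add: mult_right_mono)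
      also have "\<dots> \<le> \<rho> * (\<rho> ^ n * D)" using C(5) a'b' \<rho>01 by (intro mult_left_mono) auto
      finally show ?thesis by (simp add: mult.assoc)
    qed
    moreover have "F i ` C \<subseteq> K" "k \<in> F i ` C" using C(1,2) F_K[OF i(1)] i(3) by auto
    moreover have "compact (F i ` C)"
      by (rule compact_continuous_image[OF continuous_on_subset[OF cont] C(3)]) simp
    ultimately show ?case by (intro exI[of _ "F i ` C"]) blast
  qed
  note small = this[OF assms(2)]
  have "(\<lambda>n. \<rho> ^ n * D) \<longlonglongrightarrow> 0 * D"
    by (intro tendsto_mult LIMSEQ_realpow_zero \<rho>01 tendsto_const)
  then have "(\<lambda>n. \<rho> ^ n * D) \<longlonglongrightarrow> 0" by simp
  from order_tendstoD(2)[OF this assms(1)] obtain n where n: "\<rho> ^ n * D < e"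
    by (auto simp: eventually_sequentially)
  obtain C where "k \<in> C" "C \<subseteq> K" "compact C" "openin (top_of_set K) C" "\<forall>a\<in>C. \<forall>b\<in>C. dist a b \<le> \<rho> ^ n * D"
    using small[of n] by blast
  moreover from this(5) have "\<forall>a\<in>C. \<forall>b\<in>C. dist a b < e" using n by (meson order_le_less_trans)
  ultimately show ?thesis by blast
qed

text \<open>A small clopen piece \<open>C\<close> of \<open>K\<close> is pulled back along one word
  map over a cylinder. The result is open because \<open>C\<close> is open in \<open>K\<close>, and
  closed because \<open>C\<close> is compact and hence closed in the whole metric space.\<close>

lemma clopen_base_L:
  assumes U: "openin L U" and "z \<in> U"
  shows "\<exists>V. openin L V \<and> closedin L V \<and> z \<in> V \<and> V \<subseteq> U"
proof -
  obtain x t where xt: "z = (x, t)" by (cases z)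
  have in_L: "(x, t) \<in> topspace L" using openin_subset[OF U] assms(2) by (auto simp: xt)
  have x: "x \<in> seqs N" by (rule topspace_L_fst[OF in_L])
  obtain p where p: "(x, t) \<in> level p" using in_L by (auto simp: topspace_L)
  have "nbhd_in U p x t" using openin_L_nbhd[OF U _ p] assms(2) by (simp add: xt)
  then obtain m e where me: "0 < e" "\<forall>y\<in>cyl N x m. \<forall>s. (y, s) \<in> level p \<and> dist s t < e \<longrightarrow> (y, s) \<in> U"
    unfolding nbhd_in_def by blast
  obtain r where r: "r > 0" "\<forall>t t'. r * dist t t' \<le> dist (pw F x p t) (pw F x p t')" using pw_expansive[OF x, of p] by blast
  have pK: "pw F x p t \<in> K" using p by (simp add: level_iff)
  \<comment> \<open>The word map may shrink distances, but not by more than the factor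
    \<open>r\<close>, so diameter below \<open>r * e\<close> downstairs means distance below
    \<open>e\<close> upstairs.\<close>
  have re: "0 < r * e" using r(1) me(1) by simp
  obtain C where C: "pw F x p t \<in> C" "C \<subseteq> K" "compact C" "openin (top_of_set K) C" "\<forall>a\<in>C. \<forall>b\<in>C. dist a b < r * e"
    using K_clopen_small[OF re pK] by blast
  \<comment> \<open>The cylinder must be long enough to lie in the given neighbourhood and to fix
    the first \<open>p\<close> letters, so that all its points have the same word map of length
    \<open>p\<close>.\<close>
  define M where "M = max m p"
  define V where "V = {(y, s) \<in> topspace L. y \<in> cyl N x M \<and> pw F x p s \<in> C}"
  have V_level: "(y, s) \<in> level p" if "(y, s) \<in> V" for y s
  proof -
    have "y \<in> cyl N x M" "pw F x p s \<in> C" using that by (auto simp: V_def)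
    moreover from this(1) have "pw F y p = pw F x p" by (rule pw_cyl) (simp add: M_def)
    moreover have "y \<in> seqs N" using \<open>y \<in> cyl N x M\<close> by (simp add: cyl_def)
    ultimately show ?thesis using C(2) by (auto simp: level_iff)
  qed
  have "openin L V"
    unfolding openin_L
  proof (intro conjI allI impI)
    show "V \<subseteq> topspace L" by (auto simp: V_def)
    fix y s assume ys: "(y, s) \<in> V"
    then have y: "y \<in> cyl N x M" "pw F x p s \<in> C" by (auto simp: V_def)
    obtain d where d: "0 < d" "\<forall>k\<in>K. dist k (pw F x p s) < d \<longrightarrow> k \<in> C"
      using openin_euclidean_subtopology_iff[THEN iffD1, OF C(4)] y(2) by blast
    have "(y', s') \<in> V" if y': "y' \<in> cyl N y M" and s': "(y', s') \<in> level p" "dist s' s < d" for y' s'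
    proof -
      have y'x: "y' \<in> cyl N x M" using y' cyl_eq[OF y(1)] by simp
      then have "pw F y' p = pw F x p" by (rule pw_cyl) (simp add: M_def)
      then have "pw F x p s' \<in> K" using s'(1) by (simp add: level_iff)
      moreover have "dist (pw F x p s') (pw F x p s) < d" using pw_nonexpansive[OF x, of p s' s] s'(2) by linarith
      ultimately have "pw F x p s' \<in> C" using d(2) by blast
      moreover have "(y', s') \<in> topspace L" using s'(1) topspace_L by blast
      ultimately show ?thesis using y'x by (simp add: V_def)
    qed
    then have "nbhd_in V p y s" unfolding nbhd_in_def using d(1) by blast
    then show "\<exists>p. (y, s) \<in> level p \<and> nbhd_in V p y s" using V_level[OF ys] by blast
  qed
  moreover have "closedin L V"
  proof -
    have cont: "continuous_on UNIV (pw F x p)"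
      by (rule continuous_on_nonexpansive[OF pw_nonexpansive[OF x]])
    have "open (- C)" using compact_imp_closed[OF C(3)] by (simp add: closed_def)
    then have o: "open {s. pw F x p s \<notin> C}"
      using open_vimage[OF \<open>open (- C)\<close> cont] by (simp add: vimage_def)
    have "openin L ((seqs N \<times> {s. pw F x p s \<notin> C}) \<inter> topspace L)"
      using o openin_topspace[of "seq_top N"] by (intro openin_L_prod) (simp add: openin_prod_Times_iff topspace_seq_top)
    moreover have "openin L (((seqs N - cyl N x M) \<times> UNIV) \<inter> topspace L)"
    proof (rule openin_L_prod)
      have "openin (seq_top N) (seqs N - cyl N x M)"
        unfolding openin_seq_top
      proof (intro conjI ballI)
        fix y assume "y \<in> seqs N - cyl N x M"
        then have "cyl N y M \<subseteq> seqs N - cyl N x M" by (auto simp: cyl_def)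
        then show "\<exists>n. cyl N y n \<subseteq> seqs N - cyl N x M" ..
      qed auto
      then show "openin (prod_topology (seq_top N) euclidean) ((seqs N - cyl N x M) \<times> UNIV)"
        by (simp add: openin_prod_Times_iff)
    qed
    ultimately have "openin L (((seqs N \<times> {s. pw F x p s \<notin> C}) \<inter> topspace L) \<union> (((seqs N - cyl N x M) \<times> UNIV) \<inter> topspace L))"
      by (rule openin_Un)
    moreover have "((seqs N \<times> {s. pw F x p s \<notin> C}) \<inter> topspace L) \<union> (((seqs N - cyl N x M) \<times> UNIV) \<inter> topspace L) = topspace L - V"
    proof (intro equalityI subsetI)
      fix v assume v: "v \<in> topspace L - V"
      obtain y s where ys: "v = (y, s)" by (cases v)
      have "y \<in> seqs N" using v topspace_L_fst[of y s] by (simp add: ys)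
      then show "v \<in> ((seqs N \<times> {s. pw F x p s \<notin> C}) \<inter> topspace L) \<union> (((seqs N - cyl N x M) \<times> UNIV) \<inter> topspace L)"
        using v by (simp add: V_def ys) blast
    qed (auto simp: V_def)
    ultimately have "openin L (topspace L - V)" by (simp only:)
    moreover have "V \<subseteq> topspace L" by (auto simp: V_def)
    ultimately show ?thesis by (simp add: closedin_def)
  qed
  moreover have "z \<in> V" using in_L C(1) cyl_refl[OF x] by (simp add: V_def xt)
  moreover have "V \<subseteq> U"
  proof
    fix v assume v: "v \<in> V"
    obtain y s where ys: "v = (y, s)" by (cases v)
    have y: "y \<in> cyl N x m" "pw F x p s \<in> C"
      using v cyl_antimono[of m M N x] by (auto simp: V_def ys M_def)
    have "r * dist s t \<le> dist (pw F x p s) (pw F x p t)" using r(2) by blast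
    also have "\<dots> < r * e" using C(1,5) y(2) by blast
    finally have "dist s t < e" using r(1) by simp
    then show "v \<in> U" using me(2) y(1) V_level v by (simp add: ys)
  qed
  ultimately show ?thesis by blast
qed

lemma L_nonempty: "topspace L \<noteq> {}"
proof -
  obtain k where "k \<in> K" using K(2) by blast
  then have "((\<lambda>_. 1), k) \<in> level 0" using N by (simp add: level_iff seqs_def)
  then show ?thesis by (auto simp: topspace_L)
qed

lemma local_homeo_L: "local_homeo_zero_dim L (bundle_shift F)"
proof
  fix z assume z: "z \<in> topspace L"
  obtain x t where xt: "z = (x, t)" by (cases z)
  have "z \<in> (cyl N x 1 \<times> UNIV) \<inter> topspace L" using z cyl_refl topspace_L_fst by (auto simp: xt)
  then show "\<exists>U. openin L U \<and> z \<in> U \<and> inj_on (bundle_shift F) U"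
    using openin_L_cyl bundle_shift_inj by blast
qed (fact Hausdorff_L L_nonempty continuous_bundle_shift open_bundle_shift clopen_base_L)+

end

section \<open>The canonical action\<close>

lemma continuous_seq_shift: "continuous_map (seq_top N) (seq_top N) seq_shift"
proof (rule continuous_mapI_nbhd)
  fix x assume "x \<in> topspace (seq_top N)"
  then have x: "x \<in> seqs N" by (simp add: topspace_seq_top)
  then show "seq_shift x \<in> topspace (seq_top N)" by (simp add: topspace_seq_top seq_shift_seqs)
  fix V assume "openin (seq_top N) V" "seq_shift x \<in> V"
  then obtain n where n: "cyl N (seq_shift x) n \<subseteq> V" unfolding openin_seq_top by blast
  have "seq_shift ` cyl N x (Suc n) \<subseteq> cyl N (seq_shift x) n"
    by (auto simp: cyl_def seq_shift_def seqs_def)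
  then show "\<exists>T. openin (seq_top N) T \<and> x \<in> T \<and> seq_shift ` T \<subseteq> V"
    using n openin_cyl[of N x "Suc n"] cyl_refl[OF x, of "Suc n"] by blast
qed

lemma open_seq_shift: "open_map (seq_top N) (seq_top N) seq_shift"
  unfolding open_map_def
proof (intro allI impI)
  fix U assume U: "openin (seq_top N) U"
  show "openin (seq_top N) (seq_shift ` U)"
    unfolding openin_seq_top
  proof (intro conjI ballI)
    show "seq_shift ` U \<subseteq> seqs N" using U by (auto simp: openin_seq_top seq_shift_seqs)
    fix x' assume "x' \<in> seq_shift ` U"
    then obtain x where x: "x \<in> U" "x' = seq_shift x" by blast
    then obtain n where n: "cyl N x n \<subseteq> U" using U unfolding openin_seq_top by blast
    have xs: "x \<in> seqs N" using U x(1) by (auto simp: openin_seq_top)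
    have "y' \<in> seq_shift ` U" if y': "y' \<in> cyl N x' n" for y'
    proof -
      define y where "y i = (case i of 0 \<Rightarrow> x 0 | Suc j \<Rightarrow> y' j)" for i
      have "y \<in> cyl N x n" "seq_shift y = y'"
        using y' xs by (auto simp: y_def seqs_def cyl_def x(2) seq_shift_def split: nat.splits)
      then show ?thesis using n by blast
    qed
    then show "\<exists>n. cyl N x' n \<subseteq> seq_shift ` U" by blast
  qed
qed

lemma local_homeo_seq:
  assumes "1 \<le> N" shows "local_homeo_zero_dim (seq_top N) seq_shift"
proof
  have closed_cyl: "closedin (seq_top N) (cyl N x n)" for x n
  proof -
    have "openin (seq_top N) (seqs N - cyl N x n)"
      unfolding openin_seq_top
    proof (intro conjI ballI)
      fix y assume "y \<in> seqs N - cyl N x n"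
      then have "cyl N y n \<subseteq> seqs N - cyl N x n" by (auto simp: cyl_def)
      then show "\<exists>m. cyl N y m \<subseteq> seqs N - cyl N x n" ..
    qed auto
    then show ?thesis by (simp add: closedin_def topspace_seq_top) (auto simp: cyl_def)
  qed
  show "Hausdorff_space (seq_top N)"
    unfolding Hausdorff_space_def
  proof (intro allI impI, elim conjE)
    fix x y assume xy: "x \<in> topspace (seq_top N)" "y \<in> topspace (seq_top N)" "x \<noteq> y"
    then obtain i where "x i \<noteq> y i" by (auto simp: fun_eq_iff)
    then have "disjnt (cyl N x (Suc i)) (cyl N y (Suc i))" by (auto simp: cyl_def disjnt_iff)
    moreover have "x \<in> cyl N x (Suc i)" "y \<in> cyl N y (Suc i)" using xy by (simp_all add: topspace_seq_top cyl_refl)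
    ultimately show "\<exists>U V. openin (seq_top N) U \<and> openin (seq_top N) V \<and> x \<in> U \<and> y \<in> V \<and> disjnt U V"
      using openin_cyl[of N x "Suc i"] openin_cyl[of N y "Suc i"] by blast
  qed
  have "(\<lambda>_. 1) \<in> seqs N" using assms by (simp add: seqs_def)
  then show "topspace (seq_top N) \<noteq> {}" unfolding topspace_seq_top by blast
  show "\<exists>U. openin (seq_top N) U \<and> x \<in> U \<and> inj_on seq_shift U" if "x \<in> topspace (seq_top N)" for x
  proof -
    have "inj_on seq_shift (cyl N x 1)"
    proof (rule inj_onI)
      fix y y' assume h: "y \<in> cyl N x 1" "y' \<in> cyl N x 1" "seq_shift y = seq_shift y'"
      have "y i = y' i" for i
        using h(1,2) fun_cong[OF h(3), of "i - 1"] by (cases i) (auto simp: seq_shift_def cyl_def)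
      then show "y = y'" by (simp add: fun_eq_iff)
    qed
    moreover have "x \<in> cyl N x 1" using that by (simp add: topspace_seq_top cyl_refl)
    ultimately show ?thesis using openin_cyl[of N x 1] by blast
  qed
  show "\<exists>V. openin (seq_top N) V \<and> closedin (seq_top N) V \<and> x \<in> V \<and> V \<subseteq> U"
    if U: "openin (seq_top N) U" "x \<in> U" for U x
  proof -
    obtain n where "cyl N x n \<subseteq> U" using U unfolding openin_seq_top by blast
    moreover have "x \<in> cyl N x n" using U by (auto simp: openin_seq_top intro!: cyl_refl)
    ultimately show ?thesis using openin_cyl[of N x n] closed_cyl[of x n] by blast
  qed
qed (fact continuous_seq_shift open_seq_shift)+

lemma pw_add: "pw F x (m + j) t = pw F ((seq_shift ^^ m) x) j (pw F x m t)"
  by (induction j) (simp_all add: pw_Suc seq_shift_pow add.commute)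

context fractafold_bundle
begin

text \<open>The levels form an increasing open cover, so a finite subcover is contained in its
  largest member.\<close>

lemma compactin_level:
  assumes "compactin L C" shows "\<exists>n. C \<subseteq> level n"
proof -
  have "C \<subseteq> \<Union>(range level)" using compactin_subset_topspace[OF assms] by (simp add: topspace_L)
  moreover have "openin L U" if "U \<in> range level" for U using that openin_level by auto
  ultimately obtain \<F> where \<F>: "finite \<F>" "\<F> \<subseteq> range level" "C \<subseteq> \<Union>\<F>"
    using compactinD[OF assms, of "range level"] by metis
  obtain I where I: "finite I" "\<F> = level ` I" using \<F>(1,2) by (meson finite_subset_image)
  have "level i \<subseteq> level (Max I)" if "i \<in> I" for i using that I(1) by (intro level_mono) simp
  then have "C \<subseteq> level (Max I)" using \<F>(3) I(2) by blast
  then show ?thesis ..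
qed

lemma cylinder_fibre_open:
  assumes "\<omega> \<in> words N n" shows "openin L (cylinder N \<omega> \<times> bundle_fibre F K \<omega>)"
proof -
  have "openin (seq_top N) (cylinder N \<omega>)"
    unfolding seq_top_def by (rule topology_generated_by_Basis) (use assms in blast)
  then have "openin L ((cylinder N \<omega> \<times> UNIV) \<inter> topspace L \<inter> level n)"
    by (intro openin_Int openin_level openin_L_prod) (simp add: openin_prod_Times_iff)
  moreover have "(cylinder N \<omega> \<times> UNIV) \<inter> topspace L \<inter> level n = cylinder N \<omega> \<times> bundle_fibre F K \<omega>"
  proof (intro equalityI subsetI)
    fix v assume v: "v \<in> (cylinder N \<omega> \<times> UNIV) \<inter> topspace L \<inter> level n"
    then obtain x t where xt: "v = (x, t)" "x \<in> cylinder N \<omega>" by (cases v) auto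
    obtain \<omega>' where \<omega>': "\<omega>' \<in> words N n" "x \<in> cylinder N \<omega>'" "t \<in> bundle_fibre F K \<omega>'"
      using v by (auto simp: bundle_level_def xt(1))
    have "\<omega>' = \<omega>" using cylinder_eq_cyl[OF assms xt(2)] cylinder_eq_cyl[OF \<omega>'(1,2)] by simp
    then show "v \<in> cylinder N \<omega> \<times> bundle_fibre F K \<omega>" using \<omega>' xt by simp
  next
    fix v assume v: "v \<in> cylinder N \<omega> \<times> bundle_fibre F K \<omega>"
    then have "v \<in> level n" using assms unfolding bundle_level_def by blast
    then show "v \<in> (cylinder N \<omega> \<times> UNIV) \<inter> topspace L \<inter> level n" using v topspace_L by auto
  qed
  ultimately show ?thesis by simp
qed

text \<open>There are finitely many words of length \<open>n\<close>, and each contributes an open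
  box whose measure is a product of two probabilities.\<close>

lemma level_finite:
  assumes \<mu>: "self_similar_measure N F K \<mu>" and \<mu>\<^sub>L: "fractafold_measure N F K \<mu> \<mu>\<^sub>L"
  shows "emeasure \<mu>\<^sub>L (level n) < \<infinity>"
proof -
  have sets: "openin L U \<Longrightarrow> U \<in> sets \<mu>\<^sub>L" for U
    using \<mu>\<^sub>L by (auto simp: fractafold_measure_def is_borel_measure_def intro: sigma_sets.Basic)
  have "prob_space \<mu>" using \<mu> by (simp add: self_similar_measure_def)
  moreover have "prob_space (uniform_seq_measure N)"
    unfolding uniform_seq_measure_def
    by (intro prob_space_PiM prob_space_uniform_count_measure) (use N in auto)
  ultimately have one: "emeasure \<mu>\<^sub>L (cylinder N \<omega> \<times> bundle_fibre F K \<omega>) \<le> 1" if \<omega>: "\<omega> \<in> words N n" for \<omega>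
  proof -
    let ?U = "cylinder N \<omega>" and ?A = "bundle_fibre F K \<omega>"
    have "emeasure \<mu>\<^sub>L (?U \<times> ?A) =
        emeasure (uniform_seq_measure N) ((seq_shift ^^ n) ` ?U) * emeasure \<mu> (word_map F \<omega> ` ?A)"
      using \<mu>\<^sub>L \<omega> sets[OF cylinder_fibre_open[OF \<omega>]] unfolding fractafold_measure_def by blast
    also have "\<dots> \<le> 1 * 1"
      by (intro mult_mono prob_space.emeasure_le_1) (fact | simp)+
    finally show ?thesis by simp
  qed
  have fin: "finite (words N n)"
    using finite_lists_length_eq[of "{1..N}" n] by (simp add: words_def conj_commute)
  have "emeasure \<mu>\<^sub>L (level n) \<le> (\<Sum>\<omega>\<in>words N n. emeasure \<mu>\<^sub>L (cylinder N \<omega> \<times> bundle_fibre F K \<omega>))"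
    unfolding bundle_level_def
    by (rule emeasure_subadditive_finite[OF fin]) (use sets cylinder_fibre_open in blast)
  also have "\<dots> \<le> (\<Sum>\<omega>\<in>words N n. 1)" by (rule sum_mono[OF one])
  also have "\<dots> < \<infinity>" by (simp add: ennreal_of_nat_eq_real_of_nat)
  finally show ?thesis .
qed

sublocale L: local_homeo_zero_dim L "bundle_shift F"
  by (rule local_homeo_L)

sublocale X: local_homeo_zero_dim "seq_top N" seq_shift
  by (rule local_homeo_seq[OF N])

text \<open>The levels are open, have finite measure and exhaust the bundle, which gives
  sigma-finiteness; a compact set lies in one level and so has finite measure.\<close>

lemma ample_groupoid_measure_L:
  assumes \<mu>: "self_similar_measure N F K \<mu>" and \<mu>\<^sub>L: "fractafold_measure N F K \<mu> \<mu>\<^sub>L"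
  shows "ample_groupoid_measure L.GY \<mu>\<^sub>L"
proof -
  have borel: "is_borel_measure L \<mu>\<^sub>L" using \<mu>\<^sub>L by (simp add: fractafold_measure_def)
  have sets: "openin L U \<Longrightarrow> U \<in> sets \<mu>\<^sub>L" for U
    using borel by (auto simp: is_borel_measure_def intro: sigma_sets.Basic)
  have sf: "sigma_finite_measure \<mu>\<^sub>L"
    unfolding sigma_finite_measure_def
    using sets[OF openin_level] level_finite[OF \<mu> \<mu>\<^sub>L] borel
    by (intro exI[of _ "range level"]) (auto simp: is_borel_measure_def topspace_L less_top[symmetric])
  have cf: "emeasure \<mu>\<^sub>L C < \<infinity>" if C: "compactin L C" for C
  proof -
    obtain n where "C \<subseteq> level n" using compactin_level[OF C] by blast
    then have "emeasure \<mu>\<^sub>L C \<le> emeasure \<mu>\<^sub>L (level n)" by (rule emeasure_mono) (rule sets[OF openin_level])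
    then show ?thesis using level_finite[OF \<mu> \<mu>\<^sub>L, of n] by (rule order_le_less_trans)
  qed
  show ?thesis
    by (intro ample_groupoid_measure.intro ample_groupoid_measure_axioms.intro L.ample_groupoid_GY sf)
       (use \<mu>\<^sub>L cf in \<open>simp_all add: fractafold_measure_def\<close>)
qed

section \<open>The action groupoid and its comparison with the groupoid of the bundle\<close>

lemma canonical_action_eq:
  assumes x: "x \<in> seqs N" and rel: "(seq_shift ^^ m) x = (seq_shift ^^ n) y" and t: "pw F x m t = pw F y n s"
  shows "canonical_action F (x, int m - int n, y) (y', s) = (x, t)"
proof -
  define P where "P = (\<lambda>(m', n'). int m - int n = int m' - int n' \<and> (seq_shift ^^ m') x = (seq_shift ^^ n') y)"
  obtain m' n' where mn': "(SOME p. P p) = (m', n')" by (cases "SOME p. P p")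
  have "P (SOME p. P p)" by (rule someI[of P "(m, n)"]) (simp add: P_def rel)
  then have "P (m', n')" by (simp only: mn')
  then have k: "int m - int n = int m' - int n'" and rel': "(seq_shift ^^ m') x = (seq_shift ^^ n') y"
    by (simp_all add: P_def)
  \<comment> \<open>The pair picked by \<open>SOME\<close> differs from the given one by the same
    number \<open>j\<close> in both exponents. A larger pair applies one further word map to both
    sides; a smaller pair is reached by cancelling an injective one.\<close>
  have "pw F x m' t = pw F y n' s"
  proof (cases "m \<le> m'")
    case True
    define j where "j = m' - m"
    have "m' = m + j" "n' = n + j" using True k by (auto simp: j_def)
    then show ?thesis using rel t by (simp add: pw_add)
  next
    case False
    define j where "j = m - m'"
    have j: "m = m' + j" "n = n' + j" using False k by (auto simp: j_def)
    have "pw F ((seq_shift ^^ m') x) j (pw F x m' t) = pw F ((seq_shift ^^ m') x) j (pw F y n' s)"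
      using t rel' by (simp add: j pw_add)
    moreover have "(seq_shift ^^ m') x \<in> seqs N" using x by (simp add: seqs_def seq_shift_pow)
    ultimately show ?thesis using injD[OF bij_is_inj[OF bij_pw[of "(seq_shift ^^ m') x" j]]] by blast
  qed
  then have "inv (pw F x m') (pw F y n' s) = t"
    using inv_f_f[OF bij_is_inj[OF bij_pw[OF x, of m']], of t] by simp
  moreover have "(SOME (m', n'). int m - int n = int m' - int n' \<and> (seq_shift ^^ m') x = (seq_shift ^^ n') y) = (m', n')"
    using mn' by (simp add: P_def)
  ultimately show ?thesis by (simp add: canonical_action_def pw_def)
qed

definition AG where "AG = action_groupoid X.GY L fst (canonical_action F)"

text \<open>An arrow of the bundle groupoid is determined by its image in the base together with its
  source point. The second coordinate of the range is redundant, and \<open>from_AG\<close> recovers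
  it from the action.\<close>

definition to_AG :: "((nat \<Rightarrow> nat) \<times> 't) \<times> int \<times> ((nat \<Rightarrow> nat) \<times> 't) \<Rightarrow>
    ((nat \<Rightarrow> nat) \<times> int \<times> (nat \<Rightarrow> nat)) \<times> ((nat \<Rightarrow> nat) \<times> 't)" where
  "to_AG = (\<lambda>(z, k, w). ((fst z, k, fst w), w))"

definition from_AG :: "((nat \<Rightarrow> nat) \<times> int \<times> (nat \<Rightarrow> nat)) \<times> ((nat \<Rightarrow> nat) \<times> 't) \<Rightarrow>
    ((nat \<Rightarrow> nat) \<times> 't) \<times> int \<times> ((nat \<Rightarrow> nat) \<times> 't)" where
  "from_AG = (\<lambda>(\<gamma>, w). (canonical_action F \<gamma> w, fst (snd \<gamma>), w))"

lemma AG_simps: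
  "arrows AG = {(\<gamma>, z). \<gamma> \<in> arrows X.GY \<and> z \<in> topspace L \<and> src X.GY \<gamma> = fst z}"
  "arrow_top AG = subtopology (prod_topology (arrow_top X.GY) L) (arrows AG)"
  "unit_top AG = L" "rng AG = (\<lambda>(\<gamma>, z). canonical_action F \<gamma> z)" "src AG = snd"
  "gmult AG = (\<lambda>(\<gamma>\<^sub>1, z\<^sub>1) (\<gamma>\<^sub>2, z\<^sub>2). (gmult X.GY \<gamma>\<^sub>1 \<gamma>\<^sub>2, z\<^sub>2))"
  "ginv AG = (\<lambda>(\<gamma>, z). (ginv X.GY \<gamma>, canonical_action F \<gamma> z))"
  by (auto simp: AG_def action_groupoid_def Let_def)

lemma L_arrow_cases:
  assumes "\<gamma> \<in> arrows L.GY"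
  obtains x t m n y s where "\<gamma> = ((x, t), int m - int n, (y, s))" "(x, t) \<in> topspace L" "(y, s) \<in> topspace L"
    "(seq_shift ^^ m) x = (seq_shift ^^ n) y" "pw F x m t = pw F y n s" "x \<in> seqs N" "y \<in> seqs N"
proof -
  obtain z w m n where *: "\<gamma> = (z, int m - int n, w)" "(bundle_shift F ^^ m) z = (bundle_shift F ^^ n) w"
    "z \<in> topspace L" "w \<in> topspace L" by (rule L.arrow_cases[OF assms])
  obtain x t y s where "z = (x, t)" "w = (y, s)" by (cases z; cases w)
  with * show ?thesis using that[of x t m n y s] topspace_L_fst[of x t] topspace_L_fst[of y s]
    by (simp add: bundle_shift_pow)
qed

text \<open>Exhibits the range point \<open>(x, t)\<close> of an arrow of the action groupoid, with
  the equation that makes it related to the source under the bundle shift.\<close>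

lemma AG_arrow_cases:
  assumes "p \<in> arrows AG"
  obtains x t m n y s where "p = ((x, int m - int n, y), (y, s))" "(x, t) \<in> topspace L" "(y, s) \<in> topspace L"
    "(seq_shift ^^ m) x = (seq_shift ^^ n) y" "pw F x m t = pw F y n s" "x \<in> seqs N" "y \<in> seqs N"
proof -
  obtain \<gamma> z where pz: "p = (\<gamma>, z)" by (cases p)
  have \<gamma>: "\<gamma> \<in> arrows X.GY" and z: "z \<in> topspace L" "src X.GY \<gamma> = fst z" using assms by (auto simp: AG_simps(1) pz)
  obtain x y m n where *: "\<gamma> = (x, int m - int n, y)" "(seq_shift ^^ m) x = (seq_shift ^^ n) y"
    "x \<in> topspace (seq_top N)" "y \<in> topspace (seq_top N)" by (rule X.arrow_cases[OF \<gamma>])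
  obtain s where s: "z = (y, s)" using z(2) * by (cases z) auto
  have xs: "x \<in> seqs N" "y \<in> seqs N" using * by (simp_all add: topspace_seq_top)
  define t where "t = inv (pw F x m) (pw F y n s)"
  have t: "pw F x m t = pw F y n s" using bij_pw[OF xs(1), of m] by (simp add: t_def bij_is_surj surj_f_inv_f)
  obtain q where "(y, s) \<in> level q" using z(1) s by (auto simp: topspace_L)
  \<comment> \<open>After \<open>n\<close> letters of \<open>y\<close> and \<open>m\<close> letters
    of \<open>x\<close> the two points agree, so \<open>q\<close> further letters lead both into
    \<open>K\<close>; this places the range point in the bundle.\<close>
  then have "(y, s) \<in> level (n + q)" using level_mono[of q "n + q"] by auto
  then have "(x, t) \<in> level (m + q)" using xs *(2) t by (simp add: level_iff pw_add)
  then have "(x, t) \<in> topspace L" using topspace_L by blast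
  then show ?thesis using that[of x m n y s t] pz *(1,2) s z(1) t xs by simp
qed

lemma to_AG_eq: "to_AG ((x, t), k, (y, s)) = ((x, k, y), (y, s))"
  by (simp add: to_AG_def)

lemma from_AG_eq:
  "x \<in> seqs N \<Longrightarrow> (seq_shift ^^ m) x = (seq_shift ^^ n) y \<Longrightarrow> pw F x m t = pw F y n s \<Longrightarrow>
    from_AG ((x, int m - int n, y), (y', s)) = ((x, t), int m - int n, (y', s))"
  by (simp add: from_AG_def canonical_action_eq)

lemma to_AG_in: "\<gamma> \<in> arrows L.GY \<Longrightarrow> to_AG \<gamma> \<in> arrows AG"
proof -
  assume "\<gamma> \<in> arrows L.GY"
  then obtain x t m n y s where *: "\<gamma> = ((x, t), int m - int n, (y, s))" "(x, t) \<in> topspace L" "(y, s) \<in> topspace L"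
    "(seq_shift ^^ m) x = (seq_shift ^^ n) y" "pw F x m t = pw F y n s" "x \<in> seqs N" "y \<in> seqs N"
    by (rule L_arrow_cases)
  then show ?thesis using X.arrowsI[OF *(4)] by (simp add: to_AG_eq AG_simps(1) topspace_seq_top)
qed

lemma from_AG_in: "p \<in> arrows AG \<Longrightarrow> from_AG p \<in> arrows L.GY"
proof -
  assume "p \<in> arrows AG"
  then obtain x t m n y s where *: "p = ((x, int m - int n, y), (y, s))" "(x, t) \<in> topspace L" "(y, s) \<in> topspace L"
    "(seq_shift ^^ m) x = (seq_shift ^^ n) y" "pw F x m t = pw F y n s" "x \<in> seqs N" "y \<in> seqs N"
    by (rule AG_arrow_cases)
  have "((x, t), int m - int n, (y, s)) \<in> arrows L.GY"
    by (rule L.arrowsI) (use * in \<open>simp_all add: bundle_shift_pow\<close>)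
  then show ?thesis using from_AG_eq[OF *(6,4,5)] *(1) by simp
qed

lemma from_to_AG: "\<gamma> \<in> arrows L.GY \<Longrightarrow> from_AG (to_AG \<gamma>) = \<gamma>"
  by (erule L_arrow_cases) (simp add: to_AG_eq from_AG_eq)

lemma to_from_AG: "p \<in> arrows AG \<Longrightarrow> to_AG (from_AG p) = p"
proof (erule AG_arrow_cases)
  fix x t m n y s assume *: "p = ((x, int m - int n, y), (y, s))"
    "(seq_shift ^^ m) x = (seq_shift ^^ n) y" "pw F x m t = pw F y n s" "x \<in> seqs N"
  show ?thesis using from_AG_eq[OF *(4,2,3), of y] *(1) by (simp add: to_AG_eq)
qed

lemma topspace_AG: "topspace (arrow_top AG) = arrows AG"
proof -
  have "arrows AG \<subseteq> topspace (arrow_top X.GY) \<times> topspace L"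
    unfolding X.topspace_GY by (auto simp: AG_simps(1))
  then show ?thesis unfolding AG_simps(2) by auto
qed

lemma continuous_fst_L: "continuous_map L (seq_top N) fst"
proof (rule continuous_mapI_nbhd)
  fix z assume z: "z \<in> topspace L"
  then show "fst z \<in> topspace (seq_top N)" using topspace_L_fst[of "fst z" "snd z"] by (simp add: topspace_seq_top)
  fix V assume V: "openin (seq_top N) V" "fst z \<in> V"
  have "openin L ((V \<times> UNIV) \<inter> topspace L)" using V by (intro openin_L_prod) (simp add: openin_prod_Times_iff)
  then show "\<exists>T. openin L T \<and> z \<in> T \<and> fst ` T \<subseteq> V" using z V(2) by (intro exI[of _ "(V \<times> UNIV) \<inter> topspace L"]) (cases z, auto)
qed

lemma continuous_to_AG: "continuous_map (arrow_top L.GY) (arrow_top AG) to_AG"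
proof -
  have c1: "continuous_map (arrow_top L.GY) (arrow_top X.GY) (\<lambda>\<gamma>. fst (to_AG \<gamma>))"
  proof (rule continuous_mapI_nbhd)
    fix \<gamma> assume "\<gamma> \<in> topspace (arrow_top L.GY)"
    then have \<gamma>: "\<gamma> \<in> arrows L.GY" by (simp only: L.topspace_GY)
    obtain x t m n y s where *: "\<gamma> = ((x, t), int m - int n, (y, s))" "(x, t) \<in> topspace L" "(y, s) \<in> topspace L"
      "(seq_shift ^^ m) x = (seq_shift ^^ n) y" "pw F x m t = pw F y n s" "x \<in> seqs N" "y \<in> seqs N"
      by (rule L_arrow_cases[OF \<gamma>])
    show "fst (to_AG \<gamma>) \<in> topspace (arrow_top X.GY)"
      unfolding X.topspace_GY using to_AG_in[OF \<gamma>] by (auto simp: AG_simps(1))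
    fix V assume V: "openin (arrow_top X.GY) V" "fst (to_AG \<gamma>) \<in> V"
    obtain A B where AB: "openin (seq_top N) A" "openin (seq_top N) B" "x \<in> A" "y \<in> B" "X.Z m n A B \<subseteq> V"
      using X.nbhd_Z[OF V(1) _ *(4)] V(2) by (auto simp: *(1) to_AG_eq)
    let ?A = "{z \<in> topspace L. fst z \<in> A}" and ?B = "{z \<in> topspace L. fst z \<in> B}"
    have "openin L ?A" "openin L ?B" by (intro openin_continuous_map_preimage[OF continuous_fst_L] AB)+
    then have "openin (arrow_top L.GY) (L.Z m n ?A ?B)" by (rule L.openin_Z)
    moreover have "\<gamma> \<in> L.Z m n ?A ?B" using * AB by (simp add: L.Z_iff bundle_shift_pow)
    moreover have "(\<lambda>\<gamma>. fst (to_AG \<gamma>)) ` L.Z m n ?A ?B \<subseteq> X.Z m n A B"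
      by (auto simp: L.Z_def X.Z_iff to_AG_eq bundle_shift_pow)
    ultimately show "\<exists>T. openin (arrow_top L.GY) T \<and> \<gamma> \<in> T \<and> (\<lambda>\<gamma>. fst (to_AG \<gamma>)) ` T \<subseteq> V"
      using AB(5) by (meson subset_trans)
  qed
  have c2: "continuous_map (arrow_top L.GY) L (\<lambda>\<gamma>. snd (to_AG \<gamma>))"
    using L.continuous_src_GY by (simp add: to_AG_def case_prod_unfold)
  have "continuous_map (arrow_top L.GY) (prod_topology (arrow_top X.GY) L) to_AG"
    using continuous_map_pairedI[OF c1 c2] by simp
  then show ?thesis
    unfolding AG_simps(2) by (rule continuous_map_into_subtopology) (use to_AG_in in \<open>auto simp only: L.topspace_GY\<close>)
qed

text \<open>The source coordinate is kept, so only the range can leave the prescribed set. It is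
  confined to \<open>A\<close> by shrinking the source set until its \<open>n\<close>-th shift is
  reached from a point of \<open>A\<close> whose first \<open>m\<close> letters are those of
  \<open>x\<close>; this point is then the range.\<close>

lemma continuous_from_AG: "continuous_map (arrow_top AG) (arrow_top L.GY) from_AG"
proof (rule continuous_mapI_nbhd)
  fix p assume "p \<in> topspace (arrow_top AG)"
  then have p: "p \<in> arrows AG" by (simp only: topspace_AG)
  obtain x t m n y s where *: "p = ((x, int m - int n, y), (y, s))" "(x, t) \<in> topspace L" "(y, s) \<in> topspace L"
    "(seq_shift ^^ m) x = (seq_shift ^^ n) y" "pw F x m t = pw F y n s" "x \<in> seqs N" "y \<in> seqs N"
    by (rule AG_arrow_cases[OF p])
  show "from_AG p \<in> topspace (arrow_top L.GY)" unfolding L.topspace_GY by (rule from_AG_in[OF p])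
  fix V assume V: "openin (arrow_top L.GY) V" "from_AG p \<in> V"
  have p_eq: "from_AG p = ((x, t), int m - int n, (y, s))" using from_AG_eq[OF *(6,4,5)] *(1) by simp
  have rel: "(bundle_shift F ^^ m) (x, t) = (bundle_shift F ^^ n) (y, s)" using * by (simp add: bundle_shift_pow)
  obtain A B where AB: "openin L A" "openin L B" "(x, t) \<in> A" "(y, s) \<in> B" "L.Z m n A B \<subseteq> V"
    using L.nbhd_Z[OF V(1) _ rel] V(2) unfolding p_eq by blast
  define A' where "A' = A \<inter> ((cyl N x m \<times> UNIV) \<inter> topspace L)"
  define B' where "B' = B \<inter> {w \<in> topspace L. (bundle_shift F ^^ n) w \<in> (bundle_shift F ^^ m) ` A'}"
  have A': "openin L A'" unfolding A'_def by (intro openin_Int AB openin_L_cyl)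
  have B': "openin L B'" unfolding B'_def by (intro openin_Int AB L.open_pow_preimage L.open_pow_image A')
  let ?T = "(X.Z m n (cyl N x m) (seqs N) \<times> B') \<inter> arrows AG"
  have "openin (arrow_top X.GY) (X.Z m n (cyl N x m) (seqs N))"
    using X.openin_Z[OF openin_cyl openin_topspace] by (simp only: topspace_seq_top)
  then have "openin (arrow_top AG) ?T"
    unfolding AG_simps(2) using B' by (intro openin_subtopology_Int) (simp add: openin_prod_Times_iff)
  moreover have "p \<in> ?T"
  proof -
    have "(x, t) \<in> A'" using AB * cyl_refl by (simp add: A'_def)
    then have "(bundle_shift F ^^ n) (y, s) \<in> (bundle_shift F ^^ m) ` A'" using rel by (metis imageI)
    then have "(y, s) \<in> B'" using AB * by (simp add: B'_def)
    then show ?thesis using p * cyl_refl by (simp add: X.Z_iff)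
  qed
  moreover have "from_AG ` ?T \<subseteq> L.Z m n A B"
  proof
    fix v assume "v \<in> from_AG ` ?T"
    then obtain q where q: "q \<in> ?T" "v = from_AG q" by blast
    obtain x' y' y'' s' where q_eq: "q = ((x', int m - int n, y'), (y'', s'))"
      and q': "(seq_shift ^^ m) x' = (seq_shift ^^ n) y'" "x' \<in> cyl N x m" "(y'', s') \<in> B'"
      using q(1) by (auto simp: X.Z_def)
    have y'': "y'' = y'" using q(1) by (simp add: q_eq AG_simps(1))
    obtain a t' where at: "(a, t') \<in> A'" "(bundle_shift F ^^ n) (y', s') = (bundle_shift F ^^ m) (a, t')"
      using q'(3) y'' by (auto simp: B'_def)
    have a: "(seq_shift ^^ m) a = (seq_shift ^^ n) y'" "pw F a m t' = pw F y' n s'" "a \<in> cyl N x m"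
      using at by (auto simp: bundle_shift_pow A'_def)
    \<comment> \<open>The first \<open>m\<close> letters agree because both sequences lie in the
      same cylinder, the remaining ones because both have the same \<open>m\<close>-th
      shift.\<close>
    have "a = x'"
    proof
      fix i
      show "a i = x' i"
      proof (cases "i < m")
        case True
        then show ?thesis using a(3) q'(2) by (simp add: cyl_def)
      next
        case False
        then have "i = (i - m) + m" by simp
        then show ?thesis using fun_cong[OF trans[OF a(1) q'(1)[symmetric]], of "i - m"] by (simp add: seq_shift_pow)
      qed
    qed
    moreover have "x' \<in> seqs N" using q'(2) by (simp add: cyl_def)
    ultimately have "v = ((x', t'), int m - int n, (y', s'))"
      using from_AG_eq[of x' m n y' t' s' y'] a q'(1) q(2) by (simp add: q_eq y'')
    moreover have "(x', t') \<in> A" "(y', s') \<in> B" using at(1) q'(3) y'' \<open>a = x'\<close> by (auto simp: A'_def B'_def)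
    ultimately show "v \<in> L.Z m n A B" using at(2) \<open>a = x'\<close> by (simp add: L.Z_iff)
  qed
  ultimately show "\<exists>T. openin (arrow_top AG) T \<and> p \<in> T \<and> from_AG ` T \<subseteq> V"
    using AB(5) by (meson subset_trans)
qed

end

context fractafold_bundle
begin

lemma groupoid_transport_AG: "groupoid_transport L.GY AG to_AG from_AG"
proof -
  interpret ample_groupoid L.GY by (rule L.ample_groupoid_GY)
  show ?thesis
  proof
    show "topspace (arrow_top L.GY) = arrows L.GY" by (rule L.topspace_GY)
    show "topspace (arrow_top AG) = arrows AG" by (rule topspace_AG)
    show "homeomorphic_maps (arrow_top L.GY) (arrow_top AG) to_AG from_AG"
      unfolding homeomorphic_maps_def L.topspace_GY topspace_AG
      by (intro conjI ballI continuous_to_AG continuous_from_AG from_to_AG to_from_AG)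
    show "unit_top L.GY = unit_top AG" by (simp add: AG_simps)
  next
    fix \<gamma> assume \<gamma>: "\<gamma> \<in> arrows L.GY"
    show "ginv L.GY \<gamma> \<in> arrows L.GY" by (rule inv_in[OF \<gamma>])
    obtain x t m n y s where *: "\<gamma> = ((x, t), int m - int n, (y, s))" "(x, t) \<in> topspace L" "(y, s) \<in> topspace L"
      "(seq_shift ^^ m) x = (seq_shift ^^ n) y" "pw F x m t = pw F y n s" "x \<in> seqs N" "y \<in> seqs N"
      by (rule L_arrow_cases[OF \<gamma>])
    note act = canonical_action_eq[OF *(6,4,5), of y]
    show "rng AG (to_AG \<gamma>) = rng L.GY \<gamma>" using act *(1) by (simp add: AG_simps to_AG_eq)
    show "src AG (to_AG \<gamma>) = src L.GY \<gamma>" using *(1) by (simp add: AG_simps to_AG_eq)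
    show "to_AG (ginv L.GY \<gamma>) = ginv AG (to_AG \<gamma>)"
      using act *(1) by (simp add: AG_simps to_AG_def)
  next
    fix \<alpha> \<beta> assume "\<alpha> \<in> arrows L.GY" "\<beta> \<in> arrows L.GY" "src L.GY \<alpha> = rng L.GY \<beta>"
    then show "gmult L.GY \<alpha> \<beta> \<in> arrows L.GY" by (rule mult_in)
    show "to_AG (gmult L.GY \<alpha> \<beta>) = gmult AG (to_AG \<alpha>) (to_AG \<beta>)"
      by (cases \<alpha>; cases \<beta>) (simp add: AG_simps to_AG_def)
  qed
qed

end

lemma (in groupoid_transport) groupoid_iso: "groupoid_iso G H \<Phi>"
  unfolding groupoid_iso_def
proof (intro conjI ballI impI)
  show "bij_betw \<Phi> (arrows G) (arrows H)"
    by (rule bij_betw_byWitness[where f' = \<Psi>]) (auto simp: \<Psi>_\<Phi> \<Phi>_\<Psi> \<Phi>_in \<Psi>_in)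
  show "homeomorphic_map (arrow_top G) (arrow_top H) \<Phi>"
    using homeo unfolding homeomorphic_map_maps by blast
qed (simp_all add: src_\<Phi> rng_\<Phi> \<Phi>_mult)

section \<open>Cardinalities of the two arrow types and the conclusion\<close>

lemma inj_square:
  assumes "infinite (UNIV :: 'a set)" shows "\<exists>f :: 'a \<times> 'a \<Rightarrow> 'a. inj f"
proof -
  obtain f :: "'a \<times> 'a \<Rightarrow> 'a" where "bij_betw f (UNIV \<times> UNIV) UNIV"
    using card_of_Times_same_infinite[OF assms, THEN card_of_ordIso[THEN iffD2]] by blast
  then have "inj f" by (simp add: bij_betw_def)
  then show ?thesis by (intro exI[of _ f])
qed

text \<open>The full norms quantify over function spaces on these two types, so each must embed into
  the other. The bundle arrows contain two copies of \<open>'t\<close> and the action arrows only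
  one; the surplus is absorbed because sequences paired with \<open>'t\<close> form an infinite
  type, equipotent to its square.\<close>

lemma arrow_types_equipollent:
  "\<exists>e :: ((nat \<Rightarrow> nat) \<times> 't) \<times> int \<times> ((nat \<Rightarrow> nat) \<times> 't) \<Rightarrow>
     ((nat \<Rightarrow> nat) \<times> int \<times> (nat \<Rightarrow> nat)) \<times> ((nat \<Rightarrow> nat) \<times> 't). inj e"
  "\<exists>e :: ((nat \<Rightarrow> nat) \<times> int \<times> (nat \<Rightarrow> nat)) \<times> ((nat \<Rightarrow> nat) \<times> 't) \<Rightarrow>
     ((nat \<Rightarrow> nat) \<times> 't) \<times> int \<times> ((nat \<Rightarrow> nat) \<times> 't). inj e"
proof -
  have inf_seq: "infinite (UNIV :: (nat \<Rightarrow> nat) set)"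
  proof
    assume "finite (UNIV :: (nat \<Rightarrow> nat) set)"
    then have "finite (range (\<lambda>n _. n) :: (nat \<Rightarrow> nat) set)" by (rule finite_subset[rotated]) simp
    moreover have "inj (\<lambda>n. (\<lambda>_. n) :: nat \<Rightarrow> nat)" by (rule injI) (simp add: fun_eq_iff)
    ultimately have "finite (UNIV :: nat set)" by (rule finite_imageD)
    then show False by simp
  qed
  have "infinite (UNIV :: ((nat \<Rightarrow> nat) \<times> 't) set)"
    using inf_seq by (simp add: finite_prod)
  from inj_square[OF this] obtain f :: "((nat \<Rightarrow> nat) \<times> 't) \<times> ((nat \<Rightarrow> nat) \<times> 't) \<Rightarrow> (nat \<Rightarrow> nat) \<times> 't" where f: "inj f"
    by (rule exE)
  have "inj (\<lambda>(p, k :: int, q). ((\<lambda>_ :: nat. 0 :: nat, k, \<lambda>_ :: nat. 0 :: nat), f (p, q)))"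
    by (rule injI) (auto dest!: injD[OF f])
  then show "\<exists>e :: ((nat \<Rightarrow> nat) \<times> 't) \<times> int \<times> ((nat \<Rightarrow> nat) \<times> 't) \<Rightarrow>
     ((nat \<Rightarrow> nat) \<times> int \<times> (nat \<Rightarrow> nat)) \<times> ((nat \<Rightarrow> nat) \<times> 't). inj e" by blast
  obtain g :: "(nat \<Rightarrow> nat) \<times> (nat \<Rightarrow> nat) \<Rightarrow> nat \<Rightarrow> nat" where g: "inj g"
    using inj_square[OF inf_seq] by (rule exE)
  \<comment> \<open>In this direction only sequences have to be merged, so a pairing of sequences
    suffices; \<open>t\<close> is repeated merely to fill the second point.\<close>
  have "inj (\<lambda>((x, k :: int, y), (z, t :: 't)). ((x, t), k, (g (y, z), t)))"
    by (rule injI) (auto dest!: injD[OF g])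
  then show "\<exists>e :: ((nat \<Rightarrow> nat) \<times> int \<times> (nat \<Rightarrow> nat)) \<times> ((nat \<Rightarrow> nat) \<times> 't) \<Rightarrow>
     ((nat \<Rightarrow> nat) \<times> 't) \<times> int \<times> ((nat \<Rightarrow> nat) \<times> 't). inj e" by blast
qed

theorem corollary3p12:
  fixes N :: nat
    and F :: "nat \<Rightarrow> 't::complete_space \<Rightarrow> 't"
    and K :: "'t set"
    and \<mu> :: "'t measure"
    and \<mu>\<^sub>L :: "((nat \<Rightarrow> nat) \<times> 't) measure"
  assumes "N \<ge> 2"
    and "nondegenerate_ifs N F"
    and "\<forall>i\<in>{1..N}. surj (F i)"
    and "invariant_set N F K"
    and "open_set_condition N F"
    and "\<forall>i\<in>{1..N}. openin (top_of_set K) (F i ` K)"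
    and "self_similar_measure N F K \<mu>"
    and "fractafold_measure N F K \<mu> \<mu>\<^sub>L"
  defines "X \<equiv> seq_top N"
    and "L \<equiv> bundle_top N F K"
  defines "\<G> \<equiv> renault_deaconu X seq_shift"
    and "\<G>L \<equiv> renault_deaconu L (bundle_shift F)"
  defines "\<A> \<equiv> action_groupoid \<G> L fst (canonical_action F)"
  shows "(\<exists>\<Phi>. groupoid_iso \<G>L \<A> \<Phi>) \<and>
         (\<exists>\<Psi>. star_iso (full_cstar \<G>L) (full_cstar \<A>) \<Psi>) \<and>
         (\<exists>\<tau>. is_trace (full_cstar \<G>L) \<tau> \<and>
              densely_defined_weight (full_cstar \<G>L) \<tau> \<and>
              lower_semicontinuous_weight (full_cstar \<G>L) \<tau> \<and>
              extends_integral \<G>L \<mu>\<^sub>L \<tau>)"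
proof -
  interpret fractafold_bundle N F K
    by unfold_locales (use assms in simp_all)
  have eq: "\<A> = AG" "\<G>L = L.GY" by (simp_all add: \<A>_def \<G>_def X_def L_def \<G>L_def AG_def)
  interpret transport: groupoid_transport L.GY AG to_AG from_AG by (rule groupoid_transport_AG)
  interpret ample_groupoid_measure L.GY \<mu>\<^sub>L
    by (rule ample_groupoid_measure_L) fact+
  obtain e :: "((nat \<Rightarrow> nat) \<times> 't) \<times> int \<times> ((nat \<Rightarrow> nat) \<times> 't) \<Rightarrow>
     ((nat \<Rightarrow> nat) \<times> int \<times> (nat \<Rightarrow> nat)) \<times> ((nat \<Rightarrow> nat) \<times> 't)" where e: "inj e"
    using arrow_types_equipollent(1) by blast
  obtain e' :: "((nat \<Rightarrow> nat) \<times> int \<times> (nat \<Rightarrow> nat)) \<times> ((nat \<Rightarrow> nat) \<times> 't) \<Rightarrow>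
     ((nat \<Rightarrow> nat) \<times> 't) \<times> int \<times> ((nat \<Rightarrow> nat) \<times> 't)" where e': "inj e'"
    using arrow_types_equipollent(2) by blast
  show ?thesis
    unfolding eq
    by (intro conjI exI[of _ to_AG] exI[of _ weight] transport.groupoid_iso
        transport.star_iso_full_cstar[OF e e' L.ample_groupoid_GY]
        is_trace_weight densely_defined_weight_weight lower_semicontinuous_weight_weight extends_integral_weight)
qed

end
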